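(* Consider inviscid compressible fluid flow in a Riemannian manifold $(M,g)$ of any dimension $n>1$, with fluid velocity vector $u$, mass density $\rho$, entropy $S$ and pressure $P$, $$u_t+(u\rfloor\nabla)u=-\rho^{-1}\,\mathrm{grad}\,P,\qquad \rho_t+\mathrm{div}(\rho u)=0,\qquad S_t+u\rfloor\nabla S=0,\qquad P=P(\rho,S).$$ (i) The non-trivial kinematic conserved densities $T(t,x,u,\rho,S)$ admitted for a general equation of state $P(\rho,S)$ comprise a linear combination of - mass: $T=\rho$; - volumetric entropy: $T=\rho f(S)$; - energy: $T=\rho\big(\tfrac12 g(u,u)+e\big)$; - (linear/angular) momentum: $T=\rho\,g(u,\zeta)$, with $\mathcal L_\zeta g=0$; - Galilean momentum: $T=\rho\,(\psi-t\,u\rfloor\nabla\psi)$, with $\mathcal L_{\nabla\psi}g=0$; where $e$ is the thermodynamic energy of the fluid and $f(S)$ is an arbitrary non-constant function. (ii) The only special equations of state $P(\rho,S)$ for which extra kinematic conserved densities $T(t,x,u,\rho,S)$ arise are the polytropic case $$P=\sigma(S)\,\rho^{1+2/n}$$ with dimension-dependent exponent $\gamma=1+\tfrac2n$, where $\sigma(S)$ is an arbitrary function, and the isobaric-entropy case $$P=\kappa(S)$$ where $\kappa(S)$ is an arbitrary non-constant function. The extra admitted conserved densities consist of a linear combination of - similarity energy: $T=\rho\,g(u,\xi)-\tfrac12\lambda t\,\big(\rho\,g(u,u)+nP\big)$, with $\mathcal L_\xi g=\lambda g$, $\nabla\lambda=0$; - Galilean energy: $T=\rho\,(\theta-t\,u\rfloor\nabla\theta)+\tfrac14\lambda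 t^2\big(\rho\,g(u,u)+nP\big)$, with $\mathcal L_{\nabla\theta}g=\lambda g$, $\nabla\lambda=0$; in the polytropic case, and - non-isentropic (linear/angular) momentum: $T=\rho\,g(u,\zeta)f(S)$, with $\mathcal L_\zeta g=0$; - non-isentropic energy: $T=\tfrac12\rho\,g(u,u)f(S)-\int f(S)P'(S)\,dS$; in the isobaric-entropy case, where $f(S)$ is an arbitrary non-constant function.
   Context: $\nabla$ is the covariant derivative determined by $\nabla g=0$; $\mathrm{grad}$ and $\mathrm{div}$ are the Riemannian gradient and divergence; $\mathcal L$ is the Lie derivative; $\rfloor$ denotes contraction. $\zeta,\xi$ are vector fields on $M$ and $\psi,\theta$ are scalar fields on $M$; in $\mathcal L_{\nabla\psi}$ and $\mathcal L_{\nabla\theta}$ the gradients are regarded as vector fields by means of $g$. The pressure is a function $P(\rho,S)$ with $P_\rho\neq0$ or $P_S\neq0$, and it is determined only up to an additive constant. The thermodynamic energy is $e(\rho,S)=\int\rho^{-2}P(\rho,S)\,d\rho$. A kinematic density is a scalar function $T(t,x,u,\rho,S)$ of time and space coordinates and the fluid variables; through $x$ it may depend on the metric, volume and curvature tensors. It is a conserved density (on domains moving with the fluid) if there is a vector function $\Phi$ of $t,x,u,\rho,S$ and spatial derivatives of $u,\rho,S$ such that $D_tT=-\mathrm{Div}(Tu+\Phi)$ holds for all formal solutions of the fluid equations, where $D_t$ and $\mathrm{Div}$ are the total time derivative and total covariant divergence, acting via the chain rule. A conserved density is trivial if $T=\mathrm{Div}\,\Theta$ for all formal solutions, for some vector function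 $\Theta$ of the same variables; in particular densities depending only on $(t,x)$ are counted as trivial.
   Formalization: The isobaric-entropy list also includes the omitted conserved densities ρ(ψ − t u⌋∇ψ)f(S) with L_{∇ψ}g=0; "P_ρ≠0 or P_S≠0" means P_ρ vanishes on no open set, or P_ρ is identically 0 and P_S vanishes on no open set. *)

theory Defs
  imports "HOL-Analysis.Analysis"
begin

section \<open>Smooth functions on open sets\<close>

fun iter_deriv :: "'a::euclidean_space list \<Rightarrow> ('a \<Rightarrow> 'b::real_normed_vector) \<Rightarrow> 'a \<Rightarrow> 'b" where
  "iter_deriv [] f = f"
| "iter_deriv (b # bs) f = (\<lambda>x. frechet_derivative (iter_deriv bs f) (at x) b)"

text \<open>Used for open \<open>U\<close> only: all iterated partial derivatives exist and are differentiable.\<close>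

definition smooth_on :: "'a::euclidean_space set \<Rightarrow> ('a \<Rightarrow> 'b::real_normed_vector) \<Rightarrow> bool" where
  "smooth_on U f \<longleftrightarrow> (\<forall>bs. set bs \<subseteq> Basis \<longrightarrow> iter_deriv bs f differentiable_on U)"


section \<open>Riemannian manifolds\<close>

text \<open>
  The manifold is the whole type \<open>'m\<close>, its dimension is \<open>CARD('n)\<close>.  The atlas is indexed by
  points: \<open>cmap M p\<close> is a chart with domain \<open>cdom M p\<close> around \<open>p\<close>.  (Any atlas yields such a family
  by choosing a chart around each point.)  The tangent space at \<open>x\<close> is \<open>real ^ 'n\<close>, a tangent vector
  being represented by its components in the chosen chart \<open>cmap M x\<close> at \<open>x\<close>.  Hence \<open>metric M x\<close> is
  an inner product on \<open>real ^ 'n\<close>, a vector field is a function \<open>'m \<Rightarrow> real ^ 'n\<close>, and its components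
  in other charts are obtained through \<open>transition\<close>.
\<close>

record ('m, 'n) riemannian =
  cdom :: "'m \<Rightarrow> 'm set"
  cmap :: "'m \<Rightarrow> 'm \<Rightarrow> real ^ 'n"
  metric :: "'m \<Rightarrow> real ^ 'n \<Rightarrow> real ^ 'n \<Rightarrow> real"

definition cimg :: "('m, 'n::finite) riemannian \<Rightarrow> 'm \<Rightarrow> (real ^ 'n) set" where
  "cimg M p = cmap M p ` cdom M p"

definition cinv :: "('m, 'n::finite) riemannian \<Rightarrow> 'm \<Rightarrow> real ^ 'n \<Rightarrow> 'm" where
  "cinv M p = inv_into (cdom M p) (cmap M p)"

text \<open>Converts the components at \<open>x\<close> of a tangent vector from chart \<open>p\<close> to chart \<open>q\<close>.\<close>

definition transition ::
  "('m, 'n::finite) riemannian \<Rightarrow> 'm \<Rightarrow> 'm \<Rightarrow> 'm \<Rightarrow> real ^ 'n \<Rightarrow> real ^ 'n" where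
  "transition M p q x = frechet_derivative (cmap M q \<circ> cinv M p) (at (cmap M p x))"

text \<open>Coordinate expressions, in the chart at \<open>p\<close>, of a vector field and of the metric.\<close>

definition vcomp ::
  "('m, 'n::finite) riemannian \<Rightarrow> 'm \<Rightarrow> ('m \<Rightarrow> real ^ 'n) \<Rightarrow> real ^ 'n \<Rightarrow> real ^ 'n" where
  "vcomp M p X y = transition M (cinv M p y) p (cinv M p y) (X (cinv M p y))"

definition gcomp ::
  "('m, 'n::finite) riemannian \<Rightarrow> 'm \<Rightarrow> real ^ 'n \<Rightarrow> real ^ 'n \<Rightarrow> real ^ 'n \<Rightarrow> real" where
  "gcomp M p v w y =
     metric M (cinv M p y) (transition M p (cinv M p y) (cinv M p y) v)
                           (transition M p (cinv M p y) (cinv M p y) w)"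

definition smooth_scalar :: "('m, 'n::finite) riemannian \<Rightarrow> ('m \<Rightarrow> real) \<Rightarrow> bool" where
  "smooth_scalar M f \<longleftrightarrow> (\<forall>p. smooth_on (cimg M p) (f \<circ> cinv M p))"

definition smooth_vector :: "('m, 'n::finite) riemannian \<Rightarrow> ('m \<Rightarrow> real ^ 'n) \<Rightarrow> bool" where
  "smooth_vector M X \<longleftrightarrow> (\<forall>p. smooth_on (cimg M p) (vcomp M p X))"

definition riemannian_manifold ::
  "('m::{t2_space, second_countable_topology}, 'n::finite) riemannian \<Rightarrow> bool" where
  "riemannian_manifold M \<longleftrightarrow>
     connected (UNIV :: 'm set) \<and>
     (\<forall>p. open (cdom M p) \<and> p \<in> cdom M p \<and> open (cimg M p) \<and>
          homeomorphism (cdom M p) (cimg M p) (cmap M p) (cinv M p)) \<and>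
     (\<forall>p q. smooth_on (cmap M p ` (cdom M p \<inter> cdom M q)) (cmap M q \<circ> cinv M p)) \<and>
     (\<forall>x. bilinear (metric M x) \<and> (\<forall>v w. metric M x v w = metric M x w v) \<and>
          (\<forall>v. v \<noteq> 0 \<longrightarrow> metric M x v v > 0)) \<and>
     (\<forall>p v w. smooth_on (cimg M p) (gcomp M p v w))"

definition differential ::
  "('m, 'n::finite) riemannian \<Rightarrow> ('m \<Rightarrow> real) \<Rightarrow> 'm \<Rightarrow> real ^ 'n \<Rightarrow> real" where
  "differential M f x = frechet_derivative (f \<circ> cinv M x) (at (cmap M x x))"

definition grad :: "('m, 'n::finite) riemannian \<Rightarrow> ('m \<Rightarrow> real) \<Rightarrow> 'm \<Rightarrow> real ^ 'n" where
  "grad M f x = (THE w. \<forall>v. metric M x w v = differential M f x v)"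

text \<open>
  Derivatives at \<open>x\<close> in direction \<open>v\<close> of the components of the metric (evaluated on the constant
  coordinate fields \<open>a\<close>, \<open>b\<close>) and of a vector field, both in the chart at \<open>x\<close>.
\<close>

definition dmetric ::
  "('m, 'n::finite) riemannian \<Rightarrow> 'm \<Rightarrow> real ^ 'n \<Rightarrow> real ^ 'n \<Rightarrow> real ^ 'n \<Rightarrow> real" where
  "dmetric M x v a b = frechet_derivative (gcomp M x a b) (at (cmap M x x)) v"

definition dvector ::
  "('m, 'n::finite) riemannian \<Rightarrow> 'm \<Rightarrow> real ^ 'n \<Rightarrow> ('m \<Rightarrow> real ^ 'n) \<Rightarrow> real ^ 'n" where
  "dvector M x v X = frechet_derivative (vcomp M x X) (at (cmap M x x)) v"

text \<open>\<open>christoffel M x v w\<close> is the vector with components \<open>\<Gamma>\<^sup>k\<^sub>i\<^sub>j v\<^sup>i w\<^sup>j\<close>; \<open>nabla M x v X\<close> is the Levi-Civita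
  derivative at \<open>x\<close> of \<open>X\<close> along \<open>v\<close>.\<close>

definition christoffel ::
  "('m, 'n::finite) riemannian \<Rightarrow> 'm \<Rightarrow> real ^ 'n \<Rightarrow> real ^ 'n \<Rightarrow> real ^ 'n" where
  "christoffel M x v w =
     (THE z. \<forall>a. 2 * metric M x z a = dmetric M x v w a + dmetric M x w v a - dmetric M x a v w)"

definition nabla ::
  "('m, 'n::finite) riemannian \<Rightarrow> 'm \<Rightarrow> real ^ 'n \<Rightarrow> ('m \<Rightarrow> real ^ 'n) \<Rightarrow> real ^ 'n" where
  "nabla M x v X = dvector M x v X + christoffel M x v (X x)"

definition divergence :: "('m, 'n::finite) riemannian \<Rightarrow> ('m \<Rightarrow> real ^ 'n) \<Rightarrow> 'm \<Rightarrow> real" where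
  "divergence M X x = (\<Sum>i\<in>UNIV. nabla M x (axis i 1) X $ i)"

definition lie_metric ::
  "('m, 'n::finite) riemannian \<Rightarrow> ('m \<Rightarrow> real ^ 'n) \<Rightarrow> 'm \<Rightarrow> real ^ 'n \<Rightarrow> real ^ 'n \<Rightarrow> real" where
  "lie_metric M X x v w =
     dmetric M x (X x) v w + metric M x (dvector M x v X) w + metric M x v (dvector M x w X)"

definition killing :: "('m, 'n::finite) riemannian \<Rightarrow> ('m \<Rightarrow> real ^ 'n) \<Rightarrow> bool" where
  "killing M X \<longleftrightarrow> smooth_vector M X \<and> (\<forall>x v w. lie_metric M X x v w = 0)"

definition homothetic ::
  "('m, 'n::finite) riemannian \<Rightarrow> ('m \<Rightarrow> real ^ 'n) \<Rightarrow> ('m \<Rightarrow> real) \<Rightarrow> bool" where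
  "homothetic M X \<Lambda> \<longleftrightarrow> smooth_vector M X \<and> smooth_scalar M \<Lambda> \<and>
     (\<forall>x v w. lie_metric M X x v w = \<Lambda> x * metric M x v w) \<and> (\<forall>x. grad M \<Lambda> x = 0)"


section \<open>Equations of state\<close>

text \<open>The mass density takes values in an open interval \<open>I\<close> of positive reals, the entropy in an open
  interval \<open>J\<close>.\<close>

definition open_interval :: "real set \<Rightarrow> bool" where
  "open_interval A \<longleftrightarrow> open A \<and> is_interval A \<and> A \<noteq> {}"

definition generically_nonzero :: "'a::topological_space set \<Rightarrow> ('a \<Rightarrow> real) \<Rightarrow> bool" where
  "generically_nonzero D h \<longleftrightarrow> (\<forall>U. open U \<and> U \<noteq> {} \<and> U \<subseteq> D \<longrightarrow> (\<exists>z\<in>U. h z \<noteq> 0))"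

text \<open>
  The condition ``\<open>P\<^sub>\<rho> \<noteq> 0\<close> or \<open>P\<^sub>S \<noteq> 0\<close>''.  Smooth functions that are neither generically
  nonzero nor identically zero have to be excluded: a pressure depending only on the entropy for
  \<open>S < 0\<close> but on the density for \<open>S > 0\<close> has additional conserved densities supported in \<open>S < 0\<close>,
  and a locally constant pressure also has additional ones.  For real-analytic \<open>P\<close> the condition
  just says that \<open>P\<close> is not constant.
\<close>

definition equation_of_state :: "real set \<Rightarrow> real set \<Rightarrow> (real \<Rightarrow> real \<Rightarrow> real) \<Rightarrow> bool" where
  "equation_of_state I J P \<longleftrightarrow>
     smooth_on (I \<times> J) (\<lambda>(r, s). P r s) \<and>
     (generically_nonzero (I \<times> J) (\<lambda>(r, s). deriv (\<lambda>r'. P r' s) r) \<or>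
      (\<forall>r\<in>I. \<forall>s\<in>J. deriv (\<lambda>r'. P r' s) r = 0) \<and>
      generically_nonzero (I \<times> J) (\<lambda>(r, s). deriv (\<lambda>s'. P r s') s))"

definition thermodynamic_energy ::
  "real set \<Rightarrow> real set \<Rightarrow> (real \<Rightarrow> real \<Rightarrow> real) \<Rightarrow> (real \<Rightarrow> real \<Rightarrow> real) \<Rightarrow> bool" where
  "thermodynamic_energy I J P e \<longleftrightarrow>
     smooth_on (I \<times> J) (\<lambda>(r, s). e r s) \<and>
     (\<forall>r\<in>I. \<forall>s\<in>J. ((\<lambda>r'. e r' s) has_real_derivative P r s / r\<^sup>2) (at r))"

definition polytropic ::
  "nat \<Rightarrow> real set \<Rightarrow> real set \<Rightarrow> (real \<Rightarrow> real \<Rightarrow> real) \<Rightarrow> bool" where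
  "polytropic n I J P \<longleftrightarrow>
     (\<exists>\<sigma>. \<forall>r\<in>I. \<forall>s\<in>J. P r s = \<sigma> s * r powr (1 + 2 / real n))"

definition isobaric_entropy ::
  "real set \<Rightarrow> real set \<Rightarrow> (real \<Rightarrow> real \<Rightarrow> real) \<Rightarrow> (real \<Rightarrow> real) \<Rightarrow> bool" where
  "isobaric_entropy I J P \<kappa> \<longleftrightarrow> \<not> \<kappa> constant_on J \<and> (\<forall>r\<in>I. \<forall>s\<in>J. P r s = \<kappa> s)"


section \<open>Formal solutions and conserved densities\<close>

type_synonym ('m, 'n) density = "real \<Rightarrow> 'm \<Rightarrow> real ^ 'n \<Rightarrow> real \<Rightarrow> real \<Rightarrow> real"

type_synonym ('m, 'n) flux =
  "real \<Rightarrow> ('m \<Rightarrow> real ^ 'n) \<Rightarrow> ('m \<Rightarrow> real) \<Rightarrow> ('m \<Rightarrow> real) \<Rightarrow> 'm \<Rightarrow> real ^ 'n"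

definition fluid_state ::
  "('m, 'n::finite) riemannian \<Rightarrow> real set \<Rightarrow> real set \<Rightarrow>
   ('m \<Rightarrow> real ^ 'n) \<Rightarrow> ('m \<Rightarrow> real) \<Rightarrow> ('m \<Rightarrow> real) \<Rightarrow> bool" where
  "fluid_state M I J u \<rho> S \<longleftrightarrow>
     smooth_vector M u \<and> smooth_scalar M \<rho> \<and> smooth_scalar M S \<and> (\<forall>x. \<rho> x \<in> I \<and> S x \<in> J)"

text \<open>
  A formal solution at an instant of time: the fluid variables on \<open>M\<close> are arbitrary (so that their
  spatial jets at a point are arbitrary), and their first time derivatives \<open>u'\<close>, \<open>\<rho>'\<close>, \<open>S'\<close> are tied
  to them by the fluid equations.  No other time derivatives enter the conservation law.
\<close>

definition formal_solution ::
  "('m, 'n::finite) riemannian \<Rightarrow> real set \<Rightarrow> real set \<Rightarrow> (real \<Rightarrow> real \<Rightarrow> real) \<Rightarrow>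
   ('m \<Rightarrow> real ^ 'n) \<Rightarrow> ('m \<Rightarrow> real) \<Rightarrow> ('m \<Rightarrow> real) \<Rightarrow>
   ('m \<Rightarrow> real ^ 'n) \<Rightarrow> ('m \<Rightarrow> real) \<Rightarrow> ('m \<Rightarrow> real) \<Rightarrow> bool" where
  "formal_solution M I J P u \<rho> S u' \<rho>' S' \<longleftrightarrow>
     fluid_state M I J u \<rho> S \<and>
     (\<forall>x. u' x + nabla M x (u x) u = - (1 / \<rho> x) *\<^sub>R grad M (\<lambda>z. P (\<rho> z) (S z)) x \<and>
          \<rho>' x + divergence M (\<lambda>z. \<rho> z *\<^sub>R u z) x = 0 \<and>
          S' x + differential M S x (u x) = 0)"

definition same_jet ::
  "('m, 'n::finite) riemannian \<Rightarrow> nat \<Rightarrow> 'm \<Rightarrow>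
   ('m \<Rightarrow> real ^ 'n) \<Rightarrow> ('m \<Rightarrow> real) \<Rightarrow> ('m \<Rightarrow> real) \<Rightarrow>
   ('m \<Rightarrow> real ^ 'n) \<Rightarrow> ('m \<Rightarrow> real) \<Rightarrow> ('m \<Rightarrow> real) \<Rightarrow> bool" where
  "same_jet M k x u \<rho> S v \<tau> R \<longleftrightarrow>
     (\<forall>bs. set bs \<subseteq> Basis \<and> length bs \<le> k \<longrightarrow>
        iter_deriv bs (vcomp M x u) (cmap M x x) = iter_deriv bs (vcomp M x v) (cmap M x x) \<and>
        iter_deriv bs (\<rho> \<circ> cinv M x) (cmap M x x) = iter_deriv bs (\<tau> \<circ> cinv M x) (cmap M x x) \<and>
        iter_deriv bs (S \<circ> cinv M x) (cmap M x x) = iter_deriv bs (R \<circ> cinv M x) (cmap M x x))"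

text \<open>
  A vector function of \<open>t\<close>, \<open>x\<close>, the fluid variables and finitely many of their spatial derivatives,
  rendered as a differential operator: its value at \<open>x\<close> depends only on a jet of finite order at
  \<open>x\<close>, and it takes smooth arguments to vector fields that are smooth in \<open>(t, x)\<close>.
\<close>

definition vector_function ::
  "('m, 'n::finite) riemannian \<Rightarrow> real set \<Rightarrow> real set \<Rightarrow> ('m, 'n) flux \<Rightarrow> bool" where
  "vector_function M I J \<Phi> \<longleftrightarrow>
     (\<exists>k. \<forall>t u \<rho> S v \<tau> R x.
        fluid_state M I J u \<rho> S \<and> fluid_state M I J v \<tau> R \<and> same_jet M k x u \<rho> S v \<tau> R \<longrightarrow>
        \<Phi> t u \<rho> S x = \<Phi> t v \<tau> R x) \<and>
     (\<forall>u \<rho> S p. fluid_state M I J u \<rho> S \<longrightarrow>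
        smooth_on (UNIV \<times> cimg M p) (\<lambda>(t, y). vcomp M p (\<Phi> t u \<rho> S) y))"

definition kinematic_density ::
  "('m, 'n::finite) riemannian \<Rightarrow> real set \<Rightarrow> real set \<Rightarrow> ('m, 'n) density \<Rightarrow> bool" where
  "kinematic_density M I J T \<longleftrightarrow>
     (\<forall>p. smooth_on (UNIV \<times> cimg M p \<times> UNIV \<times> I \<times> J)
        (\<lambda>(t, y, v, r, s). T t (cinv M p y) (transition M p (cinv M p y) (cinv M p y) v) r s))"

text \<open>The derivative at \<open>h = 0\<close> below is the total time derivative \<open>T\<^sub>t + T\<^sub>u u' + T\<^sub>\<rho> \<rho>' + T\<^sub>S S'\<close>, the
  spatial point being held fixed.\<close>

definition conserved_density ::
  "('m, 'n::finite) riemannian \<Rightarrow> real set \<Rightarrow> real set \<Rightarrow> (real \<Rightarrow> real \<Rightarrow> real) \<Rightarrow>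
   ('m, 'n) density \<Rightarrow> bool" where
  "conserved_density M I J P T \<longleftrightarrow>
     kinematic_density M I J T \<and>
     (\<exists>\<Phi>. vector_function M I J \<Phi> \<and>
        (\<forall>t u \<rho> S u' \<rho>' S' x. formal_solution M I J P u \<rho> S u' \<rho>' S' \<longrightarrow>
           deriv (\<lambda>h. T (t + h) x (u x + h *\<^sub>R u' x) (\<rho> x + h * \<rho>' x) (S x + h * S' x)) 0 =
           - divergence M (\<lambda>z. T t z (u z) (\<rho> z) (S z) *\<^sub>R u z + \<Phi> t u \<rho> S z) x))"

definition trivial_density ::
  "('m, 'n::finite) riemannian \<Rightarrow> real set \<Rightarrow> real set \<Rightarrow> (real \<Rightarrow> real \<Rightarrow> real) \<Rightarrow>
   ('m, 'n) density \<Rightarrow> bool" where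
  "trivial_density M I J P T \<longleftrightarrow>
     (\<exists>\<Theta>. vector_function M I J \<Theta> \<and>
        (\<forall>t u \<rho> S u' \<rho>' S' x. formal_solution M I J P u \<rho> S u' \<rho>' S' \<longrightarrow>
           T t x (u x) (\<rho> x) (S x) = divergence M (\<Theta> t u \<rho> S) x)) \<or>
     (\<exists>h. \<forall>t x v. \<forall>r\<in>I. \<forall>s\<in>J. T t x v r s = h t x)"

text \<open>\<open>generated M I J P F T\<close>: modulo trivial conserved densities, \<open>T\<close> is a (finite) linear combination
  of members of \<open>F\<close> with constant coefficients.\<close>

definition generated ::
  "('m, 'n::finite) riemannian \<Rightarrow> real set \<Rightarrow> real set \<Rightarrow> (real \<Rightarrow> real \<Rightarrow> real) \<Rightarrow>
   ('m, 'n) density set \<Rightarrow> ('m, 'n) density \<Rightarrow> bool" where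
  "generated M I J P F T \<longleftrightarrow>
     (\<exists>(N::nat) c L T\<^sub>0. (\<forall>i<N. L i \<in> F) \<and>
        conserved_density M I J P T\<^sub>0 \<and> trivial_density M I J P T\<^sub>0 \<and>
        (\<forall>t x v. \<forall>r\<in>I. \<forall>s\<in>J. T t x v r s = (\<Sum>i<N. c i * L i t x v r s) + T\<^sub>0 t x v r s))"


section \<open>The kinematic conserved densities\<close>

definition mass_density :: "('m, 'n::finite) density" where
  "mass_density = (\<lambda>t x v r s. r)"

definition entropy_density :: "(real \<Rightarrow> real) \<Rightarrow> ('m, 'n::finite) density" where
  "entropy_density f = (\<lambda>t x v r s. r * f s)"

definition energy_density ::
  "('m, 'n::finite) riemannian \<Rightarrow> (real \<Rightarrow> real \<Rightarrow> real) \<Rightarrow> ('m, 'n) density" where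
  "energy_density M e = (\<lambda>t x v r s. r * (1/2 * metric M x v v + e r s))"

definition momentum_density ::
  "('m, 'n::finite) riemannian \<Rightarrow> ('m \<Rightarrow> real ^ 'n) \<Rightarrow> ('m, 'n) density" where
  "momentum_density M \<zeta> = (\<lambda>t x v r s. r * metric M x v (\<zeta> x))"

definition galilean_momentum_density ::
  "('m, 'n::finite) riemannian \<Rightarrow> ('m \<Rightarrow> real) \<Rightarrow> ('m, 'n) density" where
  "galilean_momentum_density M \<psi> = (\<lambda>t x v r s. r * (\<psi> x - t * differential M \<psi> x v))"

definition similarity_energy_density ::
  "('m, 'n::finite) riemannian \<Rightarrow> (real \<Rightarrow> real \<Rightarrow> real) \<Rightarrow>
   ('m \<Rightarrow> real ^ 'n) \<Rightarrow> ('m \<Rightarrow> real) \<Rightarrow> ('m, 'n) density" where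
  "similarity_energy_density M P \<xi> \<Lambda> = (\<lambda>t x v r s.
     r * metric M x v (\<xi> x) - 1/2 * \<Lambda> x * t * (r * metric M x v v + real CARD('n) * P r s))"

definition galilean_energy_density ::
  "('m, 'n::finite) riemannian \<Rightarrow> (real \<Rightarrow> real \<Rightarrow> real) \<Rightarrow>
   ('m \<Rightarrow> real) \<Rightarrow> ('m \<Rightarrow> real) \<Rightarrow> ('m, 'n) density" where
  "galilean_energy_density M P \<theta> \<Lambda> = (\<lambda>t x v r s.
     r * (\<theta> x - t * differential M \<theta> x v) +
     1/4 * \<Lambda> x * t\<^sup>2 * (r * metric M x v v + real CARD('n) * P r s))"

definition nonisentropic_momentum_density ::
  "('m, 'n::finite) riemannian \<Rightarrow> ('m \<Rightarrow> real ^ 'n) \<Rightarrow> (real \<Rightarrow> real) \<Rightarrow> ('m, 'n) density" where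
  "nonisentropic_momentum_density M \<zeta> f = (\<lambda>t x v r s. r * metric M x v (\<zeta> x) * f s)"

definition nonisentropic_galilean_density ::
  "('m, 'n::finite) riemannian \<Rightarrow> ('m \<Rightarrow> real) \<Rightarrow> (real \<Rightarrow> real) \<Rightarrow> ('m, 'n) density" where
  "nonisentropic_galilean_density M \<psi> f =
     (\<lambda>t x v r s. r * (\<psi> x - t * differential M \<psi> x v) * f s)"

text \<open>\<open>K\<close> stands for \<open>\<integral> f(S) P'(S) dS\<close>.\<close>

definition nonisentropic_energy_density ::
  "('m, 'n::finite) riemannian \<Rightarrow> (real \<Rightarrow> real) \<Rightarrow> (real \<Rightarrow> real) \<Rightarrow> ('m, 'n) density" where
  "nonisentropic_energy_density M f K = (\<lambda>t x v r s. 1/2 * r * metric M x v v * f s - K s)"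

definition nonconstant_fun :: "real set \<Rightarrow> (real \<Rightarrow> real) \<Rightarrow> bool" where
  "nonconstant_fun J f \<longleftrightarrow> smooth_on J f \<and> \<not> f constant_on J"

definition antideriv_on :: "real set \<Rightarrow> (real \<Rightarrow> real) \<Rightarrow> (real \<Rightarrow> real) \<Rightarrow> bool" where
  "antideriv_on J f K \<longleftrightarrow> (\<forall>s\<in>J. (K has_real_derivative f s) (at s))"

definition general_densities ::
  "('m, 'n::finite) riemannian \<Rightarrow> real set \<Rightarrow> (real \<Rightarrow> real \<Rightarrow> real) \<Rightarrow> ('m, 'n) density set" where
  "general_densities M J e =
     {mass_density} \<union>
     {entropy_density f | f. nonconstant_fun J f} \<union>
     {energy_density M e} \<union>
     {momentum_density M \<zeta> | \<zeta>. killing M \<zeta>} \<union>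
     {galilean_momentum_density M \<psi> | \<psi>. smooth_scalar M \<psi> \<and> killing M (grad M \<psi>)}"

definition polytropic_densities ::
  "('m, 'n::finite) riemannian \<Rightarrow> (real \<Rightarrow> real \<Rightarrow> real) \<Rightarrow> ('m, 'n) density set" where
  "polytropic_densities M P =
     {similarity_energy_density M P \<xi> \<Lambda> | \<xi> \<Lambda>. homothetic M \<xi> \<Lambda>} \<union>
     {galilean_energy_density M P \<theta> \<Lambda> | \<theta> \<Lambda>. smooth_scalar M \<theta> \<and> homothetic M (grad M \<theta>) \<Lambda>}"

definition isobaric_densities ::
  "('m, 'n::finite) riemannian \<Rightarrow> real set \<Rightarrow> (real \<Rightarrow> real) \<Rightarrow> ('m, 'n) density set" where
  "isobaric_densities M J \<kappa> =
     {nonisentropic_momentum_density M \<zeta> f | \<zeta> f. killing M \<zeta> \<and> nonconstant_fun J f} \<union>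
     {nonisentropic_energy_density M f K | f K.
        nonconstant_fun J f \<and> antideriv_on J (\<lambda>s. f s * deriv \<kappa> s) K}"

text \<open>
  For \<open>P = \<kappa>(S)\<close> the Galilean momenta may be multiplied by a function of the entropy as well:
  with \<open>K' = f \<kappa>'\<close>, the density \<open>\<rho> (\<psi> - t u\<rfloor>\<nabla>\<psi>) f(S)\<close> is conserved with \<open>\<Phi> = - t K(S) grad \<psi>\<close>,
  because a gradient Killing vector is divergence free.  These densities are not combinations of the
  preceding ones if \<open>\<psi>\<close> and \<open>f\<close> are not constant; if every such \<open>\<psi>\<close> is constant, they reduce to
  volumetric entropies.
\<close>

definition isobaric_galilean_densities ::
  "('m, 'n::finite) riemannian \<Rightarrow> real set \<Rightarrow> ('m, 'n) density set" where
  "isobaric_galilean_densities M J =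
     {nonisentropic_galilean_density M \<psi> f | \<psi> f.
        smooth_scalar M \<psi> \<and> killing M (grad M \<psi>) \<and> nonconstant_fun J f}"

definition extra_density ::
  "('m, 'n::finite) riemannian \<Rightarrow> real set \<Rightarrow> real set \<Rightarrow> (real \<Rightarrow> real \<Rightarrow> real) \<Rightarrow>
   (real \<Rightarrow> real \<Rightarrow> real) \<Rightarrow> ('m, 'n) density \<Rightarrow> bool" where
  "extra_density M I J P e T \<longleftrightarrow>
     conserved_density M I J P T \<and> \<not> generated M I J P (general_densities M J e) T"

text \<open>The pressure matters only up to an additive constant.\<close>

definition special_eos ::
  "nat \<Rightarrow> real set \<Rightarrow> real set \<Rightarrow> (real \<Rightarrow> real \<Rightarrow> real) \<Rightarrow> bool" where
  "special_eos n I J P \<longleftrightarrow>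
     (\<exists>P\<^sub>0. polytropic n I J (\<lambda>r s. P r s - P\<^sub>0)) \<or> (\<exists>\<kappa>. isobaric_entropy I J P \<kappa>)"

end

(* A density is conserved iff the "energy form" of its balance law is a total divergence, so in a
   chart iff its Euler-Lagrange expressions vanish.  The first of these forces
     T = r (c/2 |v|^2 + g(zeta, v)) + Q,
   with c, zeta, Q independent of v, and the second gives grad c = 0, L_zeta g = - c_t g and the
   equations for Q.  If P_r does not vanish identically, c and zeta do not depend on s, and c_t <> 0
   yields the ODE (1 + n/2) (P - P0) = (n/2) r P_r, whose solutions are the polytropic equations of
   state; zeta is then affine in t with a gradient as its slope.  If P_r = 0, then c_t = 0 while c
   and zeta may depend on s; a Killing field is determined by its 1-jet at a point, so zeta is a
   finite combination of Killing fields with coefficients depending on s.  The extra densities are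
   told apart from the general ones by T(v) + T(-v) - 2 T(0) and T(v) - T(-v). *)
theory Submission
  imports Defs
begin

text \<open>A flux is known only through its values on global states and may have any finite order,
  so no equations can be read off its jets. What survives is locality: changing a resting fluid
  inside a compact part of a chart changes the flux only there, and the integral of the energy form
  does not notice. As this form is affine in the first derivatives of the state, its variation is of
  first order and splits into a symmetry of the derivative part and one zeroth-order equation. In
  the other direction all listed densities belong to one family with the explicit flux
  \<open>a F X + C F u\<close>, where \<open>dF = f dP\<close>.

  The exponent 1 + 2/n has its origin in a trace: the Lie equation for zeta gives div zeta = - n c_t
  / 2, and this is the factor of the pressure in the equation for the time derivative of Q. The
  coefficients c and zeta are first obtained point by point; recovering them from T by differences
  in v makes them global and smooth. Derivatives of P are cancelled on the dense set where they are
  nonzero, followed by continuity.\<close>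

abbreviation der :: "('a::real_normed_vector \<Rightarrow> 'b::real_normed_vector) \<Rightarrow> 'a \<Rightarrow> 'a \<Rightarrow> 'b" where
  "der f x \<equiv> frechet_derivative f (at x)"

section \<open>Calculus of functions with all partial derivatives\<close>

lemma der_eq: "(f has_derivative f') (at x) \<Longrightarrow> der f x = f'"
  using frechet_derivative_at by metis

text \<open>\<open>smooth_on\<close> adds derivatives at the outer end of a list; here a partial
  derivative is taken first and the rest of the condition is put on it. In this form an induction on
  \<open>k\<close>, with the function generalised, proves each closure property, because the
  derivative of a sum, a product or a composite is built from functions of one order less.\<close>

primrec ck :: "nat \<Rightarrow> 'a::euclidean_space set \<Rightarrow> ('a \<Rightarrow> 'b::real_normed_vector) \<Rightarrow> bool" where
  "ck 0 U f = True"
| "ck (Suc k) U f \<longleftrightarrow> f differentiable_on U \<and> (\<forall>b\<in>Basis. ck k U (\<lambda>x. der f x b))"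

lemma iter_deriv_append1: "iter_deriv (bs @ [b]) f = iter_deriv bs (\<lambda>x. der f x b)"
  by (induction bs) auto

lemma smooth_imp_ck: "smooth_on U f \<Longrightarrow> ck k U f"
proof (induction k arbitrary: f)
  case (Suc k)
  have "smooth_on U (\<lambda>x. der f x b)" if "b \<in> Basis" for b
    unfolding smooth_on_def
  proof (intro allI impI)
    fix bs :: "'a list" assume "set bs \<subseteq> Basis"
    then have "iter_deriv (bs @ [b]) f differentiable_on U"
      using Suc.prems that unfolding smooth_on_def by (metis Un_subset_iff empty_subsetI insert_subset list.simps(15) set_append empty_set)
    then show "iter_deriv bs (\<lambda>x. der f x b) differentiable_on U"
      by (simp only: iter_deriv_append1)
  qed
  moreover have "f differentiable_on U"
    using Suc.prems unfolding smooth_on_def by (metis empty_set empty_subsetI iter_deriv.simps(1))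
  ultimately show ?case using Suc.IH by auto
qed auto

lemma ck_imp_iter_deriv:
  "ck (Suc (length bs)) U f \<Longrightarrow> set bs \<subseteq> Basis \<Longrightarrow> iter_deriv bs f differentiable_on U"
proof (induction bs arbitrary: f rule: rev_induct)
  case (snoc b bs)
  then have "ck (Suc (length bs)) U (\<lambda>x. der f x b)" by auto
  with snoc show ?case by (simp only: iter_deriv_append1) auto
qed auto

lemma smooth_iff_ck: "smooth_on U f \<longleftrightarrow> (\<forall>k. ck k U f)"
  using smooth_imp_ck ck_imp_iter_deriv unfolding smooth_on_def by metis

lemma ck_has_derivative:
  assumes "ck (Suc k) U f" "open U" "x \<in> U"
  shows "(f has_derivative der f x) (at x)"
  using assms by (metis ck.simps(2) differentiable_on_eq_differentiable_at frechet_derivative_works)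

text \<open>\<open>frechet_derivative\<close> is a choice among all derivatives, and near
  \<open>x\<close> both functions have the same ones; so the equation holds also where neither is
  differentiable.\<close>

lemma der_cong:
  assumes "open U" "x \<in> U" "\<And>z. z \<in> U \<Longrightarrow> f z = g z"
  shows "der f x = der g x"
proof -
  have "(f has_derivative f') (at x) \<longleftrightarrow> (g has_derivative f') (at x)" for f'
    using has_derivative_transform_within_open[of f _ x UNIV U g] has_derivative_transform_within_open[of g _ x UNIV U f] assms
    by auto
  then show ?thesis unfolding frechet_derivative_def by simp
qed

lemma ck_cong:
  assumes "open U" "\<And>x. x \<in> U \<Longrightarrow> f x = g x" "ck k U f"
  shows "ck k U g"
  using assms(2,3)
proof (induction k arbitrary: f g)
  case (Suc k)
  have "(g has_derivative der f x) (at x)" if "x \<in> U" for x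
    by (rule has_derivative_transform_within_open[OF ck_has_derivative[OF Suc.prems(2) assms(1) that] assms(1) that])
      (simp add: Suc.prems)
  then have "g differentiable_on U"
    by (meson assms(1) differentiable_def differentiable_on_eq_differentiable_at)
  moreover have "ck k U (\<lambda>x. der g x b)" if "b \<in> Basis" for b
  proof (rule Suc.IH[of "\<lambda>x. der f x b"])
    show "der f x b = der g x b" if "x \<in> U" for x
      by (rule fun_cong[OF der_cong[OF assms(1) that]]) (rule Suc.prems)
  qed (use Suc.prems that in auto)
  ultimately show ?case by simp
qed auto

lemma ck_SucI':
  assumes "open U" "\<And>x. x \<in> U \<Longrightarrow> (f has_derivative f' x) (at x)"
    and "\<And>b. b \<in> Basis \<Longrightarrow> ck k U (\<lambda>x. f' x b)"
  shows "ck (Suc k) U f"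
proof -
  have "f differentiable_on U"
    using assms(1,2) by (metis differentiable_on_eq_differentiable_at differentiable_def)
  moreover have "ck k U (\<lambda>x. der f x b)" if "b \<in> Basis" for b
    by (rule ck_cong[OF assms(1) _ assms(3)[OF that]]) (simp add: der_eq[OF assms(2)])
  ultimately show ?thesis by simp
qed

lemma ck_Suc_imp: "ck (Suc k) U f \<Longrightarrow> ck k U f"
  by (induction k arbitrary: f) auto

lemma ck_const: "open U \<Longrightarrow> ck k U (\<lambda>x. c)"
proof (induction k arbitrary: c)
  case (Suc k) show ?case by (rule ck_SucI'[where f'="\<lambda>x h. 0"]) (use Suc in auto)
qed auto

lemma ck_linear: "open U \<Longrightarrow> bounded_linear f \<Longrightarrow> ck k U f"
proof (cases k)
  case (Suc j) assume "open U" "bounded_linear f" then show ?thesis unfolding Suc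
    by (intro ck_SucI'[where f'="\<lambda>x. f"]) (auto intro: bounded_linear_imp_has_derivative ck_const)
qed auto

lemma ck_add: "open U \<Longrightarrow> ck k U f \<Longrightarrow> ck k U g \<Longrightarrow> ck k U (\<lambda>x. f x + g x)"
proof (induction k arbitrary: f g)
  case (Suc k) show ?case
    by (rule ck_SucI'[where f'="\<lambda>x h. der f x h + der g x h"])
      (use Suc in \<open>auto intro!: has_derivative_add ck_has_derivative simp del: ck.simps, auto\<close>)
qed auto

lemma ck_bounded_linear: "bounded_linear h \<Longrightarrow> open U \<Longrightarrow> ck k U f \<Longrightarrow> ck k U (\<lambda>x. h (f x))"
proof (induction k arbitrary: f)
  case (Suc k) show ?case
    by (rule ck_SucI'[where f'="\<lambda>x b. h (der f x b)"])
      (use Suc in \<open>auto intro!: bounded_linear.has_derivative[OF Suc.prems(1)] ck_has_derivative simp del: ck.simps, auto\<close>)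
qed auto

text \<open>By the Leibniz rule the derivative is a sum of two terms of the same shape, each with
  one factor differentiated once, so the induction closes.\<close>

lemma ck_bilinear:
  assumes "bounded_bilinear B" "open U"
  shows "ck k U f \<Longrightarrow> ck k U g \<Longrightarrow> ck k U (\<lambda>x. B (f x) (g x))"
proof (induction k arbitrary: f g)
  case (Suc k)
  have s: "ck k U f" "ck k U g" using Suc.prems ck_Suc_imp by blast+
  show ?case
  proof (rule ck_SucI'[where f'="\<lambda>x h. B (f x) (der g x h) + B (der f x h) (g x)"])
    show "ck k U (\<lambda>x. B (f x) (der g x b) + B (der f x b) (g x))" if "b \<in> Basis" for b
      using Suc that s by (intro ck_add assms Suc.IH) auto
  qed (use Suc assms in \<open>auto intro!: bounded_bilinear.FDERIV[OF assms(1)] ck_has_derivative simp del: ck.simps\<close>)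
qed auto

lemma ck_sum: "open U \<Longrightarrow> (\<And>i. i \<in> A \<Longrightarrow> ck k U (f i)) \<Longrightarrow> ck k U (\<lambda>x. \<Sum>i\<in>A. f i x)"
  by (induction A rule: infinite_finite_induct) (auto intro: ck_const ck_add)

lemma linear_expand:
  fixes L :: "'a::euclidean_space \<Rightarrow> 'b::real_vector"
  assumes "linear L" shows "L v = (\<Sum>b\<in>Basis. (v \<bullet> b) *\<^sub>R L b)"
proof -
  have "L v = L (\<Sum>b\<in>Basis. (v \<bullet> b) *\<^sub>R b)" by (simp only: euclidean_representation)
  also have "\<dots> = (\<Sum>b\<in>Basis. L ((v \<bullet> b) *\<^sub>R b))" using linear_sum[OF assms] by blast
  finally show ?thesis using linear_cmul[OF assms] by simp
qed

lemma linear_expand_axis: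
  fixes L :: "real ^ 'n \<Rightarrow> 'b::real_vector"
  assumes "linear L" shows "L v = (\<Sum>i\<in>UNIV. (v $ i) *\<^sub>R L (axis i 1))"
proof -
  have "L v = L (\<Sum>i\<in>UNIV. (v $ i) *\<^sub>R axis i 1)"
    using basis_expansion[of v] by (simp add: scalar_mult_eq_scaleR)
  then show ?thesis by (simp add: linear_sum[OF assms] linear_cmul[OF assms])
qed

text \<open>The chain rule yields \<open>der g (f x) (der f x b)\<close>, whose direction varies
  with \<open>x\<close>. Expanded in the basis it becomes a sum of components of a partial
  derivative of \<open>f\<close> times partial derivatives of \<open>g\<close> composed with
  \<open>f\<close>, and the latter fall under the induction hypothesis, which is generalised over
  \<open>g\<close>.\<close>

lemma ck_compose:
  fixes f :: "'a::euclidean_space \<Rightarrow> 'b::euclidean_space" and g :: "'b \<Rightarrow> 'c::real_normed_vector"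
  assumes U: "open U" and V: "open V" and sub: "\<And>x. x \<in> U \<Longrightarrow> f x \<in> V"
  shows "ck k U f \<Longrightarrow> ck k V g \<Longrightarrow> ck k U (\<lambda>x. g (f x))"
proof (induction k arbitrary: g)
  case (Suc k)
  have s: "ck k U f" using Suc.prems ck_Suc_imp by blast
  have hd: "((\<lambda>x. g (f x)) has_derivative (\<lambda>h. der g (f x) (der f x h))) (at x)" if "x \<in> U" for x
    using has_derivative_compose[OF ck_has_derivative[OF Suc.prems(1) U that]
        ck_has_derivative[OF Suc.prems(2) V sub[OF that]]] .
  have ex: "der g (f x) (der f x b) = (\<Sum>c\<in>Basis. (der f x b \<bullet> c) *\<^sub>R der g (f x) c)" if "x \<in> U" for x b
    by (rule linear_expand) (meson Suc.prems(2) V ck_has_derivative has_derivative_linear sub that)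
  show ?case
  proof (rule ck_SucI'[OF U hd])
    fix b :: 'a assume b: "b \<in> Basis"
    show "ck k U (\<lambda>x. der g (f x) (der f x b))"
      by (rule ck_cong[OF U ex[symmetric]])
        (use b Suc s U in \<open>auto intro!: ck_sum ck_bilinear[OF bounded_bilinear_scaleR] ck_bounded_linear[OF bounded_linear_inner_left]\<close>)
  qed (use U in auto)
qed auto

named_theorems smooth_intros

lemma smooth_cong: "open U \<Longrightarrow> (\<And>x. x \<in> U \<Longrightarrow> f x = g x) \<Longrightarrow> smooth_on U f \<Longrightarrow> smooth_on U g"
  using ck_cong unfolding smooth_iff_ck by metis

lemma smooth_const [smooth_intros]: "open U \<Longrightarrow> smooth_on U (\<lambda>x. c)"
  by (simp add: smooth_iff_ck ck_const)

lemma smooth_linear: "open U \<Longrightarrow> bounded_linear f \<Longrightarrow> smooth_on U f"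
  by (simp add: smooth_iff_ck ck_linear)

lemma smooth_id [smooth_intros]: "open U \<Longrightarrow> smooth_on U (\<lambda>x. x)"
  by (simp add: smooth_linear)

lemma smooth_bounded_linear: "bounded_linear h \<Longrightarrow> open U \<Longrightarrow> smooth_on U f \<Longrightarrow> smooth_on U (\<lambda>x. h (f x))"
  by (simp add: smooth_iff_ck ck_bounded_linear)

lemma smooth_add [smooth_intros]: "open U \<Longrightarrow> smooth_on U f \<Longrightarrow> smooth_on U g \<Longrightarrow> smooth_on U (\<lambda>x. f x + g x)"
  by (simp add: smooth_iff_ck ck_add)

lemma smooth_sum [smooth_intros]:
  "open U \<Longrightarrow> (\<And>i. i \<in> A \<Longrightarrow> smooth_on U (f i)) \<Longrightarrow> smooth_on U (\<lambda>x. \<Sum>i\<in>A. f i x)"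
  by (simp add: smooth_iff_ck ck_sum)

lemma smooth_bilinear:
  "bounded_bilinear B \<Longrightarrow> open U \<Longrightarrow> smooth_on U f \<Longrightarrow> smooth_on U g \<Longrightarrow> smooth_on U (\<lambda>x. B (f x) (g x))"
  by (simp add: smooth_iff_ck ck_bilinear)

lemmas smooth_scaleR [smooth_intros] = smooth_bilinear[OF bounded_bilinear_scaleR]
lemmas smooth_mult [smooth_intros] = smooth_bilinear[OF bounded_bilinear_mult]
lemmas smooth_inner [smooth_intros] = smooth_bilinear[OF bounded_bilinear_inner]
lemmas smooth_fst [smooth_intros] = smooth_bounded_linear[OF bounded_linear_fst]
lemmas smooth_snd [smooth_intros] = smooth_bounded_linear[OF bounded_linear_snd]
lemmas smooth_nth [smooth_intros] = smooth_bounded_linear[OF bounded_linear_vec_nth]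
lemmas smooth_minus [smooth_intros] = smooth_bounded_linear[OF bounded_linear_minus[OF bounded_linear_ident]]

lemma smooth_diff [smooth_intros]: "open U \<Longrightarrow> smooth_on U f \<Longrightarrow> smooth_on U g \<Longrightarrow> smooth_on U (\<lambda>x. f x - g x)"
  using smooth_add[OF _ _ smooth_minus, of U f g] by simp

lemma smooth_Pair [smooth_intros]:
  assumes "open U" "smooth_on U f" "smooth_on U g" shows "smooth_on U (\<lambda>x. (f x, g x))"
proof -
  have b: "bounded_linear (\<lambda>y::'b. (y, 0::'c))" "bounded_linear (\<lambda>y::'c. (0::'b, y))"
    by (intro bounded_linear_Pair bounded_linear_ident bounded_linear_zero)+
  have "smooth_on U (\<lambda>x. (f x, 0::'c) + (0::'b, g x))"
    by (intro smooth_add smooth_bounded_linear[OF b(1)] smooth_bounded_linear[OF b(2)] assms)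
  then show ?thesis by simp
qed

lemma smooth_power [smooth_intros]:
  fixes f :: "'a::euclidean_space \<Rightarrow> real"
  shows "open U \<Longrightarrow> smooth_on U f \<Longrightarrow> smooth_on U (\<lambda>x. f x ^ n)"
  by (induction n) (auto intro: smooth_intros)

lemma smooth_prod [smooth_intros]:
  fixes f :: "'i \<Rightarrow> 'a::euclidean_space \<Rightarrow> real"
  shows "open U \<Longrightarrow> (\<And>i. i \<in> A \<Longrightarrow> smooth_on U (f i)) \<Longrightarrow> smooth_on U (\<lambda>x. \<Prod>i\<in>A. f i x)"
  by (induction A rule: infinite_finite_induct) (auto intro: smooth_intros)

lemma smooth_compose:
  fixes f :: "'a::euclidean_space \<Rightarrow> 'b::euclidean_space"
  assumes "open U" "open V" "\<And>x. x \<in> U \<Longrightarrow> f x \<in> V" "smooth_on U f" "smooth_on V g"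
  shows "smooth_on U (\<lambda>x. g (f x))"
  using assms ck_compose unfolding smooth_iff_ck by metis

lemma smooth_subset: "smooth_on V f \<Longrightarrow> U \<subseteq> V \<Longrightarrow> smooth_on U f"
  unfolding smooth_on_def using differentiable_on_subset by blast

lemma smooth_has_derivative: "smooth_on U f \<Longrightarrow> open U \<Longrightarrow> x \<in> U \<Longrightarrow> (f has_derivative der f x) (at x)"
  using ck_has_derivative smooth_iff_ck by blast

lemma smooth_linear_der: "smooth_on U f \<Longrightarrow> open U \<Longrightarrow> x \<in> U \<Longrightarrow> linear (der f x)"
  using smooth_has_derivative has_derivative_linear by blast

lemma has_vector_derivative_line:
  assumes H: "smooth_on U H" "open U" and y: "y + t *\<^sub>R v \<in> U"
  shows "((\<lambda>h. H (y + h *\<^sub>R v)) has_vector_derivative der H (y + t *\<^sub>R v) v) (at t within S)"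
proof -
  have "((\<lambda>h. y + h *\<^sub>R v) has_derivative (\<lambda>h. h *\<^sub>R v)) (at t within S)" by (auto intro!: derivative_eq_intros)
  from has_derivative_compose[OF this smooth_has_derivative[OF H y]] show ?thesis
    unfolding has_vector_derivative_def linear_cmul[OF smooth_linear_der[OF H y]] .
qed

lemma smooth_continuous_on: "smooth_on U f \<Longrightarrow> open U \<Longrightarrow> continuous_on U f"
  by (meson continuous_at_imp_continuous_on has_derivative_continuous smooth_has_derivative)

lemma smooth_openI:
  assumes "\<And>x. x \<in> U \<Longrightarrow> \<exists>V. open V \<and> x \<in> V \<and> smooth_on V f"
  shows "smooth_on U f"
  unfolding smooth_on_def
proof (intro allI impI)
  fix bs :: "'a list" assume bs: "set bs \<subseteq> Basis"
  show "iter_deriv bs f differentiable_on U"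
    unfolding differentiable_on_def
  proof
    fix x assume "x \<in> U"
    then obtain V where "open V" "x \<in> V" "smooth_on V f" using assms by blast
    then show "iter_deriv bs f differentiable at x within U"
      using bs unfolding smooth_on_def
      by (meson differentiable_at_withinI differentiable_on_eq_differentiable_at)
  qed
qed

lemma smooth_der_basis: "smooth_on U f \<Longrightarrow> b \<in> Basis \<Longrightarrow> smooth_on U (\<lambda>x. der f x b)"
  unfolding smooth_iff_ck by (metis ck.simps(2))

lemma smooth_der_compose [smooth_intros]:
  fixes f :: "'a::euclidean_space \<Rightarrow> 'b::real_normed_vector" and \<phi> h :: "'c::euclidean_space \<Rightarrow> 'a"
  assumes U: "open U" and \<phi>: "\<And>x. x \<in> U \<Longrightarrow> \<phi> x \<in> V" "smooth_on U \<phi>" and V: "open V" "smooth_on V f"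
    and h: "smooth_on U h"
  shows "smooth_on U (\<lambda>x. der f (\<phi> x) (h x))"
proof -
  have ex: "der f (\<phi> x) (h x) = (\<Sum>b\<in>Basis. (h x \<bullet> b) *\<^sub>R der f (\<phi> x) b)" if "x \<in> U" for x
    by (rule linear_expand[OF smooth_linear_der[OF V(2,1) \<phi>(1)[OF that]]])
  show ?thesis
  proof (rule smooth_cong[OF U ex[symmetric]])
  show "smooth_on U (\<lambda>x. \<Sum>b\<in>Basis. (h x \<bullet> b) *\<^sub>R der f (\<phi> x) b)"
  proof (intro smooth_sum smooth_scaleR smooth_inner smooth_const U h)
    show "smooth_on U (\<lambda>x. der f (\<phi> x) b)" if "b \<in> Basis" for b
      by (rule smooth_compose[OF U V(1) \<phi> smooth_der_basis[OF V(2) that]])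
  qed
  qed
qed

lemma smooth_der:
  assumes "open U" "smooth_on U f" "smooth_on U h" shows "smooth_on U (\<lambda>x. der f x (h x))"
  by (rule smooth_der_compose[where V=U]) (auto intro: assms smooth_id)

lemma smooth_vec_lambda [smooth_intros]:
  assumes "open U" "\<And>i. smooth_on U (f i)"
  shows "smooth_on U (\<lambda>x. \<chi> i. (f i x :: real))"
proof -
  have "(\<lambda>x. \<chi> i. f i x) = (\<lambda>x. \<Sum>i\<in>UNIV. f i x *\<^sub>R axis i 1)"
    by (auto simp: vec_eq_iff axis_def if_distrib cong: if_cong)
  then show ?thesis by (simp only:) (intro smooth_intros assms)
qed

text \<open>The derivative of the inverse is a polynomial in the inverse itself, so each order
  follows from the one before.\<close>

lemma smooth_inverse_real: "smooth_on (-{0}) (inverse :: real \<Rightarrow> real)"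
proof -
  have "ck k (-{0}) (inverse :: real \<Rightarrow> real)" for k
  proof (induction k)
    case (Suc k)
    show ?case
      by (rule ck_SucI'[where f'="\<lambda>x h. - (inverse x * h * inverse x)"])
        (use Suc in \<open>auto intro!: has_derivative_inverse' ck_bilinear[OF bounded_bilinear_mult]
          ck_bounded_linear[OF bounded_linear_minus[OF bounded_linear_ident]]\<close>)
  qed auto
  then show ?thesis by (simp add: smooth_iff_ck)
qed

lemma smooth_inverse [smooth_intros]:
  fixes f :: "'a::euclidean_space \<Rightarrow> real"
  assumes "open U" "smooth_on U f" "\<And>x. x \<in> U \<Longrightarrow> f x \<noteq> 0"
  shows "smooth_on U (\<lambda>x. inverse (f x))"
  by (rule smooth_compose[OF assms(1) _ _ assms(2) smooth_inverse_real]) (use assms in auto)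

lemma smooth_divide [smooth_intros]:
  fixes f g :: "'a::euclidean_space \<Rightarrow> real"
  assumes "open U" "smooth_on U f" "smooth_on U g" "\<And>x. x \<in> U \<Longrightarrow> g x \<noteq> 0"
  shows "smooth_on U (\<lambda>x. f x / g x)"
  unfolding divide_inverse by (intro smooth_intros assms)

lemma smooth_exp [smooth_intros]:
  fixes f :: "'a::euclidean_space \<Rightarrow> real"
  assumes "open U" "smooth_on U f" shows "smooth_on U (\<lambda>x. exp (f x))"
proof (rule smooth_compose[OF assms(1) open_UNIV _ assms(2)])
  have "ck k UNIV (exp :: real \<Rightarrow> real)" for k
  proof (induction k)
    case (Suc k)
    have e: "(exp has_derivative (*) (exp x)) (at x)" for x :: real
      using DERIV_exp[of x] by (simp add: has_field_derivative_def)
    show ?case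
      by (rule ck_SucI'[OF open_UNIV e]) (use Suc in auto)
  qed auto
  then show "smooth_on UNIV (exp :: real \<Rightarrow> real)" by (simp add: smooth_iff_ck)
qed auto

lemma smooth_ln [smooth_intros]:
  fixes f :: "'a::euclidean_space \<Rightarrow> real"
  assumes "open U" "smooth_on U f" "\<And>x. x \<in> U \<Longrightarrow> f x > 0"
  shows "smooth_on U (\<lambda>x. ln (f x))"
proof (rule smooth_compose[OF assms(1) _ _ assms(2), of "{0<..}"])
  have "ck k {0<..} (ln :: real \<Rightarrow> real)" for k
  proof (cases k)
    case (Suc j)
    have e: "(ln has_derivative (*) (inverse x)) (at x)" if "x \<in> {0<..}" for x :: real
      using DERIV_ln[of x] that by (simp add: has_field_derivative_def divide_inverse)
    show ?thesis unfolding Suc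
    proof (rule ck_SucI'[OF _ e])
      have "smooth_on {0<..} (\<lambda>x::real. inverse x)"
        by (intro smooth_intros) auto
      then show "ck j {0<..} (\<lambda>x::real. inverse x * b)" if "b \<in> Basis" for b
        using that by (simp add: smooth_iff_ck)
    qed auto
  qed auto
  then show "smooth_on {0<..} (ln :: real \<Rightarrow> real)" by (simp add: smooth_iff_ck)
qed (use assms in auto)

subsection \<open>Symmetry of second derivatives\<close>

lemma der_inner:
  assumes "f differentiable (at x)" shows "der (\<lambda>z. f z \<bullet> c) x v = der f x v \<bullet> c"
proof -
  have "((\<lambda>z. f z \<bullet> c) has_derivative (\<lambda>v. der f x v \<bullet> c)) (at x)"
    using assms frechet_derivative_works bounded_linear.has_derivative[OF bounded_linear_inner_left] by blast
  then show ?thesis using der_eq by metis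
qed

lemma smooth_differentiable: "smooth_on U f \<Longrightarrow> open U \<Longrightarrow> x \<in> U \<Longrightarrow> f differentiable (at x)"
  using smooth_has_derivative differentiable_def by blast

text \<open>Differentiating \<open>f (x + s a + w b) - f (x + w b) = \<integral>\<^sub>0\<^sup>s \<partial>\<^sub>a f (x + u a + w b) du\<close> in \<open>w\<close> and then in \<open>s\<close> at \<open>0\<close>.\<close>

lemma der_swap:
  fixes f :: "'a::euclidean_space \<Rightarrow> 'b::euclidean_space"
  assumes U: "open U" "x \<in> U" and f: "smooth_on U f"
  shows "der (\<lambda>z. der f z a) x b = der (\<lambda>z. der f z b) x a"
proof -
  define p where "p u w = x + u *\<^sub>R a + w *\<^sub>R b" for u w
  have sd: "smooth_on U (\<lambda>z. der f z c)" for c by (intro smooth_der U f smooth_const)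
  have "open ((\<lambda>z. p (fst z) (snd z)) -` U)" unfolding p_def by (intro open_vimage U continuous_intros)
  then obtain d where d: "d > 0" "ball (0, 0) d \<subseteq> (\<lambda>z. p (fst z) (snd z)) -` U"
    using U(2) open_contains_ball by (metis (no_types, lifting) add.right_neutral fst_conv p_def scale_zero_left snd_conv vimageI)
  \<comment> \<open>\<open>norm (u, w)\<close> is at most
    \<open>\<bar>u\<bar> + \<bar>w\<bar>\<close>, so the closed square of half side
    \<open>d / 3\<close> lies in the open ball of radius \<open>d\<close>.\<close>
  define e where "e = d / 3"
  have e: "e > 0" using d by (simp add: e_def)
  have pU: "p u w \<in> U" if "\<bar>u\<bar> \<le> e" "\<bar>w\<bar> \<le> e" for u w
  proof -
    have "norm (u, w) < d" using norm_Pair_le[of u w] that d(1) unfolding e_def by simp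
    then have "(u, w) \<in> ball (0, 0) d" by (simp add: dist_norm norm_Pair)
    then show ?thesis using d(2) by fastforce
  qed
  have hd: "((\<lambda>u. H (p u w)) has_vector_derivative der H (p u w) a) (at u within S)"
    "((\<lambda>w. H (p u w)) has_vector_derivative der H (p u w) b) (at w within S)"
    if H: "smooth_on U H" and u: "\<bar>u\<bar> \<le> e" "\<bar>w\<bar> \<le> e" for H :: "'a \<Rightarrow> 'b" and u w S
    using has_vector_derivative_line[OF H U(1), of "x + w *\<^sub>R b" u a S] has_vector_derivative_line[OF H U(1), of "x + u *\<^sub>R a" w b S] pU[OF u]
    by (simp_all add: p_def add_ac)
  have c: "continuous_on S (\<lambda>z. H (p (P z) (Q z)))"
    if "smooth_on U H" "continuous_on S P" "continuous_on S Q" "\<And>z. z \<in> S \<Longrightarrow> \<bar>P z\<bar> \<le> e \<and> \<bar>Q z\<bar> \<le> e"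
    for H :: "'a \<Rightarrow> 'b" and S :: "'z::topological_space set" and P Q
    by (rule continuous_on_compose2[OF smooth_continuous_on[OF that(1) U(1)]])
      (use that pU in \<open>auto simp: p_def intro!: continuous_intros\<close>)
  have sdd: "smooth_on U (\<lambda>z. der (\<lambda>z. der f z a) z b)" by (intro smooth_der U sd smooth_const)
  have eq: "der f (p s 0) b - der f (p 0 0) b = integral {0..s} (\<lambda>u. der (\<lambda>z. der f z a) (p u 0) b)" if s: "0 \<le> s" "s \<le> e" for s
  proof -
    let ?E = "{- e<..<e}"
    have int: "integral (cbox 0 s) (\<lambda>u. der f (p u w) a) = f (p s w) - f (p 0 w)" if "w \<in> ?E" for w
      using fundamental_theorem_of_calculus[OF s(1), of "\<lambda>u. f (p u w)" "\<lambda>u. der f (p u w) a"] hd(1)[OF f, of _ w] s that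
      by (auto intro!: integral_unique)
    have "((\<lambda>w. integral (cbox 0 s) (\<lambda>u. der f (p u w) a)) has_vector_derivative
        integral (cbox 0 s) (\<lambda>u. der (\<lambda>z. der f z a) (p u 0) b)) (at 0 within ?E)"
    proof (rule leibniz_rule_vector_derivative)
      show "(\<lambda>u. der f (p u w) a) integrable_on cbox 0 s" if "w \<in> ?E" for w
        by (intro integrable_continuous c[OF sd] continuous_intros) (use s that in auto)
      show "continuous_on (?E \<times> cbox 0 s) (\<lambda>(w, u). der (\<lambda>z. der f z a) (p u w) b)"
        unfolding case_prod_unfold by (intro c[OF sdd] continuous_intros) (use s in auto)
    qed (use hd(2)[OF sd] e s in auto)
    then have "((\<lambda>w. integral (cbox 0 s) (\<lambda>u. der f (p u w) a)) has_vector_derivative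
        integral (cbox 0 s) (\<lambda>u. der (\<lambda>z. der f z a) (p u 0) b)) (at 0)"
      using at_within_open[of 0 ?E] e by simp
    from has_vector_derivative_transform_within_open[OF this, of ?E] int e
    have A: "((\<lambda>w. f (p s w) - f (p 0 w)) has_vector_derivative
        integral {0..s} (\<lambda>u. der (\<lambda>z. der f z a) (p u 0) b)) (at 0)" by simp
    have "((\<lambda>w. f (p s w) - f (p 0 w)) has_vector_derivative der f (p s 0) b - der f (p 0 0) b) (at 0)"
      by (intro has_vector_derivative_diff hd(2)[OF f]) (use s e in auto)
    from vector_derivative_unique_at[OF this A] show ?thesis .
  qed
  \<comment> \<open>The identity \<open>eq\<close> is available for \<open>s \<ge> 0\<close> only,
    so both sides are differentiated at the left end of \<open>{0..e}\<close>; on an interval with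
    more than one point such a derivative is unique.\<close>
  have "((\<lambda>s. integral {0..s} (\<lambda>u. der (\<lambda>z. der f z a) (p u 0) b)) has_vector_derivative
      der (\<lambda>z. der f z a) (p 0 0) b) (at 0 within {0..e})"
    by (intro integral_has_vector_derivative c[OF sdd] continuous_intros) (use e in auto)
  moreover have D: "((\<lambda>s. der f (p s 0) b - der f (p 0 0) b) has_vector_derivative der (\<lambda>z. der f z b) (p 0 0) a - 0) (at 0 within {0..e})"
    by (intro has_vector_derivative_diff hd(1)[OF sd] has_vector_derivative_const) (use e in auto)
  have "((\<lambda>s. integral {0..s} (\<lambda>u. der (\<lambda>z. der f z a) (p u 0) b)) has_vector_derivative
      der (\<lambda>z. der f z b) (p 0 0) a - 0) (at 0 within {0..e})"
    by (rule has_vector_derivative_transform[OF _ _ D]) (simp_all add: eq less_imp_le[OF e])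
  ultimately have "der (\<lambda>z. der f z a) (p 0 0) b = der (\<lambda>z. der f z b) (p 0 0) a - 0"
    using vector_derivative_unique_within_closed_interval[of 0 e 0] e by auto
  then show ?thesis by (simp add: p_def)
qed

subsection \<open>Bump functions\<close>

lemma smooth_exp_inverse: "smooth_on UNIV (\<lambda>x::real. if x > 0 then exp (- inverse x) else 0)"
proof -
  \<comment> \<open>This family is closed under differentiation: the derivative of
    \<open>h k\<close> is \<open>h (k+2) - k h (k+1)\<close>, also at 0, where every member is flat.
    The function of the lemma is \<open>h 0\<close>.\<close>
  define h where "h k x = (if x > 0 then inverse x ^ k * exp (- inverse x) else 0)" for k :: nat and x :: real
  have lim: "((\<lambda>x. h k x) \<longlongrightarrow> 0) (at 0)" for k
  proof -
    have "((\<lambda>x. x ^ k / exp x) \<longlongrightarrow> (0::real)) at_top" by (rule tendsto_power_div_exp_0)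
    then have "((\<lambda>x. (inverse x) ^ k / exp (inverse x)) \<longlongrightarrow> (0::real)) (at_right 0)"
      by (rule filterlim_compose) (rule filterlim_inverse_at_top_right)
    then have "((\<lambda>x. h k x) \<longlongrightarrow> 0) (at_right 0)"
      by (rule Lim_transform_eventually)
        (auto simp: eventually_at_right_field h_def exp_minus field_simps intro!: exI[of _ 1])
    moreover have "((\<lambda>x. h k x) \<longlongrightarrow> 0) (at_left 0)"
      by (rule Lim_transform_eventually[OF tendsto_const])
        (auto simp: eventually_at_left_field h_def intro!: exI[of _ "-1"])
    ultimately show ?thesis by (simp add: filterlim_split_at)
  qed
  have hd: "(h k has_derivative (\<lambda>t. t * (h (k+2) x - real k * h (k+1) x))) (at x)" for k x
  proof -
    have "(h k has_real_derivative (h (k+2) x - real k * h (k+1) x)) (at x)"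
    proof -
      consider "x < 0" | "x = 0" | "x > 0" by linarith
      then show ?thesis
      proof cases
        case 1
        have "((\<lambda>x. 0) has_real_derivative (h (k+2) x - real k * h (k+1) x)) (at x)"
          using 1 by (auto simp: h_def)
        then show ?thesis
          by (rule has_field_derivative_transform_within_open[of _ _ _ "{..<0}"]) (use 1 in \<open>auto simp: h_def\<close>)
      next
        case 2
        \<comment> \<open>The difference quotient of \<open>h k\<close> at 0 is
          \<open>h (k+1)\<close>, so the derivative at 0 is the limit of the next member.\<close>
        have "((\<lambda>x. h (k+1) x) \<longlongrightarrow> 0) (at 0)" by (rule lim)
        then have "((\<lambda>x. (h k x - h k 0) / (x - 0)) \<longlongrightarrow> 0) (at 0)"
          by (rule Lim_transform_eventually) (auto simp: h_def eventually_at_topological divide_inverse mult_ac intro!: exI[of _ UNIV])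
        then show ?thesis using 2 by (simp add: has_field_derivative_iff h_def)
      next
        case 3
        have "((\<lambda>x. inverse x ^ k * exp (- inverse x)) has_real_derivative (h (k+2) x - real k * h (k+1) x)) (at x)"
          using 3 power_minus_mult[of "k - 1" x] by (cases "k = 0"; cases "k = 1"; cases k) (auto intro!: derivative_eq_intros simp: h_def field_simps power2_eq_square)
        then show ?thesis
          by (rule has_field_derivative_transform_within_open[of _ _ _ "{0<..}"]) (use 3 in \<open>auto simp: h_def\<close>)
      qed
    qed
    then show ?thesis by (simp add: has_field_derivative_def mult_commute_abs)
  qed
  have "ck n UNIV (h k)" for n k
  proof (induction n arbitrary: k)
    case (Suc n)
    have cd: "ck n UNIV (\<lambda>x. f x - c * g x)" if "ck n UNIV f" "ck n UNIV g" for f g :: "real \<Rightarrow> real" and c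
      using ck_add[OF open_UNIV that(1) ck_bounded_linear[OF bounded_linear_mult_right[of "-c"] open_UNIV that(2)]] by simp
    show ?case by (rule ck_SucI'[OF open_UNIV hd]) (auto intro!: cd Suc)
  qed auto
  then have "smooth_on UNIV (h 0)" by (simp add: smooth_iff_ck)
  then show ?thesis by (simp add: h_def [abs_def] cong: if_cong)
qed

lemma bump_exists:
  fixes y0 :: "'a::euclidean_space"
  assumes "r > 0"
  obtains \<theta> :: "'a \<Rightarrow> real" where "smooth_on UNIV \<theta>" "\<And>y. 0 \<le> \<theta> y" "\<And>y. \<theta> y \<le> 1"
    "\<And>y. y \<in> ball y0 (r/2) \<Longrightarrow> \<theta> y = 1" "\<And>y. y \<notin> ball y0 r \<Longrightarrow> \<theta> y = 0"
proof -
  define h where "h x = (if x > 0 then exp (- inverse x) else 0)" for x :: real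
  have h: "smooth_on UNIV h" using smooth_exp_inverse by (simp add: h_def [abs_def])
  have hp: "h x \<ge> 0" "h x = 0 \<longleftrightarrow> x \<le> 0" for x by (auto simp: h_def)
  have pos: "h x + h (c - x) > 0" if "c > 0" for x c
    using hp(1)[of x] hp(1)[of "c - x"] hp(2)[of x] hp(2)[of "c-x"] that by (smt (verit))
  \<comment> \<open>The value of \<open>q\<close> on the sphere of radius \<open>r/2\<close>: inside
    it \<open>h (c - q y)\<close> vanishes and the quotient is 1. The denominator is positive
    because \<open>q\<close> and \<open>c - q\<close> cannot both be nonpositive.\<close>
  define c where "c = r\<^sup>2 - (r/2)\<^sup>2"
  have c: "c > 0" using assms by (auto simp: c_def power2_eq_square)
  define q where "q y = r\<^sup>2 - (y - y0) \<bullet> (y - y0)" for y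
  define \<theta> where "\<theta> y = h (q y) / (h (q y) + h (c - q y))" for y
  have q: "smooth_on UNIV q" unfolding q_def by (intro smooth_intros open_UNIV)
  have hq: "smooth_on UNIV (\<lambda>y. h (q y))" "smooth_on UNIV (\<lambda>y. h (c - q y))"
    by (rule smooth_compose[OF _ _ _ _ h]; auto intro!: q smooth_intros)+
  show thesis
  proof
    show "smooth_on UNIV \<theta>" unfolding \<theta>_def
      by (intro smooth_intros hq open_UNIV) (use pos[OF c] in \<open>smt (verit)\<close>)
    show "0 \<le> \<theta> y" "\<theta> y \<le> 1" for y using hp(1) pos[OF c, of "q y"] by (auto simp: \<theta>_def divide_le_eq)
    show "\<theta> y = 1" if "y \<in> ball y0 (r/2)" for y
    proof -
      have "norm (y - y0) ^ 2 \<le> (r/2)^2" using that by (intro power_mono) (auto simp: dist_norm norm_minus_commute)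
      then have "h (c - q y) = 0" unfolding hp(2) c_def q_def by (simp add: power2_norm_eq_inner)
      then show ?thesis using pos[OF c, of "q y"] by (auto simp: \<theta>_def)
    qed
    show "\<theta> y = 0" if "y \<notin> ball y0 r" for y
    proof -
      have "norm (y - y0) ^ 2 \<ge> r^2" using that assms by (intro power_mono) (auto simp: dist_norm norm_minus_commute)
      then have "h (q y) = 0" unfolding hp(2) q_def by (simp add: power2_norm_eq_inner)
      then show ?thesis by (simp add: \<theta>_def)
    qed
  qed
qed


subsection \<open>Null Lagrangians\<close>

text \<open>The 1 in the denominator admits \<open>v = 0\<close>.\<close>

lemma scaled_norm_less:
  assumes "d > 0" "\<bar>h\<bar> < d / (norm v + 1)" shows "\<bar>h\<bar> * norm v < d"
proof -
  have "\<bar>h\<bar> * norm v \<le> \<bar>h\<bar> * (norm v + 1)" by (simp add: mult_left_mono)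
  also have "\<dots> < d" using assms by (simp add: pos_less_divide_eq add_nonneg_pos)
  finally show ?thesis .
qed

text \<open>Translating \<open>f\<close> by a short multiple of \<open>v\<close> keeps its support
  inside the box and so leaves the integral unchanged; differentiation under the integral sign then
  gives 0.\<close>

lemma integral_der_zero_UNIV:
  fixes f :: "'a::euclidean_space \<Rightarrow> real"
  assumes f: "smooth_on UNIV f" and K: "compact K" "K \<subseteq> box a b" and z: "\<And>y. y \<notin> K \<Longrightarrow> f y = 0"
  shows "integral (cbox a b) (\<lambda>y. der f y v) = 0"
proof (cases "K = {}")
  case True
  then have "f = (\<lambda>y. 0)" using z by auto
  then show ?thesis by simp
next
  case ne: False
  \<comment> \<open>The distance from the support to the outside of the box: shorter translations
    lose nothing of the support.\<close>
  obtain d where d: "d > 0" "\<And>x y. x \<in> K \<Longrightarrow> y \<notin> box a b \<Longrightarrow> d \<le> dist x y"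
  proof -
    have "\<exists>d>0. \<forall>x\<in>K. \<forall>y\<in>- box a b. d \<le> dist x y"
      using K by (intro separate_compact_closed) (auto simp: closed_Compl open_box)
    then show thesis using that by blast
  qed
  define e where "e = d / (norm v + 1)"
  have e: "e > 0" using d by (simp add: e_def add_nonneg_pos)
  have hv: "norm (h *\<^sub>R v) < d" if "\<bar>h\<bar> < e" for h
    using scaled_norm_less[OF d(1) that[unfolded e_def]] by simp
  have cf: "continuous_on S f" for S
    using smooth_continuous_on[OF f open_UNIV] continuous_on_subset by blast
  have cst: "integral (cbox a b) (\<lambda>y. f (y + h *\<^sub>R v)) = integral UNIV f" if h: "\<bar>h\<bar> < e" for h
  proof -
    have "integral (cbox a b) (\<lambda>y. f (y + h *\<^sub>R v)) = integral (cbox (a + h *\<^sub>R v) (b + h *\<^sub>R v)) f"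
      using integral_shift_cbox_plus[of a b f "h *\<^sub>R v"] by (simp add: o_def add.commute)
    also have "\<dots> = integral UNIV f"
    proof -
      have "y \<in> cbox (a + h *\<^sub>R v) (b + h *\<^sub>R v)" if "y \<in> K" for y
      proof -
        have "y - h *\<^sub>R v \<in> box a b"
          using d(2)[OF that, of "y - h *\<^sub>R v"] hv[OF h] by (auto simp: dist_norm)
        then have "y - h *\<^sub>R v \<in> cbox a b" using box_subset_cbox by blast
        then show ?thesis by (auto simp: mem_box inner_diff_left inner_add_left algebra_simps)
      qed
      then have "f = (\<lambda>y. if y \<in> cbox (a + h *\<^sub>R v) (b + h *\<^sub>R v) then f y else 0)"
        using z by (auto simp: fun_eq_iff)
      then show ?thesis
        using Henstock_Kurzweil_Integration.integral_restrict_UNIV[of "cbox (a + h *\<^sub>R v) (b + h *\<^sub>R v)" f] by simp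
    qed
    finally show ?thesis .
  qed
  note fd = has_vector_derivative_line[OF f open_UNIV UNIV_I]
  have "smooth_on UNIV (\<lambda>y. der f y v)" by (intro smooth_der f smooth_const open_UNIV)
  then have cd: "continuous_on S (\<lambda>y. der f y v)" for S
    using smooth_continuous_on[OF _ open_UNIV] continuous_on_subset by blast
  have "((\<lambda>h. integral (cbox a b) (\<lambda>y. f (y + h *\<^sub>R v))) has_vector_derivative
         integral (cbox a b) (\<lambda>y. der f (y + 0 *\<^sub>R v) v)) (at 0 within {-e<..<e})"
  proof (rule leibniz_rule_vector_derivative[OF fd])
    show "(\<lambda>y. f (y + h *\<^sub>R v)) integrable_on cbox a b" for h
      by (intro integrable_continuous continuous_on_compose2[OF cf] continuous_intros) auto
    show "continuous_on ({-e<..<e} \<times> cbox a b) (\<lambda>(h, y). der f (y + h *\<^sub>R v) v)"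
      unfolding case_prod_beta
      by (intro continuous_on_compose2[OF cd[of UNIV]] continuous_intros) auto
  qed (use e in auto)
  then have "((\<lambda>h. integral (cbox a b) (\<lambda>y. f (y + h *\<^sub>R v))) has_vector_derivative
         integral (cbox a b) (\<lambda>y. der f y v)) (at 0)"
    using at_within_open[of 0 "{-e<..<e}"] e by simp
  moreover have "((\<lambda>h. integral (cbox a b) (\<lambda>y. f (y + h *\<^sub>R v))) has_vector_derivative 0) (at 0)"
    by (rule has_vector_derivative_transform_within_open[of "\<lambda>h. integral UNIV f" _ _ "{-e<..<e}"])
      (use e cst in auto)
  ultimately show ?thesis using vector_derivative_unique_at by blast
qed

text \<open>The extension by zero is smooth on \<open>U\<close> and on the complement of
  \<open>K\<close>, two open sets that cover the space.\<close>

lemma integral_der_zero: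
  fixes f :: "'a::euclidean_space \<Rightarrow> real"
  assumes f: "smooth_on U f" "open U" "cbox a b \<subseteq> U" and K: "compact K" "K \<subseteq> box a b"
    and z: "\<And>y. y \<in> U - K \<Longrightarrow> f y = 0"
  shows "integral (cbox a b) (\<lambda>y. der f y v) = 0"
proof -
  define g where "g y = (if y \<in> U then f y else 0)" for y
  have KU: "K \<subseteq> U" using K f box_subset_cbox by blast
  have "smooth_on UNIV g"
  proof (rule smooth_openI)
    fix y :: 'a
    show "\<exists>V. open V \<and> y \<in> V \<and> smooth_on V g"
    proof (cases "y \<in> U")
      case True
      then show ?thesis using smooth_cong[OF f(2) _ f(1), of g] f(2) by (auto simp: g_def)
    next
      case False
      have o: "open (- K)" using K by (simp add: compact_imp_closed open_Compl)
      have "smooth_on (- K) g"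
        by (rule smooth_cong[OF o _ smooth_const[OF o, of 0]]) (use z in \<open>auto simp: g_def\<close>)
      then show ?thesis using o False KU by blast
    qed
  qed
  then have "integral (cbox a b) (\<lambda>y. der g y v) = 0"
    by (rule integral_der_zero_UNIV[OF _ K]) (use z KU in \<open>auto simp: g_def\<close>)
  moreover have "der g y v = der f y v" if "y \<in> cbox a b" for y
    by (rule fun_cong[OF der_cong[of U]]) (use that f in \<open>auto simp: g_def\<close>)
  ultimately show ?thesis
    using Henstock_Kurzweil_Integration.integral_cong[of "cbox a b" "\<lambda>y. der g y v" "\<lambda>y. der f y v"] by simp
qed

lemma der_Pair_smooth:
  assumes "smooth_on V f" "open V" "(x, y) \<in> V"
  shows "((\<lambda>h. f (x, h)) has_derivative (\<lambda>t. der f (x, y) (0, t))) (at y)"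
    "((\<lambda>h. f (h, y)) has_derivative (\<lambda>t. der f (x, y) (t, 0))) (at x)"
  by (rule has_derivative_compose[where f="\<lambda>h. (x, h)", OF _ smooth_has_derivative[OF assms]]
      has_derivative_compose[where f="\<lambda>h. (h, y)", OF _ smooth_has_derivative[OF assms]],
      auto intro!: derivative_eq_intros)+

context
  fixes U :: "'y::euclidean_space set" and \<Omega> :: "'w::euclidean_space set"
    and F :: "'y \<times> 'w \<Rightarrow> real" and G :: "'y \<Rightarrow> 'w \<Rightarrow> 'y \<times> 'w \<Rightarrow> real" and w0 :: 'w
  assumes U: "open U" and \<Omega>: "open \<Omega>" "convex \<Omega>" "w0 \<in> \<Omega>"
    and F: "smooth_on (U \<times> \<Omega>) F" and G: "\<And>b \<eta>. b \<in> Basis \<Longrightarrow> smooth_on (U \<times> \<Omega>) (G b \<eta>)"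
    and Gl: "\<And>b z. b \<in> Basis \<Longrightarrow> z \<in> U \<times> \<Omega> \<Longrightarrow> linear (\<lambda>\<eta>. G b \<eta> z)"
    and null: "\<And>K \<omega>. compact K \<Longrightarrow> K \<subseteq> U \<Longrightarrow> smooth_on UNIV \<omega> \<Longrightarrow> (\<And>y. y \<notin> K \<Longrightarrow> \<omega> y = 0) \<Longrightarrow>
      (\<And>y. w0 + \<omega> y \<in> \<Omega>) \<Longrightarrow>
      \<exists>\<Psi>. smooth_on U \<Psi> \<and> (\<forall>y\<in>U - K. \<Psi> y = 0) \<and>
        (\<forall>y\<in>U. F (y, w0 + \<omega> y) + (\<Sum>b\<in>Basis. G b (der \<omega> y b) (y, w0 + \<omega> y)) - F (y, w0) =
           (\<Sum>b\<in>Basis. der \<Psi> y b \<bullet> b))"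
begin

lemma G_expand:
  assumes "b \<in> Basis" "z \<in> U \<times> \<Omega>"
  shows "G b \<xi> z = (\<Sum>c\<in>Basis. (\<xi> \<bullet> c) * G b c z)"
  using linear_expand[OF Gl[OF assms], of \<xi>] by simp

text \<open>Integrating \<open>null\<close> over a box around the support removes the divergence:
  \<open>\<Psi>\<close> vanishes off \<open>K\<close>, so the derivatives of its components have
  integral zero.\<close>

lemma null_lagrangian_integral:
  assumes K: "compact K" "K \<subseteq> box a b'" "cbox a b' \<subseteq> U" and \<omega>: "smooth_on UNIV \<omega>" "\<And>y. y \<notin> K \<Longrightarrow> \<omega> y = 0"
      "\<And>y. w0 + \<omega> y \<in> \<Omega>"
  shows "integral (cbox a b') (\<lambda>y. F (y, w0 + \<omega> y) + (\<Sum>b\<in>Basis. G b (der \<omega> y b) (y, w0 + \<omega> y)) - F (y, w0)) = 0"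
proof -
  have KU: "K \<subseteq> U" using K box_subset_cbox by blast
  obtain \<Psi> where \<Psi>: "smooth_on U \<Psi>" "\<And>y. y \<in> U - K \<Longrightarrow> \<Psi> y = 0"
    "\<And>y. y\<in>U \<Longrightarrow> F (y, w0 + \<omega> y) + (\<Sum>b\<in>Basis. G b (der \<omega> y b) (y, w0 + \<omega> y)) - F (y, w0) =
           (\<Sum>b\<in>Basis. der \<Psi> y b \<bullet> b)"
    using null[OF K(1) KU \<omega>] by blast
  have s: "smooth_on U (\<lambda>y. \<Psi> y \<bullet> b)" for b by (intro smooth_intros U \<Psi>)
  have i0: "integral (cbox a b') (\<lambda>y. der (\<lambda>y. \<Psi> y \<bullet> b) y b) = 0" for b
    by (rule integral_der_zero[OF s U K(3,1,2)]) (simp add: \<Psi>(2))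
  have "integral (cbox a b') (\<lambda>y. \<Sum>b\<in>Basis. der (\<lambda>y. \<Psi> y \<bullet> b) y b) = 0"
  proof (subst Henstock_Kurzweil_Integration.integral_sum)
    show "(\<lambda>y. der (\<lambda>y. \<Psi> y \<bullet> b) y b) integrable_on cbox a b'" for b
      by (intro integrable_continuous continuous_on_subset[OF smooth_continuous_on[OF smooth_der[OF U s smooth_const[OF U]] U] K(3)])
  qed (auto simp: i0)
  then show ?thesis
    using K(3) by (subst Henstock_Kurzweil_Integration.integral_cong[of _ _ "\<lambda>y. \<Sum>b\<in>Basis. der (\<lambda>y. \<Psi> y \<bullet> b) y b"])
      (auto simp: \<Psi>(3) der_inner[OF smooth_differentiable[OF \<Psi>(1) U]] subset_iff)
qed

text \<open>The Lagrangian is \<open>F + (\<Sum>b. G b (d_b w))\<close>, affine in the derivatives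
  of the field \<open>w\<close>. Its Euler-Lagrange expression therefore has no second derivatives
  and is a function of the 1-jet, here with value \<open>w1\<close> and derivative \<open>A\<close>
  at \<open>y0\<close>. Were it nonzero there, a localised variation of a field with this jet would
  change an integral that \<open>null_lagrangian_integral\<close> keeps fixed.\<close>

lemma euler_lagrange:
  assumes y0: "y0 \<in> U" and w1: "w1 \<in> \<Omega>" and A: "bounded_linear A"
  shows "der F (y0, w1) (0, \<eta>) + (\<Sum>b\<in>Basis. der (G b (A b)) (y0, w1) (0, \<eta>)) =
         (\<Sum>b\<in>Basis. der (G b \<eta>) (y0, w1) (b, A b))"
proof (rule ccontr)
  define w where "w y = w1 + A (y - y0)" for y
  \<comment> \<open>The Euler-Lagrange expression along \<open>w0 + \<omega>\<close> in the
    direction \<open>\<eta>\<close>; the last sum is the total divergence of the components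
    \<open>G b \<eta>\<close>.\<close>
  define q where "q \<omega> y = der F (y, w0 + \<omega> y) (0, \<eta>) + (\<Sum>b\<in>Basis. der (G b (der \<omega> y b)) (y, w0 + \<omega> y) (0, \<eta>))
     - (\<Sum>b\<in>Basis. der (G b \<eta>) (y, w0 + \<omega> y) (b, der \<omega> y b))" for \<omega> y
  assume asm: "\<not> ?thesis"
  have UO: "open (U \<times> \<Omega>)" using U \<Omega> by (simp add: open_Times)
  \<comment> \<open>One \<open>\<delta>\<close> is spent on the affine field moving away from
    \<open>w1\<close>, the other on the variation along \<open>\<eta>\<close>.\<close>
  obtain \<delta> where \<delta>: "\<delta> > 0" "ball w1 (2*\<delta>) \<subseteq> \<Omega>"
  proof -
    obtain d where "d > 0" "ball w1 d \<subseteq> \<Omega>" using \<Omega>(1) w1 open_contains_ball by blast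
    then show thesis using that[of "d/2"] by simp
  qed
  obtain a b' where ab: "y0 \<in> box a b'" "cbox a b' \<subseteq> U" by (rule open_contains_cbox[OF U y0]) auto
  have A0: "A 0 = 0" using A by (simp add: linear_simps)
  have "isCont (\<lambda>y. A (y - y0)) y0"
    by (intro bounded_linear.isCont[OF A] continuous_intros)
  then have "\<exists>d>0. \<forall>y. dist y y0 < d \<longrightarrow> dist (A (y - y0)) (A (y0 - y0)) < \<delta>"
    using \<delta>(1) unfolding continuous_at_eps_delta by blast
  then obtain r1 where r1: "r1 > 0" "\<And>y. dist y y0 < r1 \<Longrightarrow> norm (A (y - y0)) < \<delta>"
    by (auto simp: A0)
  obtain r2 where r2: "r2 > 0" "cball y0 r2 \<subseteq> box a b'" using ab(1) open_box open_contains_cball by blast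
  define r where "r = min r1 r2"
  have r: "r > 0" using r1 r2 by (simp add: r_def)
  have rK: "cball y0 r \<subseteq> box a b'" using r2 by (auto simp: r_def)
  obtain ch :: "'y \<Rightarrow> real" where ch: "smooth_on UNIV ch" "\<And>y. 0 \<le> ch y" "\<And>y. ch y \<le> 1"
    "\<And>y. y \<in> ball y0 (r/2) \<Longrightarrow> ch y = 1" "\<And>y. y \<notin> ball y0 r \<Longrightarrow> ch y = 0"
    using bump_exists[OF r] by metis
  \<comment> \<open>Cut off so that \<open>w0 + \<omega> y\<close> is the convex combination of
    \<open>w0\<close> and \<open>w y\<close> with weight \<open>ch y\<close>: it has the prescribed
    jet at \<open>y0\<close>, equals \<open>w0\<close> far away and stays in the convex set
    \<open>\<Omega>\<close>.\<close>
  define \<omega> where "\<omega> y = ch y *\<^sub>R (w y - w0)" for y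
  let ?p = "\<lambda>y. (y, w0 + \<omega> y)"
  have sw: "smooth_on UNIV w" unfolding w_def
    by (intro smooth_intros open_UNIV smooth_bounded_linear[OF A])
  have s\<omega>: "smooth_on UNIV \<omega>" unfolding \<omega>_def by (intro smooth_intros open_UNIV sw ch)
  have wb: "norm (w y - w1) < \<delta>" if "y \<in> ball y0 r" for y
    using r1(2)[of y] that by (auto simp: w_def dist_commute r_def)
  have w\<Omega>: "w y \<in> \<Omega>" if "y \<in> ball y0 r" for y
    using wb[OF that] \<delta> by (auto simp: subset_iff dist_norm norm_minus_commute)
  have o\<Omega>: "w0 + \<omega> y \<in> \<Omega>" for y
  proof (cases "y \<in> ball y0 r")
    case True
    have "(1 - ch y) *\<^sub>R w0 + ch y *\<^sub>R w y \<in> \<Omega>"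
      using convexD[OF \<Omega>(2,3) w\<Omega>[OF True], of "1 - ch y" "ch y"] ch(2,3)[of y] by auto
    then show ?thesis by (simp add: \<omega>_def algebra_simps)
  qed (use ch(5) \<Omega> in \<open>auto simp: \<omega>_def\<close>)
  have near: "w0 + \<omega> y = w y" if "y \<in> ball y0 (r/2)" for y
    using ch(4)[OF that] by (simp add: \<omega>_def)
  have der\<omega>: "der \<omega> y = A" if "y \<in> ball y0 (r/2)" for y
  proof -
    have "((\<lambda>y. w y - w0) has_derivative A) (at y)" unfolding w_def
      by (auto intro!: derivative_eq_intros bounded_linear.has_derivative[OF A])
    then have "(\<omega> has_derivative A) (at y)"
      by (rule has_derivative_transform_within_open[OF _ open_ball that]) (use near in \<open>auto simp: algebra_simps\<close>)
    then show ?thesis by (rule der_eq)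
  qed
  have Gs: "smooth_on (U \<times> \<Omega>) (G b \<xi>)" if "b \<in> Basis" for b \<xi> by (rule G[OF that])
  have dG: "der (G b \<xi>) z h = (\<Sum>c\<in>Basis. (\<xi> \<bullet> c) * der (G b c) z h)" if "b \<in> Basis" "z \<in> U \<times> \<Omega>" for b \<xi> z h
  proof -
    have "((\<lambda>z. \<Sum>c\<in>Basis. (\<xi> \<bullet> c) * G b c z) has_derivative (\<lambda>h. \<Sum>c\<in>Basis. (\<xi> \<bullet> c) * der (G b c) z h)) (at z)"
      by (intro has_derivative_sum has_derivative_mult_right smooth_has_derivative[OF Gs UO] that)
    then have "(G b \<xi> has_derivative (\<lambda>h. \<Sum>c\<in>Basis. (\<xi> \<bullet> c) * der (G b c) z h)) (at z)"
      by (rule has_derivative_transform_within_open[OF _ UO that(2)]) (use G_expand[OF that(1)] in auto)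
    then show ?thesis by (simp add: der_eq)
  qed
  have so: "smooth_on U ?p"
    by (intro smooth_intros U smooth_subset[OF s\<omega>]) auto
  have sd\<omega>: "smooth_on U (\<lambda>y. der \<omega> y b)" for b
    by (rule smooth_subset[OF smooth_der[OF open_UNIV s\<omega> smooth_const]]) auto
  have sq: "smooth_on U (q \<omega>)"
  proof -
    have "smooth_on U (\<lambda>y. der F (?p y) (0, \<eta>) + (\<Sum>b\<in>Basis. \<Sum>c\<in>Basis. (der \<omega> y b \<bullet> c) * der (G b c) (?p y) (0, \<eta>))
     - (\<Sum>b\<in>Basis. der (G b \<eta>) (?p y) (b, der \<omega> y b)))"
      by (intro smooth_add smooth_diff smooth_sum smooth_mult smooth_inner U sd\<omega> smooth_const
          smooth_der_compose[OF U _ so UO F] smooth_der_compose[OF U _ so UO Gs] smooth_Pair)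
        (use o\<Omega> in auto)
    then show ?thesis
      by (rule smooth_cong[OF U, rotated]) (use dG o\<Omega> in \<open>auto simp: q_def intro!: sum.cong\<close>)
  qed
  have q0: "q \<omega> y0 \<noteq> 0"
    using asm near[of y0] der\<omega>[of y0] r by (simp add: q_def w_def A0)
  define \<sigma> where "\<sigma> = sgn (q \<omega> y0)"
  have cq: "continuous_on U (q \<omega>)" using smooth_continuous_on[OF sq U] .
  have "isCont (\<lambda>y. \<sigma> * q \<omega> y) y0"
    using cq continuous_on_eq_continuous_at[OF U] y0 by (intro continuous_intros) blast
  moreover have "\<sigma> * q \<omega> y0 > 0" using q0 unfolding \<sigma>_def by (simp add: sgn_if)
  ultimately have "\<exists>d>0. \<forall>y. dist y y0 < d \<longrightarrow> dist (\<sigma> * q \<omega> y) (\<sigma> * q \<omega> y0) < \<sigma> * q \<omega> y0"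
    unfolding continuous_at_eps_delta by blast
  then obtain r3 where r3': "r3 > 0" "\<And>y. dist y y0 < r3 \<Longrightarrow> dist (\<sigma> * q \<omega> y) (\<sigma> * q \<omega> y0) < \<sigma> * q \<omega> y0"
    by blast
  have r3: "r3 > 0" "\<And>y. dist y y0 < r3 \<Longrightarrow> \<sigma> * q \<omega> y > 0"
    using r3' by (auto simp: dist_real_def abs_less_iff)
  define \<rho> where "\<rho> = min r3 (r/2)"
  have \<rho>: "\<rho> > 0" "\<rho> \<le> r/2" "\<rho> \<le> r3" using r3 r by (auto simp: \<rho>_def)
  obtain th :: "'y \<Rightarrow> real" where th: "smooth_on UNIV th" "\<And>y. 0 \<le> th y" "\<And>y. th y \<le> 1"
    "\<And>y. y \<in> ball y0 (\<rho>/2) \<Longrightarrow> th y = 1" "\<And>y. y \<notin> ball y0 \<rho> \<Longrightarrow> th y = 0"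
    using bump_exists[OF \<rho>(1)] by metis
  define e where "e = \<delta> / (norm \<eta> + 1)"
  have e: "e > 0" using \<delta> by (simp add: e_def add_nonneg_pos)
  have e\<eta>: "\<bar>t\<bar> * norm \<eta> < \<delta>" if "\<bar>t\<bar> < e" for t
    by (rule scaled_norm_less[OF \<delta>(1) that[unfolded e_def]])
  have oe\<Omega>: "w0 + (\<omega> y + (t * th y) *\<^sub>R \<eta>) \<in> \<Omega>" if t: "\<bar>t\<bar> < e" for y t
  proof (cases "y \<in> ball y0 \<rho>")
    case True
    then have y: "y \<in> ball y0 (r/2)" "y \<in> ball y0 r" using \<rho> r by auto
    have "norm ((t * th y) *\<^sub>R \<eta>) \<le> \<bar>t\<bar> * norm \<eta>"
      using th(2,3)[of y] by (auto simp: abs_mult mult_left_le mult_right_mono)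
    then have "norm (w y - w1 + (t * th y) *\<^sub>R \<eta>) < \<delta> + \<delta>"
      using e\<eta>[OF t] wb[OF y(2)] by (intro norm_triangle_lt) linarith
    then have "w y + (t * th y) *\<^sub>R \<eta> \<in> \<Omega>"
      using \<delta>(2) by (auto simp: subset_iff dist_norm norm_minus_commute algebra_simps)
    then show ?thesis using near[OF y(1)] by (simp add: add.assoc[symmetric])
  qed (use th(5) o\<Omega> in auto)
  \<comment> \<open>The varied Lagrangian as a function of \<open>(t, y)\<close>. The direction
    argument of \<open>G\<close> is expanded in the basis, since \<open>G b \<xi>\<close> is known
    to be smooth only for fixed \<open>\<xi>\<close>.\<close>
  define L where "L z = F (snd z, w0 + (\<omega> (snd z) + (fst z * th (snd z)) *\<^sub>R \<eta>)) +
     (\<Sum>b\<in>Basis. \<Sum>c\<in>Basis. ((der \<omega> (snd z) b + (fst z * der th (snd z) b) *\<^sub>R \<eta>) \<bullet> c) *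
         G b c (snd z, w0 + (\<omega> (snd z) + (fst z * th (snd z)) *\<^sub>R \<eta>)))" for z :: "real \<times> 'y"
  let ?E = "{-e<..<e} \<times> U"
  have oE: "open ?E" using U by (simp add: open_Times)
  have sE: "smooth_on ?E (\<lambda>z. f (snd z))" if "smooth_on UNIV f" for f :: "'y \<Rightarrow> 'z::real_normed_vector"
    by (rule smooth_compose[OF oE open_UNIV _ _ that]) (auto intro!: smooth_intros oE)
  have sp: "smooth_on ?E (\<lambda>z. (snd z, w0 + (\<omega> (snd z) + (fst z * th (snd z)) *\<^sub>R \<eta>)))"
    by (intro smooth_intros oE sE[OF s\<omega>] sE[OF th(1)])
  have sL: "smooth_on ?E L" unfolding L_def
    by (intro smooth_add smooth_sum smooth_mult smooth_inner smooth_scaleR smooth_const smooth_fst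
         smooth_id oE smooth_compose[OF oE UO _ sp F] smooth_compose[OF oE UO _ sp Gs]
         sE[OF smooth_der[OF open_UNIV s\<omega> smooth_const]] sE[OF smooth_der[OF open_UNIV th(1) smooth_const]])
      (use oe\<Omega> in auto)
  have cL: "continuous_on ?E L" using smooth_continuous_on[OF sL oE] .
  have J: "integral (cbox a b') (\<lambda>y. L (t, y)) = integral (cbox a b') (\<lambda>y. F (y, w0))" if t: "\<bar>t\<bar> < e" for t
  proof -
    define \<omega>t where "\<omega>t y = \<omega> y + (t * th y) *\<^sub>R \<eta>" for y
    have st: "smooth_on UNIV \<omega>t" unfolding \<omega>t_def by (intro smooth_intros open_UNIV s\<omega> th(1))
    have "integral (cbox a b') (\<lambda>y. F (y, w0 + \<omega>t y) + (\<Sum>b\<in>Basis. G b (der \<omega>t y b) (y, w0 + \<omega>t y)) - F (y, w0)) = 0"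
    proof (rule null_lagrangian_integral[OF compact_cball rK ab(2) st])
      show "\<omega>t y = 0" if "y \<notin> cball y0 r" for y
        using that ch(5)[of y] th(5)[of y] \<rho> r by (auto simp: \<omega>t_def \<omega>_def)
      show "w0 + \<omega>t y \<in> \<Omega>" for y using oe\<Omega>[OF t] by (simp add: \<omega>t_def)
    qed
    moreover have "der \<omega>t y b = der \<omega> y b + (t * der th y b) *\<^sub>R \<eta>" for y b
    proof -
      have "(\<omega>t has_derivative (\<lambda>b. der \<omega> y b + (t * der th y b) *\<^sub>R \<eta>)) (at y)" unfolding \<omega>t_def
        by (intro has_derivative_add has_derivative_scaleR_left has_derivative_mult_right smooth_has_derivative[OF s\<omega>]
            smooth_has_derivative[OF th(1)]) auto
      then show ?thesis by (simp add: der_eq)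
    qed
    moreover have "F (y, w0 + \<omega>t y) + (\<Sum>b\<in>Basis. G b (der \<omega>t y b) (y, w0 + \<omega>t y)) = L (t, y)" if "y \<in> cbox a b'" for y
    proof -
      have "(y, w0 + \<omega>t y) \<in> U \<times> \<Omega>" using that ab(2) oe\<Omega>[OF t] by (auto simp: \<omega>t_def)
      then have "G b \<xi> (y, w0 + \<omega>t y) = (\<Sum>c\<in>Basis. (\<xi> \<bullet> c) * G b c (y, w0 + \<omega>t y))" if "b \<in> Basis" for b \<xi>
        using G_expand[OF that] by blast
      then show ?thesis using calculation(2) by (simp add: L_def \<omega>t_def)
    qed
    ultimately have "integral (cbox a b') (\<lambda>y. L (t, y) - F (y, w0)) = 0"
      using Henstock_Kurzweil_Integration.integral_cong[of "cbox a b'" "\<lambda>y. L (t, y) - F (y, w0)"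
        "\<lambda>y. F (y, w0 + \<omega>t y) + (\<Sum>b\<in>Basis. G b (der \<omega>t y b) (y, w0 + \<omega>t y)) - F (y, w0)"] by simp
    moreover have "(\<lambda>y. L (t, y)) integrable_on cbox a b'"
      by (intro integrable_continuous continuous_on_compose2[OF cL] continuous_intros) (use ab t in auto)
    moreover have "(\<lambda>y. F (y, w0)) integrable_on cbox a b'"
      by (intro integrable_continuous continuous_on_compose2[OF smooth_continuous_on[OF F UO]] continuous_intros)
        (use ab \<Omega> in auto)
    ultimately show ?thesis by (simp add: Henstock_Kurzweil_Integration.integral_diff)
  qed
  \<comment> \<open>Integration by parts: the derivative of the cut-off \<open>th\<close> that the
    variation produces is absorbed into the divergence of \<open>S\<close>, which integrates to
    zero.\<close>
  define S where "S b y = th y * G b \<eta> (?p y)" for b y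
  have sS: "smooth_on U (S b)" if "b \<in> Basis" for b unfolding S_def
    by (intro smooth_mult U smooth_subset[OF th(1)] smooth_compose[OF U UO _ so Gs[OF that]]) (use o\<Omega> in auto)
  have dL: "der L (0, y) (1, 0) = th y * q \<omega> y + (\<Sum>b\<in>Basis. der (S b) y b)" if y: "y \<in> U" for y
  proof -
    have z: "(?p y) \<in> U \<times> \<Omega>" using y o\<Omega> by simp
    have hp: "((\<lambda>t. (y, w0 + (\<omega> y + (t * th y) *\<^sub>R \<eta>))) has_derivative (\<lambda>t. (0, (t * th y) *\<^sub>R \<eta>))) (at 0)"
      by (auto intro!: derivative_eq_intros)
    have ct: "((\<lambda>t. H (y, w0 + (\<omega> y + (t * th y) *\<^sub>R \<eta>))) has_derivative (\<lambda>t. der H (?p y) (0, (t * th y) *\<^sub>R \<eta>))) (at 0)"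
      if "smooth_on (U \<times> \<Omega>) H" for H :: "'y \<times> 'w \<Rightarrow> real"
      using has_derivative_compose[OF hp, of H "der H (?p y)"] smooth_has_derivative[OF that UO z] by simp
    have "((\<lambda>t. L (t, y)) has_derivative (\<lambda>t. der F (?p y) (0, (t * th y) *\<^sub>R \<eta>) +
      (\<Sum>b\<in>Basis. \<Sum>c\<in>Basis. (der \<omega> y b \<bullet> c) * der (G b c) (?p y) (0, (t * th y) *\<^sub>R \<eta>) +
         t * der th y b * (\<eta> \<bullet> c) * G b c (?p y)))) (at 0)"
      unfolding L_def fst_conv snd_conv
    proof (intro has_derivative_add ct[OF F] has_derivative_sum)
      fix b :: 'y and c :: 'w assume b: "b \<in> Basis"
      have "((\<lambda>t. (der \<omega> y b + (t * der th y b) *\<^sub>R \<eta>) \<bullet> c) has_derivative (\<lambda>t. t * der th y b * (\<eta> \<bullet> c))) (at 0)"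
        by (auto intro!: derivative_eq_intros)
      from has_derivative_mult[OF this ct[OF Gs[OF b, of c]]]
      show "((\<lambda>t. (der \<omega> y b + (t * der th y b) *\<^sub>R \<eta>) \<bullet> c * G b c (y, w0 + (\<omega> y + (t * th y) *\<^sub>R \<eta>)))
         has_derivative (\<lambda>t. (der \<omega> y b \<bullet> c) * der (G b c) (?p y) (0, (t * th y) *\<^sub>R \<eta>) +
         t * der th y b * (\<eta> \<bullet> c) * G b c (?p y))) (at 0)"
        by simp
    qed
    moreover have "(\<lambda>t. der L (0, y) (t, 0)) = der (\<lambda>t. L (t, y)) 0"
      using der_Pair_smooth(2)[OF sL oE, of 0 y] e y by (simp add: der_eq)
    ultimately have "(\<lambda>t. der L (0, y) (t, 0)) = (\<lambda>t. der F (?p y) (0, (t * th y) *\<^sub>R \<eta>) +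
      (\<Sum>b\<in>Basis. \<Sum>c\<in>Basis. (der \<omega> y b \<bullet> c) * der (G b c) (?p y) (0, (t * th y) *\<^sub>R \<eta>) +
         t * der th y b * (\<eta> \<bullet> c) * G b c (?p y)))" by (simp add: der_eq)
    then have 1: "der L (0, y) (1, 0) = der F (?p y) (0, th y *\<^sub>R \<eta>) +
      (\<Sum>b\<in>Basis. \<Sum>c\<in>Basis. (der \<omega> y b \<bullet> c) * der (G b c) (?p y) (0, th y *\<^sub>R \<eta>) +
         der th y b * (\<eta> \<bullet> c) * G b c (?p y))" by (metis (no_types, lifting) mult_1 sum.cong)
    have 2: "(\<Sum>c\<in>Basis. (der \<omega> y b \<bullet> c) * der (G b c) (?p y) (0, th y *\<^sub>R \<eta>) +
         der th y b * (\<eta> \<bullet> c) * G b c (?p y)) = th y * der (G b (der \<omega> y b)) (?p y) (0, \<eta>) +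
           der th y b * G b \<eta> (?p y)" if b: "b \<in> Basis" for b
    proof -
      have "der (G b c) (?p y) (0, th y *\<^sub>R \<eta>) = th y * der (G b c) (?p y) (0, \<eta>)" for c
        using linear_cmul[OF smooth_linear_der[OF Gs[OF b, of c] UO z], of "th y" "(0, \<eta>)"] by simp
      then show ?thesis
        by (simp add: sum.distrib dG[OF b z, of "der \<omega> y b"] G_expand[OF b z, of \<eta>] sum_distrib_left mult_ac)
    qed
    have 3: "der F (?p y) (0, th y *\<^sub>R \<eta>) = th y * der F (?p y) (0, \<eta>)"
      using linear_cmul[OF smooth_linear_der[OF F UO z], of "th y" "(0, \<eta>)"] by simp
    have 4: "der (S b) y b = th y * der (G b \<eta>) (?p y) (b, der \<omega> y b) + der th y b * G b \<eta> (?p y)"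
      if b: "b \<in> Basis" for b
    proof -
      have hp: "(?p has_derivative (\<lambda>h. (h, der \<omega> y h))) (at y)"
        using smooth_has_derivative[OF s\<omega>, of y] by (auto intro!: derivative_eq_intros)
      have "((\<lambda>y. G b \<eta> (?p y)) has_derivative (\<lambda>h. der (G b \<eta>) (?p y) (h, der \<omega> y h))) (at y)"
        using has_derivative_compose[OF hp smooth_has_derivative[OF Gs[OF b] UO z]] .
      from has_derivative_mult[OF smooth_has_derivative[OF th(1)] this]
      show ?thesis unfolding S_def [abs_def] by (simp add: der_eq)
    qed
    show ?thesis unfolding 1 3 q_def using 2 4
      by (simp add: sum.distrib algebra_simps sum_distrib_left)
  qed
  have tv: "((\<lambda>s. L (s, y)) has_vector_derivative der L (t, y) (1, 0)) (at t within {-e<..<e})" if "t \<in> {-e<..<e}" "y \<in> cbox a b'" for t y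
  proof -
    have tz: "(t, y) \<in> ?E" using that ab(2) by auto
    have "(\<lambda>s. der L (t, y) (s, 0)) = (\<lambda>s. s *\<^sub>R der L (t, y) (1, 0))"
    proof
      show "der L (t, y) (s, 0) = s *\<^sub>R der L (t, y) (1, 0)" for s
        using linear_cmul[OF smooth_linear_der[OF sL oE tz], of s "(1, 0)"] by simp
    qed
    from has_derivative_at_withinI[OF der_Pair_smooth(2)[OF sL oE tz]] this show ?thesis
      unfolding has_vector_derivative_def by (simp only:)
  qed
  have "((\<lambda>t. integral (cbox a b') (\<lambda>y. L (t, y))) has_vector_derivative
         integral (cbox a b') (\<lambda>y. der L (0, y) (1, 0))) (at 0 within {-e<..<e})"
  proof (rule leibniz_rule_vector_derivative[OF tv])
    show "(\<lambda>y. L (t, y)) integrable_on cbox a b'" if "t \<in> {-e<..<e}" for t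
      by (intro integrable_continuous continuous_on_compose2[OF cL] continuous_intros) (use ab that in auto)
    have "continuous_on ?E (\<lambda>z. der L z (1, 0))"
      by (rule smooth_continuous_on[OF smooth_der[OF oE sL smooth_const[OF oE]] oE])
    then show "continuous_on ({-e<..<e} \<times> cbox a b') (\<lambda>(t, y). der L (t, y) (1, 0))"
      using ab(2) by (auto intro: continuous_on_subset simp: case_prod_beta)
  qed (use e in auto)
  then have "((\<lambda>t. integral (cbox a b') (\<lambda>y. L (t, y))) has_vector_derivative
         integral (cbox a b') (\<lambda>y. der L (0, y) (1, 0))) (at 0)"
    using at_within_open[of 0 "{-e<..<e}"] e by simp
  moreover have "((\<lambda>t. integral (cbox a b') (\<lambda>y. L (t, y))) has_vector_derivative 0) (at 0)"
  proof (rule has_vector_derivative_transform_within_open[OF has_vector_derivative_const])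
    show "0 \<in> {-e<..<e}" "open {-e<..<e}" using e by auto
    show "integral (cbox a b') (\<lambda>y. F (y, w0)) = integral (cbox a b') (\<lambda>y. L (t, y))" if "t \<in> {-e<..<e}" for t
      by (rule J[symmetric]) (use that in auto)
  qed
  ultimately have "integral (cbox a b') (\<lambda>y. der L (0, y) (1, 0)) = 0" using vector_derivative_unique_at by blast
  then have i1: "integral (cbox a b') (\<lambda>y. th y * q \<omega> y + (\<Sum>b\<in>Basis. der (S b) y b)) = 0"
    using Henstock_Kurzweil_Integration.integral_cong[of "cbox a b'" "\<lambda>y. th y * q \<omega> y + (\<Sum>b\<in>Basis. der (S b) y b)"
        "\<lambda>y. der L (0, y) (1, 0)"] dL ab(2) by (simp add: subset_iff)
  have iS: "(\<lambda>y. der (S b) y b) integrable_on cbox a b'" if "b \<in> Basis" for b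
    by (intro integrable_continuous continuous_on_subset[OF smooth_continuous_on[OF smooth_der[OF U sS[OF that] smooth_const[OF U]] U] ab(2)])
  have "integral (cbox a b') (\<lambda>y. \<Sum>b\<in>Basis. der (S b) y b) = 0"
  proof (subst Henstock_Kurzweil_Integration.integral_sum[OF finite_Basis iS])
    have "integral (cbox a b') (\<lambda>y. der (S b) y b) = 0" if "b \<in> Basis" for b
    proof (rule integral_der_zero[OF sS[OF that] U ab(2) compact_cball rK])
      show "S b y = 0" if "y \<in> U - cball y0 r" for y
        using that th(5)[of y] \<rho> r by (auto simp: S_def)
    qed
    then show "(\<Sum>b\<in>Basis. integral (cbox a b') (\<lambda>y. der (S b) y b)) = 0" by simp
  qed
  moreover have cthq: "continuous_on (cbox a b') (\<lambda>y. th y * q \<omega> y)"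
    by (intro continuous_intros continuous_on_subset[OF cq ab(2)] continuous_on_subset[OF smooth_continuous_on[OF th(1)]]) auto
  ultimately have "integral (cbox a b') (\<lambda>y. th y * q \<omega> y) = 0"
    using i1 by (subst (asm) Henstock_Kurzweil_Integration.integral_add)
      (auto intro: integrable_continuous integrable_sum iS)
  then have "integral (cbox a b') (\<lambda>y. \<sigma> * (th y * q \<omega> y)) = 0" by simp
  moreover have "\<sigma> * (th y * q \<omega> y) \<ge> 0" for y
  proof (cases "y \<in> ball y0 \<rho>")
    case True
    then have "\<sigma> * q \<omega> y > 0" using r3(2)[of y] \<rho> by (auto simp: dist_commute)
    then show ?thesis using th(2)[of y] mult_nonneg_nonneg[of "th y" "\<sigma> * q \<omega> y"] by (simp add: mult_ac)
  qed (use th(5) in auto)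
  \<comment> \<open>A nonnegative continuous function with integral zero vanishes on the box, yet
    this one is positive at \<open>y0\<close>.\<close>
  moreover have "continuous_on (cbox a b') (\<lambda>y. \<sigma> * (th y * q \<omega> y))"
    by (intro continuous_on_mult_left cthq)
  ultimately have "\<sigma> * (th y0 * q \<omega> y0) = 0"
    using integral_cbox_eq_0_iff[of a b' "\<lambda>y. \<sigma> * (th y * q \<omega> y)"] ab(1) box_subset_cbox by blast
  then show False using r3(2)[of y0] r3(1) th(4)[of y0] \<rho> by auto
qed

text \<open>The Euler-Lagrange equation holds for every derivative \<open>A\<close> of the field.
  \<open>A = 0\<close> isolates the zeroth-order part; an \<open>A\<close> of rank one along
  \<open>b\<close>, after subtraction of that part, leaves the symmetry of the derivative of
  \<open>G b\<close>, a closedness condition in \<open>w\<close>.\<close>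

lemma null_lagrangian:
  assumes y0: "y0 \<in> U" and w1: "w1 \<in> \<Omega>"
  shows null_lagrangian_zeroth: "der F (y0, w1) (0, \<eta>) = (\<Sum>b\<in>Basis. der (G b \<eta>) (y0, w1) (b, 0))"
    and null_lagrangian_first: "b \<in> Basis \<Longrightarrow> der (G b \<xi>) (y0, w1) (0, \<eta>) = der (G b \<eta>) (y0, w1) (0, \<xi>)"
proof -
  have UO: "open (U \<times> \<Omega>)" using U \<Omega> by (simp add: open_Times)
  have z: "(y0, w1) \<in> U \<times> \<Omega>" using assms by simp
  have G0: "der (G b 0) (y0, w1) h = 0" if "b \<in> Basis" for b h
  proof -
    have "der (G b 0) (y0, w1) = der (\<lambda>z. 0) (y0, w1)"
      by (rule der_cong[OF UO z]) (simp add: linear_0[OF Gl[OF that]])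
    then show ?thesis by simp
  qed
  show 0: "der F (y0, w1) (0, \<eta>) = (\<Sum>b\<in>Basis. der (G b \<eta>) (y0, w1) (b, 0))" for \<eta>
    using euler_lagrange[OF y0 w1 bounded_linear_zero, of \<eta>] by (simp add: G0)
  show "der (G b \<xi>) (y0, w1) (0, \<eta>) = der (G b \<eta>) (y0, w1) (0, \<xi>)" if b: "b \<in> Basis"
  proof -
    have A: "bounded_linear (\<lambda>y. (y \<bullet> b) *\<^sub>R \<xi>)"
      by (intro bounded_linear_scaleR_left[THEN bounded_linear_compose] bounded_linear_inner_left)
    have "(\<Sum>c\<in>Basis. der (G c ((c \<bullet> b) *\<^sub>R \<xi>)) (y0, w1) (0, \<eta>)) = (\<Sum>c\<in>Basis. if c = b then der (G b \<xi>) (y0, w1) (0, \<eta>) else 0)"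
      by (rule sum.cong) (use b G0 in \<open>auto simp: inner_Basis\<close>)
    moreover have "der (G c \<eta>) (y0, w1) (c, (c \<bullet> b) *\<^sub>R \<xi>) = der (G c \<eta>) (y0, w1) (c, 0) + (if c = b then der (G b \<eta>) (y0, w1) (0, \<xi>) else 0)"
      if c: "c \<in> Basis" for c
      using linear_add[OF smooth_linear_der[OF G[OF c, of \<eta>] UO z], of "(c, 0)" "(0, (c \<bullet> b) *\<^sub>R \<xi>)"]
        linear_0[OF smooth_linear_der[OF G[OF c, of \<eta>] UO z]] b c
      by (auto simp: inner_Basis zero_prod_def)
    ultimately show ?thesis
      using euler_lagrange[OF y0 w1 A, of \<eta>] 0[of \<eta>] b by (simp add: sum.distrib)
  qed
qed

end


subsection \<open>Riemannian geometry in a chart\<close>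

text \<open>One chart with its metric, detached from the manifold. Smoothness is required for
  constant arguments; bilinearity extends it to variable ones.\<close>

locale coord_metric =
  fixes U :: "(real ^ 'n::finite) set" and G :: "real ^ 'n \<Rightarrow> real ^ 'n \<Rightarrow> real ^ 'n \<Rightarrow> real"
  assumes U: "open U" and bil: "y \<in> U \<Longrightarrow> bilinear (G y)"
    and sym: "y \<in> U \<Longrightarrow> G y v w = G y w v" and pos: "y \<in> U \<Longrightarrow> v \<noteq> 0 \<Longrightarrow> G y v v > 0"
    and smooth: "smooth_on U (\<lambda>y. G y v w)"
begin

definition sharp :: "real ^ 'n \<Rightarrow> (real ^ 'n \<Rightarrow> real) \<Rightarrow> real ^ 'n" where
  "sharp y \<alpha> = (THE z. \<forall>a. G y z a = \<alpha> a)"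

definition dG :: "real ^ 'n \<Rightarrow> real ^ 'n \<Rightarrow> real ^ 'n \<Rightarrow> real ^ 'n \<Rightarrow> real" where
  "dG y v a b = der (\<lambda>y. G y a b) y v"

definition christ :: "real ^ 'n \<Rightarrow> real ^ 'n \<Rightarrow> real ^ 'n \<Rightarrow> real ^ 'n" where
  "christ y v w = (THE z. \<forall>a. 2 * G y z a = dG y v w a + dG y w v a - dG y a v w)"

definition nabc :: "(real ^ 'n \<Rightarrow> real ^ 'n) \<Rightarrow> real ^ 'n \<Rightarrow> real ^ 'n \<Rightarrow> real ^ 'n" where
  "nabc X y v = der X y v + christ y v (X y)"

definition divc :: "(real ^ 'n \<Rightarrow> real ^ 'n) \<Rightarrow> real ^ 'n \<Rightarrow> real" where
  "divc X y = (\<Sum>i\<in>UNIV. nabc X y (axis i 1) $ i)"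

definition liec :: "(real ^ 'n \<Rightarrow> real ^ 'n) \<Rightarrow> real ^ 'n \<Rightarrow> real ^ 'n \<Rightarrow> real ^ 'n \<Rightarrow> real" where
  "liec X y v w = dG y (X y) v w + G y (der X y v) w + G y v (der X y w)"

definition gram :: "real ^ 'n \<Rightarrow> real ^ 'n ^ 'n" where
  "gram y = (\<chi> i j. G y (axis i 1) (axis j 1))"

text \<open>The square keeps the volume density \<open>\<surd>det g\<close> smooth without using \<open>det g > 0\<close>.\<close>

definition vol :: "real ^ 'n \<Rightarrow> real" where
  "vol y = exp (ln ((det (gram y))\<^sup>2) / 4)"

lemma lin1: "y \<in> U \<Longrightarrow> linear (\<lambda>v. G y v w)" and lin2: "y \<in> U \<Longrightarrow> linear (G y v)"
  using bil unfolding bilinear_def by auto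

lemmas G_simps = linear_add[OF lin1] linear_add[OF lin2] linear_diff[OF lin1] linear_diff[OF lin2]
  linear_cmul[OF lin1] linear_cmul[OF lin2] linear_0[OF lin1] linear_0[OF lin2]
  linear_neg[OF lin1] linear_neg[OF lin2]

lemma G_eqD: "y \<in> U \<Longrightarrow> (\<And>a. G y v a = G y w a) \<Longrightarrow> v = w"
  using pos[of y "v - w"] by (force simp: G_simps)

lemma G_expand: "y \<in> U \<Longrightarrow> G y a b = (\<Sum>i\<in>UNIV. \<Sum>j\<in>UNIV. a $ i * b $ j * G y (axis i 1) (axis j 1))"
proof -
  assume y: "y \<in> U"
  show ?thesis
    by (subst linear_expand_axis[OF lin1[OF y]], subst linear_expand_axis[OF lin2[OF y]]) (simp add: sum_distrib_left mult_ac)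
qed

lemma has_derivative_G0: "y \<in> U \<Longrightarrow> ((\<lambda>y. G y a b) has_derivative (\<lambda>v. dG y v a b)) (at y)"
  unfolding dG_def by (rule smooth_has_derivative[OF smooth U])

text \<open>The product rule is proved in components with respect to the axes, where smoothness for
  constant arguments is enough, and the sums are then reassembled.\<close>

lemma has_derivative_G:
  assumes V: "open V" "z \<in> V" "\<And>z. z \<in> V \<Longrightarrow> \<phi> z \<in> U"
    and "(\<phi> has_derivative \<phi>') (at z)" "(\<alpha> has_derivative \<alpha>') (at z)" "(\<beta> has_derivative \<beta>') (at z)"
  shows "((\<lambda>z. G (\<phi> z) (\<alpha> z) (\<beta> z)) has_derivative
      (\<lambda>h. dG (\<phi> z) (\<phi>' h) (\<alpha> z) (\<beta> z) + G (\<phi> z) (\<alpha>' h) (\<beta> z) + G (\<phi> z) (\<alpha> z) (\<beta>' h))) (at z)"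
proof -
  have pz: "\<phi> z \<in> U" using V by blast
  have 1: "((\<lambda>z. G (\<phi> z) a b) has_derivative (\<lambda>h. dG (\<phi> z) (\<phi>' h) a b)) (at z)" for a b
    using has_derivative_compose[OF assms(4) has_derivative_G0[OF pz]] .
  have c: "((\<lambda>z. \<alpha> z $ i) has_derivative (\<lambda>h. \<alpha>' h $ i)) (at z)" "((\<lambda>z. \<beta> z $ i) has_derivative (\<lambda>h. \<beta>' h $ i)) (at z)" for i
    using assms(5,6) bounded_linear.has_derivative[OF bounded_linear_vec_nth] by blast+
  define D where "D h = (\<Sum>i\<in>UNIV. \<Sum>j\<in>UNIV. \<alpha> z $ i * \<beta> z $ j * dG (\<phi> z) (\<phi>' h) (axis i 1) (axis j 1) +
        (\<alpha> z $ i * \<beta>' h $ j + \<alpha>' h $ i * \<beta> z $ j) * G (\<phi> z) (axis i 1) (axis j 1))" for h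
  have "((\<lambda>z. \<Sum>i\<in>UNIV. \<Sum>j\<in>UNIV. \<alpha> z $ i * \<beta> z $ j * G (\<phi> z) (axis i 1) (axis j 1)) has_derivative D) (at z)"
    unfolding D_def
    by (intro has_derivative_sum has_derivative_mult c 1)
  then have 2: "((\<lambda>z. G (\<phi> z) (\<alpha> z) (\<beta> z)) has_derivative D) (at z)"
    by (rule has_derivative_transform_within_open[OF _ V(1,2)]) (use G_expand V(3) in auto)
  have dx: "dG (\<phi> z) v a b = (\<Sum>i\<in>UNIV. \<Sum>j\<in>UNIV. a $ i * b $ j * dG (\<phi> z) v (axis i 1) (axis j 1))" for v a b
  proof -
    have "((\<lambda>y. \<Sum>i\<in>UNIV. \<Sum>j\<in>UNIV. a $ i * b $ j * G y (axis i 1) (axis j 1)) has_derivative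
       (\<lambda>v. \<Sum>i\<in>UNIV. \<Sum>j\<in>UNIV. a $ i * b $ j * dG (\<phi> z) v (axis i 1) (axis j 1))) (at (\<phi> z))"
      by (intro has_derivative_sum has_derivative_mult_right has_derivative_G0 pz)
    then have "((\<lambda>y. G y a b) has_derivative
       (\<lambda>v. \<Sum>i\<in>UNIV. \<Sum>j\<in>UNIV. a $ i * b $ j * dG (\<phi> z) v (axis i 1) (axis j 1))) (at (\<phi> z))"
      by (rule has_derivative_transform_within_open[OF _ U pz]) (use G_expand in auto)
    from fun_cong[OF der_eq[OF this], of v] show ?thesis unfolding dG_def .
  qed
  have "D h = dG (\<phi> z) (\<phi>' h) (\<alpha> z) (\<beta> z) + G (\<phi> z) (\<alpha>' h) (\<beta> z) + G (\<phi> z) (\<alpha> z) (\<beta>' h)" for h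
    unfolding D_def dx[of "\<phi>' h" "\<alpha> z" "\<beta> z"] G_expand[OF pz, of "\<alpha>' h"] G_expand[OF pz, of "\<alpha> z" "\<beta>' h"]
    by (simp add: sum.distrib algebra_simps)
  then have "D = (\<lambda>h. dG (\<phi> z) (\<phi>' h) (\<alpha> z) (\<beta> z) + G (\<phi> z) (\<alpha>' h) (\<beta> z) + G (\<phi> z) (\<alpha> z) (\<beta>' h))" ..
  with 2 show ?thesis by (simp only:)
qed

lemma dG_linear1: "y \<in> U \<Longrightarrow> linear (\<lambda>v. dG y v a b)"
  using has_derivative_G0 has_derivative_linear by blast

lemma dG_sym: "y \<in> U \<Longrightarrow> dG y v a b = dG y v b a"
  unfolding dG_def using der_cong[OF U, of y "\<lambda>y. G y a b" "\<lambda>y. G y b a"] sym by auto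

lemma dG_add: "y \<in> U \<Longrightarrow> dG y v (a + a') b = dG y v a b + dG y v a' b"
proof -
  assume y: "y \<in> U"
  have "((\<lambda>y. G y (a + a') b) has_derivative (\<lambda>v. dG y v a b + dG y v a' b)) (at y)"
    by (rule has_derivative_transform_within_open[OF has_derivative_add[OF has_derivative_G0[OF y] has_derivative_G0[OF y]] U y])
      (simp add: G_simps)
  from fun_cong[OF has_derivative_unique[OF has_derivative_G0[OF y] this], of v] show ?thesis .
qed

lemma dG_cmul: "y \<in> U \<Longrightarrow> dG y v (c *\<^sub>R a) b = c * dG y v a b"
proof -
  assume y: "y \<in> U"
  have "((\<lambda>y. G y (c *\<^sub>R a) b) has_derivative (\<lambda>v. c * dG y v a b)) (at y)"
    by (rule has_derivative_transform_within_open[OF has_derivative_mult_right[OF has_derivative_G0[OF y]] U y])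
      (simp add: G_simps)
  from fun_cong[OF has_derivative_unique[OF has_derivative_G0[OF y] this], of v] show ?thesis .
qed

lemma dG_linear2: "y \<in> U \<Longrightarrow> linear (\<lambda>a. dG y v a b)"
  by (rule linearI) (auto simp: dG_add dG_cmul)

lemma dG_linear3: "y \<in> U \<Longrightarrow> linear (\<lambda>b. dG y v a b)"
  using dG_linear2[of y v a] dG_sym[of y v a] by (auto simp: linear_iff)

lemmas dG_simps = linear_add[OF dG_linear1] linear_add[OF dG_linear2] linear_add[OF dG_linear3]
  linear_cmul[OF dG_linear1] linear_cmul[OF dG_linear2] linear_cmul[OF dG_linear3]
  linear_0[OF dG_linear1] linear_0[OF dG_linear2] linear_0[OF dG_linear3]
  linear_neg[OF dG_linear1] linear_neg[OF dG_linear2] linear_neg[OF dG_linear3]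
  linear_diff[OF dG_linear1] linear_diff[OF dG_linear2] linear_diff[OF dG_linear3]

lemma smooth_G:
  assumes V: "open V" "\<And>z. z \<in> V \<Longrightarrow> \<phi> z \<in> U" "smooth_on V \<phi>" and "smooth_on V \<alpha>" "smooth_on V \<beta>"
  shows "smooth_on V (\<lambda>z. G (\<phi> z) (\<alpha> z) (\<beta> z))"
proof (rule smooth_cong[OF V(1) G_expand[OF V(2), symmetric]])
  show "smooth_on V (\<lambda>z. \<Sum>i\<in>UNIV. \<Sum>j\<in>UNIV. \<alpha> z $ i * \<beta> z $ j * G (\<phi> z) (axis i 1) (axis j 1))"
    by (intro smooth_sum smooth_mult smooth_nth assms smooth_compose[OF V(1) U V(2) V(3) smooth])
qed

lemma smooth_dG:
  assumes V: "open V" "\<And>z. z \<in> V \<Longrightarrow> \<phi> z \<in> U" "smooth_on V \<phi>" and "smooth_on V \<kappa>" "smooth_on V \<alpha>" "smooth_on V \<beta>"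
  shows "smooth_on V (\<lambda>z. dG (\<phi> z) (\<kappa> z) (\<alpha> z) (\<beta> z))"
proof -
  have ex: "dG y v a b = (\<Sum>i\<in>Basis. \<Sum>j\<in>Basis. (a \<bullet> i) * (b \<bullet> j) * dG y v i j)" if "y \<in> U" for y v a b
    by (subst linear_expand[OF dG_linear2[OF that]], subst linear_expand[OF dG_linear3[OF that]])
      (simp add: sum_distrib_left mult_ac)
  show ?thesis
  proof (rule smooth_cong[OF V(1) ex[OF V(2), symmetric]])
    show "smooth_on V (\<lambda>z. \<Sum>i\<in>Basis. \<Sum>j\<in>Basis. (\<alpha> z \<bullet> i) * (\<beta> z \<bullet> j) * dG (\<phi> z) (\<kappa> z) i j)"
      unfolding dG_def
      by (intro smooth_sum smooth_mult smooth_inner smooth_const assms smooth_der_compose[OF V(1) V(2) V(3) U smooth])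
  qed
qed

lemma gram_mult: "y \<in> U \<Longrightarrow> gram y *v z = (\<chi> i. G y z (axis i 1))"
proof -
  assume y: "y \<in> U"
  have "G y z (axis i 1) = (\<Sum>j\<in>UNIV. z $ j * G y (axis j 1) (axis i 1))" for i
    using G_expand[OF y, of z "axis i 1"]
    by (simp add: axis_def if_distrib[of "\<lambda>x. _ * x"] if_distrib[of "\<lambda>x. x * _"] cong: if_cong)
  then show ?thesis using sym[OF y]
    by (auto simp: vec_eq_iff gram_def matrix_vector_mult_def mult.commute intro!: sum.cong)
qed

lemma det_gram: "y \<in> U \<Longrightarrow> det (gram y) \<noteq> 0"
proof -
  assume y: "y \<in> U"
  have "z = 0" if "gram y *v z = 0" for z
  proof (rule G_eqD[OF y])
    have "G y z (axis i 1) = 0" for i using that gram_mult[OF y, of z] by (simp add: vec_eq_iff)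
    then show "G y z a = G y 0 a" for a
      by (subst linear_expand[OF lin2[OF y]]) (auto simp: G_simps(7)[OF y] Basis_vec_def intro!: sum.neutral)
  qed
  then have "inj ((*v) (gram y))"
    using linear_injective_0[OF matrix_vector_mul_linear[of "gram y"]] by auto
  then show ?thesis
    using invertible_det_nz invertible_left_inverse matrix_left_invertible_injective by blast
qed

text \<open>Cramer's rule writes the raised covector as a quotient of determinants in the entries of
  the Gram matrix. This is what makes \<open>sharp\<close>, and with it the Christoffel symbols,
  smooth.\<close>

lemma sharp_cramer:
  assumes y: "y \<in> U" and \<alpha>: "linear \<alpha>"
  shows "(\<forall>a. G y z a = \<alpha> a) \<longleftrightarrow> z = (\<chi> k. det (\<chi> i j. if j = k then \<alpha> (axis i 1) else gram y $ i $ j) / det (gram y))"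
proof -
  have "(\<forall>a. G y z a = \<alpha> a) \<longleftrightarrow> gram y *v z = (\<chi> i. \<alpha> (axis i 1))"
  proof
    assume "gram y *v z = (\<chi> i. \<alpha> (axis i 1))"
    then have *: "G y z (axis i 1) = \<alpha> (axis i 1)" for i by (simp add: gram_mult[OF y] vec_eq_iff)
    show "\<forall>a. G y z a = \<alpha> a"
    proof
      fix a show "G y z a = \<alpha> a"
        using linear_expand[OF lin2[OF y], of z a] linear_expand[OF \<alpha>, of a] *
        by (auto simp: Basis_vec_def intro!: sum.cong)
    qed
  qed (simp add: gram_mult[OF y])
  also have "\<dots> \<longleftrightarrow> z = (\<chi> k. det (\<chi> i j. if j = k then (\<chi> i. \<alpha> (axis i 1)) $ i else gram y $ i $ j) / det (gram y))"
    by (rule cramer[OF det_gram[OF y]])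
  finally show "(\<forall>a. G y z a = \<alpha> a) \<longleftrightarrow> z = (\<chi> k. det (\<chi> i j. if j = k then \<alpha> (axis i 1) else gram y $ i $ j) / det (gram y))"
    by (simp cong: if_cong)
qed

lemma sharp_eq: "y \<in> U \<Longrightarrow> linear \<alpha> \<Longrightarrow>
    sharp y \<alpha> = (\<chi> k. det (\<chi> i j. if j = k then \<alpha> (axis i 1) else gram y $ i $ j) / det (gram y))"
  unfolding sharp_def using sharp_cramer by auto

lemma G_sharp: "y \<in> U \<Longrightarrow> linear \<alpha> \<Longrightarrow> G y (sharp y \<alpha>) a = \<alpha> a"
  using sharp_cramer[of y \<alpha> "sharp y \<alpha>"] sharp_eq by blast

lemma sharp_unique: "y \<in> U \<Longrightarrow> (\<And>a. G y z a = \<alpha> a) \<Longrightarrow> sharp y \<alpha> = z"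
  unfolding sharp_def by (rule the_equality) (auto intro: G_eqD)

lemma smooth_det:
  fixes A :: "'c::euclidean_space \<Rightarrow> real ^ 'k ^ 'k"
  assumes "open V" "\<And>i j. smooth_on V (\<lambda>z. A z $ i $ j)"
  shows "smooth_on V (\<lambda>z. det (A z))"
  unfolding det_def by (intro smooth_intros assms)

lemma smooth_gram: "smooth_on U (\<lambda>y. gram y $ i $ j)"
  unfolding gram_def by (simp add: smooth)

lemma smooth_sharp:
  assumes V: "open V" "\<And>z. z \<in> V \<Longrightarrow> \<phi> z \<in> U" "smooth_on V \<phi>"
    and \<alpha>: "\<And>a. smooth_on V (\<lambda>z. \<alpha> z a)" "\<And>z. z \<in> V \<Longrightarrow> linear (\<alpha> z)"
  shows "smooth_on V (\<lambda>z. sharp (\<phi> z) (\<alpha> z))"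
proof (rule smooth_cong[OF V(1) sharp_eq[OF V(2) \<alpha>(2), symmetric]])
  have g: "smooth_on V (\<lambda>z. gram (\<phi> z) $ i $ j)" for i j
    by (rule smooth_compose[OF V(1) U V(2) V(3) smooth_gram])
  have "smooth_on V (\<lambda>z. (\<chi> i j. if j = k then \<alpha> z (axis i 1) else gram (\<phi> z) $ i $ j) $ i $ j)" for i j k
    using g \<alpha>(1) by (cases "j = k") auto
  then show "smooth_on V (\<lambda>z. \<chi> k. det (\<chi> i j. if j = k then \<alpha> z (axis i 1) else gram (\<phi> z) $ i $ j) / det (gram (\<phi> z)))"
    by (intro smooth_vec_lambda smooth_divide smooth_det V(1) g) (use det_gram V(2) in auto)
qed

lemma christ_alt: "y \<in> U \<Longrightarrow> christ y v w = sharp y (\<lambda>a. (dG y v w a + dG y w v a - dG y a v w) / 2)"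
  unfolding christ_def sharp_def by (auto intro!: arg_cong[where f=The] simp: fun_eq_iff field_simps)

lemma koszul_linear: "y \<in> U \<Longrightarrow> linear (\<lambda>a. (dG y v w a + dG y w v a - dG y a v w) / 2)"
  by (rule linearI) (auto simp: dG_simps field_simps)

lemma G_christ: "y \<in> U \<Longrightarrow> G y (christ y v w) a = (dG y v w a + dG y w v a - dG y a v w) / 2"
  using G_sharp[OF _ koszul_linear] christ_alt by simp

lemma christ_linear1: "y \<in> U \<Longrightarrow> linear (\<lambda>v. christ y v w)"
  by (rule linearI; rule G_eqD[of y]; simp add: G_christ G_simps dG_simps field_simps)

lemma christ_linear2: "y \<in> U \<Longrightarrow> linear (christ y v)"
  by (rule linearI; rule G_eqD[of y]; simp add: G_christ G_simps dG_simps field_simps)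

lemma smooth_christ:
  assumes V: "open V" "\<And>z. z \<in> V \<Longrightarrow> \<phi> z \<in> U" "smooth_on V \<phi>" and "smooth_on V \<alpha>" "smooth_on V \<beta>"
  shows "smooth_on V (\<lambda>z. christ (\<phi> z) (\<alpha> z) (\<beta> z))"
proof (rule smooth_cong[OF V(1) christ_alt[OF V(2), symmetric]])
  show "smooth_on V (\<lambda>z. sharp (\<phi> z) (\<lambda>a. (dG (\<phi> z) (\<alpha> z) (\<beta> z) a + dG (\<phi> z) (\<beta> z) (\<alpha> z) a - dG (\<phi> z) a (\<alpha> z) (\<beta> z)) / 2))"
    by (intro smooth_sharp assms koszul_linear smooth_divide smooth_add smooth_diff smooth_dG smooth_const) auto
qed

text \<open>Jacobi's formula. Differentiating one row at a time leaves determinants in which row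
  \<open>k\<close> is replaced by its derivative. That row is a combination of the rows of the Gram
  matrix, with the components of \<open>sharp y (dG y w (axis k 1))\<close> as coefficients, and
  only the coefficient of row \<open>k\<close> itself survives.\<close>

lemma has_derivative_det_gram:
  assumes y: "y \<in> U"
  shows "((\<lambda>y. det (gram y)) has_derivative
     (\<lambda>w. det (gram y) * (\<Sum>k\<in>UNIV. sharp y (dG y w (axis k 1)) $ k))) (at y)"
proof -
  have e: "((\<lambda>y. gram y $ i $ j) has_derivative (\<lambda>w. dG y w (axis i 1) (axis j 1))) (at y)" for i j
    unfolding gram_def using has_derivative_G0[OF y] by simp
  define R where "R k w = (\<chi> i. if i = k then (\<chi> j. dG y w (axis k 1) (axis j 1)) else row i (gram y))" for k w
  have detR: "det (R k w) = sharp y (dG y w (axis k 1)) $ k * det (gram y)" for k w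
  proof -
    define X where "X = sharp y (dG y w (axis k 1))"
    have "G y X a = dG y w (axis k 1) a" for a
      unfolding X_def by (rule G_sharp[OF y dG_linear3[OF y]])
    then have "dG y w (axis k 1) (axis j 1) = (\<Sum>i\<in>UNIV. X $ i * G y (axis i 1) (axis j 1))" for j
      using G_expand[OF y, of X "axis j 1"]
      by (simp add: axis_def[of j] if_distrib[of "\<lambda>x. _ * x"] if_distrib[of "\<lambda>x. x * _"] cong: if_cong)
    then have eq: "(\<chi> j. dG y w (axis k 1) (axis j 1)) = (\<Sum>i\<in>UNIV. X $ i *s row i (gram y))"
      by (simp add: vec_eq_iff row_def gram_def)
    show ?thesis unfolding R_def eq using cramer_lemma_transpose[of k X "gram y"] by (simp add: X_def cong: if_cong)
  qed
  have "((\<lambda>y. det (gram y)) has_derivative (\<lambda>w. \<Sum>p\<in>{p. p permutes (UNIV::'n set)}. of_int (sign p) *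
      (\<Sum>k\<in>UNIV. dG y w (axis k 1) (axis (p k) 1) * (\<Prod>i\<in>UNIV - {k}. gram y $ i $ p i)))) (at y)"
    unfolding det_def by (intro has_derivative_sum has_derivative_mult_right has_derivative_prod e)
  moreover have "(\<Sum>p\<in>{p. p permutes (UNIV::'n set)}. of_int (sign p) *
      (\<Sum>k\<in>UNIV. dG y w (axis k 1) (axis (p k) 1) * (\<Prod>i\<in>UNIV - {k}. gram y $ i $ p i))) =
      det (gram y) * (\<Sum>k\<in>UNIV. sharp y (dG y w (axis k 1)) $ k)" for w
  proof -
    have "det (R k w) = (\<Sum>p\<in>{p. p permutes (UNIV::'n set)}. of_int (sign p) *
       (dG y w (axis k 1) (axis (p k) 1) * (\<Prod>i\<in>UNIV - {k}. gram y $ i $ p i)))" for k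
    proof -
      have "(\<Prod>i\<in>UNIV. R k w $ i $ p i) = dG y w (axis k 1) (axis (p k) 1) * (\<Prod>i\<in>UNIV - {k}. gram y $ i $ p i)" for p
        by (subst prod.remove[of _ k]) (auto simp: R_def row_def intro!: prod.cong)
      then show ?thesis unfolding det_def by simp
    qed
    then show ?thesis using detR[of _ w]
      by (simp add: sum_distrib_left sum.swap[of _ "{p. p permutes (UNIV::'n set)}"] mult.commute)
  qed
  ultimately show ?thesis by (simp only:)
qed

text \<open>Both sides contract the derivative of the metric with the inverse metric, in the
  differentiated index and one of the others; which of the two is which does not matter, because the
  inverse metric is symmetric.\<close>

lemma trace_dG_swap:
  assumes y: "y \<in> U"
  shows "(\<Sum>k\<in>UNIV. sharp y (dG y (axis k 1) w) $ k) = (\<Sum>k\<in>UNIV. sharp y (\<lambda>a. dG y a (axis k 1) w) $ k)"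
proof -
  \<comment> \<open>The rows of the inverse metric: \<open>s k\<close> raises the
    \<open>k\<close>-th coordinate.\<close>
  define s where "s k = sharp y (\<lambda>a. a $ k)" for k
  have nl: "linear (\<lambda>a::real ^ 'n. a $ k)" for k by (rule bounded_linear.linear[OF bounded_linear_vec_nth])
  have s: "G y (s k) z = z $ k" for k z unfolding s_def by (rule G_sharp[OF y nl])
  have comp: "sharp y \<alpha> $ k = \<alpha> (s k)" if "linear \<alpha>" for \<alpha> k
    using s[of k "sharp y \<alpha>"] G_sharp[OF y that, of "s k"] sym[OF y] by simp
  have ss: "s k $ j = s j $ k" for j k using s[of j "s k"] s[of k "s j"] sym[OF y] by simp
  have ex: "\<alpha> v = (\<Sum>j\<in>UNIV. v $ j * \<alpha> (axis j 1))" if "linear \<alpha>" for \<alpha> :: "real ^ 'n \<Rightarrow> real" and v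
    using linear_expand_axis[OF that, of v] by simp
  have "(\<Sum>k\<in>UNIV. sharp y (dG y (axis k 1) w) $ k) = (\<Sum>k\<in>UNIV. \<Sum>j\<in>UNIV. s k $ j * dG y (axis k 1) w (axis j 1))"
    by (intro sum.cong refl) (simp only: comp[OF dG_linear3[OF y]], rule ex[OF dG_linear3[OF y]])
  also have "\<dots> = (\<Sum>j\<in>UNIV. \<Sum>k\<in>UNIV. s j $ k * dG y (axis k 1) (axis j 1) w)"
    by (subst sum.swap) (simp add: ss[of _ j for j] dG_sym[OF y, of _ w])
  also have "\<dots> = (\<Sum>k\<in>UNIV. sharp y (\<lambda>a. dG y a (axis k 1) w) $ k)"
    by (intro sum.cong refl) (simp only: comp[OF dG_linear1[OF y]], rule ex[OF dG_linear1[OF y], symmetric])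
  finally show ?thesis .
qed

text \<open>Two of the three terms of the Koszul formula cancel in the trace by
  \<open>trace_dG_swap\<close>.\<close>

lemma trace_christ:
  assumes y: "y \<in> U"
  shows "(\<Sum>k\<in>UNIV. christ y (axis k 1) w $ k) = (\<Sum>k\<in>UNIV. sharp y (dG y w (axis k 1)) $ k) / 2"
proof -
  have "2 *\<^sub>R christ y (axis k 1) w = sharp y (dG y (axis k 1) w) + sharp y (dG y w (axis k 1)) - sharp y (\<lambda>a. dG y a (axis k 1) w)" for k
    by (rule G_eqD[OF y]) (simp add: G_simps[OF y] G_christ[OF y] G_sharp[OF y dG_linear3[OF y]] G_sharp[OF y dG_linear1[OF y]])
  then have "2 * christ y (axis k 1) w $ k = sharp y (dG y (axis k 1) w) $ k + sharp y (dG y w (axis k 1)) $ k - sharp y (\<lambda>a. dG y a (axis k 1) w) $ k" for k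
    by (metis vector_add_component vector_minus_component vector_scaleR_component scaleR_conv_of_real of_real_numeral real_scaleR_def)
  then have "(\<Sum>k\<in>UNIV. 2 * christ y (axis k 1) w $ k) = (\<Sum>k\<in>UNIV. sharp y (dG y w (axis k 1)) $ k)"
    using trace_dG_swap[OF y, of w] by (simp add: sum.distrib sum_subtractf)
  then show ?thesis by (simp add: sum_distrib_left[symmetric])
qed

lemma vol_pos: "vol y > 0" by (simp add: vol_def)

lemma smooth_vol: "smooth_on U vol"
  unfolding vol_def
  by (intro smooth_intros U smooth_det smooth_gram) (use det_gram in auto)

text \<open>The logarithmic derivative of the volume density is half the trace of the derivative of
  the metric, and \<open>trace_christ\<close> identifies this with the traced Christoffel
  symbol.\<close>

lemma der_vol:
  assumes y: "y \<in> U"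
  shows "der vol y w = vol y * (\<Sum>k\<in>UNIV. christ y (axis k 1) w $ k)"
proof -
  define h where "h t = exp (ln (t\<^sup>2) / 4)" for t :: real
  let ?d = "det (gram y)"
  have "(h has_real_derivative h ?d / (2 * ?d)) (at ?d)"
    unfolding h_def using det_gram[OF y]
    by (auto simp: zero_less_mult_iff linorder_neq_iff intro!: derivative_eq_intros simp: field_simps power2_eq_square)
  then have "(h has_derivative (*) (h ?d / (2 * ?d))) (at ?d)" by (simp add: has_field_derivative_def)
  from has_derivative_compose[OF has_derivative_det_gram[OF y] this]
  have "(vol has_derivative (\<lambda>w. h ?d / (2 * ?d) * (?d * (\<Sum>k\<in>UNIV. sharp y (dG y w (axis k 1)) $ k)))) (at y)"
    by (simp add: vol_def [abs_def] h_def)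
  moreover have "h ?d / (2 * ?d) * (?d * (\<Sum>k\<in>UNIV. sharp y (dG y w (axis k 1)) $ k)) = vol y * (\<Sum>k\<in>UNIV. christ y (axis k 1) w $ k)" for w
    using det_gram[OF y] by (simp add: trace_christ[OF y] vol_def h_def)
  ultimately have "(vol has_derivative (\<lambda>w. vol y * (\<Sum>k\<in>UNIV. christ y (axis k 1) w $ k))) (at y)" by (simp only:)
  then show ?thesis by (simp add: der_eq)
qed

lemma divc_alt:
  assumes y: "y \<in> U"
  shows "vol y * divc X y = vol y * (\<Sum>i\<in>UNIV. der X y (axis i 1) $ i) + der vol y (X y)"
  unfolding divc_def nabc_def der_vol[OF y] by (simp add: sum.distrib algebra_simps)

text \<open>The Voss-Weyl formula: multiplied by the volume density, a covariant divergence becomes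
  the Euclidean divergence of a field of components, which is the kind that the null Lagrangian
  lemmas speak about.\<close>

lemma divc_vol:
  assumes y: "y \<in> U" and X: "X differentiable (at y)"
  shows "vol y * divc X y = (\<Sum>b\<in>Basis. der (\<lambda>y. vol y *\<^sub>R X y) y b \<bullet> b)"
proof -
  have "(X has_derivative der X y) (at y)" using X frechet_derivative_works by blast
  from der_eq[OF has_derivative_scaleR[OF smooth_has_derivative[OF smooth_vol U y] this]]
  have d: "der (\<lambda>y. vol y *\<^sub>R X y) y v = vol y *\<^sub>R der X y v + der vol y v *\<^sub>R X y" for v
    by simp
  have "(\<Sum>b\<in>Basis. der (\<lambda>y. vol y *\<^sub>R X y) y b \<bullet> b) = (\<Sum>i\<in>UNIV. der (\<lambda>y. vol y *\<^sub>R X y) y (axis i 1) $ i)"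
    unfolding Basis_vec_def by (subst sum.UNION_disjoint) (auto simp: axis_eq_axis inner_axis)
  also have "\<dots> = vol y * (\<Sum>i\<in>UNIV. der X y (axis i 1) $ i) + (\<Sum>i\<in>UNIV. X y $ i * der vol y (axis i 1))"
    by (simp add: d sum.distrib sum_distrib_left mult.commute)
  also have "(\<Sum>i\<in>UNIV. X y $ i * der vol y (axis i 1)) = der vol y (X y)"
    using linear_expand_axis[OF smooth_linear_der[OF smooth_vol U y], of "X y"] by simp
  finally show ?thesis using divc_alt[OF y, of X] by simp
qed

end

section \<open>Behaviour under changes of coordinates\<close>

lemma has_derivative_der_apply:
  fixes \<phi> :: "'a::euclidean_space \<Rightarrow> 'b::euclidean_space"
  assumes O: "open O'" "y \<in> O'" and \<phi>: "smooth_on O' \<phi>" and X: "(X has_derivative X') (at y)"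
  shows "((\<lambda>y. der \<phi> y (X y)) has_derivative (\<lambda>v. der (\<lambda>z. der \<phi> z (X y)) y v + der \<phi> y (X' v))) (at y)"
proof -
  have L: "linear (der \<phi> z)" if "z \<in> O'" for z using smooth_linear_der[OF \<phi> O(1) that] .
  have db: "((\<lambda>z. der \<phi> z b) has_derivative der (\<lambda>z. der \<phi> z b) y) (at y)" for b
    by (rule smooth_has_derivative[OF smooth_der[OF O(1) \<phi> smooth_const[OF O(1)]] O])
  have 1: "((\<lambda>y. \<Sum>b\<in>Basis. (X y \<bullet> b) *\<^sub>R der \<phi> y b) has_derivative
      (\<lambda>v. \<Sum>b\<in>Basis. (X y \<bullet> b) *\<^sub>R der (\<lambda>z. der \<phi> z b) y v + (X' v \<bullet> b) *\<^sub>R der \<phi> y b)) (at y)"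
    by (intro has_derivative_sum has_derivative_scaleR db has_derivative_inner_left X)
  have 2: "((\<lambda>z. \<Sum>b\<in>Basis. (X y \<bullet> b) *\<^sub>R der \<phi> z b) has_derivative
      (\<lambda>v. \<Sum>b\<in>Basis. (X y \<bullet> b) *\<^sub>R der (\<lambda>z. der \<phi> z b) y v)) (at y)"
    by (intro has_derivative_sum has_derivative_scaleR_right db)
  have 3: "der (\<lambda>z. der \<phi> z (X y)) y v = (\<Sum>b\<in>Basis. (X y \<bullet> b) *\<^sub>R der (\<lambda>z. der \<phi> z b) y v)" for v
    using der_eq[OF has_derivative_transform_within_open[OF 2 O, of "\<lambda>z. der \<phi> z (X y)"]] linear_expand[OF L]
    by auto
  have "((\<lambda>y. der \<phi> y (X y)) has_derivative
      (\<lambda>v. \<Sum>b\<in>Basis. (X y \<bullet> b) *\<^sub>R der (\<lambda>z. der \<phi> z b) y v + (X' v \<bullet> b) *\<^sub>R der \<phi> y b)) (at y)"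
    by (rule has_derivative_transform_within_open[OF 1 O]) (use linear_expand[OF L] in auto)
  then show ?thesis unfolding 3 linear_expand[OF L[OF O(2)], of "X' v" for v] by (simp add: sum.distrib)
qed

text \<open>Similar maps have the same trace; this is why the divergence can be computed in any
  chart.\<close>

lemma trace_conj:
  fixes L J K :: "real ^ 'n \<Rightarrow> real ^ 'n"
  assumes "linear L" "linear J" "linear K" "\<And>v. K (J v) = v"
  shows "(\<Sum>i\<in>UNIV. J (L (K (axis i 1))) $ i) = (\<Sum>i\<in>UNIV. L (axis i 1) $ i)"
proof -
  have t: "(\<Sum>i\<in>UNIV. F (axis i 1) $ i) = trace (matrix F)" for F :: "real ^ 'n \<Rightarrow> real ^ 'n"
    by (simp add: trace_def matrix_def)
  have "(\<Sum>i\<in>UNIV. J (L (K (axis i 1))) $ i) = trace (matrix (J \<circ> (L \<circ> K)))"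
    using t[of "J \<circ> (L \<circ> K)"] by simp
  also have "\<dots> = trace (matrix J ** matrix (L \<circ> K))"
    by (simp add: matrix_compose linear_compose assms)
  also have "\<dots> = trace (matrix (L \<circ> K) ** matrix J)" by (rule trace_mul_sym)
  also have "\<dots> = trace (matrix (L \<circ> K \<circ> J))" by (simp add: matrix_compose linear_compose assms)
  also have "L \<circ> K \<circ> J = L" using assms(4) by auto
  finally show ?thesis using t by simp
qed

locale coord_change = c: coord_metric U G + c': coord_metric U' G'
  for U G U' G' +
  fixes O' and \<phi>
  assumes O': "open O'" "O' \<subseteq> U" and \<phi>U: "\<And>y. y \<in> O' \<Longrightarrow> \<phi> y \<in> U'" and \<phi>: "smooth_on O' \<phi>"
    and iso: "\<And>y v w. y \<in> O' \<Longrightarrow> G y v w = G' (\<phi> y) (der \<phi> y v) (der \<phi> y w)"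
    and surj: "\<And>y. y \<in> O' \<Longrightarrow> surj (der \<phi> y)"
begin

lemma der_der: "y \<in> O' \<Longrightarrow> ((\<lambda>z. der \<phi> z a) has_derivative (\<lambda>v. der (\<lambda>z. der \<phi> z a) y v)) (at y)"
  by (rule smooth_has_derivative[OF smooth_der[OF O'(1) \<phi> smooth_const[OF O'(1)]] O'(1)])

lemma dG_change:
  assumes y: "y \<in> O'"
  shows "c.dG y v a b = c'.dG (\<phi> y) (der \<phi> y v) (der \<phi> y a) (der \<phi> y b) +
    G' (\<phi> y) (der (\<lambda>z. der \<phi> z a) y v) (der \<phi> y b) + G' (\<phi> y) (der \<phi> y a) (der (\<lambda>z. der \<phi> z b) y v)"
proof -
  have "((\<lambda>y. G y a b) has_derivative (\<lambda>v. c'.dG (\<phi> y) (der \<phi> y v) (der \<phi> y a) (der \<phi> y b) +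
    G' (\<phi> y) (der (\<lambda>z. der \<phi> z a) y v) (der \<phi> y b) + G' (\<phi> y) (der \<phi> y a) (der (\<lambda>z. der \<phi> z b) y v))) (at y)"
    by (rule has_derivative_transform_within_open[OF c'.has_derivative_G[OF O'(1) y \<phi>U
        smooth_has_derivative[OF \<phi> O'(1) y] der_der[OF y] der_der[OF y]] O'(1) y]) (simp_all add: iso)
  from fun_cong[OF der_eq[OF this], of v] show ?thesis unfolding c.dG_def .
qed

lemma der_X_change:
  assumes y: "y \<in> O'" and X: "(X has_derivative der X y) (at y)" and X': "(X' has_derivative der X' (\<phi> y)) (at (\<phi> y))"
    and XX': "\<And>y. y \<in> O' \<Longrightarrow> X' (\<phi> y) = der \<phi> y (X y)"
  shows "der X' (\<phi> y) (der \<phi> y v) = der (\<lambda>z. der \<phi> z (X y)) y v + der \<phi> y (der X y v)"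
proof -
  have "((\<lambda>y. X' (\<phi> y)) has_derivative (\<lambda>v. der X' (\<phi> y) (der \<phi> y v))) (at y)"
    by (rule has_derivative_compose[OF smooth_has_derivative[OF \<phi> O'(1) y] X'])
  from has_derivative_unique[OF this
    has_derivative_transform_within_open[OF has_derivative_der_apply[OF O'(1) y \<phi> X] O'(1) y]]
  show ?thesis using XX' by (auto dest: fun_cong)
qed

text \<open>Second derivatives of \<open>\<phi>\<close> enter through the derivative of the
  transformed field and through the three derivatives of the metric. Tested against a vector
  \<open>der \<phi> y b\<close> they cancel, because they are symmetric in their directions;
  \<open>surj\<close> supplies enough test vectors.\<close>

lemma nabc_change:
  assumes y: "y \<in> O'" and X: "(X has_derivative der X y) (at y)" and X': "(X' has_derivative der X' (\<phi> y)) (at (\<phi> y))"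
    and XX': "\<And>y. y \<in> O' \<Longrightarrow> X' (\<phi> y) = der \<phi> y (X y)"
  shows "c'.nabc X' (\<phi> y) (der \<phi> y v) = der \<phi> y (c.nabc X y v)"
proof (rule c'.G_eqD[OF \<phi>U[OF y]])
  fix a
  obtain b where a: "a = der \<phi> y b" using surj[OF y] by blast
  have yU: "y \<in> U" using y O' by blast
  have L: "linear (der \<phi> y)" using smooth_linear_der[OF \<phi> O'(1) y] .
  note sw = der_swap[OF O'(1) y \<phi>]
  have dX: "der X' (\<phi> y) (der \<phi> y v) = der (\<lambda>z. der \<phi> z (X y)) y v + der \<phi> y (der X y v)"
    by (rule der_X_change[OF y X X' XX'])
  have "G' (\<phi> y) (der \<phi> y (c.nabc X y v)) a = G y (der X y v) b + (c.dG y v (X y) b + c.dG y (X y) v b - c.dG y b v (X y)) / 2"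
    by (simp add: a iso[OF y, symmetric] c.nabc_def c.G_simps[OF yU] c.G_christ[OF yU])
  also have "\<dots> = G' (\<phi> y) (c'.nabc X' (\<phi> y) (der \<phi> y v)) a"
    unfolding a c'.nabc_def XX'[OF y] dX dG_change[OF y] iso[OF y]
      c'.G_simps[OF \<phi>U[OF y]] c'.G_christ[OF \<phi>U[OF y]]
      sw[of v "X y"] sw[of b v] sw[of b "X y"]
      c'.sym[OF \<phi>U[OF y], of _ "der (\<lambda>z. der \<phi> z v) y (X y)"] c'.sym[OF \<phi>U[OF y], of _ "der (\<lambda>z. der \<phi> z v) y b"]
      c'.sym[OF \<phi>U[OF y], of _ "der (\<lambda>z. der \<phi> z (X y)) y b"]
    by argo
  finally show "G' (\<phi> y) (c'.nabc X' (\<phi> y) (der \<phi> y v)) a = G' (\<phi> y) (der \<phi> y (c.nabc X y v)) a" by simp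
qed

text \<open>The second derivatives of \<open>\<phi>\<close> cancel in pairs between the metric term
  and the two terms with derivatives of \<open>X\<close>.\<close>

lemma liec_change:
  assumes y: "y \<in> O'" and X: "(X has_derivative der X y) (at y)" and X': "(X' has_derivative der X' (\<phi> y)) (at (\<phi> y))"
    and XX': "\<And>y. y \<in> O' \<Longrightarrow> X' (\<phi> y) = der \<phi> y (X y)"
  shows "c'.liec X' (\<phi> y) (der \<phi> y v) (der \<phi> y w) = c.liec X y v w"
proof -
  have dX: "der X' (\<phi> y) (der \<phi> y v) = der (\<lambda>z. der \<phi> z (X y)) y v + der \<phi> y (der X y v)" for v
    by (rule der_X_change[OF y X X' XX'])
  show ?thesis
  unfolding c'.liec_def c.liec_def XX'[OF y] dX dG_change[OF y] iso[OF y] c'.G_simps[OF \<phi>U[OF y]]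
    der_swap[OF O'(1) y \<phi>, of v "X y"] der_swap[OF O'(1) y \<phi>, of w "X y"] by argo
qed

end


subsection \<open>Charts of a manifold\<close>

locale riem =
  fixes M :: "('m::{t2_space, second_countable_topology}, 'n::finite) riemannian"
  assumes M: "riemannian_manifold M"
begin

definition gp :: "'m \<Rightarrow> real ^ 'n \<Rightarrow> real ^ 'n \<Rightarrow> real ^ 'n \<Rightarrow> real" where
  "gp p y v w = gcomp M p v w y"

definition overlap :: "'m \<Rightarrow> 'm \<Rightarrow> (real ^ 'n) set" where
  "overlap p q = cmap M p ` (cdom M p \<inter> cdom M q)"

abbreviation change :: "'m \<Rightarrow> 'm \<Rightarrow> real ^ 'n \<Rightarrow> real ^ 'n" where
  "change p q \<equiv> cmap M q \<circ> cinv M p"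

lemma chart:
  shows open_cdom: "open (cdom M p)" and in_cdom [simp]: "p \<in> cdom M p" and open_cimg: "open (cimg M p)"
    and homeo: "homeomorphism (cdom M p) (cimg M p) (cmap M p) (cinv M p)"
  using M unfolding riemannian_manifold_def by auto

lemma cinv_cmap [simp]: "x \<in> cdom M p \<Longrightarrow> cinv M p (cmap M p x) = x"
  and cmap_in [simp]: "x \<in> cdom M p \<Longrightarrow> cmap M p x \<in> cimg M p"
  and cmap_cinv [simp]: "y \<in> cimg M p \<Longrightarrow> cmap M p (cinv M p y) = y"
  and cinv_in [simp]: "y \<in> cimg M p \<Longrightarrow> cinv M p y \<in> cdom M p"
  using homeo[of p] unfolding homeomorphism_def by auto

lemma continuous_on_cinv: "continuous_on (cimg M p) (cinv M p)"
  and continuous_on_cmap: "continuous_on (cdom M p) (cmap M p)"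
  using homeo[of p] unfolding homeomorphism_def by auto

lemma mem_overlap: "y \<in> overlap p q \<longleftrightarrow> y \<in> cimg M p \<and> cinv M p y \<in> cdom M q"
  unfolding overlap_def by (auto simp: image_iff intro!: bexI[of _ "cinv M p y"])

lemma open_cinv_vimage: "open W \<Longrightarrow> open {y \<in> cimg M p. cinv M p y \<in> W}"
proof -
  assume "open W"
  then have "open (cimg M p \<inter> cinv M p -` W)" by (rule continuous_open_preimage[OF continuous_on_cinv open_cimg])
  moreover have "cimg M p \<inter> cinv M p -` W = {y \<in> cimg M p. cinv M p y \<in> W}" by auto
  ultimately show ?thesis by simp
qed

lemma open_overlap: "open (overlap p q)"
proof -
  have "overlap p q = {y \<in> cimg M p. cinv M p y \<in> cdom M q}" using mem_overlap by blast
  then show ?thesis using open_cinv_vimage[OF open_cdom] by simp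
qed

lemma smooth_change: "smooth_on (overlap p q) (change p q)"
  using M unfolding riemannian_manifold_def overlap_def by auto

lemma change_in: "y \<in> overlap p q \<Longrightarrow> change p q y \<in> cimg M q"
  using mem_overlap by simp

lemma change_in_overlap: "y \<in> overlap p q \<Longrightarrow> change p q y \<in> overlap q p"
  using mem_overlap by simp

lemma transition_der: "y \<in> cimg M p \<Longrightarrow> transition M p q (cinv M p y) = der (change p q) y"
  by (simp add: transition_def)

lemma has_derivative_change:
  "x \<in> cdom M p \<Longrightarrow> x \<in> cdom M q \<Longrightarrow> (change p q has_derivative transition M p q x) (at (cmap M p x))"
  using smooth_has_derivative[OF smooth_change open_overlap, of "cmap M p x" p q] mem_overlap
  by (simp add: transition_def)

lemma transition_linear: "x \<in> cdom M p \<Longrightarrow> x \<in> cdom M q \<Longrightarrow> linear (transition M p q x)"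
  using has_derivative_change has_derivative_linear by blast

lemma transition_self: "x \<in> cdom M p \<Longrightarrow> transition M p p x v = v"
proof -
  assume x: "x \<in> cdom M p"
  have "((\<lambda>y. y) has_derivative (\<lambda>v. v)) (at (cmap M p x))" by simp
  then have "(change p p has_derivative (\<lambda>v. v)) (at (cmap M p x))"
    by (rule has_derivative_transform_within_open[OF _ open_cimg cmap_in[OF x]]) simp
  from has_derivative_unique[OF this has_derivative_change[OF x x]] show ?thesis by (simp add: fun_eq_iff)
qed

lemma transition_trans:
  assumes "x \<in> cdom M p" "x \<in> cdom M q" "x \<in> cdom M r"
  shows "transition M q r x (transition M p q x v) = transition M p r x v"
proof -
  have x: "cmap M p x \<in> {y \<in> cimg M p. cinv M p y \<in> cdom M q}" using assms by simp
  have "((\<lambda>y. change q r (change p q y)) has_derivative (\<lambda>v. transition M q r x (transition M p q x v))) (at (cmap M p x))"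
    by (rule has_derivative_compose[OF has_derivative_change[OF assms(1,2)]])
      (use has_derivative_change[OF assms(2,3)] assms in \<open>simp add: o_def\<close>)
  then have "(change p r has_derivative (\<lambda>v. transition M q r x (transition M p q x v))) (at (cmap M p x))"
    by (rule has_derivative_transform_within_open[OF _ open_cinv_vimage[OF open_cdom] x]) simp
  from has_derivative_unique[OF this has_derivative_change[OF assms(1,3)]] show ?thesis by (simp add: fun_eq_iff)
qed

lemma transition_inverse [simp]:
  "x \<in> cdom M p \<Longrightarrow> x \<in> cdom M q \<Longrightarrow> transition M q p x (transition M p q x v) = v"
  by (simp add: transition_trans transition_self)

lemma metric:
  shows metric_bil: "bilinear (metric M x)" and metric_sym: "metric M x v w = metric M x w v"
    and metric_pos: "v \<noteq> 0 \<Longrightarrow> metric M x v v > 0"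
  using M unfolding riemannian_manifold_def by auto

lemma gp_smooth: "smooth_on (cimg M p) (\<lambda>y. gp p y v w)"
  using M unfolding riemannian_manifold_def gp_def by simp

lemma gp_metric: "gp p y v w = metric M (cinv M p y) (transition M p (cinv M p y) (cinv M p y) v) (transition M p (cinv M p y) (cinv M p y) w)"
  by (simp add: gp_def gcomp_def)

sublocale ch: coord_metric "cimg M p" "gp p" for p
proof
  show "open (cimg M p)" by (rule open_cimg)
  show "smooth_on (cimg M p) (\<lambda>y. gp p y v w)" for v w by (rule gp_smooth)
  fix y assume y: "y \<in> cimg M p"
  define x where "x = cinv M p y"
  have x: "x \<in> cdom M p" using y by (simp add: x_def)
  have l: "linear (transition M p x x)" by (rule transition_linear[OF x in_cdom])
  have m: "linear (metric M x v)" "linear (\<lambda>v. metric M x v w)" for v w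
    using metric_bil unfolding bilinear_def by auto
  show "bilinear (gp p y)"
    unfolding gp_metric x_def[symmetric] bilinear_def
    using linear_compose[OF l m(1)] linear_compose[OF l m(2)] by (simp add: o_def)
  show "gp p y v w = gp p y w v" for v w unfolding gp_metric by (rule metric_sym)
  show "0 < gp p y v v" if "v \<noteq> 0" for v
  proof -
    have "transition M p x x v \<noteq> 0"
      using transition_inverse[OF x in_cdom, of v] that linear_0[OF transition_linear[OF in_cdom x]] by force
    then show ?thesis unfolding gp_metric x_def[symmetric] by (rule metric_pos)
  qed
qed

text \<open>Tangent vectors at \<open>x\<close> are stored by their components in the chart at
  \<open>x\<close>. At the centre of that chart components and vectors coincide, so the global
  definitions can be read there as chart expressions.\<close>

lemma vcomp_center [simp]: "vcomp M x X (cmap M x x) = X x"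
  by (simp add: vcomp_def transition_self)

lemma gp_center [simp]: "gp x (cmap M x x) = metric M x"
  by (simp add: fun_eq_iff gp_metric transition_self)

lemma vcomp_change:
  assumes "y \<in> overlap p q"
  shows "vcomp M q X (change p q y) = der (change p q) y (vcomp M p X y)"
proof -
  define x where "x = cinv M p y"
  have x: "x \<in> cdom M p" "x \<in> cdom M q" "y \<in> cimg M p" using assms mem_overlap by (auto simp: x_def)
  have "cinv M q (change p q y) = x" using x by (simp add: x_def)
  then show ?thesis
    unfolding vcomp_def using transition_der[OF x(3), of q] transition_trans[OF in_cdom x(1,2)] by (simp add: x_def)
qed

lemma coord_change: "coord_change (cimg M p) (gp p) (cimg M q) (gp q) (overlap p q) (change p q)"
proof (intro coord_change.intro ch.coord_metric_axioms coord_change_axioms.intro)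
  show "overlap p q \<subseteq> cimg M p" using mem_overlap by auto
  fix y assume y: "y \<in> overlap p q"
  define x where "x = cinv M p y"
  have x: "x \<in> cdom M p" "x \<in> cdom M q" "y \<in> cimg M p" using y mem_overlap by (auto simp: x_def)
  have cx: "cinv M q (change p q y) = x" using x by (simp add: x_def)
  have d: "der (change p q) y = transition M p q x" using transition_der[OF x(3), of q] by (simp add: x_def)
  show "gp p y v w = gp q (change p q y) (der (change p q) y v) (der (change p q) y w)" for v w
    unfolding gp_metric cx d x_def[symmetric] by (simp add: transition_trans x)
  show "surj (der (change p q) y)" unfolding d
    by (rule surjI[of _ "transition M q p x"]) (simp add: x)
qed (use open_overlap smooth_change change_in in auto)

lemma smooth_vcomp: "smooth_vector M X \<Longrightarrow> smooth_on (cimg M p) (vcomp M p X)"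
  by (simp add: smooth_vector_def)

lemma has_derivative_vcomp: "smooth_vector M X \<Longrightarrow> y \<in> cimg M p \<Longrightarrow> (vcomp M p X has_derivative der (vcomp M p X) y) (at y)"
  using smooth_has_derivative[OF smooth_vcomp open_cimg] by blast

lemma smooth_comp: "smooth_scalar M f \<Longrightarrow> smooth_on (cimg M p) (f \<circ> cinv M p)"
  by (simp add: smooth_scalar_def)

lemma has_derivative_comp: "smooth_scalar M f \<Longrightarrow> y \<in> cimg M p \<Longrightarrow> (f \<circ> cinv M p has_derivative der (f \<circ> cinv M p) y) (at y)"
  using smooth_has_derivative[OF smooth_comp open_cimg] by blast

lemma dmetric_center: "dmetric M x = ch.dG x (cmap M x x)"
proof -
  have "(\<lambda>y. gp x y a b) = gcomp M x a b" for a b by (simp add: fun_eq_iff gp_def)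
  then show ?thesis unfolding dmetric_def ch.dG_def by (simp add: fun_eq_iff)
qed

lemma christoffel_center: "christoffel M x v w = ch.christ x (cmap M x x) v w"
  unfolding christoffel_def ch.christ_def by (simp add: dmetric_center)

lemma nabla_center: "nabla M x v X = ch.nabc x (vcomp M x X) (cmap M x x) v"
  unfolding nabla_def ch.nabc_def dvector_def christoffel_center by simp

lemma lie_center: "lie_metric M X x v w = ch.liec x (vcomp M x X) (cmap M x x) v w"
  unfolding lie_metric_def ch.liec_def dvector_def dmetric_center by simp

context
  fixes p x y J
  assumes y: "y \<in> cimg M p" and x: "x = cinv M p y" and J: "J = transition M p x x"
begin

lemma ov: "y \<in> overlap p x" using y x mem_overlap by simp
lemma chx: "change p x y = cmap M x x" using x y by simp
lemma dJ: "der (change p x) y = J" using transition_der[OF y, of x] by (simp add: x J)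

lemma nabla_chart: "smooth_vector M X \<Longrightarrow> nabla M x (J v) X = J (ch.nabc p (vcomp M p X) y v)"
  using coord_change.nabc_change[OF coord_change ov has_derivative_vcomp[OF _ y] has_derivative_vcomp[OF _ change_in[OF ov]], of X X v]
  unfolding nabla_center chx dJ using vcomp_change by blast

lemma lie_chart: "smooth_vector M X \<Longrightarrow> lie_metric M X x (J v) (J w) = ch.liec p (vcomp M p X) y v w"
  using coord_change.liec_change[OF coord_change ov has_derivative_vcomp[OF _ y] has_derivative_vcomp[OF _ change_in[OF ov]], of X X v w]
  unfolding lie_center chx dJ using vcomp_change by blast

lemma differential_chart: "smooth_scalar M f \<Longrightarrow> differential M f x (J v) = der (f \<circ> cinv M p) y v"
proof -
  assume f: "smooth_scalar M f"
  have "((\<lambda>y. (f \<circ> cinv M x) (change p x y)) has_derivative (\<lambda>v. differential M f x (J v))) (at y)"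
    unfolding differential_def chx[symmetric] dJ[symmetric]
    by (rule has_derivative_compose[OF smooth_has_derivative[OF smooth_change open_overlap ov] has_derivative_comp[OF f change_in[OF ov]]])
  then have "(f \<circ> cinv M p has_derivative (\<lambda>v. differential M f x (J v))) (at y)"
    by (rule has_derivative_transform_within_open[OF _ open_overlap ov]) (simp add: mem_overlap)
  from der_eq[OF this] show ?thesis by simp
qed

lemma linear_J: "linear J" unfolding J by (rule transition_linear) (use x y in auto)

lemma J_inv: "transition M x p x (J v) = v" "J (transition M x p x v) = v"
  unfolding J using x y by auto

lemma vcomp_J: "vcomp M p X y = transition M x p x (X x)" "J (vcomp M p X y) = X x"
  unfolding vcomp_def x[symmetric] by (simp_all add: J_inv)

lemma metric_J: "metric M x (J v) (J w) = gp p y v w"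
  unfolding gp_metric x J by simp

lemma divergence_chart:
  assumes X: "smooth_vector M X"
  shows "divergence M X x = ch.divc p (vcomp M p X) y"
proof -
  let ?K = "transition M x p x"
  have K: "linear ?K" by (rule transition_linear) (use x y in auto)
  have L: "linear (ch.nabc p (vcomp M p X) y)"
    unfolding ch.nabc_def
    using linear_compose_add[OF has_derivative_linear[OF has_derivative_vcomp[OF X y]] ch.christ_linear1[OF y]] by simp
  have "nabla M x (axis i 1) X = J (ch.nabc p (vcomp M p X) y (?K (axis i 1)))" for i
    using nabla_chart[OF X, of "?K (axis i 1)"] by (simp add: J_inv)
  then show ?thesis unfolding divergence_def ch.divc_def
    using trace_conj[OF L linear_J K J_inv(1)] by simp
qed

lemma grad_chart:
  assumes f: "smooth_scalar M f"
  shows "grad M f x = J (ch.sharp p y (der (f \<circ> cinv M p) y))" (is "_ = ?w")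
proof -
  have l: "linear (der (f \<circ> cinv M p) y)" using has_derivative_linear[OF has_derivative_comp[OF f y]] .
  have *: "metric M x ?w v = differential M f x v" for v
    using metric_J[of _ "transition M x p x v"] ch.G_sharp[OF y l] differential_chart[OF f, of "transition M x p x v"]
    by (simp add: J_inv)
  show ?thesis unfolding grad_def
  proof (rule the_equality)
    show "w = ?w" if "\<forall>v. metric M x w v = differential M f x v" for w
      using ch.G_eqD[OF cmap_in[OF in_cdom, of x], of w ?w] that * by simp
  qed (use * in simp)
qed

end

lemma grad_metric:
  assumes "smooth_scalar M f" shows "metric M x (grad M f x) v = differential M f x v"
proof -
  have l: "linear (der (f \<circ> cinv M x) (cmap M x x))"
    using has_derivative_linear[OF has_derivative_comp[OF assms cmap_in[OF in_cdom]]] .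
  have "grad M f x = ch.sharp x (cmap M x x) (der (f \<circ> cinv M x) (cmap M x x))"
    using grad_chart[of "cmap M x x" x x "transition M x x x", OF _ _ refl assms] by (simp add: transition_self)
  then show ?thesis using ch.G_sharp[where p=x, OF cmap_in[OF in_cdom] l] by (simp add: differential_def)
qed

lemma metric_eqD: "(\<And>a. metric M x v a = metric M x w a) \<Longrightarrow> v = w"
  using ch.G_eqD[OF cmap_in[OF in_cdom, of x], of v w] by simp

lemma linear_metric: "linear (metric M x v)" "linear (\<lambda>v. metric M x v w)"
  using metric_bil unfolding bilinear_def by auto

subsection \<open>Extending local data\<close>

lemma closed_cinv_image: "compact K \<Longrightarrow> K \<subseteq> cimg M p \<Longrightarrow> closed (cinv M p ` K)"
  by (intro compact_imp_closed compact_continuous_image continuous_on_subset[OF continuous_on_cinv])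

text \<open>For \<open>f\<close> with compact support in the chart this is a smooth field on the
  whole manifold. Such fields are the perturbations on which a conservation law is tested.\<close>

definition ext_vector :: "'m \<Rightarrow> (real ^ 'n \<Rightarrow> real ^ 'n) \<Rightarrow> 'm \<Rightarrow> real ^ 'n" where
  "ext_vector p f x = (if x \<in> cdom M p then transition M p x x (f (cmap M p x)) else 0)"

text \<open>The offset \<open>c\<close> is the value of a constant background: densities are
  positive, so 0 would not do.\<close>

definition ext_scalar :: "'m \<Rightarrow> real \<Rightarrow> (real ^ 'n \<Rightarrow> real) \<Rightarrow> 'm \<Rightarrow> real" where
  "ext_scalar p c f x = c + (if x \<in> cdom M p then f (cmap M p x) else 0)"

lemma vcomp_ext: "y \<in> cimg M p \<Longrightarrow> vcomp M p (ext_vector p f) y = f y"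
  unfolding vcomp_def ext_vector_def by simp

lemma ext_scalar_comp: "y \<in> cimg M p \<Longrightarrow> (ext_scalar p c f \<circ> cinv M p) y = c + f y"
  unfolding ext_scalar_def by simp

context
  fixes p K
  assumes K: "compact K" "K \<subseteq> cimg M p"
begin

lemma open_off: "open {y \<in> cimg M q. cinv M q y \<in> - cinv M p ` K}"
  by (rule open_cinv_vimage) (simp add: closed_cinv_image[OF K] open_Compl)

lemma on_off:
  assumes "y \<in> cimg M q" "cinv M q y \<notin> cdom M p"
  shows "y \<in> {y \<in> cimg M q. cinv M q y \<in> - cinv M p ` K}"
proof -
  have "cinv M p ` K \<subseteq> cdom M p" using K by auto
  then show ?thesis using assms by blast
qed

lemma off_cmap: "x \<notin> cinv M p ` K \<Longrightarrow> x \<in> cdom M p \<Longrightarrow> cmap M p x \<notin> K"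
  by (metis cinv_cmap imageI)

text \<open>Two open sets cover each chart: the overlap with chart \<open>p\<close>, where the
  change of coordinates applies, and the complement of the image of \<open>K\<close>, where the
  field is zero. That image is closed, being compact in a Hausdorff space.\<close>

lemma smooth_ext_vector:
  assumes f: "smooth_on UNIV f" "\<And>y. y \<notin> K \<Longrightarrow> f y = 0"
  shows "smooth_vector M (ext_vector p f)"
  unfolding smooth_vector_def
proof (intro allI smooth_openI)
  fix q y assume y: "y \<in> cimg M q"
  show "\<exists>V. open V \<and> y \<in> V \<and> smooth_on V (vcomp M q (ext_vector p f))"
  proof (cases "cinv M q y \<in> cdom M p")
    case True
    have "smooth_on (overlap q p) (vcomp M q (ext_vector p f))"
    proof (rule smooth_cong[OF open_overlap])
      show "der (change p q) (change q p z) (f (change q p z)) = vcomp M q (ext_vector p f) z" if "z \<in> overlap q p" for z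
        using vcomp_change[OF change_in_overlap[OF that], of "ext_vector p f"] vcomp_ext[OF change_in[OF that], of f] that mem_overlap
        by simp
      show "smooth_on (overlap q p) (\<lambda>z. der (change p q) (change q p z) (f (change q p z)))"
        by (rule smooth_der_compose[OF open_overlap change_in_overlap smooth_change open_overlap smooth_change
             smooth_compose[OF open_overlap open_UNIV UNIV_I smooth_change f(1)]])
    qed
    moreover have "y \<in> overlap q p" using True y mem_overlap by simp
    ultimately show ?thesis using open_overlap[of q p] by blast
  next
    case False
    let ?V = "{y \<in> cimg M q. cinv M q y \<in> - cinv M p ` K}"
    have "smooth_on ?V (vcomp M q (ext_vector p f))"
    proof (rule smooth_cong[OF open_off _ smooth_const[OF open_off, of q 0]])
      fix z assume z: "z \<in> ?V"
      then have "ext_vector p f (cinv M q z) = 0"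
        using f(2)[OF off_cmap, of "cinv M q z"] linear_0[OF transition_linear[of "cinv M q z" p "cinv M q z"]] by (auto simp: ext_vector_def)
      then show "0 = vcomp M q (ext_vector p f) z"
        using linear_0[OF transition_linear[of "cinv M q z" "cinv M q z" q]] z by (simp add: vcomp_def)
    qed
    then show ?thesis using open_off[of q] on_off[OF y False] by blast
  qed
qed

lemma smooth_ext_scalar:
  assumes f: "smooth_on UNIV f" "\<And>y. y \<notin> K \<Longrightarrow> f y = 0"
  shows "smooth_scalar M (ext_scalar p c f)"
  unfolding smooth_scalar_def
proof (intro allI smooth_openI)
  fix q y assume y: "y \<in> cimg M q"
  show "\<exists>V. open V \<and> y \<in> V \<and> smooth_on V (ext_scalar p c f \<circ> cinv M q)"
  proof (cases "cinv M q y \<in> cdom M p")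
    case True
    have "smooth_on (overlap q p) (ext_scalar p c f \<circ> cinv M q)"
    proof (rule smooth_cong[OF open_overlap])
      show "c + f (change q p z) = (ext_scalar p c f \<circ> cinv M q) z" if "z \<in> overlap q p" for z
        using that mem_overlap by (simp add: ext_scalar_def)
      show "smooth_on (overlap q p) (\<lambda>z. c + f (change q p z))"
        by (rule smooth_add[OF open_overlap smooth_const[OF open_overlap]
              smooth_compose[OF open_overlap open_UNIV UNIV_I smooth_change f(1)]])
    qed
    moreover have "y \<in> overlap q p" using True y mem_overlap by simp
    ultimately show ?thesis using open_overlap[of q p] by blast
  next
    case False
    let ?V = "{y \<in> cimg M q. cinv M q y \<in> - cinv M p ` K}"
    have "smooth_on ?V (ext_scalar p c f \<circ> cinv M q)"
      by (rule smooth_cong[OF open_off _ smooth_const[OF open_off, of q c]])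
        (use f(2)[OF off_cmap] in \<open>auto simp: ext_scalar_def\<close>)
    then show ?thesis using open_off[of q] on_off[OF y False] by blast
  qed
qed

end

lemma iter_deriv_cong:
  assumes "open V" "\<And>y. y \<in> V \<Longrightarrow> f y = g y" "y \<in> V"
  shows "iter_deriv bs f y = iter_deriv bs g y"
  using assms(3)
proof (induction bs arbitrary: y)
  case (Cons b bs)
  show ?case unfolding iter_deriv.simps
    by (rule fun_cong[OF der_cong[OF assms(1) Cons.prems]]) (rule Cons.IH)
qed (use assms in auto)

text \<open>Gives the locality of fluxes: states that agree on an open set have the same jets of
  every order there, hence the same flux, whatever its order.\<close>

lemma same_jet_open:
  assumes W: "open W" "x \<in> W" and eq: "\<And>z. z \<in> W \<Longrightarrow> u z = v z \<and> \<rho> z = \<tau> z \<and> S z = R z"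
  shows "same_jet M k x u \<rho> S v \<tau> R"
proof -
  let ?V = "{y \<in> cimg M x. cinv M x y \<in> W}"
  have V: "open ?V" by (rule open_cinv_vimage[OF W(1)])
  have xV: "cmap M x x \<in> ?V" using W by simp
  show ?thesis unfolding same_jet_def
    by (intro allI impI conjI iter_deriv_cong[OF V _ xV]) (use eq in \<open>auto simp: vcomp_def\<close>)
qed

end

subsection \<open>The conservation law in a chart\<close>

context coord_metric
begin

lemma divc_scale:
  assumes y: "y \<in> U" and "(f has_derivative f') (at y)" "(X has_derivative der X y) (at y)"
  shows "divc (\<lambda>y. f y *\<^sub>R X y) y = f y * divc X y + f' (X y)"
proof -
  have d: "der (\<lambda>y. f y *\<^sub>R X y) y = (\<lambda>v. f y *\<^sub>R der X y v + f' v *\<^sub>R X y)"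
    using der_eq[OF has_derivative_scaleR[OF assms(2,3)]] .
  have l: "linear f'" using assms(2) has_derivative_linear by blast
  have "(\<Sum>i\<in>UNIV. f' (axis i 1) * X y $ i) = f' (X y)"
    using linear_expand_axis[OF l, of "X y"] by (simp add: mult.commute)
  then show ?thesis unfolding divc_def nabc_def d
    by (simp add: linear_cmul[OF christ_linear2[OF y]] sum.distrib sum_distrib_left algebra_simps)
qed

lemma divc_add:
  assumes y: "y \<in> U" and "(X has_derivative der X y) (at y)" "(Y has_derivative der Y y) (at y)"
  shows "divc (\<lambda>y. X y + Y y) y = divc X y + divc Y y"
  unfolding divc_def nabc_def der_eq[OF has_derivative_add[OF assms(2,3)]]
  by (simp add: linear_add[OF christ_linear2[OF y]] sum.distrib algebra_simps)

text \<open>This is \<open>D_t T + Div (T u)\<close> after the time derivatives have been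
  eliminated. The first term is the derivative along the flow, in which the Christoffel term moves
  \<open>v\<close> parallelly; the second has the factor \<open>T - r T_r\<close> in front of
  \<open>div u\<close>; the third is the acceleration by the pressure. Gradients of density and
  entropy occur in the pressure only, since both are carried along by the flow.\<close>

definition energy_form where
  "energy_form Th P t y v r s dv dr ds =
    der Th (t, y, v, r, s) (1, v, - christ y v v, 0, 0) +
    (Th (t, y, v, r, s) - r * der Th (t, y, v, r, s) (0, 0, 0, 1, 0)) * (\<Sum>i\<in>UNIV. (dv (axis i 1) + christ y (axis i 1) v) $ i) -
    der Th (t, y, v, r, s) (0, 0, sharp y (\<lambda>a. der (\<lambda>(r, s). P r s) (r, s) (dr a, ds a)), 0, 0) / r"

end

definition (in riem) That :: "('m, 'n) density \<Rightarrow> 'm \<Rightarrow> real \<times> (real ^ 'n) \<times> (real ^ 'n) \<times> real \<times> real \<Rightarrow> real" where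
  "That T p = (\<lambda>(t, y, v, r, s). T t (cinv M p y) (transition M p (cinv M p y) (cinv M p y) v) r s)"

locale fluid = riem M for M :: "('m::{t2_space, second_countable_topology}, 'n::finite) riemannian" +
  fixes I J :: "real set" and P :: "real \<Rightarrow> real \<Rightarrow> real"
  assumes I: "open_interval I" "I \<subseteq> {0<..}" and J: "open_interval J"
    and P: "smooth_on (I \<times> J) (\<lambda>(r, s). P r s)"
begin

abbreviation "conserved \<equiv> conserved_density M I J P"
abbreviation "kinematic \<equiv> kinematic_density M I J"
abbreviation "fluid_st \<equiv> fluid_state M I J"
abbreviation "vec_fun \<equiv> vector_function M I J"

abbreviation chart_state where
  "chart_state p u \<rho> S y \<equiv> (vcomp M p u y, (\<rho> \<circ> cinv M p) y, (S \<circ> cinv M p) y)"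

abbreviation chart_deriv where
  "chart_deriv p u \<rho> S y b \<equiv> (der (vcomp M p u) y b, der (\<rho> \<circ> cinv M p) y b, der (S \<circ> cinv M p) y b)"

lemma open_I: "open I" and open_J: "open J" using I J unfolding open_interval_def by auto
lemma pos_I: "r \<in> I \<Longrightarrow> r > 0" using I by auto
lemma conv_I: "convex I" and conv_J: "convex J"
  using I J unfolding open_interval_def by (auto simp: is_interval_convex)

lemma open_dom: "open (UNIV \<times> cimg M p \<times> UNIV \<times> I \<times> J)"
  by (intro open_Times open_UNIV open_I open_J open_cimg)

lemma smooth_That: "kinematic T \<Longrightarrow> smooth_on (UNIV \<times> cimg M p \<times> UNIV \<times> I \<times> J) (That T p)"
  unfolding kinematic_density_def That_def by simp

lemma That_center: "That T x (t, cmap M x x, v, r, s) = T t x v r s"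
  by (simp add: That_def transition_self)

lemma vcomp_scale: "y \<in> cimg M p \<Longrightarrow> vcomp M p (\<lambda>z. f z *\<^sub>R X z) y = f (cinv M p y) *\<^sub>R vcomp M p X y"
  using linear_cmul[OF transition_linear[of "cinv M p y" "cinv M p y" p]] by (simp add: vcomp_def)

lemma smooth_vector_scale:
  assumes "smooth_scalar M f" "smooth_vector M X" shows "smooth_vector M (\<lambda>z. f z *\<^sub>R X z)"
  unfolding smooth_vector_def
proof
  fix p
  show "smooth_on (cimg M p) (vcomp M p (\<lambda>z. f z *\<^sub>R X z))"
    by (rule smooth_cong[OF open_cimg vcomp_scale[symmetric]], assumption)
      (intro smooth_scaleR open_cimg smooth_comp[unfolded o_def] smooth_vcomp assms)
qed

lemma vcomp_add: "y \<in> cimg M p \<Longrightarrow> vcomp M p (\<lambda>z. X z + Y z) y = vcomp M p X y + vcomp M p Y y"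
  using linear_add[OF transition_linear[of "cinv M p y" "cinv M p y" p]] by (simp add: vcomp_def)

lemma smooth_vector_add:
  assumes "smooth_vector M Y" "smooth_vector M X" shows "smooth_vector M (\<lambda>z. Y z + X z)"
  unfolding smooth_vector_def
proof
  fix p
  show "smooth_on (cimg M p) (vcomp M p (\<lambda>z. Y z + X z))"
    by (rule smooth_cong[OF open_cimg vcomp_add[symmetric]], assumption) (intro smooth_add open_cimg smooth_vcomp assms)
qed

lemma divergence_scale:
  assumes f: "smooth_scalar M f" and X: "smooth_vector M X"
  shows "divergence M (\<lambda>z. f z *\<^sub>R X z) x = f x * divergence M X x + differential M f x (X x)"
proof -
  let ?y = "cmap M x x"
  have y: "?y \<in> cimg M x" by simp
  have "ch.divc x (vcomp M x (\<lambda>z. f z *\<^sub>R X z)) ?y = ch.divc x (\<lambda>y. (f \<circ> cinv M x) y *\<^sub>R vcomp M x X y) ?y"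
    unfolding ch.divc_def ch.nabc_def using der_cong[OF open_cimg y vcomp_scale[of _ x f X]] vcomp_scale[OF y, of f X] by simp
  also have "\<dots> = f x * ch.divc x (vcomp M x X) ?y + differential M f x (X x)"
    using ch.divc_scale[OF y has_derivative_comp[OF f y] has_derivative_vcomp[OF X y]] by (simp add: differential_def)
  finally show ?thesis
    using divergence_chart[of ?y x x _ X] divergence_chart[of ?y x x _ "\<lambda>z. f z *\<^sub>R X z"] smooth_vector_scale[OF f X] X by simp
qed

lemma divergence_add:
  assumes Y: "smooth_vector M Y" and X: "smooth_vector M X"
  shows "divergence M (\<lambda>z. Y z + X z) x = divergence M Y x + divergence M X x"
proof -
  let ?y = "cmap M x x"
  have y: "?y \<in> cimg M x" by simp
  have "ch.divc x (vcomp M x (\<lambda>z. Y z + X z)) ?y = ch.divc x (\<lambda>y. vcomp M x Y y + vcomp M x X y) ?y"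
    unfolding ch.divc_def ch.nabc_def using der_cong[OF open_cimg y vcomp_add[of _ x Y X]] vcomp_add[OF y, of Y X] by simp
  also have "\<dots> = ch.divc x (vcomp M x Y) ?y + ch.divc x (vcomp M x X) ?y"
    by (rule ch.divc_add[OF y has_derivative_vcomp[OF Y y] has_derivative_vcomp[OF X y]])
  finally show ?thesis
    using divergence_chart[of ?y x x _ X] divergence_chart[of ?y x x _ Y] divergence_chart[of ?y x x _ "\<lambda>z. Y z + X z"]
      smooth_vector_add[OF Y X] X Y by simp
qed

lemma smooth_scalar_state:
  assumes st: "fluid_st u \<rho> S" and T: "kinematic T"
  shows "smooth_on (cimg M p) (\<lambda>y. That T p (t, y, chart_state p u \<rho> S y))"
    "smooth_scalar M (\<lambda>z. T t z (u z) (\<rho> z) (S z))"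
proof -
  show 1: "smooth_on (cimg M p) (\<lambda>y. That T p (t, y, chart_state p u \<rho> S y))" for p
    using st unfolding fluid_state_def
    by (intro smooth_compose[OF open_cimg open_dom _ _ smooth_That[OF T]] smooth_Pair smooth_const smooth_id open_cimg
        smooth_vcomp smooth_comp) auto
  show "smooth_scalar M (\<lambda>z. T t z (u z) (\<rho> z) (S z))"
    unfolding smooth_scalar_def
    by (intro allI smooth_cong[OF open_cimg _ 1]) (simp add: That_def vcomp_def)
qed

lemma smooth_scalar_P:
  assumes "fluid_st u \<rho> S" and F: "smooth_on (I \<times> J) (\<lambda>(r, s). F r s)"
  shows "smooth_scalar M (\<lambda>z. F (\<rho> z) (S z))"
  unfolding smooth_scalar_def
proof
  fix p
  have "smooth_on (cimg M p) (\<lambda>y. (\<lambda>(r, s). F r s) ((\<rho> \<circ> cinv M p) y, (S \<circ> cinv M p) y))"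
    using assms(1) unfolding fluid_state_def
    by (intro smooth_compose[OF open_cimg open_Times[OF open_I open_J] _ _ F] smooth_Pair open_cimg smooth_comp) auto
  then show "smooth_on (cimg M p) ((\<lambda>z. F (\<rho> z) (S z)) \<circ> cinv M p)" by (simp add: o_def)
qed

lemma der_P_comp:
  assumes st: "fluid_st u \<rho> S" and F: "smooth_on (I \<times> J) (\<lambda>(r, s). F r s)" and y: "y \<in> cimg M p"
  shows "der ((\<lambda>z. F (\<rho> z) (S z)) \<circ> cinv M p) y a =
    der (\<lambda>(r, s). F r s) ((\<rho> \<circ> cinv M p) y, (S \<circ> cinv M p) y) (der (\<rho> \<circ> cinv M p) y a, der (S \<circ> cinv M p) y a)"
proof -
  have s: "smooth_scalar M \<rho>" "smooth_scalar M S" "((\<rho> \<circ> cinv M p) y, (S \<circ> cinv M p) y) \<in> I \<times> J"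
    using st unfolding fluid_state_def by auto
  have "((\<lambda>y. (\<lambda>(r, s). F r s) ((\<rho> \<circ> cinv M p) y, (S \<circ> cinv M p) y)) has_derivative
     (\<lambda>a. der (\<lambda>(r, s). F r s) ((\<rho> \<circ> cinv M p) y, (S \<circ> cinv M p) y) (der (\<rho> \<circ> cinv M p) y a, der (S \<circ> cinv M p) y a))) (at y)"
    by (rule has_derivative_compose[OF has_derivative_Pair[OF has_derivative_comp[OF s(1) y] has_derivative_comp[OF s(2) y]]
       smooth_has_derivative[OF F open_Times[OF open_I open_J] s(3)]])
  from der_eq[OF this] show ?thesis by (simp add: o_def)
qed

text \<open>The advective parts of \<open>u'\<close>, \<open>\<rho>'\<close> and \<open>S'\<close>
  are opposite to the derivatives along \<open>u\<close> that the divergence of \<open>T u\<close>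
  contains. What is left after cancellation is \<open>energy_form\<close>, in any chart around the
  point.\<close>

lemma conservation_chart:
  assumes sol: "formal_solution M I J P u \<rho> S u' \<rho>' S'" and T: "kinematic T"
    and y: "y \<in> cimg M p" and x: "x = cinv M p y"
  shows "deriv (\<lambda>h. T (t + h) x (u x + h *\<^sub>R u' x) (\<rho> x + h * \<rho>' x) (S x + h * S' x)) 0 +
      divergence M (\<lambda>z. T t z (u z) (\<rho> z) (S z) *\<^sub>R u z) x =
    ch.energy_form p (That T p) P t y (vcomp M p u y) (\<rho> x) (S x)
      (der (vcomp M p u) y) (der (\<rho> \<circ> cinv M p) y) (der (S \<circ> cinv M p) y)"
proof -
  have st: "fluid_st u \<rho> S" using sol unfolding formal_solution_def by auto
  then have sm: "smooth_vector M u" "smooth_scalar M \<rho>" "smooth_scalar M S" "\<rho> x \<in> I" "S x \<in> J"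
    unfolding fluid_state_def by auto
  define v where "v = vcomp M p u y"
  define J1 where "J1 = transition M p x x"
  define K where "K = transition M x p x"
  let ?z = "(t, y, v, \<rho> x, S x)"
  let ?D = "der (That T p) ?z"
  have zin: "?z \<in> UNIV \<times> cimg M p \<times> UNIV \<times> I \<times> J" using y sm by auto
  have hd: "(That T p has_derivative ?D) (at ?z)"
    by (rule smooth_has_derivative[OF smooth_That[OF T] open_dom zin])
  have lD: "linear ?D" using hd has_derivative_linear by blast
  have lK: "linear K" unfolding K_def by (rule transition_linear) (use x y in auto)
  have Jv: "J1 v = u x" unfolding v_def J1_def by (rule vcomp_J(2)[OF y x refl])
  have KJ: "K (J1 a) = a" "J1 (K a) = a" for a unfolding K_def J1_def by (rule J_inv[OF y x refl])+
  have lJ: "linear J1" unfolding J1_def by (rule linear_J[OF y x refl])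
  define gP where "gP = ch.sharp p y (\<lambda>a. der (\<lambda>(r, s). P r s) (\<rho> x, S x) (der (\<rho> \<circ> cinv M p) y a, der (S \<circ> cinv M p) y a))"
  have u': "K (u' x) = - der (vcomp M p u) y v - ch.christ p y v v - (1 / \<rho> x) *\<^sub>R gP"
  proof -
    have "u' x + nabla M x (u x) u = - (1 / \<rho> x) *\<^sub>R grad M (\<lambda>z. P (\<rho> z) (S z)) x"
      using sol unfolding formal_solution_def by blast
    also have "nabla M x (u x) u = J1 (ch.nabc p (vcomp M p u) y v)"
      using nabla_chart[OF y x J1_def sm(1), of v] Jv by simp
    also have "grad M (\<lambda>z. P (\<rho> z) (S z)) x = J1 gP"
      unfolding grad_chart[OF y x J1_def smooth_scalar_P[OF st P]] gP_def der_P_comp[OF st P y, abs_def] by (simp add: x)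
    finally have "u' x = - J1 (ch.nabc p (vcomp M p u) y v) - (1 / \<rho> x) *\<^sub>R J1 gP"
      by (simp add: algebra_simps eq_neg_iff_add_eq_0)
    then have "K (u' x) = - ch.nabc p (vcomp M p u) y v - (1 / \<rho> x) *\<^sub>R gP"
      by (simp add: linear_diff[OF lK] linear_neg[OF lK] linear_cmul[OF lK] KJ)
    then show ?thesis by (simp add: ch.nabc_def v_def)
  qed
  define d where "d = (\<Sum>i\<in>UNIV. (der (vcomp M p u) y (axis i 1) + ch.christ p y (axis i 1) v) $ i)"
  have dd: "divergence M u x = d"
    using divergence_chart[OF y x refl sm(1)] by (simp add: ch.divc_def ch.nabc_def d_def v_def)
  have \<rho>': "\<rho>' x = - \<rho> x * d - der (\<rho> \<circ> cinv M p) y v"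
  proof -
    have "\<rho>' x + divergence M (\<lambda>z. \<rho> z *\<^sub>R u z) x = 0" using sol unfolding formal_solution_def by blast
    then show ?thesis using divergence_scale[OF sm(2,1), of x] dd differential_chart[OF y x J1_def sm(2), of v] Jv by simp
  qed
  have S': "S' x = - der (S \<circ> cinv M p) y v"
  proof -
    have "S' x + differential M S x (u x) = 0" using sol unfolding formal_solution_def by blast
    then show ?thesis using differential_chart[OF y x J1_def sm(3), of v] Jv by simp
  qed
  have "deriv (\<lambda>h. T (t + h) x (u x + h *\<^sub>R u' x) (\<rho> x + h * \<rho>' x) (S x + h * S' x)) 0 = ?D (1, 0, K (u' x), \<rho>' x, S' x)"
  proof -
    have eq: "T (t + h) x (u x + h *\<^sub>R u' x) r s = That T p (t + h, y, v + h *\<^sub>R K (u' x), r, s)" for h r s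
      unfolding That_def using Jv KJ lJ by (simp add: x[symmetric] J1_def[symmetric] linear_add linear_cmul)
    have "((\<lambda>h. (t + h, y, v + h *\<^sub>R K (u' x), \<rho> x + h * \<rho>' x, S x + h * S' x)) has_derivative
        (\<lambda>h. (h, 0, h *\<^sub>R K (u' x), h * \<rho>' x, h * S' x))) (at 0)"
      by (auto intro!: derivative_eq_intros)
    from has_derivative_compose[OF this, of "That T p" ?D]
    have "((\<lambda>h. T (t + h) x (u x + h *\<^sub>R u' x) (\<rho> x + h * \<rho>' x) (S x + h * S' x)) has_derivative
       (\<lambda>h. ?D (h, 0, h *\<^sub>R K (u' x), h * \<rho>' x, h * S' x))) (at 0)"
      unfolding eq using hd by simp
    moreover have "?D (h, 0, h *\<^sub>R K (u' x), h * \<rho>' x, h * S' x) = ?D (1, 0, K (u' x), \<rho>' x, S' x) * h" for h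
      using linear_cmul[OF lD, of h "(1, 0, K (u' x), \<rho>' x, S' x)"] by simp
    ultimately show ?thesis
      by (intro DERIV_imp_deriv) (simp add: has_field_derivative_def)
  qed
  moreover have "divergence M (\<lambda>z. T t z (u z) (\<rho> z) (S z) *\<^sub>R u z) x = T t x (u x) (\<rho> x) (S x) * d +
     ?D (0, v, chart_deriv p u \<rho> S y v)"
  proof -
    have "((\<lambda>y. (t, y, chart_state p u \<rho> S y)) has_derivative
      (\<lambda>a. (0, a, chart_deriv p u \<rho> S y a))) (at y)"
      by (intro has_derivative_Pair has_derivative_const has_derivative_ident has_derivative_vcomp has_derivative_comp sm y)
    from has_derivative_compose[OF this, of "That T p" ?D]
    have "((\<lambda>y. That T p (t, y, chart_state p u \<rho> S y)) has_derivative
       (\<lambda>a. ?D (0, a, chart_deriv p u \<rho> S y a))) (at y)"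
      using hd by (simp add: v_def x)
    then have "((\<lambda>z. T t z (u z) (\<rho> z) (S z)) \<circ> cinv M p has_derivative
       (\<lambda>a. ?D (0, a, chart_deriv p u \<rho> S y a))) (at y)"
      by (rule has_derivative_transform_within_open[OF _ open_cimg y]) (simp add: That_def vcomp_def)
    from fun_cong[OF der_eq[OF this], of v] show ?thesis
      using divergence_scale[OF smooth_scalar_state(2)[OF st T] sm(1), of t x] dd
        differential_chart[OF y x J1_def smooth_scalar_state(2)[OF st T], of t v] Jv by simp
  qed
  moreover have "T t x (u x) (\<rho> x) (S x) = That T p ?z"
    unfolding That_def using Jv by (simp add: x[symmetric] J1_def[symmetric])
  \<comment> \<open>Here the advective derivatives cancel: the sum of the two directions contains
    derivatives of the state only through \<open>gP\<close> and \<open>d\<close>.\<close>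
  moreover have "?D (1, 0, K (u' x), \<rho>' x, S' x) + ?D (0, v, chart_deriv p u \<rho> S y v)
    = ?D (1, v, - ch.christ p y v v, 0, 0) - ?D (0, 0, gP, 0, 0) / \<rho> x - \<rho> x * d * ?D (0, 0, 0, 1, 0)"
  proof -
    have "?D (1, 0, K (u' x), \<rho>' x, S' x) + ?D (0, v, chart_deriv p u \<rho> S y v)
      = ?D (1, v, - ch.christ p y v v - (1 / \<rho> x) *\<^sub>R gP, - \<rho> x * d, 0)"
      unfolding linear_add[OF lD, symmetric] u' \<rho>' S' by simp
    also have "(1, v, - ch.christ p y v v - (1 / \<rho> x) *\<^sub>R gP, - \<rho> x * d, 0) =
       (1, v, - ch.christ p y v v, 0, 0) - (1 / \<rho> x) *\<^sub>R (0, 0, gP, 0, 0) - (\<rho> x * d) *\<^sub>R (0, 0, 0, 1, 0)" by simp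
    also have "?D \<dots> = ?D (1, v, - ch.christ p y v v, 0, 0) - (1 / \<rho> x) *\<^sub>R ?D (0, 0, gP, 0, 0) - (\<rho> x * d) *\<^sub>R ?D (0, 0, 0, 1, 0)"
      by (simp only: linear_diff[OF lD] linear_cmul[OF lD])
    finally show ?thesis unfolding real_scaleR_def by argo
  qed
  ultimately show ?thesis
    unfolding ch.energy_form_def v_def[symmetric] gP_def[symmetric] d_def[symmetric] by (simp add: algebra_simps)
qed

text \<open>The fluid equations are already solved for the time derivatives and therefore put no
  restriction on the state itself.\<close>

lemma formal_solution_exists:
  "fluid_st u \<rho> S \<Longrightarrow> \<exists>u' \<rho>' S'. formal_solution M I J P u \<rho> S u' \<rho>' S'"
  unfolding formal_solution_def
  by (intro exI[of _ "\<lambda>x. - nabla M x (u x) u + - (1 / \<rho> x) *\<^sub>R grad M (\<lambda>z. P (\<rho> z) (S z)) x"]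
      exI[of _ "\<lambda>x. - divergence M (\<lambda>z. \<rho> z *\<^sub>R u z) x"] exI[of _ "\<lambda>x. - differential M S x (u x)"]) auto

end


section \<open>Explicit fluxes: one family of conserved densities\<close>

lemma der_curve:
  assumes f: "smooth_on V f" "open V" "z \<in> V" and \<gamma>: "(\<gamma> has_derivative (\<lambda>h. h *\<^sub>R w)) (at 0)" "\<gamma> 0 = z"
    and D: "((\<lambda>h. f (\<gamma> h)) has_real_derivative D) (at 0)"
  shows "der f z w = D"
proof -
  have "((\<lambda>h. f (\<gamma> h)) has_derivative (\<lambda>h. der f z (h *\<^sub>R w))) (at 0)"
    using has_derivative_compose[OF \<gamma>(1), of f "der f z"] smooth_has_derivative[OF f] \<gamma>(2) by simp
  moreover have "(\<lambda>h. der f z (h *\<^sub>R w)) = (*) (der f z w)"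
    using linear_cmul[OF smooth_linear_der[OF f], of _ w] by (auto simp: fun_eq_iff)
  ultimately have "((\<lambda>h. f (\<gamma> h)) has_real_derivative der f z w) (at 0)"
    by (simp add: has_field_derivative_def)
  then show ?thesis using D DERIV_unique by blast
qed

lemma deriv_comb:
  fixes c1 g1 a1 g2 q1 :: "real \<Rightarrow> real"
  assumes "(c1 has_real_derivative dc) (at 0)" "(g1 has_real_derivative 0) (at 0)" "(a1 has_real_derivative da) (at 0)"
    "(g2 has_real_derivative dg) (at 0)" "(q1 has_real_derivative dq) (at 0)"
  shows "((\<lambda>h. c1 h * (1/2 * r * g1 h * f + b) + a1 h * f * r * g2 h + r * q1 h) has_real_derivative
    dc * (1/2 * r * g1 0 * f + b) + (da * f * r * g2 0 + a1 0 * f * r * dg) + r * dq) (at 0)"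
  using assms by (auto intro!: derivative_eq_intros simp: algebra_simps)

context coord_metric
begin

text \<open>The Lie derivative of the metric is twice the symmetric part of the covariant
  derivative, so its metric trace is twice the divergence, while the trace of \<open>c g\<close> is
  \<open>c n\<close>. The vectors \<open>s k\<close> form the dual basis in which the trace is
  taken.\<close>

lemma divc_lie:
  assumes y: "y \<in> U" and X: "linear (der X y)" and L: "\<And>v w. liec X y v w = c * G y v w"
  shows "divc X y = c * real CARD('n) / 2"
proof -
  define s where "s k = sharp y (\<lambda>a. a $ k)" for k
  have nl: "linear (\<lambda>a::real ^ 'n. a $ k)" for k by (rule bounded_linear.linear[OF bounded_linear_vec_nth])
  have s: "\<And>k z. G y (s k) z = z $ k" "\<And>z k. G y z (s k) = z $ k"
    unfolding s_def using G_sharp[OF y nl] sym[OF y] by auto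
  have ss: "s k $ j = s j $ k" for j k using s(1)[of j "s k"] s(2)[of "s j" k] by simp
  have ex: "\<alpha> v = (\<Sum>j\<in>UNIV. v $ j * \<alpha> (axis j 1))" if "linear \<alpha>" for \<alpha> :: "real ^ 'n \<Rightarrow> real" and v
    using linear_expand_axis[OF that, of v] by simp
  define A where "A = nabc X y"
  have lA: "linear A" unfolding A_def nabc_def
    using linear_compose_add[OF X christ_linear1[OF y]] by simp
  have l1: "linear (\<lambda>v. G y (A v) b)" "linear (\<lambda>v. G y b (A v))" for b
    using linear_compose[OF lA lin1[OF y]] linear_compose[OF lA lin2[OF y]] by (simp_all add: o_def)
  have lie: "liec X y v w = G y (A v) w + G y v (A w)" for v w
    unfolding liec_def A_def nabc_def
    by (simp add: G_simps[OF y] G_christ[OF y] sym[OF y, of v "christ y w (X y)"] dG_sym[OF y, of _ w] dG_sym[OF y, of _ _ "X y"] field_simps)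
  have "(\<Sum>i\<in>UNIV. G y (A (s i)) (axis i 1)) = (\<Sum>i\<in>UNIV. \<Sum>j\<in>UNIV. s i $ j * G y (A (axis j 1)) (axis i 1))"
    by (intro sum.cong refl ex[OF l1(1)])
  also have "\<dots> = (\<Sum>j\<in>UNIV. \<Sum>i\<in>UNIV. s j $ i * G y (A (axis j 1)) (axis i 1))"
    by (subst sum.swap) (simp add: ss)
  also have "\<dots> = (\<Sum>j\<in>UNIV. G y (A (axis j 1)) (s j))"
    by (intro sum.cong refl ex[OF lin2[OF y], symmetric])
  finally have sw: "(\<Sum>i\<in>UNIV. G y (A (s i)) (axis i 1)) = (\<Sum>j\<in>UNIV. G y (A (axis j 1)) (s j))" .
  have "(\<Sum>i\<in>UNIV. liec X y (axis i 1) (s i)) = 2 * divc X y"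
    unfolding lie sum.distrib sym[OF y, of _ "A (s i)" for i] sw by (simp add: s divc_def A_def)
  moreover have "(\<Sum>i\<in>UNIV. liec X y (axis i 1) (s i)) = c * real CARD('n)"
    unfolding L by (simp add: s)
  ultimately show ?thesis by simp
qed

text \<open>The left side is \<open>g(nabla_v X, v)\<close>, written as the derivative of
  \<open>g(X, v)\<close> along the geodesic with velocity \<open>v\<close>.\<close>

lemma lie_nabc:
  assumes y: "y \<in> U"
  shows "dG y v (X y) v + G y (der X y v) v - G y (X y) (christ y v v) = liec X y v v / 2"
  unfolding liec_def sym[OF y, of "X y"] G_christ[OF y]
  by (simp add: dG_sym[OF y, of v v] sym[OF y, of v "der X y v"] field_simps)

text \<open>The curve \<open>(y + h v, v - h christ y v v)\<close> agrees to first order with a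
  geodesic and its velocity. It realises the direction in the first term of
  \<open>energy_form\<close>.\<close>

lemma has_derivative_along:
  assumes y: "y \<in> U" and \<alpha>: "(\<alpha> has_vector_derivative \<alpha>') (at 0)"
  shows "((\<lambda>h. G (y + h *\<^sub>R v) (\<alpha> h) (v - h *\<^sub>R christ y v v)) has_real_derivative
     dG y v (\<alpha> 0) v + G y \<alpha>' v - G y (\<alpha> 0) (christ y v v)) (at 0)"
proof -
  let ?c = "christ y v v"
  let ?V = "{h. y + h *\<^sub>R v \<in> U}"
  have V: "open ?V"
    using continuous_open_vimage[OF U, of "\<lambda>h. y + h *\<^sub>R v"] by (simp add: vimage_def continuous_intros)
  have V0: "0 \<in> ?V" "\<And>h. h \<in> ?V \<Longrightarrow> y + h *\<^sub>R v \<in> U" using y by auto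
  have hy: "((\<lambda>h. y + h *\<^sub>R v) has_derivative (\<lambda>h. h *\<^sub>R v)) (at 0)"
    and hv: "((\<lambda>h. v - h *\<^sub>R ?c) has_derivative (\<lambda>h. - (h *\<^sub>R ?c))) (at 0)"
    by (auto intro!: derivative_eq_intros)
  have e: "(\<lambda>h. dG (y + 0 *\<^sub>R v) (h *\<^sub>R v) (\<alpha> 0) (v - 0 *\<^sub>R ?c) + G (y + 0 *\<^sub>R v) (h *\<^sub>R \<alpha>') (v - 0 *\<^sub>R ?c) +
       G (y + 0 *\<^sub>R v) (\<alpha> 0) (- (h *\<^sub>R ?c))) = (*) (dG y v (\<alpha> 0) v + G y \<alpha>' v - G y (\<alpha> 0) ?c)"
    by (simp add: fun_eq_iff dG_simps[OF y] G_simps[OF y] algebra_simps)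
  from has_derivative_G[OF V V0 hy \<alpha>[unfolded has_vector_derivative_def] hv] show ?thesis
    unfolding e by (simp only: has_field_derivative_def)
qed

text \<open>To first order the second and third argument are the velocity of a geodesic, whose
  length is constant.\<close>

lemma has_derivative_along_self:
  assumes y: "y \<in> U"
  shows "((\<lambda>h. G (y + h *\<^sub>R v) (v - h *\<^sub>R christ y v v) (v - h *\<^sub>R christ y v v)) has_real_derivative 0) (at 0)"
proof -
  have "((\<lambda>h. v - h *\<^sub>R christ y v v) has_vector_derivative - christ y v v) (at 0)"
    by (auto intro!: derivative_eq_intros)
  from has_derivative_along[OF y this, of v] show ?thesis
    using G_christ[OF y, of v v v] by (simp add: G_simps[OF y] sym[OF y, of v "christ y v v"])
qed

end

context fluid
begin

text \<open>Taken in the chart centred at \<open>x\<close>; by \<open>conservation_chart\<close>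
  every other chart around \<open>x\<close> gives the same value.\<close>

definition EE :: "('m, 'n) density \<Rightarrow> real \<Rightarrow> ('m \<Rightarrow> real ^ 'n) \<Rightarrow> ('m \<Rightarrow> real) \<Rightarrow> ('m \<Rightarrow> real) \<Rightarrow> 'm \<Rightarrow> real" where
  "EE T t u \<rho> S x = ch.energy_form x (That T x) P t (cmap M x x) (u x) (\<rho> x) (S x)
      (der (vcomp M x u) (cmap M x x)) (der (\<rho> \<circ> cinv M x) (cmap M x x)) (der (S \<circ> cinv M x) (cmap M x x))"

lemma vector_function_smooth:
  assumes \<Phi>: "vec_fun \<Phi>" and st: "fluid_st u \<rho> S"
  shows "smooth_vector M (\<Phi> t u \<rho> S)"
  unfolding smooth_vector_def
proof
  fix p
  have "smooth_on (cimg M p) (\<lambda>y. (\<lambda>(t, y). vcomp M p (\<Phi> t u \<rho> S) y) (t, y))"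
    by (rule smooth_compose[OF open_cimg open_Times[OF open_UNIV open_cimg]])
      (use \<Phi> st in \<open>auto simp: vector_function_def intro!: smooth_intros open_cimg\<close>)
  then show "smooth_on (cimg M p) (vcomp M p (\<Phi> t u \<rho> S))" by simp
qed

text \<open>Once the fluid equations have eliminated the time derivatives, quantifying over formal
  solutions amounts to quantifying over states. With the transport term \<open>Div (T u)\<close>
  moved to the left, conservation says that the energy form of each state is a divergence.\<close>

lemma conserved_iff:
  "conserved T \<longleftrightarrow> kinematic T \<and> (\<exists>\<Phi>. vec_fun \<Phi> \<and>
     (\<forall>t u \<rho> S x. fluid_st u \<rho> S \<longrightarrow> EE T t u \<rho> S x = - divergence M (\<Phi> t u \<rho> S) x))"
proof -
  let ?D = "\<lambda>\<Phi> t u \<rho> S u' \<rho>' S' x. deriv (\<lambda>h. T (t + h) x (u x + h *\<^sub>R u' x) (\<rho> x + h * \<rho>' x) (S x + h * S' x)) 0 =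
    - divergence M (\<lambda>z. T t z (u z) (\<rho> z) (S z) *\<^sub>R u z + \<Phi> t u \<rho> S z) x"
  let ?E = "\<lambda>\<Phi> t u \<rho> S x. EE T t u \<rho> S x = - divergence M (\<Phi> t u \<rho> S) x"
  have *: "?D \<Phi> t u \<rho> S u' \<rho>' S' x \<longleftrightarrow> ?E \<Phi> t u \<rho> S x"
    if T: "kinematic T" and \<Phi>: "vec_fun \<Phi>" and sol: "formal_solution M I J P u \<rho> S u' \<rho>' S'"
    for \<Phi> t u \<rho> S u' \<rho>' S' x
  proof -
    have st: "fluid_st u \<rho> S" using sol unfolding formal_solution_def by blast
    then have su: "smooth_vector M u" unfolding fluid_state_def by blast
    show ?thesis
      using conservation_chart[OF sol T, of "cmap M x x" x x t]
        divergence_add[OF smooth_vector_scale[OF smooth_scalar_state(2)[OF st T] su] vector_function_smooth[OF \<Phi> st], of t t x]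
      unfolding EE_def by auto
  qed
  show ?thesis (is "_ \<longleftrightarrow> ?R")
  proof
    assume "conserved T"
    then obtain \<Phi> where T: "kinematic T" and \<Phi>: "vec_fun \<Phi>" and
      c: "\<And>t u \<rho> S u' \<rho>' S' x. formal_solution M I J P u \<rho> S u' \<rho>' S' \<Longrightarrow> ?D \<Phi> t u \<rho> S u' \<rho>' S' x"
      unfolding conserved_density_def by blast
    have "?E \<Phi> t u \<rho> S x" if "fluid_st u \<rho> S" for t u \<rho> S x
      using formal_solution_exists[OF that] *[OF T \<Phi>] c by blast
    with T \<Phi> show ?R by blast
  next
    assume ?R
    then obtain \<Phi> where T: "kinematic T" and \<Phi>: "vec_fun \<Phi>" and c: "\<And>t u \<rho> S x. fluid_st u \<rho> S \<Longrightarrow> ?E \<Phi> t u \<rho> S x" by blast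
    have "?D \<Phi> t u \<rho> S u' \<rho>' S' x" if sol: "formal_solution M I J P u \<rho> S u' \<rho>' S'" for t u \<rho> S u' \<rho>' S' x
      using *[OF T \<Phi> sol] c sol unfolding formal_solution_def by blast
    with T \<Phi> show "conserved T" unfolding conserved_density_def by blast
  qed
qed

lemma That_in_dom: "fluid_st u \<rho> S \<Longrightarrow> (t, cmap M x x, u x, \<rho> x, S x) \<in> UNIV \<times> cimg M x \<times> UNIV \<times> I \<times> J"
  by (auto simp: fluid_state_def)

lemma vector_function_lincomb:
  assumes "vec_fun \<Phi>1" "vec_fun \<Phi>2"
  shows "vec_fun (\<lambda>t u \<rho> S x. c *\<^sub>R \<Phi>1 t u \<rho> S x + \<Phi>2 t u \<rho> S x)"
proof -
  obtain k1 where k1: "\<forall>t u \<rho> S v \<tau> R x.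
        fluid_st u \<rho> S \<and> fluid_st v \<tau> R \<and> same_jet M k1 x u \<rho> S v \<tau> R \<longrightarrow> \<Phi>1 t u \<rho> S x = \<Phi>1 t v \<tau> R x"
    using assms(1) unfolding vector_function_def by (elim conjE exE)
  obtain k2 where k2: "\<forall>t u \<rho> S v \<tau> R x.
        fluid_st u \<rho> S \<and> fluid_st v \<tau> R \<and> same_jet M k2 x u \<rho> S v \<tau> R \<longrightarrow> \<Phi>2 t u \<rho> S x = \<Phi>2 t v \<tau> R x"
    using assms(2) unfolding vector_function_def by (elim conjE exE)
  have mono: "same_jet M (max k1 k2) x u \<rho> S v \<tau> R \<Longrightarrow> same_jet M k1 x u \<rho> S v \<tau> R \<and> same_jet M k2 x u \<rho> S v \<tau> R" for x u \<rho> S v \<tau> R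
    unfolding same_jet_def by (auto simp: le_max_iff_disj)
  have "smooth_on (UNIV \<times> cimg M p) (\<lambda>(t, y). vcomp M p (\<lambda>x. c *\<^sub>R \<Phi>1 t u \<rho> S x + \<Phi>2 t u \<rho> S x) y)"
    if st: "fluid_st u \<rho> S" for u \<rho> S p
  proof (rule smooth_cong[OF open_Times[OF open_UNIV open_cimg]])
    fix z :: "real \<times> (real ^ 'n)" assume z: "z \<in> UNIV \<times> cimg M p"
    define x where "x = cinv M p (snd z)"
    have l: "linear (transition M x p x)" by (rule transition_linear) (use z in \<open>auto simp: x_def\<close>)
    show "c *\<^sub>R (\<lambda>(t, y). vcomp M p (\<Phi>1 t u \<rho> S) y) z + (\<lambda>(t, y). vcomp M p (\<Phi>2 t u \<rho> S) y) z
      = (\<lambda>(t, y). vcomp M p (\<lambda>x. c *\<^sub>R \<Phi>1 t u \<rho> S x + \<Phi>2 t u \<rho> S x) y) z"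
      unfolding vcomp_def case_prod_beta x_def[symmetric] by (simp add: linear_add[OF l] linear_cmul[OF l])
  next
    show "smooth_on (UNIV \<times> cimg M p) (\<lambda>z. c *\<^sub>R (\<lambda>(t, y). vcomp M p (\<Phi>1 t u \<rho> S) y) z + (\<lambda>(t, y). vcomp M p (\<Phi>2 t u \<rho> S) y) z)"
    proof (intro smooth_add smooth_scaleR smooth_const open_Times open_UNIV open_cimg)
      show "smooth_on (UNIV \<times> cimg M p) (\<lambda>(t, y). vcomp M p (\<Phi>1 t u \<rho> S) y)"
        using assms(1) st unfolding vector_function_def by (elim conjE) simp
      show "smooth_on (UNIV \<times> cimg M p) (\<lambda>(t, y). vcomp M p (\<Phi>2 t u \<rho> S) y)"
        using assms(2) st unfolding vector_function_def by (elim conjE) simp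
    qed
  qed
  moreover have "\<forall>t u \<rho> S v \<tau> R x. fluid_st u \<rho> S \<and> fluid_st v \<tau> R \<and> same_jet M (max k1 k2) x u \<rho> S v \<tau> R \<longrightarrow>
        c *\<^sub>R \<Phi>1 t u \<rho> S x + \<Phi>2 t u \<rho> S x = c *\<^sub>R \<Phi>1 t v \<tau> R x + \<Phi>2 t v \<tau> R x"
    using k1 k2 mono by metis
  ultimately show ?thesis unfolding vector_function_def by blast
qed

lemma conserved_lincomb:
  assumes "conserved T1" "conserved T2"
  shows "conserved (\<lambda>t x v r s. c * T1 t x v r s + T2 t x v r s)" (is "conserved ?T")
proof -
  obtain \<Phi>1 where 1: "kinematic T1" "vec_fun \<Phi>1"
     "\<And>t u \<rho> S x. fluid_st u \<rho> S \<Longrightarrow> EE T1 t u \<rho> S x = - divergence M (\<Phi>1 t u \<rho> S) x"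
    using assms(1) unfolding conserved_iff by blast
  obtain \<Phi>2 where 2: "kinematic T2" "vec_fun \<Phi>2"
     "\<And>t u \<rho> S x. fluid_st u \<rho> S \<Longrightarrow> EE T2 t u \<rho> S x = - divergence M (\<Phi>2 t u \<rho> S) x"
    using assms(2) unfolding conserved_iff by blast
  have That: "That ?T p = (\<lambda>z. c * That T1 p z + That T2 p z)" for p by (auto simp: That_def)
  have kin: "kinematic ?T"
    unfolding kinematic_density_def
  proof
    fix p
    have "smooth_on (UNIV \<times> cimg M p \<times> UNIV \<times> I \<times> J) (That ?T p)"
      unfolding That by (intro smooth_add smooth_mult smooth_const open_dom smooth_That 1 2)
    then show "smooth_on (UNIV \<times> cimg M p \<times> UNIV \<times> I \<times> J)
        (\<lambda>(t, y, v, r, s). ?T t (cinv M p y) (transition M p (cinv M p y) (cinv M p y) v) r s)"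
      unfolding That_def .
  qed
  have "EE ?T t u \<rho> S x = - divergence M (\<lambda>x. c *\<^sub>R \<Phi>1 t u \<rho> S x + \<Phi>2 t u \<rho> S x) x" if st: "fluid_st u \<rho> S" for t u \<rho> S x
  proof -
    let ?z = "(t, cmap M x x, u x, \<rho> x, S x)"
    have "(That ?T x has_derivative (\<lambda>h. c * der (That T1 x) ?z h + der (That T2 x) ?z h)) (at ?z)"
      unfolding That
      by (intro has_derivative_add has_derivative_mult_right smooth_has_derivative[OF smooth_That open_dom That_in_dom] 1 2 st)
    from der_eq[OF this, unfolded That] have "EE ?T t u \<rho> S x = c * EE T1 t u \<rho> S x + EE T2 t u \<rho> S x"
      unfolding EE_def ch.energy_form_def That by (simp add: add_divide_distrib algebra_simps)
    moreover have "divergence M (\<lambda>x. c *\<^sub>R \<Phi>1 t u \<rho> S x + \<Phi>2 t u \<rho> S x) x = c * divergence M (\<Phi>1 t u \<rho> S) x + divergence M (\<Phi>2 t u \<rho> S) x"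
    proof -
      have s: "smooth_scalar M (\<lambda>z. c)" unfolding smooth_scalar_def by (simp add: o_def smooth_const open_cimg)
      have "differential M (\<lambda>z. c) x w = 0" for w unfolding differential_def by (simp add: o_def)
      then show ?thesis
        using divergence_add[OF smooth_vector_scale[OF s vector_function_smooth[OF 1(2) st]] vector_function_smooth[OF 2(2) st]]
          divergence_scale[OF s vector_function_smooth[OF 1(2) st]] by simp
    qed
    ultimately show ?thesis using 1(3)[OF st] 2(3)[OF st] by simp
  qed
  then show ?thesis unfolding conserved_iff using kin vector_function_lincomb[OF 1(2) 2(2)] by blast
qed

lemma conserved_cong:
  assumes eq: "\<And>t x v r s. r \<in> I \<Longrightarrow> s \<in> J \<Longrightarrow> T t x v r s = T' t x v r s" and T: "conserved T"
  shows "conserved T'"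
proof -
  obtain \<Phi> where 1: "kinematic T" "vec_fun \<Phi>"
     "\<And>t u \<rho> S x. fluid_st u \<rho> S \<Longrightarrow> EE T t u \<rho> S x = - divergence M (\<Phi> t u \<rho> S) x"
    using T unfolding conserved_iff by blast
  have kin: "kinematic T'"
    unfolding kinematic_density_def
    by (rule allI, rule smooth_cong[OF open_dom _ smooth_That[OF 1(1)]]) (auto simp: That_def eq)
  have "EE T' t u \<rho> S x = EE T t u \<rho> S x" if st: "fluid_st u \<rho> S" for t u \<rho> S x
  proof -
    have "der (That T' x) (t, cmap M x x, u x, \<rho> x, S x) = der (That T x) (t, cmap M x x, u x, \<rho> x, S x)"
      by (rule der_cong[OF open_dom That_in_dom[OF st]]) (auto simp: That_def eq)
    moreover have "\<rho> x \<in> I" "S x \<in> J" using st by (auto simp: fluid_state_def)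
    ultimately show ?thesis unfolding EE_def ch.energy_form_def by (simp add: That_center eq)
  qed
  with 1 kin show ?thesis unfolding conserved_iff by metis
qed

text \<open>Every density of the classification is an instance. The factor with \<open>c0\<close>
  multiplies the energy, \<open>\<alpha> + \<beta> t\<close> the momentum along \<open>X\<close>,
  and \<open>q\<close> is the part proportional to the mass. \<open>dF\<close> makes
  \<open>F\<close> a potential of the pressure force weighted by \<open>f\<close>; \<open>db\<close>
  makes \<open>b\<close> the matching internal energy; \<open>\<Lambda>b\<close> ties
  \<open>b\<close> to \<open>F\<close> by the dimension wherever \<open>\<Lambda>\<close> does not
  vanish; \<open>dq\<close> balances the growth of the momentum factor by a gradient.\<close>

lemma conserved_family:
  fixes \<alpha> \<beta> c0 :: real and f :: "real \<Rightarrow> real" and b F :: "real \<Rightarrow> real \<Rightarrow> real" and q :: "'m \<Rightarrow> real \<Rightarrow> real"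
  assumes X: "homothetic M X \<Lambda>" and f: "smooth_on J f" and b: "smooth_on (I \<times> J) (\<lambda>(r, s). b r s)"
    and F: "smooth_on (I \<times> J) (\<lambda>(r, s). F r s)" and q: "\<And>p. smooth_on (cimg M p \<times> J) (\<lambda>(y, s). q (cinv M p y) s)"
    and dF: "\<And>r s h k. r \<in> I \<Longrightarrow> s \<in> J \<Longrightarrow> der (\<lambda>(r, s). F r s) (r, s) (h, k) = f s * der (\<lambda>(r, s). P r s) (r, s) (h, k)"
    and db: "\<And>r s. r \<in> I \<Longrightarrow> s \<in> J \<Longrightarrow> ((\<lambda>r. b r s) has_real_derivative (b r s + F r s) / r) (at r)"
    and \<Lambda>b: "\<And>x r s. r \<in> I \<Longrightarrow> s \<in> J \<Longrightarrow> \<Lambda> x * b r s = \<Lambda> x * F r s * real CARD('n) / 2"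
    and dq: "\<And>x v s. s \<in> J \<Longrightarrow> \<beta> * f s * metric M x (X x) v + differential M (\<lambda>x. q x s) x v = 0"
  shows "conserved (\<lambda>t x v r s. (c0 - \<Lambda> x * (\<alpha> * t + \<beta> * t\<^sup>2 / 2)) * (1/2 * r * metric M x v v * f s + b r s)
     + (\<alpha> + \<beta> * t) * f s * r * metric M x (X x) v + r * q x s)" (is "conserved ?T")
proof -
  have sX: "smooth_vector M X" and s\<Lambda>: "smooth_scalar M \<Lambda>" and lX: "\<And>x v w. lie_metric M X x v w = \<Lambda> x * metric M x v w"
    and d\<Lambda>: "differential M \<Lambda> x v = 0" for x v
    using X grad_metric[of \<Lambda> x v] linear_0[OF linear_metric(2)] unfolding homothetic_def by auto
  \<comment> \<open>Its time derivative \<open>- \<Lambda> a\<close> cancels the kinetic term that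
    the Lie derivative of the metric along \<open>X\<close> produces.\<close>
  define C where "C t x = c0 - \<Lambda> x * (\<alpha> * t + \<beta> * t\<^sup>2 / 2)" for t x
  define a where "a t = \<alpha> + \<beta> * t" for t
  have oIJ: "open (I \<times> J)" by (rule open_Times[OF open_I open_J])
  have That: "That ?T p (t, y, v, r, s) = C t (cinv M p y) * (1/2 * r * gp p y v v * f s + b r s)
       + a t * f s * r * gp p y (vcomp M p X y) v + r * q (cinv M p y) s" if "y \<in> cimg M p" for p t y v r s
    unfolding That_def C_def a_def gp_metric
    using vcomp_J(2)[OF that refl refl, of X] by (simp add: gp_metric)
  have kin: "kinematic ?T"
    unfolding kinematic_density_def
  proof
    fix p
    let ?V = "UNIV \<times> cimg M p \<times> UNIV \<times> I \<times> J :: (real \<times> (real ^ 'n) \<times> (real ^ 'n) \<times> real \<times> real) set"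
    have pr: "smooth_on ?V (\<lambda>z. fst z)" "smooth_on ?V (\<lambda>z. fst (snd z))" "smooth_on ?V (\<lambda>z. fst (snd (snd z)))"
        "smooth_on ?V (\<lambda>z. fst (snd (snd (snd z))))" "smooth_on ?V (\<lambda>z. snd (snd (snd (snd z))))"
      by (intro smooth_intros open_dom)+
    have s1: "smooth_on ?V (\<lambda>z. (\<Lambda> \<circ> cinv M p) (fst (snd z)))"
      by (rule smooth_compose[OF open_dom open_cimg _ pr(2) smooth_comp[OF s\<Lambda>]]) auto
    have s2: "smooth_on ?V (\<lambda>z. gp p (fst (snd z)) (fst (snd (snd z))) (fst (snd (snd z))))"
      by (rule ch.smooth_G[OF open_dom _ pr(2) pr(3) pr(3)]) auto
    have s3: "smooth_on ?V (\<lambda>z. vcomp M p X (fst (snd z)))"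
      by (rule smooth_compose[OF open_dom open_cimg _ pr(2) smooth_vcomp[OF sX]]) auto
    have s4: "smooth_on ?V (\<lambda>z. gp p (fst (snd z)) (vcomp M p X (fst (snd z))) (fst (snd (snd z))))"
      by (rule ch.smooth_G[OF open_dom _ pr(2) s3 pr(3)]) auto
    have s5: "smooth_on ?V (\<lambda>z. f (snd (snd (snd (snd z)))))"
      by (rule smooth_compose[OF open_dom open_J _ pr(5) f]) auto
    have s6: "smooth_on ?V (\<lambda>z. (\<lambda>(r, s). b r s) (fst (snd (snd (snd z))), snd (snd (snd (snd z)))))"
      by (rule smooth_compose[OF open_dom oIJ _ smooth_Pair[OF open_dom pr(4,5)] b]) auto
    have s7: "smooth_on ?V (\<lambda>z. (\<lambda>(y, s). q (cinv M p y) s) (fst (snd z), snd (snd (snd (snd z)))))"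
      by (rule smooth_compose[OF open_dom open_Times[OF open_cimg open_J] _ smooth_Pair[OF open_dom pr(2,5)] q]) auto
    have "smooth_on ?V (\<lambda>z. (c0 - (\<Lambda> \<circ> cinv M p) (fst (snd z)) * (\<alpha> * fst z + \<beta> * (fst z)\<^sup>2 / 2)) *
        (1/2 * fst (snd (snd (snd z))) * gp p (fst (snd z)) (fst (snd (snd z))) (fst (snd (snd z))) * f (snd (snd (snd (snd z)))) +
        (\<lambda>(r, s). b r s) (fst (snd (snd (snd z))), snd (snd (snd (snd z)))))
       + (\<alpha> + \<beta> * fst z) * f (snd (snd (snd (snd z)))) * fst (snd (snd (snd z))) * gp p (fst (snd z)) (vcomp M p X (fst (snd z))) (fst (snd (snd z)))
        + fst (snd (snd (snd z))) * (\<lambda>(y, s). q (cinv M p y) s) (fst (snd z), snd (snd (snd (snd z)))))"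
      by (intro smooth_add smooth_mult smooth_diff smooth_divide smooth_power smooth_const s1 s2 s4 s5 s6 s7 pr open_dom) auto
    then show "smooth_on ?V (\<lambda>(t, y, v, r, s). ?T t (cinv M p y) (transition M p (cinv M p y) (cinv M p y) v) r s)"
      by (rule smooth_cong[OF open_dom, rotated]) (use That in \<open>auto simp: That_def C_def a_def\<close>)
  qed
  \<comment> \<open>The pressure potential is carried along \<open>X\<close> with the weight of the
    momentum and along the velocity with the weight of the energy.\<close>
  define \<Phi> where "\<Phi> t u \<rho> S x = (a t * F (\<rho> x) (S x)) *\<^sub>R X x + (C t x * F (\<rho> x) (S x)) *\<^sub>R u x" for t u \<rho> S x
  have vf: "vec_fun \<Phi>"
    unfolding vector_function_def
  proof (intro conjI exI[of _ 0] allI impI)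
    fix t u \<rho> S v \<tau> R x
    assume "fluid_st u \<rho> S \<and> fluid_st v \<tau> R \<and> same_jet M 0 x u \<rho> S v \<tau> R"
    then have "same_jet M 0 x u \<rho> S v \<tau> R" by blast
    then have "u x = v x" "\<rho> x = \<tau> x" "S x = R x" unfolding same_jet_def by auto
    then show "\<Phi> t u \<rho> S x = \<Phi> t v \<tau> R x" by (simp add: \<Phi>_def)
  next
    fix u \<rho> S p
    assume st: "fluid_st u \<rho> S"
    let ?V = "UNIV \<times> cimg M p :: (real \<times> (real ^ 'n)) set"
    have oV: "open ?V" by (rule open_Times[OF open_UNIV open_cimg])
    have pr: "smooth_on ?V (\<lambda>z. fst z)" "smooth_on ?V (\<lambda>z. snd z)" by (intro smooth_intros oV)+
    have su: "smooth_vector M u" using st unfolding fluid_state_def by blast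
    have s: "smooth_on ?V (\<lambda>z. H (snd z))" if "smooth_on (cimg M p) H" for H :: "real ^ 'n \<Rightarrow> 'z::real_normed_vector"
      by (rule smooth_compose[OF oV open_cimg _ pr(2) that]) auto
    have "smooth_on ?V (\<lambda>z. (a (fst z) * ((\<lambda>x. F (\<rho> x) (S x)) \<circ> cinv M p) (snd z)) *\<^sub>R vcomp M p X (snd z) +
        (C (fst z) (cinv M p (snd z)) * ((\<lambda>x. F (\<rho> x) (S x)) \<circ> cinv M p) (snd z)) *\<^sub>R vcomp M p u (snd z))"
      unfolding a_def C_def
      by (intro smooth_add smooth_mult smooth_scaleR smooth_diff smooth_divide smooth_power smooth_const oV pr
          s smooth_vcomp sX su smooth_comp[OF s\<Lambda>, unfolded o_def] smooth_comp[OF smooth_scalar_P[OF st F]]) auto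
    then show "smooth_on ?V (\<lambda>(t, y). vcomp M p (\<Phi> t u \<rho> S) y)"
    proof (rule smooth_cong[OF oV, rotated])
      fix z :: "real \<times> (real ^ 'n)" assume z: "z \<in> ?V"
      define x where "x = cinv M p (snd z)"
      have l: "linear (transition M x p x)" by (rule transition_linear) (use z in \<open>auto simp: x_def\<close>)
      show "(a (fst z) * ((\<lambda>x. F (\<rho> x) (S x)) \<circ> cinv M p) (snd z)) *\<^sub>R vcomp M p X (snd z) +
        (C (fst z) (cinv M p (snd z)) * ((\<lambda>x. F (\<rho> x) (S x)) \<circ> cinv M p) (snd z)) *\<^sub>R vcomp M p u (snd z) =
        (\<lambda>(t, y). vcomp M p (\<Phi> t u \<rho> S) y) z"
        unfolding vcomp_def case_prod_beta o_def x_def[symmetric] \<Phi>_def by (simp add: linear_add[OF l] linear_cmul[OF l])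
    qed
  qed
  have "EE ?T t u \<rho> S x = - divergence M (\<Phi> t u \<rho> S) x" if st: "fluid_st u \<rho> S" for t u \<rho> S x
  proof -
    have sm: "smooth_vector M u" "smooth_scalar M \<rho>" "smooth_scalar M S" and rI: "\<rho> x \<in> I" and sJ: "S x \<in> J"
      using st unfolding fluid_state_def by auto
    have r0: "\<rho> x > 0" using pos_I rI by blast
    let ?y = "cmap M x x"
    have y: "?y \<in> cimg M x" by simp
    define v where "v = u x"
    define r where "r = \<rho> x"
    define s where "s = S x"
    note rI = rI[folded r_def] and sJ = sJ[folded s_def] and r0 = r0[folded r_def]
    define g where "g = metric M x"
    have gsym: "g v w = g w v" for v w unfolding g_def by (rule metric_sym)
    have lg: "linear (g v)" "linear (\<lambda>v. g v w)" for v w unfolding g_def using linear_metric by auto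
    note gl = linear_add[OF lg(1)] linear_add[OF lg(2)] linear_cmul[OF lg(1)] linear_cmul[OF lg(2)] linear_neg[OF lg(1)] linear_neg[OF lg(2)]
    let ?z = "(t, ?y, v, r, s)"
    have zin: "?z \<in> UNIV \<times> cimg M x \<times> UNIV \<times> I \<times> J" using That_in_dom[OF st] by (simp add: v_def r_def s_def)
    note dc = der_curve[OF smooth_That[OF kin] open_dom zin]
    have Tz: "That ?T x ?z = C t x * (1/2 * r * g v v * f s + b r s) + a t * f s * r * g (X x) v + r * q x s"
      unfolding That[OF y] g_def by simp
    have Dv: "der (That ?T x) ?z (0, 0, w, 0, 0) = r * f s * (C t x * g v w + a t * g (X x) w)" for w
    proof (rule dc[of "\<lambda>h. (t, ?y, v + h *\<^sub>R w, r, s)"])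
      show "((\<lambda>h. (t, ?y, v + h *\<^sub>R w, r, s)) has_derivative (\<lambda>h. h *\<^sub>R (0, 0, w, 0, 0))) (at 0)"
        by (auto intro!: derivative_eq_intros simp: zero_prod_def)
      have "That ?T x (t, ?y, v + h *\<^sub>R w, r, s) = C t x * (1/2 * r * (g v v + 2 * h * g v w + h\<^sup>2 * g w w) * f s + b r s)
         + a t * f s * r * (g (X x) v + h * g (X x) w) + r * q x s" for h
        unfolding That[OF y] by (simp add: g_def[symmetric] gl gsym[of w v] power2_eq_square algebra_simps)
      then show "((\<lambda>h. That ?T x (t, ?y, v + h *\<^sub>R w, r, s)) has_real_derivative r * f s * (C t x * g v w + a t * g (X x) w)) (at 0)"
        by (auto intro!: derivative_eq_intros simp: algebra_simps)
    qed simp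
    have Dr: "der (That ?T x) ?z (0, 0, 0, 1, 0) = (That ?T x ?z + C t x * F r s) / r"
    proof (rule dc[of "\<lambda>h. (t, ?y, v, r + h, s)"])
      show "((\<lambda>h. (t, ?y, v, r + h, s)) has_derivative (\<lambda>h. h *\<^sub>R (0, 0, 0, 1, 0))) (at 0)"
        by (auto intro!: derivative_eq_intros simp: zero_prod_def)
      have "((\<lambda>h. b (r + h) s) has_real_derivative (b r s + F r s) / r) (at 0)"
        using db[OF rI sJ] DERIV_shift[of "\<lambda>r. b r s" "(b r s + F r s) / r" 0 r] by (simp add: add.commute)
      then show "((\<lambda>h. That ?T x (t, ?y, v, r + h, s)) has_real_derivative (That ?T x ?z + C t x * F r s) / r) (at 0)"
        unfolding That[OF y] using r0
        by (auto intro!: derivative_eq_intros simp: field_simps)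
    qed simp
    \<comment> \<open>Along the flow the kinetic terms cancel, and so do the \<open>\<beta>\<close>
      term and the derivative of \<open>q\<close>. What remains is \<open>- \<Lambda> a b\<close>,
      rewritten by \<open>\<Lambda>b\<close> so that it matches the divergence of
      \<open>X\<close>.\<close>
    have Dt: "der (That ?T x) ?z (1, v, - ch.christ x ?y v v, 0, 0) = - \<Lambda> x * a t * F r s * real CARD('n) / 2"
    proof (rule dc[of "\<lambda>h. (t + h, ?y + h *\<^sub>R v, v - h *\<^sub>R ch.christ x ?y v v, r, s)"])
      let ?c = "ch.christ x ?y v v"
      show "((\<lambda>h. (t + h, ?y + h *\<^sub>R v, v - h *\<^sub>R ?c, r, s)) has_derivative (\<lambda>h. h *\<^sub>R (1, v, - ?c, 0, 0))) (at 0)"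
        by (auto intro!: derivative_eq_intros simp: zero_prod_def)
      have y0: "?y + 0 *\<^sub>R v \<in> cimg M x" by simp
      have 1: "((\<lambda>h. \<Lambda> (cinv M x (?y + h *\<^sub>R v))) has_real_derivative 0) (at 0)"
        using has_vector_derivative_line[OF smooth_comp[OF s\<Lambda>] open_cimg y0, of UNIV] d\<Lambda>[of x v]
        by (simp add: differential_def has_real_derivative_iff_has_vector_derivative)
      have 2: "((\<lambda>h. q (cinv M x (?y + h *\<^sub>R v)) s) has_real_derivative - \<beta> * f s * g (X x) v) (at 0)"
      proof -
        have "smooth_on (cimg M x) (\<lambda>y. (\<lambda>(y, s). q (cinv M x y) s) (y, s))"
          by (rule smooth_compose[OF open_cimg open_Times[OF open_cimg open_J] _ _ q])
            (use sJ in \<open>auto intro!: smooth_intros open_cimg\<close>)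
        then have "smooth_on (cimg M x) ((\<lambda>x. q x s) \<circ> cinv M x)" by (simp add: o_def)
        from has_vector_derivative_line[OF this open_cimg y0, of UNIV] dq[OF sJ, of x v]
        show ?thesis by (simp add: differential_def g_def add_eq_0_iff has_real_derivative_iff_has_vector_derivative)
      qed
      note 3 = ch.has_derivative_along_self[OF y, of v]
      have L: "ch.dG x ?y v (X x) v + g (der (vcomp M x X) ?y v) v - g (X x) ?c = \<Lambda> x * g v v / 2"
        using ch.lie_nabc[OF y, of v "vcomp M x X"] lX[of x v v] unfolding lie_center by (simp add: g_def)
      have 4: "((\<lambda>h. gp x (?y + h *\<^sub>R v) (vcomp M x X (?y + h *\<^sub>R v)) (v - h *\<^sub>R ?c)) has_real_derivative \<Lambda> x * g v v / 2) (at 0)"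
        by (rule DERIV_cong[OF ch.has_derivative_along[OF y has_vector_derivative_line[OF smooth_vcomp[OF sX] open_cimg y0, simplified]]])
          (use L in \<open>simp add: g_def\<close>)
      have c5: "((\<lambda>h. C (t + h) (cinv M x (?y + h *\<^sub>R v))) has_real_derivative - \<Lambda> x * a t) (at 0)"
        unfolding C_def a_def by (rule derivative_eq_intros refl 1 | simp)+
      have a5: "((\<lambda>h. a (t + h)) has_real_derivative \<beta>) (at 0)"
        unfolding a_def by (auto intro!: derivative_eq_intros)
      have "((\<lambda>h. C (t + h) (cinv M x (?y + h *\<^sub>R v)) * (1/2 * r * gp x (?y + h *\<^sub>R v) (v - h *\<^sub>R ?c) (v - h *\<^sub>R ?c) * f s + b r s)
       + a (t + h) * f s * r * gp x (?y + h *\<^sub>R v) (vcomp M x X (?y + h *\<^sub>R v)) (v - h *\<^sub>R ?c) + r * q (cinv M x (?y + h *\<^sub>R v)) s)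
        has_real_derivative - \<Lambda> x * a t * F r s * real CARD('n) / 2) (at 0)"
        by (rule DERIV_cong[OF deriv_comb[OF c5 3 a5 4 2]]) (use \<Lambda>b[OF rI sJ, of x] in \<open>auto simp: g_def algebra_simps\<close>)
      then show "((\<lambda>h. That ?T x (t + h, ?y + h *\<^sub>R v, v - h *\<^sub>R ?c, r, s)) has_real_derivative - \<Lambda> x * a t * F r s * real CARD('n) / 2) (at 0)"
      proof (rule has_field_derivative_transform_within_open)
        show "open ((\<lambda>h. ?y + h *\<^sub>R v) -` cimg M x)" by (intro open_vimage open_cimg continuous_intros)
      qed (use That in auto)
    qed simp
    define dr where "dr = der (\<rho> \<circ> cinv M x) ?y"
    define ds where "ds = der (S \<circ> cinv M x) ?y"
    define gP where "gP = ch.sharp x ?y (\<lambda>a. der (\<lambda>(r, s). P r s) (r, s) (dr a, ds a))"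
    have lP: "linear (\<lambda>a. der (\<lambda>(r, s). P r s) (r, s) (dr a, ds a))"
    proof -
      have "linear (\<lambda>a. (dr a, ds a))"
        unfolding dr_def ds_def using has_derivative_linear[OF has_derivative_comp[OF sm(2) y]] has_derivative_linear[OF has_derivative_comp[OF sm(3) y]]
        by (simp add: linear_iff)
      from linear_compose[OF this smooth_linear_der[OF P oIJ], of "(r, s)"] rI sJ show ?thesis by (simp add: o_def)
    qed
    have gPw: "g w gP = der (\<lambda>(r, s). P r s) (r, s) (dr w, ds w)" for w
      using ch.G_sharp[OF y lP, of w] gsym by (simp add: g_def gP_def)
    have dF': "differential M (\<lambda>z. F (\<rho> z) (S z)) x w = f s * g w gP" for w
      unfolding differential_def gPw der_P_comp[OF st F y] using dF[OF rI sJ] by (simp add: dr_def ds_def r_def s_def)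
    have du: "divergence M u x = (\<Sum>i\<in>UNIV. (der (vcomp M x u) ?y (axis i 1) + ch.christ x ?y (axis i 1) v) $ i)"
      using divergence_chart[of ?y x x _ u] sm by (simp add: ch.divc_def ch.nabc_def v_def)
    have dX: "divergence M X x = \<Lambda> x * real CARD('n) / 2"
    proof -
      have "ch.divc x (vcomp M x X) ?y = \<Lambda> x * real CARD('n) / 2"
        by (rule ch.divc_lie[OF y has_derivative_linear[OF has_derivative_vcomp[OF sX y]]])
          (use lX[of x] in \<open>simp add: lie_center\<close>)
      then show ?thesis using divergence_chart[of ?y x x _ X] sX by simp
    qed
    have E: "EE ?T t u \<rho> S x = - \<Lambda> x * a t * F r s * real CARD('n) / 2 - C t x * F r s * divergence M u x - f s * (C t x * g v gP + a t * g (X x) gP)"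
      unfolding EE_def ch.energy_form_def du v_def[symmetric] r_def[symmetric] s_def[symmetric] Dt Dr
        gP_def[unfolded dr_def ds_def, symmetric] Dv using r0 by simp
    have sF: "smooth_scalar M (\<lambda>z. F (\<rho> z) (S z))" by (rule smooth_scalar_P[OF st F])
    have scm: "smooth_scalar M (\<lambda>z. c z * F (\<rho> z) (S z))"
         "differential M (\<lambda>z. c z * F (\<rho> z) (S z)) x w = differential M c x w * F r s + c x * (f s * g w gP)" if c: "smooth_scalar M c" for c w
    proof -
      show "smooth_scalar M (\<lambda>z. c z * F (\<rho> z) (S z))" unfolding smooth_scalar_def
        using smooth_mult[OF open_cimg smooth_comp[OF c] smooth_comp[OF sF]] by (simp add: o_def)
      from der_eq[OF has_derivative_mult[OF has_derivative_comp[OF c y] has_derivative_comp[OF sF y]]]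
      show "differential M (\<lambda>z. c z * F (\<rho> z) (S z)) x w = differential M c x w * F r s + c x * (f s * g w gP)"
        using dF'[of w] by (simp add: differential_def o_def r_def s_def)
    qed
    have sc: "smooth_scalar M (\<lambda>z. c)" "differential M (\<lambda>z. c) x w = 0" for c w
      unfolding smooth_scalar_def differential_def by (simp_all add: o_def smooth_const open_cimg)
    have sC: "smooth_scalar M (C t)" "differential M (C t) x w = 0" for w
    proof -
      show "smooth_scalar M (C t)" unfolding smooth_scalar_def C_def
        using smooth_diff[OF open_cimg smooth_const[OF open_cimg] smooth_mult[OF open_cimg smooth_comp[OF s\<Lambda>] smooth_const[OF open_cimg]]]
        by (simp add: o_def)
      have "(C t \<circ> cinv M x has_derivative (\<lambda>w. 0 - der (\<Lambda> \<circ> cinv M x) ?y w * (\<alpha> * t + \<beta> * t\<^sup>2 / 2))) (at ?y)"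
        using has_derivative_diff[OF has_derivative_const has_derivative_mult_left[OF has_derivative_comp[OF s\<Lambda> y]]]
        by (simp add: C_def o_def)
      from der_eq[OF this] show "differential M (C t) x w = 0" using d\<Lambda>[of x w] by (simp add: differential_def)
    qed
    have "divergence M (\<Phi> t u \<rho> S) x = a t * F r s * (\<Lambda> x * real CARD('n) / 2) + a t * (f s * g (X x) gP)
       + (C t x * F r s * divergence M u x + C t x * (f s * g v gP))"
      unfolding \<Phi>_def
      using divergence_add[OF smooth_vector_scale[OF scm(1)[OF sc(1)] sX] smooth_vector_scale[OF scm(1)[OF sC(1)] sm(1)], of "a t" x]
        divergence_scale[OF scm(1)[OF sc(1)] sX, of "a t" x] divergence_scale[OF scm(1)[OF sC(1)] sm(1), of x]
      by (simp add: scm(2)[OF sc(1)] scm(2)[OF sC(1)] sc(2) sC(2) dX v_def[symmetric] r_def[symmetric] s_def[symmetric])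
    then show ?thesis unfolding E by (simp add: algebra_simps)
  qed
  then show ?thesis unfolding conserved_iff using kin vf by blast
qed

end


subsection \<open>Euler--Lagrange expressions of a conserved density\<close>

context fluid
begin

abbreviation \<Omega> :: "((real ^ 'n) \<times> real \<times> real) set" where "\<Omega> \<equiv> UNIV \<times> I \<times> J"

lemma open_\<Omega>: "open \<Omega>" and convex_\<Omega>: "convex \<Omega>" and open_IJ: "open (I \<times> J)"
  by (auto intro!: open_Times convex_Times open_I open_J conv_I conv_J)

text \<open>The test states are perturbations by \<open>\<omega>\<close> of a homogeneous fluid at
  rest with density \<open>r\<close> and entropy \<open>s\<close>.\<close>

definition state_v where "state_v p \<omega> = ext_vector p (\<lambda>y. fst (\<omega> y))"
definition state_r where "state_r p r \<omega> = ext_scalar p r (\<lambda>y. fst (snd (\<omega> y)))"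
definition state_s where "state_s p s \<omega> = ext_scalar p s (\<lambda>y. snd (snd (\<omega> y)))"

context
  fixes p :: 'm and K :: "(real ^ 'n) set" and \<omega> :: "real ^ 'n \<Rightarrow> (real ^ 'n) \<times> real \<times> real" and r0 s0 :: real
  assumes K: "compact K" "K \<subseteq> cimg M p" and \<omega>: "smooth_on UNIV \<omega>" "\<And>y. y \<notin> K \<Longrightarrow> \<omega> y = 0"
    and \<Omega>: "\<And>y. (0, r0, s0) + \<omega> y \<in> \<Omega>" and rs0: "r0 \<in> I" "s0 \<in> J"
begin

lemma state_fluid: "fluid_st (state_v p \<omega>) (state_r p r0 \<omega>) (state_s p s0 \<omega>)"
proof -
  have s: "smooth_on UNIV (\<lambda>y. fst (\<omega> y))" "smooth_on UNIV (\<lambda>y. fst (snd (\<omega> y)))" "smooth_on UNIV (\<lambda>y. snd (snd (\<omega> y)))"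
    by (intro smooth_fst smooth_snd open_UNIV \<omega>(1))+
  have "r0 + fst (snd (\<omega> y)) \<in> I \<and> s0 + snd (snd (\<omega> y)) \<in> J" for y
    using \<Omega>[of y] by (cases "\<omega> y") auto
  then have "state_r p r0 \<omega> x \<in> I \<and> state_s p s0 \<omega> x \<in> J" for x
    using rs0 by (auto simp: state_r_def state_s_def ext_scalar_def)
  then show ?thesis unfolding fluid_state_def state_v_def state_r_def state_s_def
    using smooth_ext_vector[OF K s(1)] smooth_ext_scalar[OF K s(2)] smooth_ext_scalar[OF K s(3)] \<omega>(2) by auto
qed

lemma state_chart:
  assumes y: "y \<in> cimg M p"
  shows "chart_state p (state_v p \<omega>) (state_r p r0 \<omega>) (state_s p s0 \<omega>) y = (0, r0, s0) + \<omega> y"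
    "chart_deriv p (state_v p \<omega>) (state_r p r0 \<omega>) (state_s p s0 \<omega>) y b = der \<omega> y b"
proof -
  show "chart_state p (state_v p \<omega>) (state_r p r0 \<omega>) (state_s p s0 \<omega>) y = (0, r0, s0) + \<omega> y"
    unfolding state_v_def state_r_def state_s_def vcomp_ext[OF y] ext_scalar_comp[OF y] by (cases "\<omega> y") simp
  have d: "(\<omega> has_derivative der \<omega> y) (at y)" by (rule smooth_has_derivative[OF \<omega>(1)]) auto
  have "(vcomp M p (state_v p \<omega>) has_derivative (\<lambda>b. fst (der \<omega> y b))) (at y)"
    by (rule has_derivative_transform_within_open[OF has_derivative_fst[OF d] open_cimg y])
      (simp add: state_v_def vcomp_ext)
  moreover have "(state_r p r0 \<omega> \<circ> cinv M p has_derivative (\<lambda>b. fst (snd (der \<omega> y b)))) (at y)"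
    by (rule has_derivative_transform_within_open[OF has_derivative_add_const[OF has_derivative_fst[OF has_derivative_snd[OF d]]] open_cimg y])
      (simp add: state_r_def ext_scalar_def add.commute)
  moreover have "(state_s p s0 \<omega> \<circ> cinv M p has_derivative (\<lambda>b. snd (snd (der \<omega> y b)))) (at y)"
    by (rule has_derivative_transform_within_open[OF has_derivative_add_const[OF has_derivative_snd[OF has_derivative_snd[OF d]]] open_cimg y])
      (simp add: state_s_def ext_scalar_def add.commute)
  ultimately show "chart_deriv p (state_v p \<omega>) (state_r p r0 \<omega>) (state_s p s0 \<omega>) y b = der \<omega> y b"
    by (simp add: der_eq)
qed

end

text \<open>Supplies the hypothesis \<open>null\<close> of the null Lagrangian lemmas. The
  difference between the fluxes of the perturbed and of the resting fluid vanishes off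
  \<open>K\<close> by locality; multiplied by \<open>c\<close> and the volume density, it has as
  Euclidean divergence the difference between the two values of the Lagrangian.\<close>

lemma chart_null_hyp:
  fixes F :: "(real ^ 'n) \<times> (real ^ 'n) \<times> real \<times> real \<Rightarrow> real" and G
  assumes vf: "vec_fun \<Phi>" and rs0: "r0 \<in> I" "s0 \<in> J"
    and Gl: "\<And>b z. b \<in> Basis \<Longrightarrow> z \<in> cimg M p \<times> \<Omega> \<Longrightarrow> linear (\<lambda>\<eta>. G b \<eta> z)"
    and L: "\<And>u \<rho> S y. fluid_st u \<rho> S \<Longrightarrow> y \<in> cimg M p \<Longrightarrow>
      F (y, chart_state p u \<rho> S y) +
      (\<Sum>b\<in>Basis. G b (chart_deriv p u \<rho> S y b)
          (y, chart_state p u \<rho> S y)) = ch.vol p y * (c * divergence M (\<Phi> t u \<rho> S) (cinv M p y))"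
    and K: "compact K" "K \<subseteq> cimg M p" and \<omega>: "smooth_on UNIV \<omega>" "\<And>y. y \<notin> K \<Longrightarrow> \<omega> y = 0"
    and \<Omega>: "\<And>y. (0, r0, s0) + \<omega> y \<in> \<Omega>"
  shows "\<exists>\<Psi>. smooth_on (cimg M p) \<Psi> \<and> (\<forall>y\<in>cimg M p - K. \<Psi> y = 0) \<and>
        (\<forall>y\<in>cimg M p. F (y, (0, r0, s0) + \<omega> y) + (\<Sum>b\<in>Basis. G b (der \<omega> y b) (y, (0, r0, s0) + \<omega> y)) - F (y, (0, r0, s0)) =
           (\<Sum>b\<in>Basis. der \<Psi> y b \<bullet> b))"
proof -
  define \<omega>0 where "\<omega>0 = (\<lambda>y::real ^ 'n. 0 :: (real ^ 'n) \<times> real \<times> real)"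
  have z: "smooth_on UNIV \<omega>0" "\<And>y. y \<notin> K \<Longrightarrow> \<omega>0 y = 0" "\<And>y. (0, r0, s0) + \<omega>0 y \<in> \<Omega>"
    using rs0 by (auto simp: \<omega>0_def smooth_const)
  let ?u = "state_v p \<omega>" and ?r = "state_r p r0 \<omega>" and ?s = "state_s p s0 \<omega>"
  let ?ub = "state_v p \<omega>0" and ?rb = "state_r p r0 \<omega>0" and ?sb = "state_s p s0 \<omega>0"
  have st: "fluid_st ?u ?r ?s" by (rule state_fluid[OF K \<omega> \<Omega> rs0])
  have st0: "fluid_st ?ub ?rb ?sb" by (rule state_fluid[OF K z rs0])
  have s1: "smooth_vector M (\<Phi> t ?u ?r ?s)" by (rule vector_function_smooth[OF vf st])
  have s0: "smooth_vector M (\<Phi> t ?ub ?rb ?sb)" by (rule vector_function_smooth[OF vf st0])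
  define X where "X y = c *\<^sub>R (vcomp M p (\<Phi> t ?u ?r ?s) y - vcomp M p (\<Phi> t ?ub ?rb ?sb) y)" for y
  have sX: "smooth_on (cimg M p) X" unfolding X_def
    by (intro smooth_scaleR smooth_const smooth_diff open_cimg smooth_vcomp s1 s0)
  show ?thesis
  proof (intro exI[of _ "\<lambda>y. ch.vol p y *\<^sub>R X y"] conjI ballI)
    show "smooth_on (cimg M p) (\<lambda>y. ch.vol p y *\<^sub>R X y)"
      by (intro smooth_scaleR open_cimg ch.smooth_vol sX)
  next
    fix y assume y: "y \<in> cimg M p - K"
    let ?W = "- cinv M p ` K"
    have W: "open ?W" using closed_cinv_image[OF K] by (simp add: open_Compl)
    have yW: "cinv M p y \<in> ?W"
    proof
      assume "cinv M p y \<in> cinv M p ` K"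
      then obtain y' where "y' \<in> K" "cinv M p y = cinv M p y'" by blast
      then have "y = y'" using y K cmap_cinv by (metis DiffD1 subsetD)
      then show False using y \<open>y' \<in> K\<close> by blast
    qed
    have eq: "?u z = ?ub z \<and> ?r z = ?rb z \<and> ?s z = ?sb z" if "z \<in> ?W" for z
      using \<omega>(2)[OF off_cmap[OF K, of z]] that
      by (cases "z \<in> cdom M p") (auto simp: \<omega>0_def state_v_def state_r_def state_s_def ext_vector_def ext_scalar_def)
    have "same_jet M k (cinv M p y) ?u ?r ?s ?ub ?rb ?sb" for k
      by (rule same_jet_open[OF W yW eq])
    then have "\<Phi> t ?u ?r ?s (cinv M p y) = \<Phi> t ?ub ?rb ?sb (cinv M p y)"
      using vf st st0 unfolding vector_function_def by blast
    then show "ch.vol p y *\<^sub>R X y = 0" by (simp add: X_def vcomp_def)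
  next
    fix y assume y: "y \<in> cimg M p"
    have dX: "(X has_derivative der X y) (at y)" by (rule smooth_has_derivative[OF sX open_cimg y])
    let ?Y = "vcomp M p (\<Phi> t ?u ?r ?s)" and ?Xb = "vcomp M p (\<Phi> t ?ub ?rb ?sb)"
    have d: "(?Y has_derivative der ?Y y) (at y)" "(?Xb has_derivative der ?Xb y) (at y)"
      by (rule has_derivative_vcomp[OF s1 y], rule has_derivative_vcomp[OF s0 y])
    have dXe: "der X y v = c *\<^sub>R (der ?Y y v - der ?Xb y v)" for v
      using der_eq[OF has_derivative_scaleR_right[OF has_derivative_diff[OF d], of c]] unfolding X_def [abs_def] by simp
    have "ch.divc p X y = c * (ch.divc p ?Y y - ch.divc p ?Xb y)"
      unfolding ch.divc_def ch.nabc_def dXe X_def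
      by (simp add: linear_cmul[OF ch.christ_linear2[OF y]] linear_diff[OF ch.christ_linear2[OF y]]
          sum_subtractf sum.distrib sum_distrib_left algebra_simps)
    also have "\<dots> = c * divergence M (\<Phi> t ?u ?r ?s) (cinv M p y) - c * divergence M (\<Phi> t ?ub ?rb ?sb) (cinv M p y)"
      using divergence_chart[OF y refl refl s1] divergence_chart[OF y refl refl s0] by (simp add: algebra_simps)
    finally have dv: "ch.divc p X y = c * divergence M (\<Phi> t ?u ?r ?s) (cinv M p y) - c * divergence M (\<Phi> t ?ub ?rb ?sb) (cinv M p y)" .
    have c1: "chart_state p ?u ?r ?s y = (0, r0, s0) + \<omega> y" "chart_deriv p ?u ?r ?s y b = der \<omega> y b" for b
      by (rule state_chart[OF K \<omega>(1) _ _ rs0 y]; use \<omega> \<Omega> in blast)+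
    have c0: "chart_state p ?ub ?rb ?sb y = (0, r0, s0) + \<omega>0 y" "chart_deriv p ?ub ?rb ?sb y b = der \<omega>0 y b" for b
      by (rule state_chart[OF K z(1) _ _ rs0 y]; use z in blast)+
    have "ch.vol p y * ch.divc p X y = (F (y, (0, r0, s0) + \<omega> y) + (\<Sum>b\<in>Basis. G b (der \<omega> y b) (y, (0, r0, s0) + \<omega> y))) -
       (F (y, (0, r0, s0) + \<omega>0 y) + (\<Sum>b\<in>Basis. G b (der \<omega>0 y b) (y, (0, r0, s0) + \<omega>0 y)))"
      using L[OF st y] L[OF st0 y]
      unfolding c1 c0 dv by (simp add: algebra_simps)
    moreover have "G b (der \<omega>0 y b) (y, (0, r0, s0) + \<omega>0 y) = 0" if "b \<in> Basis" for b
      using linear_0[OF Gl[OF that], of "(y, 0, r0, s0)"] y rs0 by (simp add: \<omega>0_def)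
    ultimately show "F (y, (0, r0, s0) + \<omega> y) + (\<Sum>b\<in>Basis. G b (der \<omega> y b) (y, (0, r0, s0) + \<omega> y)) - F (y, (0, r0, s0)) =
           (\<Sum>b\<in>Basis. der (\<lambda>y. ch.vol p y *\<^sub>R X y) y b \<bullet> b)"
      using ch.divc_vol[OF y, of X] dX differentiableI by (auto simp: \<omega>0_def)
  qed
qed

text \<open>A divergence that is a function of the undifferentiated state is a null Lagrangian
  without derivative part; the zeroth-order equation then says that it does not depend on the
  state.\<close>

lemma trivial_no_dependence:
  assumes vf: "vec_fun \<Theta>" and T: "kinematic T"
    and tr: "\<And>u \<rho> S x. fluid_st u \<rho> S \<Longrightarrow> T t x (u x) (\<rho> x) (S x) = divergence M (\<Theta> t u \<rho> S) x"
    and w: "r \<in> I" "s \<in> J"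
  shows "der (That T x) (t, cmap M x x, v, r, s) (0, 0, \<eta>) = 0"
proof -
  let ?p = x
  define F where "F = (\<lambda>z. ch.vol ?p (fst z) * That T ?p (t, z))"
  define G where "G = (\<lambda>(b::real ^ 'n) (\<eta>::(real ^ 'n) \<times> real \<times> real) (z::(real ^ 'n) \<times> (real ^ 'n) \<times> real \<times> real). 0::real)"
  have o: "open (cimg M ?p \<times> \<Omega>)" by (rule open_Times[OF open_cimg open_\<Omega>])
  have sF: "smooth_on (cimg M ?p \<times> \<Omega>) F" unfolding F_def
    by (intro smooth_mult o smooth_compose[OF o open_cimg _ smooth_fst[OF o smooth_id[OF o]] ch.smooth_vol]
      smooth_compose[OF o open_dom _ smooth_Pair[OF o smooth_const[OF o] smooth_id[OF o]] smooth_That[OF T]]) auto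
  have sG: "smooth_on (cimg M ?p \<times> \<Omega>) (G b \<eta>)" for b \<eta> unfolding G_def by (rule smooth_const[OF o])
  have Gl: "linear (\<lambda>\<eta>. G b \<eta> z)" for b z unfolding G_def by (simp add: linear_iff)
  have L: "F (y, chart_state ?p u \<rho> S y) +
      (\<Sum>b\<in>Basis. G b (chart_deriv ?p u \<rho> S y b)
          (y, chart_state ?p u \<rho> S y)) = ch.vol ?p y * (1 * divergence M (\<Theta> t u \<rho> S) (cinv M ?p y))"
    if "fluid_st u \<rho> S" "y \<in> cimg M ?p" for u \<rho> S y
    using tr[OF that(1), of "cinv M ?p y"] that(2) vcomp_J(2)[OF that(2) refl refl, of u]
    by (simp add: F_def G_def That_def)
  have y: "cmap M x x \<in> cimg M ?p" by simp
  have w1: "(v, r, s) \<in> \<Omega>" using w by simp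
  have w0: "(0, r, s) \<in> \<Omega>" using w by simp
  have "der F (cmap M x x, v, r, s) (0, \<eta>) = (\<Sum>b\<in>Basis. der (G b \<eta>) (cmap M x x, v, r, s) (b, 0))"
    by (rule null_lagrangian_zeroth[OF open_cimg open_\<Omega> convex_\<Omega> w0 sF sG Gl chart_null_hyp[OF vf w Gl L] y w1])
  then have "der F (cmap M x x, v, r, s) (0, \<eta>) = 0" by (simp add: G_def)
  moreover have "der F (cmap M x x, v, r, s) (0, \<eta>) = ch.vol ?p (cmap M x x) * der (That T ?p) (t, cmap M x x, v, r, s) (0, 0, \<eta>)"
  proof -
    have z: "(cmap M x x, v, r, s) \<in> cimg M ?p \<times> \<Omega>" "(t, cmap M x x, v, r, s) \<in> UNIV \<times> cimg M ?p \<times> \<Omega>" using w by auto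
    have "((\<lambda>w. F (cmap M x x, w)) has_derivative (\<lambda>\<eta>. der F (cmap M x x, v, r, s) (0, \<eta>))) (at (v, r, s))"
      by (rule der_Pair_smooth(1)[OF sF o z(1)])
    moreover have "((\<lambda>w. (t, cmap M x x, w)) has_derivative (\<lambda>\<eta>. (0, 0, \<eta>))) (at (v, r, s))"
      by (auto intro!: derivative_eq_intros)
    note has_derivative_mult_right[OF has_derivative_compose[OF this smooth_has_derivative[OF smooth_That[OF T] open_dom z(2)]], of "ch.vol ?p (cmap M x x)"]
    ultimately show ?thesis
      using has_derivative_unique unfolding F_def fst_conv by (auto dest: has_derivative_unique fun_cong[of _ _ \<eta>])
  qed
  ultimately show ?thesis using ch.vol_pos[of ?p "cmap M x x"] by simp
qed

end


lemma sum_Basis_axis: "(\<Sum>b\<in>Basis. D b \<bullet> b) = (\<Sum>i\<in>UNIV. D (axis i (1::real)) $ i)"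
  for D :: "real ^ 'n \<Rightarrow> real ^ 'n"
  unfolding Basis_vec_def by (subst sum.UNION_disjoint) (auto simp: axis_eq_axis inner_axis)

context fluid
begin

abbreviation Pc :: "real \<times> real \<Rightarrow> real" where "Pc \<equiv> \<lambda>(r, s). P r s"

text \<open>For a basis vector \<open>b\<close> this is a row of the inverse metric, the gradient of
  the coordinate \<open>y \<bullet> b\<close>.\<close>

abbreviation raised :: "'m \<Rightarrow> real ^ 'n \<Rightarrow> real ^ 'n \<Rightarrow> real ^ 'n" where
  "raised p y b \<equiv> ch.sharp p y (\<lambda>a. a \<bullet> b)"

definition Bf :: "('m, 'n) density \<Rightarrow> 'm \<Rightarrow> real \<Rightarrow> real ^ 'n \<Rightarrow> (real ^ 'n) \<times> real \<times> real \<Rightarrow> real" where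
  "Bf T p t y w = That T p (t, y, w) - fst (snd w) * der (That T p) (t, y, w) (0, 0, 0, 1, 0)"

definition Sf :: "('m, 'n) density \<Rightarrow> 'm \<Rightarrow> real \<Rightarrow> real ^ 'n \<Rightarrow> real ^ 'n \<Rightarrow> (real ^ 'n) \<times> real \<times> real \<Rightarrow> real" where
  "Sf T p t y a w = der (That T p) (t, y, w) (0, 0, a, 0, 0) / fst (snd w)"

definition Af :: "('m, 'n) density \<Rightarrow> 'm \<Rightarrow> real \<Rightarrow> real ^ 'n \<Rightarrow> (real ^ 'n) \<times> real \<times> real \<Rightarrow> real" where
  "Af T p t y w = der (That T p) (t, y, w) (1, fst w, - ch.christ p y (fst w) (fst w), 0, 0)"

text \<open>\<open>FF\<close> and \<open>GG\<close> are the parts of \<open>vol * EE\<close> of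
  degree 0 and 1 in the derivatives of the state. In \<open>GG\<close> the argument
  \<open>\<eta>\<close> is the derivative of \<open>(v, r, s)\<close> in the direction
  \<open>b\<close>; the Christoffel trace in \<open>div u\<close> belongs to
  \<open>FF\<close>.\<close>

definition FF where
  "FF T p t z = ch.vol p (fst z) * (Af T p t (fst z) (snd z) + Bf T p t (fst z) (snd z) *
      (\<Sum>i\<in>UNIV. ch.christ p (fst z) (axis i 1) (fst (snd z)) $ i))"

definition GG where
  "GG T p t b \<eta> z = ch.vol p (fst z) * (Bf T p t (fst z) (snd z) * (b \<bullet> fst \<eta>) -
      Sf T p t (fst z) (raised p (fst z) b) (snd z) * der Pc (snd (snd z)) (snd \<eta>))"

lemma open_chart_dom: "open (cimg M p \<times> \<Omega>)" by (rule open_Times[OF open_cimg open_\<Omega>])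

lemma linear_sharp_basis: "linear (\<lambda>a::real ^ 'n. a \<bullet> b)"
  by (rule bounded_linear.linear[OF bounded_linear_inner_left])

lemma der_fix:
  assumes "smooth_on (cimg M p \<times> \<Omega>) (\<lambda>z. H (fst z) (snd z))" "y \<in> cimg M p" "w \<in> \<Omega>"
  shows "(H y has_derivative der (H y) w) (at w)"
proof -
  have "((\<lambda>w. H (fst (y, w)) (snd (y, w))) has_derivative (\<lambda>\<eta>. der (\<lambda>z. H (fst z) (snd z)) (y, w) (0, \<eta>))) (at w)"
    by (rule der_Pair_smooth(1)[OF assms(1) open_chart_dom]) (use assms in auto)
  then have "(H y has_derivative (\<lambda>\<eta>. der (\<lambda>z. H (fst z) (snd z)) (y, w) (0, \<eta>))) (at w)" by simp
  with der_eq[OF this] show ?thesis by simp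
qed

context
  fixes T and p :: 'm and t :: real
  assumes T: "kinematic T"
begin

lemma smooth_parts:
  shows "smooth_on (cimg M p \<times> \<Omega>) fst" "smooth_on (cimg M p \<times> \<Omega>) snd"
    "smooth_on (cimg M p \<times> \<Omega>) (\<lambda>z. fst (snd z))" "smooth_on (cimg M p \<times> \<Omega>) (\<lambda>z. snd (snd z))"
    "smooth_on (cimg M p \<times> \<Omega>) (\<lambda>z. fst (snd (snd z)))"
    "smooth_on (cimg M p \<times> \<Omega>) (\<lambda>z. ((t, fst z, snd z) :: real \<times> (real ^ 'n) \<times> (real ^ 'n) \<times> real \<times> real))"
  by (intro smooth_intros open_chart_dom)+

lemma smooth_D:
  assumes "smooth_on (cimg M p \<times> \<Omega>) h"
  shows "smooth_on (cimg M p \<times> \<Omega>) (\<lambda>z. der (That T p) (t, fst z, snd z) (h z))"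
  by (rule smooth_der_compose[OF open_chart_dom _ smooth_parts(6) open_dom smooth_That[OF T] assms]) auto

lemma smooth_N: "smooth_on (cimg M p \<times> \<Omega>) (\<lambda>z. That T p (t, fst z, snd z))"
  by (rule smooth_compose[OF open_chart_dom open_dom _ smooth_parts(6) smooth_That[OF T]]) auto

lemma smooth_Bf: "smooth_on (cimg M p \<times> \<Omega>) (\<lambda>z. Bf T p t (fst z) (snd z))"
  unfolding Bf_def
  by (intro smooth_diff smooth_mult smooth_N smooth_parts smooth_D smooth_const open_chart_dom)

lemma smooth_Sf:
  assumes "smooth_on (cimg M p \<times> \<Omega>) h"
  shows "smooth_on (cimg M p \<times> \<Omega>) (\<lambda>z. Sf T p t (fst z) (h z) (snd z))"
  unfolding Sf_def
  by (intro smooth_divide smooth_parts smooth_D smooth_Pair smooth_const open_chart_dom assms) (use pos_I in fastforce)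

lemma smooth_Af: "smooth_on (cimg M p \<times> \<Omega>) (\<lambda>z. Af T p t (fst z) (snd z))"
  unfolding Af_def
  by (intro smooth_D smooth_Pair smooth_const open_chart_dom smooth_parts smooth_minus ch.smooth_christ) auto

lemma smooth_dP: "smooth_on (cimg M p \<times> \<Omega>) (\<lambda>z. der Pc (snd (snd z)) k)"
  by (rule smooth_der_compose[OF open_chart_dom _ smooth_parts(4) open_IJ P smooth_const[OF open_chart_dom]]) auto

lemma smooth_FF: "smooth_on (cimg M p \<times> \<Omega>) (FF T p t)"
  unfolding FF_def
proof (intro smooth_mult smooth_add smooth_sum smooth_nth open_chart_dom smooth_Af smooth_Bf)
  show "smooth_on (cimg M p \<times> \<Omega>) (\<lambda>z. ch.vol p (fst z))"
    by (rule smooth_compose[OF open_chart_dom open_cimg _ smooth_parts(1) ch.smooth_vol]) auto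
  show "smooth_on (cimg M p \<times> \<Omega>) (\<lambda>z. ch.christ p (fst z) (axis i 1) (fst (snd z)))" for i
    by (rule ch.smooth_christ[OF open_chart_dom _ smooth_parts(1) smooth_const[OF open_chart_dom] smooth_parts(3)]) auto
qed

lemma smooth_GG: "smooth_on (cimg M p \<times> \<Omega>) (GG T p t b \<eta>)"
  unfolding GG_def
proof (intro smooth_mult smooth_diff open_chart_dom smooth_Bf smooth_Sf smooth_const smooth_dP)
  show "smooth_on (cimg M p \<times> \<Omega>) (\<lambda>z. ch.vol p (fst z))"
    by (rule smooth_compose[OF open_chart_dom open_cimg _ smooth_parts(1) ch.smooth_vol]) auto
  show "smooth_on (cimg M p \<times> \<Omega>) (\<lambda>z. raised p (fst z) b)"
    by (rule ch.smooth_sharp[OF open_chart_dom _ smooth_parts(1) smooth_const[OF open_chart_dom] linear_sharp_basis]) auto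
qed

lemma linear_GG:
  assumes "z \<in> cimg M p \<times> \<Omega>" shows "linear (\<lambda>\<eta>. GG T p t b \<eta> z)"
proof -
  have "snd (snd z) \<in> I \<times> J" using assms by auto
  then have l: "linear (der Pc (snd (snd z)))" by (rule smooth_linear_der[OF P open_IJ])
  show ?thesis unfolding GG_def
    by (simp add: linear_iff linear_add[OF l] linear_cmul[OF l] inner_add_right algebra_simps)
qed

lemma linear_D: "y \<in> cimg M p \<Longrightarrow> w \<in> \<Omega> \<Longrightarrow> linear (der (That T p) (t, y, w))"
  by (rule smooth_linear_der[OF smooth_That[OF T] open_dom]) auto

lemma Sf_add: "y \<in> cimg M p \<Longrightarrow> w \<in> \<Omega> \<Longrightarrow> Sf T p t y (a + a') w = Sf T p t y a w + Sf T p t y a' w"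
  using linear_add[OF linear_D, of y w "(0, 0, a, 0, 0)" "(0, 0, a', 0, 0)"] by (simp add: Sf_def add_divide_distrib)

lemma Sf_cmul: "y \<in> cimg M p \<Longrightarrow> w \<in> \<Omega> \<Longrightarrow> Sf T p t y (c *\<^sub>R a) w = c * Sf T p t y a w"
  using linear_cmul[OF linear_D, of y w c "(0, 0, a, 0, 0)"] by (simp add: Sf_def)

lemma linear_Sf: "y \<in> cimg M p \<Longrightarrow> w \<in> \<Omega> \<Longrightarrow> linear (\<lambda>a. Sf T p t y a w)"
  by (rule linearI) (auto simp: Sf_add Sf_cmul)

lemma chart_lagrangian:
  assumes st: "fluid_st u \<rho> S" and y: "y \<in> cimg M p"
  shows "FF T p t (y, chart_state p u \<rho> S y) +
      (\<Sum>b\<in>Basis. GG T p t b (chart_deriv p u \<rho> S y b)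
          (y, chart_state p u \<rho> S y)) = ch.vol p y * EE T t u \<rho> S (cinv M p y)"
proof -
  define x where "x = cinv M p y"
  obtain u' \<rho>' S' where sol: "formal_solution M I J P u \<rho> S u' \<rho>' S'" using formal_solution_exists[OF st] by blast
  have sm: "smooth_scalar M \<rho>" "smooth_scalar M S" "\<rho> x \<in> I" "S x \<in> J" using st unfolding fluid_state_def by auto
  have E: "EE T t u \<rho> S x = ch.energy_form p (That T p) P t y (vcomp M p u y) (\<rho> x) (S x)
      (der (vcomp M p u) y) (der (\<rho> \<circ> cinv M p) y) (der (S \<circ> cinv M p) y)"
    unfolding EE_def conservation_chart[OF sol T y x_def, symmetric]
    using conservation_chart[OF sol T, of "cmap M x x" x x t] by simp
  define w where "w = (vcomp M p u y, \<rho> x, S x)"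
  have w: "w \<in> \<Omega>" using sm by (simp add: w_def)
  define dr where "dr = der (\<rho> \<circ> cinv M p) y"
  define ds where "ds = der (S \<circ> cinv M p) y"
  define q where "q a = der Pc (\<rho> x, S x) (dr a, ds a)" for a
  have lq: "linear q"
  proof -
    have "linear (\<lambda>a. (dr a, ds a))"
      unfolding dr_def ds_def using has_derivative_linear[OF has_derivative_comp[OF sm(1) y]] has_derivative_linear[OF has_derivative_comp[OF sm(2) y]]
      by (simp add: linear_iff)
    from linear_compose[OF this smooth_linear_der[OF P open_IJ], of "(\<rho> x, S x)"] sm show ?thesis by (simp add: o_def q_def [abs_def])
  qed
  \<comment> \<open>Splitting the pressure gradient over the basis matches it with the sum over
    directions in the Lagrangian.\<close>
  have "ch.sharp p y q = (\<Sum>b\<in>Basis. q b *\<^sub>R raised p y b)"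
  proof (rule ch.sharp_unique[OF y])
    fix a
    have "gp p y (\<Sum>b\<in>Basis. q b *\<^sub>R raised p y b) a = (\<Sum>b\<in>Basis. q b * (a \<bullet> b))"
      by (simp add: linear_sum[OF ch.lin1[OF y]] linear_cmul[OF ch.lin1[OF y]] ch.G_sharp[OF y linear_sharp_basis])
    also have "\<dots> = q a" using linear_expand[OF lq, of a] by (simp add: mult.commute)
    finally show "gp p y (\<Sum>b\<in>Basis. q b *\<^sub>R raised p y b) a = q a" .
  qed
  then have "der (That T p) (t, y, w) (0, 0, ch.sharp p y q, 0, 0) / \<rho> x = Sf T p t y (\<Sum>b\<in>Basis. q b *\<^sub>R raised p y b) w"
    by (simp add: Sf_def w_def)
  also have "\<dots> = (\<Sum>b\<in>Basis. q b * Sf T p t y (raised p y b) w)"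
    by (simp add: linear_sum[OF linear_Sf[OF y w]] linear_cmul[OF linear_Sf[OF y w]])
  finally have 1: "der (That T p) (t, y, w) (0, 0, ch.sharp p y q, 0, 0) / \<rho> x = (\<Sum>b\<in>Basis. q b * Sf T p t y (raised p y b) w)" .
  have e2: "EE T t u \<rho> S x = Af T p t y w + Bf T p t y w * ((\<Sum>i\<in>UNIV. der (vcomp M p u) y (axis i 1) $ i) +
       (\<Sum>i\<in>UNIV. ch.christ p y (axis i 1) (fst w) $ i)) - (\<Sum>b\<in>Basis. q b * Sf T p t y (raised p y b) w)"
    unfolding E ch.energy_form_def 1[symmetric] unfolding Af_def Bf_def w_def fst_conv snd_conv q_def dr_def ds_def
    by (simp add: sum.distrib)
  have "ch.vol p y * EE T t u \<rho> S x = FF T p t (y, w) + ch.vol p y * (Bf T p t y w * (\<Sum>b\<in>Basis. der (vcomp M p u) y b \<bullet> b) -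
       (\<Sum>b\<in>Basis. q b * Sf T p t y (raised p y b) w))"
    unfolding e2 FF_def sum_Basis_axis by (simp add: algebra_simps)
  also have "\<dots> = FF T p t (y, w) + (\<Sum>b\<in>Basis. GG T p t b (der (vcomp M p u) y b, dr b, ds b) (y, w))"
    unfolding GG_def q_def by (simp add: sum_distrib_left sum_distrib_right sum_subtractf inner_commute w_def mult_ac right_diff_distrib)
  finally show ?thesis by (simp add: w_def x_def dr_def ds_def)
qed

lemma der_GG_w:
  assumes y: "y \<in> cimg M p" and w: "w \<in> \<Omega>"
  defines "a \<equiv> \<lambda>b. raised p y b"
  shows "der (GG T p t b \<xi>) (y, w) (0, \<eta>) = ch.vol p y * (der (Bf T p t y) w \<eta> * (b \<bullet> fst \<xi>) -
    (der (Sf T p t y (a b)) w \<eta> * der Pc (snd w) (snd \<xi>) + Sf T p t y (a b) w * der (\<lambda>q. der Pc q (snd \<xi>)) (snd w) (snd \<eta>)))"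
proof -
  have z: "(y, w) \<in> cimg M p \<times> \<Omega>" using y w by simp
  have sw: "snd w \<in> I \<times> J" using w by auto
  have 1: "((\<lambda>w. GG T p t b \<xi> (y, w)) has_derivative (\<lambda>\<eta>. der (GG T p t b \<xi>) (y, w) (0, \<eta>))) (at w)"
    by (rule der_Pair_smooth(1)[OF smooth_GG open_chart_dom z])
  have dP: "((\<lambda>w. der Pc (snd w) (snd \<xi>)) has_derivative (\<lambda>\<eta>. der (\<lambda>q. der Pc q (snd \<xi>)) (snd w) (snd \<eta>))) (at w)"
    by (rule has_derivative_compose[OF has_derivative_snd[OF has_derivative_ident]
       smooth_has_derivative[OF smooth_der[OF open_IJ P smooth_const[OF open_IJ]] open_IJ sw]])
  have dB: "(Bf T p t y has_derivative der (Bf T p t y) w) (at w)" by (rule der_fix[OF smooth_Bf y w])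
  have dS: "(Sf T p t y (a b) has_derivative der (Sf T p t y (a b)) w) (at w)"
    using der_fix[where H="\<lambda>y. Sf T p t y (a b)", OF smooth_Sf[OF smooth_const[OF open_chart_dom]] y w] .
  have "((\<lambda>w. GG T p t b \<xi> (y, w)) has_derivative (\<lambda>\<eta>. ch.vol p y * (der (Bf T p t y) w \<eta> * (b \<bullet> fst \<xi>) -
    (Sf T p t y (a b) w * der (\<lambda>q. der Pc q (snd \<xi>)) (snd w) (snd \<eta>) + der (Sf T p t y (a b)) w \<eta> * der Pc (snd w) (snd \<xi>))))) (at w)"
    unfolding GG_def fst_conv snd_conv a_def
    by (intro has_derivative_mult_right has_derivative_diff has_derivative_mult_left dB has_derivative_mult dS[unfolded a_def] dP)
  from fun_cong[OF has_derivative_unique[OF 1 this], of \<eta>] show ?thesis by (simp add: algebra_simps)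
qed

end

lemma conserved_null:
  assumes T: "conserved T" and r0: "r0 \<in> I" "s0 \<in> J" and K: "compact K" "K \<subseteq> cimg M p"
    and \<omega>: "smooth_on UNIV \<omega>" "\<And>y. y \<notin> K \<Longrightarrow> \<omega> y = 0" and \<Omega>: "\<And>y. (0, r0, s0) + \<omega> y \<in> \<Omega>"
  shows "\<exists>\<Psi>. smooth_on (cimg M p) \<Psi> \<and> (\<forall>y\<in>cimg M p - K. \<Psi> y = 0) \<and>
        (\<forall>y\<in>cimg M p. FF T p t (y, (0, r0, s0) + \<omega> y) + (\<Sum>b\<in>Basis. GG T p t b (der \<omega> y b) (y, (0, r0, s0) + \<omega> y)) - FF T p t (y, (0, r0, s0)) =
           (\<Sum>b\<in>Basis. der \<Psi> y b \<bullet> b))"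
proof -
  obtain \<Phi> where kin: "kinematic T" and vf: "vec_fun \<Phi>" and
     c: "\<And>t u \<rho> S x. fluid_st u \<rho> S \<Longrightarrow> EE T t u \<rho> S x = - divergence M (\<Phi> t u \<rho> S) x"
    using T unfolding conserved_iff by blast
  show ?thesis
  proof (rule chart_null_hyp[OF vf r0 linear_GG[OF kin] _ K \<omega> \<Omega>])
    show "FF T p t (y, chart_state p u \<rho> S y) +
       (\<Sum>b\<in>Basis. GG T p t b (chart_deriv p u \<rho> S y b)
          (y, chart_state p u \<rho> S y)) = ch.vol p y * (- 1 * divergence M (\<Phi> t u \<rho> S) (cinv M p y))"
      if "fluid_st u \<rho> S" "y \<in> cimg M p" for u \<rho> S y
      unfolding chart_lagrangian[OF kin that] using c[OF that(1)] by simp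
  qed
qed

context
  fixes T and p :: 'm and t :: real and y :: "real ^ 'n" and w :: "(real ^ 'n) \<times> real \<times> real"
  assumes T: "conserved T" and y: "y \<in> cimg M p" and w: "w \<in> \<Omega>"
begin

lemma kinT: "kinematic T" using T unfolding conserved_density_def by blast

text \<open>The symmetry condition of the null Lagrangian, divided by the volume density. Second
  derivatives of \<open>P\<close> are symmetric and drop out, and since the rows of the inverse
  metric span, the basis vector \<open>b\<close> can be replaced by an arbitrary
  \<open>a\<close>.\<close>

lemma EL_first:
  "der (Bf T p t y) w \<eta> * gp p y a (fst \<xi>) - der (Sf T p t y a) w \<eta> * der Pc (snd w) (snd \<xi>) =
   der (Bf T p t y) w \<xi> * gp p y a (fst \<eta>) - der (Sf T p t y a) w \<xi> * der Pc (snd w) (snd \<eta>)"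
proof -
  have w0: "(0, fst (snd w), snd (snd w)) \<in> \<Omega>" using w by auto
  then have w0': "fst (snd w) \<in> I" "snd (snd w) \<in> J" by auto
  have sw: "snd w \<in> I \<times> J" using w by auto
  have D: "der (Bf T p t y) w \<eta> * (b \<bullet> fst \<xi>) - der (Sf T p t y (raised p y b)) w \<eta> * der Pc (snd w) (snd \<xi>) =
     der (Bf T p t y) w \<xi> * (b \<bullet> fst \<eta>) - der (Sf T p t y (raised p y b)) w \<xi> * der Pc (snd w) (snd \<eta>)" if b: "b \<in> Basis" for b
  proof -
    have "der (GG T p t b \<xi>) (y, w) (0, \<eta>) = der (GG T p t b \<eta>) (y, w) (0, \<xi>)"
      by (rule null_lagrangian_first[OF open_cimg open_\<Omega> convex_\<Omega> w0 smooth_FF[OF kinT] smooth_GG[OF kinT] linear_GG[OF kinT]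
         conserved_null[OF T w0'] y w b])
    moreover have "der (\<lambda>q. der Pc q (snd \<xi>)) (snd w) (snd \<eta>) = der (\<lambda>q. der Pc q (snd \<eta>)) (snd w) (snd \<xi>)"
      by (rule der_swap[OF open_IJ sw P])
    ultimately show ?thesis
      unfolding der_GG_w[OF kinT y w] using ch.vol_pos[of p y] by simp
  qed
  have ae: "a = (\<Sum>b\<in>Basis. gp p y a b *\<^sub>R raised p y b)"
  proof (rule ch.G_eqD[OF y])
    fix e
    have "gp p y (\<Sum>b\<in>Basis. gp p y a b *\<^sub>R raised p y b) e = (\<Sum>b\<in>Basis. gp p y a b * (e \<bullet> b))"
      by (simp add: linear_sum[OF ch.lin1[OF y]] linear_cmul[OF ch.lin1[OF y]] ch.G_sharp[OF y linear_sharp_basis])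
    then show "gp p y a e = gp p y (\<Sum>b\<in>Basis. gp p y a b *\<^sub>R raised p y b) e"
      using linear_expand[OF ch.lin2[OF y], of a e] by (simp add: mult.commute)
  qed
  have dSe: "der (Sf T p t y a) w h = (\<Sum>b\<in>Basis. gp p y a b * der (Sf T p t y (raised p y b)) w h)" for h
  proof -
    have dS: "(Sf T p t y c has_derivative der (Sf T p t y c) w) (at w)" for c
      using der_fix[where H="\<lambda>y. Sf T p t y c", OF smooth_Sf[OF kinT smooth_const[OF open_chart_dom]] y w] .
    have "((\<lambda>w. \<Sum>b\<in>Basis. gp p y a b * Sf T p t y (raised p y b) w) has_derivative (\<lambda>h. \<Sum>b\<in>Basis. gp p y a b * der (Sf T p t y (raised p y b)) w h)) (at w)"
      by (intro has_derivative_sum has_derivative_mult_right dS)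
    then have "(Sf T p t y a has_derivative (\<lambda>h. \<Sum>b\<in>Basis. gp p y a b * der (Sf T p t y (raised p y b)) w h)) (at w)"
    proof (rule has_derivative_transform_within_open[OF _ open_\<Omega> w])
      show "(\<Sum>b\<in>Basis. gp p y a b * Sf T p t y (raised p y b) w) = Sf T p t y a w" if "w \<in> \<Omega>" for w
        by (subst (2) ae) (simp add: linear_sum[OF linear_Sf[OF kinT y that]] linear_cmul[OF linear_Sf[OF kinT y that]])
    qed
    from der_eq[OF this] show ?thesis by simp
  qed
  have ge: "gp p y a e = (\<Sum>b\<in>Basis. gp p y a b * (b \<bullet> e))" for e
    using linear_expand[OF ch.lin2[OF y], of a e] by (simp add: mult.commute inner_commute)
  have "(\<Sum>b\<in>Basis. gp p y a b * (der (Bf T p t y) w \<eta> * (b \<bullet> fst \<xi>) - der (Sf T p t y (raised p y b)) w \<eta> * der Pc (snd w) (snd \<xi>))) =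
    (\<Sum>b\<in>Basis. gp p y a b * (der (Bf T p t y) w \<xi> * (b \<bullet> fst \<eta>) - der (Sf T p t y (raised p y b)) w \<xi> * der Pc (snd w) (snd \<eta>)))"
    by (rule sum.cong[OF refl]) (simp add: D)
  then show ?thesis
    unfolding dSe ge[of "fst \<xi>"] ge[of "fst \<eta>"] right_diff_distrib sum_subtractf
    by (simp add: sum_distrib_left sum_distrib_right mult_ac)
qed

text \<open>\<open>Z\<close> is the velocity gradient of \<open>T / r\<close> at the fixed state
  \<open>w\<close>, as a field on the chart. In directions without velocity component
  \<open>GG\<close> is \<open>- der Pc (snd w) \<delta>\<close> times a component of
  \<open>vol Z\<close>, so the sum of its derivatives is the divergence of \<open>Z\<close> by the
  Voss-Weyl formula.\<close>

lemma EL_zeroth: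
  assumes Z: "smooth_on (cimg M p) Z"
    and TZ: "\<And>y a. y \<in> cimg M p \<Longrightarrow> der (That T p) (t, y, w) (0, 0, a, 0, 0) = fst (snd w) * gp p y (Z y) a"
  shows "der (Af T p t y) w (0, \<delta>) + der (Bf T p t y) w (0, \<delta>) * (\<Sum>i\<in>UNIV. ch.christ p y (axis i 1) (fst w) $ i)
     = - der Pc (snd w) \<delta> * ch.divc p Z y"
proof -
  have w0: "(0, fst (snd w), snd (snd w)) \<in> \<Omega>" using w by auto
  then have w0': "fst (snd w) \<in> I" "snd (snd w) \<in> J" by auto
  have z: "(y, w) \<in> cimg M p \<times> \<Omega>" using y w by simp
  have r0: "fst (snd w) \<noteq> 0" using pos_I[OF w0'(1)] by simp
  have "der (FF T p t) (y, w) (0, 0, \<delta>) = (\<Sum>b\<in>Basis. der (GG T p t b (0, \<delta>)) (y, w) (b, 0))"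
    by (rule null_lagrangian_zeroth[OF open_cimg open_\<Omega> convex_\<Omega> w0 smooth_FF[OF kinT] smooth_GG[OF kinT] linear_GG[OF kinT]
         conserved_null[OF T w0'] y w])
  also have "\<dots> = (\<Sum>b\<in>Basis. - der Pc (snd w) \<delta> * (der (\<lambda>y. ch.vol p y *\<^sub>R Z y) y b \<bullet> b))"
  proof (rule sum.cong[OF refl])
    fix b :: "real ^ 'n" assume b: "b \<in> Basis"
    have 1: "((\<lambda>y. GG T p t b (0, \<delta>) (y, w)) has_derivative (\<lambda>h. der (GG T p t b (0, \<delta>)) (y, w) (h, 0))) (at y)"
      by (rule der_Pair_smooth(2)[OF smooth_GG[OF kinT] open_chart_dom z])
    have sv: "smooth_on (cimg M p) (\<lambda>y. ch.vol p y *\<^sub>R Z y)" by (intro smooth_scaleR open_cimg ch.smooth_vol Z)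
    have "((\<lambda>y. - der Pc (snd w) \<delta> * ((ch.vol p y *\<^sub>R Z y) \<bullet> b)) has_derivative (\<lambda>h. - der Pc (snd w) \<delta> * (der (\<lambda>y. ch.vol p y *\<^sub>R Z y) y h \<bullet> b))) (at y)"
      by (intro has_derivative_mult_right has_derivative_inner_left smooth_has_derivative[OF sv open_cimg y])
    then have 2: "((\<lambda>y. GG T p t b (0, \<delta>) (y, w)) has_derivative (\<lambda>h. - der Pc (snd w) \<delta> * (der (\<lambda>y. ch.vol p y *\<^sub>R Z y) y h \<bullet> b))) (at y)"
    proof (rule has_derivative_transform_within_open[OF _ open_cimg y])
      fix y assume y: "y \<in> cimg M p"
      have "gp p y (Z y) (raised p y b) = Z y \<bullet> b"
        using ch.G_sharp[OF y linear_sharp_basis, of b "Z y"] ch.sym[OF y] by simp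
      then show "- der Pc (snd w) \<delta> * ((ch.vol p y *\<^sub>R Z y) \<bullet> b) = GG T p t b (0, \<delta>) (y, w)"
        unfolding GG_def Sf_def fst_conv snd_conv TZ[OF y] using r0 by simp
    qed
    from fun_cong[OF has_derivative_unique[OF 1 2], of b]
    show "der (GG T p t b (0, \<delta>)) (y, w) (b, 0) = - der Pc (snd w) \<delta> * (der (\<lambda>y. ch.vol p y *\<^sub>R Z y) y b \<bullet> b)" .
  qed
  also have "\<dots> = - der Pc (snd w) \<delta> * (ch.vol p y * ch.divc p Z y)"
    using ch.divc_vol[OF y smooth_differentiable[OF Z open_cimg y]] by (simp add: sum_distrib_left)
  finally have R: "der (FF T p t) (y, w) (0, 0, \<delta>) = - der Pc (snd w) \<delta> * (ch.vol p y * ch.divc p Z y)" .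
  have 1: "((\<lambda>w. FF T p t (y, w)) has_derivative (\<lambda>\<eta>. der (FF T p t) (y, w) (0, \<eta>))) (at w)"
    by (rule der_Pair_smooth(1)[OF smooth_FF[OF kinT] open_chart_dom z])
  define \<gamma> where "\<gamma> v = (\<Sum>i\<in>UNIV. ch.christ p y (axis i 1) v $ i)" for v
  have g: "linear \<gamma>" unfolding \<gamma>_def
    by (simp add: linear_iff linear_add[OF ch.christ_linear2[OF y]] linear_cmul[OF ch.christ_linear2[OF y]] sum.distrib sum_distrib_left)
  have dA: "(Af T p t y has_derivative der (Af T p t y) w) (at w)" by (rule der_fix[OF smooth_Af[OF kinT] y w])
  have dB: "(Bf T p t y has_derivative der (Bf T p t y) w) (at w)" by (rule der_fix[OF smooth_Bf[OF kinT] y w])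
  have "((\<lambda>w. \<gamma> (fst w)) has_derivative (\<lambda>\<eta>. \<gamma> (fst \<eta>))) (at w)"
    using bounded_linear.has_derivative[OF linear_conv_bounded_linear[THEN iffD1, OF g] has_derivative_fst[OF has_derivative_ident]] .
  then have "((\<lambda>w. FF T p t (y, w)) has_derivative (\<lambda>\<eta>. ch.vol p y * (der (Af T p t y) w \<eta> + (Bf T p t y w * \<gamma> (fst \<eta>) + der (Bf T p t y) w \<eta> * \<gamma> (fst w))))) (at w)"
    unfolding FF_def fst_conv snd_conv \<gamma>_def[symmetric]
    by (intro has_derivative_mult_right has_derivative_add has_derivative_mult dA dB)
  from fun_cong[OF has_derivative_unique[OF 1 this], of "(0, \<delta>)"] R
  have "ch.vol p y * (der (Af T p t y) w (0, \<delta>) + der (Bf T p t y) w (0, \<delta>) * \<gamma> (fst w)) = ch.vol p y * (- der Pc (snd w) \<delta> * ch.divc p Z y)"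
    using linear_0[OF g] by (simp add: mult_ac)
  moreover have n: "ch.vol p y \<noteq> 0" using ch.vol_pos[of p y] by simp
  ultimately show ?thesis unfolding mult_left_cancel[OF n] \<gamma>_def by blast
qed

end

end


text \<open>If \<open>f x \<noteq> 0\<close>, continuity gives an open set without zeros of
  \<open>f\<close>, and \<open>h\<close> is nonzero somewhere on it. This is how derivatives of the
  pressure are cancelled.\<close>

lemma generically_nonzero_zero:
  assumes h: "generically_nonzero D h" and D: "open D" and f: "continuous_on D f" and z: "\<And>x. x \<in> D \<Longrightarrow> h x * f x = (0::real)"
    and x: "x \<in> D"
  shows "f x = 0"
proof (rule ccontr)
  assume "f x \<noteq> 0"
  define V where "V = {x \<in> D. f x \<noteq> 0}"
  have "open (D \<inter> f -` (- {0}))" by (rule continuous_open_preimage[OF f D]) auto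
  moreover have "D \<inter> f -` (- {0}) = V" by (auto simp: V_def)
  ultimately have "open V" by simp
  moreover have "x \<in> V" using x \<open>f x \<noteq> 0\<close> by (simp add: V_def)
  ultimately obtain z where "z \<in> V" "h z \<noteq> 0" using h unfolding generically_nonzero_def V_def by blast
  then show False using z[of z] by (auto simp: V_def)
qed

lemma const_deriv_zero:
  fixes f :: "real \<Rightarrow> real"
  assumes "convex A" "\<And>x. x \<in> A \<Longrightarrow> (f has_real_derivative 0) (at x)" "a \<in> A" "b \<in> A"
  shows "f a = f b"
  using has_field_derivative_zero_constant[OF assms(1), of f] assms has_field_derivative_at_within by metis

lemma const_on_line:
  fixes f :: "'a::euclidean_space \<Rightarrow> real"
  assumes f: "smooth_on V f" "open V" and A: "convex A" "a \<in> A" "b \<in> A" and \<gamma>: "\<And>h. h \<in> A \<Longrightarrow> x + h *\<^sub>R v \<in> V"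
    and d: "\<And>h. h \<in> A \<Longrightarrow> der f (x + h *\<^sub>R v) v = 0"
  shows "f (x + a *\<^sub>R v) = f (x + b *\<^sub>R v)"
proof (rule const_deriv_zero[OF A(1) _ A(2,3)])
  show "((\<lambda>h. f (x + h *\<^sub>R v)) has_real_derivative 0) (at h)" if "h \<in> A" for h
    using has_vector_derivative_line[OF f \<gamma>[OF that], of UNIV] d[OF that]
    by (simp add: has_real_derivative_iff_has_vector_derivative)
qed

section \<open>Dependence of a conserved density on the velocity\<close>

locale fluid_eos = fluid M I J P for M :: "('m::{t2_space, second_countable_topology}, 'n::finite) riemannian" and I J P +
  assumes n: "CARD('n) > 1" and eos: "equation_of_state I J P"
begin

text \<open>The first alternative of \<open>equation_of_state\<close>; otherwise the pressure is a
  function of the entropy alone.\<close>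

definition gen_r where "gen_r \<longleftrightarrow> generically_nonzero (I \<times> J) (\<lambda>q. der Pc q (1, 0))"

lemma der_Pc:
  assumes "r \<in> I" "s \<in> J"
  shows "((\<lambda>r'. P r' s) has_real_derivative der Pc (r, s) (1, 0)) (at r)" "((\<lambda>s'. P r s') has_real_derivative der Pc (r, s) (0, 1)) (at s)"
proof -
  have l: "linear (der Pc (r, s))" using smooth_linear_der[OF P open_IJ] assms by auto
  have e: "(\<lambda>h. der Pc (r, s) (h *\<^sub>R k)) = (*) (der Pc (r, s) k)" for k
    by (simp add: fun_eq_iff linear_cmul[OF l])
  have z: "(r, s) \<in> I \<times> J" using assms by simp
  note d = der_Pair_smooth[OF P open_IJ z, unfolded e[of "(1, 0)", simplified] e[of "(0, 1)", simplified] prod.case]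
  show "((\<lambda>r'. P r' s) has_real_derivative der Pc (r, s) (1, 0)) (at r)" "((\<lambda>s'. P r s') has_real_derivative der Pc (r, s) (0, 1)) (at s)"
    using d unfolding has_field_derivative_def by blast+
qed

lemma generically_cong: "(\<And>z. z \<in> D \<Longrightarrow> f z = g z) \<Longrightarrow> generically_nonzero D f \<Longrightarrow> generically_nonzero D g"
  unfolding generically_nonzero_def by (metis subsetD)

lemma eos_cases: "gen_r \<or> (\<forall>q\<in>I \<times> J. der Pc q (1, 0) = 0) \<and> generically_nonzero (I \<times> J) (\<lambda>q. der Pc q (0, 1))"
proof -
  have d: "deriv (\<lambda>r'. P r' s) r = der Pc (r, s) (1, 0)" "deriv (\<lambda>s'. P r s') s = der Pc (r, s) (0, 1)" if "r \<in> I" "s \<in> J" for r s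
    using der_Pc[OF that] DERIV_imp_deriv by auto
  from eos show ?thesis
    unfolding equation_of_state_def
  proof (elim conjE disjE)
    assume "generically_nonzero (I \<times> J) (\<lambda>(r, s). deriv (\<lambda>r'. P r' s) r)"
    then show ?thesis
      by (intro disjI1, unfold gen_r_def, elim generically_cong[rotated]) (auto simp: d)
  next
    assume a: "\<forall>r\<in>I. \<forall>s\<in>J. deriv (\<lambda>r'. P r' s) r = 0" "generically_nonzero (I \<times> J) (\<lambda>(r, s). deriv (\<lambda>s'. P r s') s)"
    have "generically_nonzero (I \<times> J) (\<lambda>q. der Pc q (0, 1))"
      by (rule generically_cong[OF _ a(2)]) (auto simp: d)
    moreover have "\<forall>q\<in>I \<times> J. der Pc q (1, 0) = 0" using a(1) d by auto
    ultimately show ?thesis by blast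
  qed
qed

lemma ex_interior: obtains r1 s1 where "r1 \<in> I" "s1 \<in> J"
  using I J that unfolding open_interval_def by blast

context
  fixes p :: 'm and y :: "real ^ 'n" and N :: "(real ^ 'n) \<times> real \<times> real \<Rightarrow> real" and B and S
  assumes y: "y \<in> cimg M p" and N: "smooth_on \<Omega> N"
  defines "B \<equiv> \<lambda>w. N w - fst (snd w) * der N w (0, 1, 0)" and "S \<equiv> \<lambda>a w. der N w (a, 0, 0) / fst (snd w)"
  assumes first': "\<forall>w\<in>\<Omega>. \<forall>a \<xi> \<eta>. der B w \<eta> * gp p y a (fst \<xi>) - der (S a) w \<eta> * der Pc (snd w) (snd \<xi>) =
    der B w \<xi> * gp p y a (fst \<eta>) - der (S a) w \<xi> * der Pc (snd w) (snd \<eta>)"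
begin

lemma first: "w \<in> \<Omega> \<Longrightarrow> der B w \<eta> * gp p y a (fst \<xi>) - der (S a) w \<eta> * der Pc (snd w) (snd \<xi>) =
    der B w \<xi> * gp p y a (fst \<eta>) - der (S a) w \<xi> * der Pc (snd w) (snd \<eta>)"
  using first' by blast

lemma sN: "smooth_on \<Omega> (\<lambda>w. der N w h)" by (intro smooth_der open_\<Omega> N smooth_const)

lemma sB: "smooth_on \<Omega> B" unfolding B_def
  by (intro smooth_diff smooth_mult smooth_fst smooth_snd smooth_id open_\<Omega> N sN)

lemma sS: "smooth_on \<Omega> (S a)" unfolding S_def
  by (intro smooth_divide smooth_fst smooth_snd smooth_id open_\<Omega> sN) (use pos_I in fastforce)

lemma der_Pc_0: "w \<in> \<Omega> \<Longrightarrow> der Pc (snd w) 0 = 0"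
  by (rule linear_0[OF smooth_linear_der[OF P open_IJ]]) auto

text \<open>Dimension at least 2 enters here: there is a nonzero \<open>a\<close> orthogonal to
  \<open>e\<close>, and the symmetry condition for the velocity directions \<open>e\<close> and
  \<open>a\<close> then has a vanishing right side.\<close>

lemma B_v:
  assumes w: "w \<in> \<Omega>" shows "der B w (e, 0, 0) = 0"
proof -
  let ?g = "gp p y"
  note gl = linear_add[OF ch.lin1[OF y]] linear_cmul[OF ch.lin1[OF y]] linear_diff[OF ch.lin1[OF y]]
  obtain i j :: 'n where ij: "i \<noteq> j"
    using n card_le_Suc0_iff_eq[of "UNIV :: 'n set"] by auto
  have "\<exists>a. a \<noteq> 0 \<and> ?g a e = 0"
  proof (cases "?g (axis i 1) e = 0")
    case True
    moreover have "axis i 1 \<noteq> (0 :: real ^ 'n)" by (simp add: axis_eq_0_iff)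
    ultimately show ?thesis by blast
  next
    case False
    \<comment> \<open>Orthogonal to \<open>e\<close> by construction, and nonzero because its
      \<open>j\<close>-th component is \<open>- ?g (axis i 1) e\<close>.\<close>
    let ?a = "?g (axis j 1) e *\<^sub>R axis i 1 - ?g (axis i 1) e *\<^sub>R axis j (1::real)"
    have "?a $ j \<noteq> 0" using False ij by (simp add: axis_def)
    then have "?a \<noteq> 0" by (metis zero_index)
    moreover have "?g ?a e = 0" by (simp add: gl)
    ultimately show ?thesis by blast
  qed
  then obtain a where a: "a \<noteq> 0" "?g a e = 0" by blast
  have "der B w (e, 0, 0) * ?g a a = der B w (a, 0, 0) * ?g a e"
    using first[OF w, of "(e, 0, 0)" a "(a, 0, 0)"] der_Pc_0[OF w] by (simp add: zero_prod_def)
  then show ?thesis using ch.pos[OF y a(1)] a(2) by simp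
qed

lemma S_v: "w \<in> \<Omega> \<Longrightarrow> der (S a) w (e, 0, 0) * der Pc (snd w) k = - der B w (0, k) * gp p y a e"
  using first[of w "(0, k)" a "(e, 0, 0)"] der_Pc_0[of w] linear_0[OF ch.lin2[OF y]] by (simp add: zero_prod_def)

text \<open>By \<open>B_v\<close> the expression \<open>N - r N_r\<close> does not depend on the
  velocity; differentiated in \<open>v\<close>, this says that \<open>N_v / r\<close> does not
  depend on \<open>r\<close>.\<close>

lemma S_r:
  assumes w: "w \<in> \<Omega>" shows "der (S a) w (0, 1, 0) = 0"
proof -
  have r0: "fst (snd w) \<noteq> 0" using pos_I w by fastforce
  have d1: "((\<lambda>w. der N w h) has_derivative der (\<lambda>w. der N w h) w) (at w)" for h
    by (rule smooth_has_derivative[OF sN open_\<Omega> w])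
  have hr: "((\<lambda>w::(real ^ 'n) \<times> real \<times> real. fst (snd w)) has_derivative (\<lambda>\<eta>. fst (snd \<eta>))) (at w)"
    by (intro has_derivative_fst has_derivative_snd has_derivative_ident)
  have "(B has_derivative (\<lambda>\<eta>. der N w \<eta> - (fst (snd w) * der (\<lambda>w. der N w (0, 1, 0)) w \<eta> + fst (snd \<eta>) * der N w (0, 1, 0)))) (at w)"
    unfolding B_def by (intro has_derivative_diff has_derivative_mult smooth_has_derivative[OF N open_\<Omega> w] hr d1)
  from fun_cong[OF der_eq[OF this], of "(a, 0, 0)"] B_v[OF w, of a]
  have 1: "der N w (a, 0, 0) = fst (snd w) * der (\<lambda>w. der N w (0, 1, 0)) w (a, 0, 0)" by simp
  have "(S a has_derivative (\<lambda>\<eta>. (der (\<lambda>w. der N w (a, 0, 0)) w \<eta> * fst (snd w) - der N w (a, 0, 0) * fst (snd \<eta>)) / (fst (snd w) * fst (snd w)))) (at w)"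
    unfolding S_def by (rule has_derivative_divide'[OF d1 hr r0])
  from fun_cong[OF der_eq[OF this], of "(0, 1, 0)"] show ?thesis
    using 1 der_swap[OF open_\<Omega> w N, of "(a, 0, 0)" "(0, 1, 0)"] by simp
qed

lemma S_s: "w \<in> \<Omega> \<Longrightarrow> der Pc (snd w) (1, 0) * der (S a) w (0, 0, 1) = 0"
  using first[of w "(0, 0, 1)" a "(0, 1, 0)"] S_r[of w a] linear_0[OF ch.lin2[OF y]] by auto

lemma S_const_r:
  assumes "r \<in> I" "r' \<in> I" "s \<in> J" shows "S a (v, r, s) = S a (v, r', s)"
  using const_on_line[OF sS open_\<Omega> conv_I assms(1,2), of "(v, 0, s)" "(0, 1, 0)" a] S_r assms by simp

lemma smooth_der_S: "smooth_on (I \<times> J) (\<lambda>q. der (S a) (v, q) h)"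
  by (rule smooth_der_compose[OF open_IJ _ smooth_Pair[OF open_IJ smooth_const[OF open_IJ] smooth_id[OF open_IJ]]
      open_\<Omega> sS smooth_const[OF open_IJ]]) auto

text \<open>\<open>S_s\<close> gives the vanishing of the entropy derivative only after
  multiplication by \<open>P_r\<close>; genericity removes the factor.\<close>

lemma S_const_s:
  assumes "r \<in> I" "s \<in> J" "s' \<in> J" and A: "gen_r" shows "S a (v, r, s) = S a (v, r, s')"
proof -
  have "der (S a) (v, r, s) (0, 0, 1) = 0" if "r \<in> I" "s \<in> J" for r s
  proof -
    let ?f = "\<lambda>q. der (S a) (v, q) (0, 0, 1)"
    note c = smooth_continuous_on[OF smooth_der_S open_IJ]
    have "?f (r, s) = 0"
      by (rule generically_nonzero_zero[OF A[unfolded gen_r_def] open_IJ c]) (use S_s[of "(v, _)" a] that in auto)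
    then show ?thesis .
  qed
  then show ?thesis
    using const_on_line[OF sS open_\<Omega> conv_J assms(2,3), of "(v, r, 0)" "(0, 0, 1)" a] assms by simp
qed

lemma B_const_v: "w \<in> \<Omega> \<Longrightarrow> B w = B (0, snd w)"
  using const_on_line[OF sB open_\<Omega> convex_UNIV, of 1 0 "(0, snd w)" "(fst w, 0, 0)"] B_v by (cases w) auto

lemma B_der_const:
  assumes "q \<in> I \<times> J" shows "der B (v, q) (0, k) = der B (0, q) (0, k)"
proof -
  have z: "(v, q) \<in> \<Omega>" "(0, q) \<in> \<Omega>" using assms by auto
  have "((\<lambda>q. B (v, q)) has_derivative (\<lambda>k. der B (v, q) (0, k))) (at q)"
    by (rule der_Pair_smooth(1)[OF sB open_\<Omega> z(1)])
  then have "((\<lambda>q. B (0, q)) has_derivative (\<lambda>k. der B (v, q) (0, k))) (at q)"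
  proof (rule has_derivative_transform_within_open[OF _ open_IJ assms])
    show "B (v, q) = B (0, q)" if "q \<in> I \<times> J" for q
      using B_const_v[of "(v, q)"] that by simp
  qed
  from fun_cong[OF has_derivative_unique[OF this der_Pair_smooth(1)[OF sB open_\<Omega> z(2)]], of k] show ?thesis .
qed

text \<open>After multiplication by a derivative of the pressure, \<open>S_v\<close> expresses both
  sides through the same derivative of \<open>B\<close>. Read with \<open>b\<close> fixed: the
  velocity Hessian of \<open>N / r\<close> is a multiple of the metric, with a factor that does not
  depend on \<open>v\<close>.\<close>

lemma S_vv:
  assumes r: "r \<in> I" and s: "s \<in> J"
  shows "der (S a) (v, r, s) (e, 0, 0) * gp p y b b = der (S b) (0, r, s) (b, 0, 0) * gp p y a e"
proof -
  obtain k where k: "generically_nonzero (I \<times> J) (\<lambda>q. der Pc q k)"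
    using eos_cases unfolding gen_r_def by blast
  let ?f = "\<lambda>q. der (S a) (v, q) (e, 0, 0) * gp p y b b - der (S b) (0, q) (b, 0, 0) * gp p y a e"
  have c: "continuous_on (I \<times> J) ?f"
    by (rule smooth_continuous_on[OF _ open_IJ], intro smooth_diff smooth_mult smooth_const smooth_der_S open_IJ)
  have "?f (r, s) = 0"
  proof (rule generically_nonzero_zero[OF k open_IJ c])
    fix q assume q: "q \<in> I \<times> J"
    then have "der (S a) (v, q) (e, 0, 0) * der Pc q k = - der B (0, q) (0, k) * gp p y a e"
      "der (S b) (0, q) (b, 0, 0) * der Pc q k = - der B (0, q) (0, k) * gp p y b b"
      using S_v[of "(v, q)" a e k] S_v[of "(0, q)" b b k] B_der_const[OF q, of v k] by auto
    then show "der Pc q k * ?f q = 0" by (simp add: algebra_simps)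
  qed (use r s in auto)
  then show ?thesis by simp
qed

text \<open>By \<open>S_vv\<close> the velocity gradient of \<open>N / r\<close> is affine in
  \<open>v\<close> with linear part \<open>c g\<close>. Integration along the ray from 0 to
  \<open>v\<close> gives the kinetic and the momentum term; the rest is the value at
  \<open>v = 0\<close>.\<close>

lemma density_structure:
  "\<exists>c \<zeta>. (\<forall>v a. \<forall>r\<in>I. \<forall>s\<in>J. der N (v, r, s) (a, 0, 0) = r * (c s * gp p y v a + gp p y (\<zeta> s) a)) \<and>
     (\<forall>v. \<forall>r\<in>I. \<forall>s\<in>J. N (v, r, s) = r * (1/2 * c s * gp p y v v + gp p y (\<zeta> s) v) + N (0, r, s)) \<and>
     (\<forall>v \<delta>. \<forall>r\<in>I. \<forall>s\<in>J. der B (v, r, s) (0, \<delta>) = - c s * der Pc (r, s) \<delta>) \<and>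
     (gen_r \<longrightarrow> (\<forall>s\<in>J. \<forall>s'\<in>J. c s = c s' \<and> \<zeta> s = \<zeta> s'))"
proof -
  obtain r1 s1 where r1: "r1 \<in> I" and s1: "s1 \<in> J" using ex_interior .
  let ?g = "gp p y"
  define b where "b = (axis undefined 1 :: real ^ 'n)"
  have b: "?g b b > 0" by (rule ch.pos[OF y]) (simp add: b_def axis_eq_0_iff)
  \<comment> \<open>Read off at the reference density \<open>r1\<close>; by \<open>S_const_r\<close>
    every other density gives the same.\<close>
  define c where "c s = der (S b) (0, r1, s) (b, 0, 0) / ?g b b" for s
  define \<zeta> where "\<zeta> s = ch.sharp p y (\<lambda>a. S a (0, r1, s))" for s
  have lS: "linear (\<lambda>a. S a w)" if w: "w \<in> \<Omega>" for w
  proof -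
    have l: "linear (der N w)" by (rule smooth_linear_der[OF N open_\<Omega> w])
    show ?thesis unfolding S_def
      using linear_add[OF l, of "(_, 0, 0)" "(_, 0, 0)"] linear_cmul[OF l, of _ "(_, 0, 0)"]
      by (intro linearI) (simp_all add: add_divide_distrib)
  qed
  have \<zeta>: "?g (\<zeta> s) a = S a (0, r1, s)" if "s \<in> J" for s a
    unfolding \<zeta>_def by (rule ch.G_sharp[OF y lS]) (use r1 that in auto)
  have cr: "der (S b) (0, r, s) (b, 0, 0) = c s * ?g b b" if "r \<in> I" "s \<in> J" for r s
  proof -
    have z: "(0, r, s) \<in> \<Omega>" "(0, r1, s) \<in> \<Omega>" using that r1 by auto
    have "(\<lambda>v. S b (v, r, s)) = (\<lambda>v. S b (v, r1, s))" using S_const_r[OF that(1) r1 that(2)] by auto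
    then have "der (S b) (0, r, s) (b, 0) = der (S b) (0, r1, s) (b, 0)"
      using has_derivative_unique[OF der_Pair_smooth(2)[OF sS open_\<Omega> z(1), of b] _, of "\<lambda>h. der (S b) (0, r1, s) (h, 0)"]
        der_Pair_smooth(2)[OF sS open_\<Omega> z(2), of b] by (simp add: fun_eq_iff)
    then show ?thesis using b by (simp add: c_def zero_prod_def)
  qed
  have S_lin: "S a (v, r, s) = c s * ?g v a + ?g (\<zeta> s) a" if rs: "r \<in> I" "s \<in> J" for a v r s
  proof -
    define f where "f w = S a w - c s * ?g (fst w) a" for w
    have "linear (\<lambda>v. ?g v a)" by (rule ch.lin1[OF y])
    then have bl: "bounded_linear (\<lambda>v. ?g v a)" by (simp add: linear_conv_bounded_linear)
    have f: "smooth_on \<Omega> f" unfolding f_def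
      by (intro smooth_diff smooth_mult smooth_const open_\<Omega> sS smooth_bounded_linear[OF bl] smooth_fst smooth_id)
    have df: "der f (h, r, s) (v, 0, 0) = 0" for h
    proof -
      have z: "(h, r, s) \<in> \<Omega>" using rs by simp
      have "(f has_derivative (\<lambda>\<eta>. der (S a) (h, r, s) \<eta> - c s * ?g (fst \<eta>) a)) (at (h, r, s))" unfolding f_def
        by (intro has_derivative_diff has_derivative_mult_right smooth_has_derivative[OF sS open_\<Omega> z]
            bounded_linear.has_derivative[OF bl] has_derivative_fst has_derivative_ident)
      from fun_cong[OF der_eq[OF this], of "(v, 0, 0)"] show ?thesis
        using S_vv[OF rs, of a h v b] cr[OF rs] b ch.sym[OF y, of v a] by simp
    qed
    have "f (v, r, s) = f (0, r, s)"
      using const_on_line[OF f open_\<Omega> convex_UNIV, of 1 0 "(0, r, s)" "(v, 0, 0)"] df rs by simp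
    then show ?thesis
      using \<zeta>[OF rs(2), of a] S_const_r[OF rs(1) r1 rs(2), of a 0] linear_0[OF ch.lin1[OF y]] by (simp add: f_def)
  qed
  have dN: "der N (v, r, s) (a, 0, 0) = r * (c s * ?g v a + ?g (\<zeta> s) a)" if "r \<in> I" "s \<in> J" for v r s a
    using S_lin[OF that, of a v] pos_I[OF that(1)] by (simp add: S_def field_simps)
  have Nv: "N (v, r, s) = r * (1/2 * c s * ?g v v + ?g (\<zeta> s) v) + N (0, r, s)" if rs: "r \<in> I" "s \<in> J" for v r s
  proof -
    have "((\<lambda>h. N (h *\<^sub>R v, r, s) - r * (1/2 * h\<^sup>2 * c s * ?g v v + h * ?g (\<zeta> s) v)) has_derivative (\<lambda>t. 0)) (at h within UNIV)" for h
    proof -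
      have z: "(h *\<^sub>R v, r, s) \<in> \<Omega>" using rs by simp
      have "((\<lambda>h. N (h *\<^sub>R v, r, s)) has_derivative (\<lambda>t. der N (h *\<^sub>R v, r, s) (t *\<^sub>R v, 0, 0))) (at h)"
        by (rule has_derivative_compose[where f="\<lambda>h. (h *\<^sub>R v, r, s)", OF _ smooth_has_derivative[OF N open_\<Omega> z]])
          (auto intro!: derivative_eq_intros simp: zero_prod_def)
      then have "((\<lambda>h. N (h *\<^sub>R v, r, s)) has_derivative (\<lambda>t. t * (r * (c s * h * ?g v v + ?g (\<zeta> s) v)))) (at h)"
        unfolding dN[OF rs] by (simp add: linear_cmul[OF ch.lin1[OF y]] linear_cmul[OF ch.lin2[OF y]] algebra_simps)
      moreover have "((\<lambda>h. r * (1/2 * h\<^sup>2 * c s * ?g v v + h * ?g (\<zeta> s) v)) has_derivative (\<lambda>t. t * (r * (c s * h * ?g v v + ?g (\<zeta> s) v)))) (at h)"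
        by (auto intro!: derivative_eq_intros simp: algebra_simps fun_eq_iff)
      ultimately show ?thesis using has_derivative_diff by fastforce
    qed
    from has_derivative_zero_constant[OF convex_UNIV this] obtain C where
      "\<And>h. N (h *\<^sub>R v, r, s) - r * (1/2 * h\<^sup>2 * c s * ?g v v + h * ?g (\<zeta> s) v) = C" by auto
    from this[of 0] this[of 1] show ?thesis by simp
  qed
  have dB: "der B (v, r, s) (0, \<delta>) = - c s * der Pc (r, s) \<delta>" if rs: "r \<in> I" "s \<in> J" for v r s \<delta>
  proof -
    have "?g b b * (der B (0, r, s) (0, \<delta>) + c s * der Pc (r, s) \<delta>) = 0"
      using S_v[of "(0, r, s)" b b \<delta>] cr[OF rs] rs by (simp add: algebra_simps)
    then show ?thesis using b rs B_der_const[of "(r, s)" v \<delta>] by simp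
  qed
  have "c s = c s' \<and> \<zeta> s = \<zeta> s'" if A: gen_r and ss: "s \<in> J" "s' \<in> J" for s s'
  proof
    have \<zeta>e: "(\<lambda>a. S a (v, r1, s)) = (\<lambda>a. S a (v, r1, s'))" for v using S_const_s[OF r1 ss A] by auto
    then show "\<zeta> s = \<zeta> s'" unfolding \<zeta>_def by simp
    have "c s * ?g b b + ?g (\<zeta> s) b = c s' * ?g b b + ?g (\<zeta> s') b"
      using S_lin[OF r1 ss(1), of b b] S_lin[OF r1 ss(2), of b b] S_const_s[OF r1 ss A, of b b] by simp
    with \<open>\<zeta> s = \<zeta> s'\<close> b show "c s = c s'" by simp
  qed
  then show ?thesis using dN Nv dB by blast
qed

end

end


section \<open>The coefficients of a density as functions of time, place and entropy\<close>

context coord_metric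
begin

lemma liec_polarize:
  assumes y: "y \<in> U" and X: "linear (der X y)" and L: "\<And>v. liec X y v v = c * G y v v"
  shows "liec X y v w = c * G y v w"
proof -
  have sy: "liec X y v w = liec X y w v" for v w
    unfolding liec_def using sym[OF y] dG_sym[OF y] by simp
  have "liec X y (v + w) (v + w) = liec X y v v + liec X y w w + 2 * liec X y v w"
    using sy[of v w] unfolding liec_def by (simp add: linear_add[OF X] G_simps[OF y] dG_simps[OF y] algebra_simps)
  then show ?thesis unfolding L by (simp add: G_simps[OF y] sym[OF y, of w v] algebra_simps)
qed

end

context fluid_eos
begin

definition r1 where "r1 = (SOME r. r \<in> I)"

lemma r1: "r1 \<in> I" unfolding r1_def using ex_interior by (metis someI)

text \<open>\<open>density_structure\<close> yields coefficients at each point separately.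
  Recovering them from \<open>T\<close> itself, \<open>cT\<close> as a second difference in the
  velocity and \<open>zT\<close> from the odd part, defines them globally and gives their
  smoothness.\<close>

definition cT :: "('m, 'n) density \<Rightarrow> real \<Rightarrow> 'm \<Rightarrow> real \<Rightarrow> real" where
  "cT T t x s = (T t x (axis undefined 1) r1 s + T t x (- axis undefined 1) r1 s - 2 * T t x 0 r1 s) /
      (r1 * metric M x (axis undefined 1) (axis undefined 1))"

definition zT :: "('m, 'n) density \<Rightarrow> real \<Rightarrow> 'm \<Rightarrow> real \<Rightarrow> real ^ 'n" where
  "zT T t x s = ch.sharp x (cmap M x x) (\<lambda>a. (T t x a r1 s - T t x (- a) r1 s) / (2 * r1))"

context
  fixes T :: "('m, 'n) density"
  assumes T: "conserved T"
begin

lemma kin: "kinematic T" using T unfolding conserved_density_def by blast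

text \<open>The second difference in the velocity removes the momentum term and the rest value, the
  odd part keeps only the momentum; so \<open>cT\<close> and \<open>zT\<close> are the coefficients
  that \<open>density_structure\<close> provides in the chart centred at \<open>x\<close>.\<close>

lemma structure_at:
  fixes t :: real and x :: 'm
  shows "r \<in> I \<Longrightarrow> s \<in> J \<Longrightarrow> T t x v r s = r * (1/2 * cT T t x s * metric M x v v + metric M x (zT T t x s) v) + T t x 0 r s" (is "_ \<Longrightarrow> _ \<Longrightarrow> ?A v r s")
    and "r \<in> I \<Longrightarrow> s \<in> J \<Longrightarrow> der (Bf T x t (cmap M x x)) (v, r, s) (0, \<delta>) = - cT T t x s * der Pc (r, s) \<delta>" (is "_ \<Longrightarrow> _ \<Longrightarrow> ?B v r s \<delta>")
    and "gen_r \<Longrightarrow> s \<in> J \<Longrightarrow> s' \<in> J \<Longrightarrow> cT T t x s = cT T t x s' \<and> zT T t x s = zT T t x s'" (is "_ \<Longrightarrow> _ \<Longrightarrow> _ \<Longrightarrow> ?C s s'")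
proof -
  let ?y = "cmap M x x"
  have y: "?y \<in> cimg M x" by simp
  define N where "N = (\<lambda>w. That T x (t, ?y, w))"
  have sN: "smooth_on \<Omega> N" unfolding N_def
    by (rule smooth_compose[OF open_\<Omega> open_dom _ _ smooth_That[OF kin]])
      (auto intro!: smooth_intros open_\<Omega>)
  have dN: "der N w \<eta> = der (That T x) (t, ?y, w) (0, 0, \<eta>)" if "w \<in> \<Omega>" for w \<eta>
  proof -
    have z: "(t, ?y, w) \<in> UNIV \<times> cimg M x \<times> \<Omega>" using that by simp
    have "((\<lambda>w. (t, ?y, w)) has_derivative (\<lambda>\<eta>. (0, 0, \<eta>))) (at w)" by (auto intro!: derivative_eq_intros)
    from has_derivative_compose[OF this smooth_has_derivative[OF smooth_That[OF kin] open_dom z]]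
    have "(N has_derivative (\<lambda>\<eta>. der (That T x) (t, ?y, w) (0, 0, \<eta>))) (at w)" unfolding N_def .
    from fun_cong[OF der_eq[OF this]] show ?thesis .
  qed
  define B where "B = (\<lambda>w. N w - fst (snd w) * der N w (0, 1, 0))"
  define S where "S = (\<lambda>a w. der N w (a, 0, 0) / fst (snd w))"
  have dB: "der B w = der (Bf T x t ?y) w" if w: "w \<in> \<Omega>" for w
    by (rule der_cong[OF open_\<Omega> w]) (simp add: B_def Bf_def dN, simp add: N_def)
  have dS: "der (S a) w = der (Sf T x t ?y a) w" if w: "w \<in> \<Omega>" for w a
    by (rule der_cong[OF open_\<Omega> w]) (simp add: S_def Sf_def dN)
  have first: "\<forall>w\<in>\<Omega>. \<forall>a \<xi> \<eta>. der B w \<eta> * gp x ?y a (fst \<xi>) - der (S a) w \<eta> * der Pc (snd w) (snd \<xi>) =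
    der B w \<xi> * gp x ?y a (fst \<eta>) - der (S a) w \<xi> * der Pc (snd w) (snd \<eta>)"
  proof (intro ballI allI)
    fix w a \<xi> \<eta> assume w: "w \<in> \<Omega>"
    show "der B w \<eta> * gp x ?y a (fst \<xi>) - der (S a) w \<eta> * der Pc (snd w) (snd \<xi>) =
      der B w \<xi> * gp x ?y a (fst \<eta>) - der (S a) w \<xi> * der Pc (snd w) (snd \<eta>)"
      unfolding dB[OF w] dS[OF w] by (rule EL_first[OF T y w])
  qed
  obtain c \<zeta> where c: "\<forall>v. \<forall>r\<in>I. \<forall>s\<in>J. N (v, r, s) = r * (1/2 * c s * gp x ?y v v + gp x ?y (\<zeta> s) v) + N (0, r, s)"
    "\<forall>v \<delta>. \<forall>r\<in>I. \<forall>s\<in>J. der B (v, r, s) (0, \<delta>) = - c s * der Pc (r, s) \<delta>"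
    "gen_r \<longrightarrow> (\<forall>s\<in>J. \<forall>s'\<in>J. c s = c s' \<and> \<zeta> s = \<zeta> s')"
    using density_structure[OF y sN first[unfolded B_def S_def]] unfolding B_def [symmetric]
    by (elim exE conjE) (rule that; assumption)
  let ?g = "metric M x"
  have NT: "T t x v r s = r * (1/2 * c s * ?g v v + ?g (\<zeta> s) v) + T t x 0 r s" if "r \<in> I" "s \<in> J" for v r s
    using c(1)[rule_format, OF that, of v] unfolding N_def That_center gp_center .
  have r0: "r1 > 0" using pos_I[OF r1] .
  have gneg: "?g (- v) w = - ?g v w" "?g w (- v) = - ?g w v" for v w
    using linear_neg[OF linear_metric(1)] linear_neg[OF linear_metric(2)] by auto
  have cT: "cT T t x s = c s" if "s \<in> J" for s
  proof -
    have "?g (axis undefined 1) (axis undefined 1) > 0" by (rule metric_pos) (simp add: axis_eq_0_iff)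
    then show ?thesis
      unfolding cT_def NT[OF r1 that, of "axis undefined 1"] NT[OF r1 that, of "- axis undefined 1"] gneg
      using r0 by (simp add: field_simps)
  qed
  have zT: "zT T t x s = \<zeta> s" if "s \<in> J" for s
    unfolding zT_def
  proof (rule ch.sharp_unique[OF y])
    fix a show "gp x ?y (\<zeta> s) a = (T t x a r1 s - T t x (- a) r1 s) / (2 * r1)"
      unfolding NT[OF r1 that, of a] NT[OF r1 that, of "- a"] gneg using r0 by (simp add: field_simps)
  qed
  show "r \<in> I \<Longrightarrow> s \<in> J \<Longrightarrow> ?A v r s" using NT[of r s v] cT zT by (simp only:)
  show "r \<in> I \<Longrightarrow> s \<in> J \<Longrightarrow> ?B v r s \<delta>" using c(2)[rule_format, of r s v \<delta>] cT dB[of "(v, r, s)"] by simp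
  show "gen_r \<Longrightarrow> s \<in> J \<Longrightarrow> s' \<in> J \<Longrightarrow> ?C s s'" using c(3)[rule_format, of s s'] cT[of s] cT[of s'] zT[of s] zT[of s'] by argo
qed

lemma That_structure:
  assumes y: "y \<in> cimg M p" and rs: "r \<in> I" "s \<in> J"
  shows "That T p (t, y, v, r, s) = r * (1/2 * cT T t (cinv M p y) s * gp p y v v + gp p y (vcomp M p (\<lambda>x. zT T t x s) y) v) + T t (cinv M p y) 0 r s"
proof -
  define x where "x = cinv M p y"
  let ?J = "transition M p x x"
  have "That T p (t, y, v, r, s) = T t x (?J v) r s" by (simp add: That_def x_def)
  also have "\<dots> = r * (1/2 * cT T t x s * metric M x (?J v) (?J v) + metric M x (zT T t x s) (?J v)) + T t x 0 r s"
    by (rule structure_at(1)[OF rs])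
  also have "metric M x (?J v) (?J v) = gp p y v v" by (rule metric_J[OF y x_def refl])
  also have "metric M x (zT T t x s) (?J v) = gp p y (vcomp M p (\<lambda>x. zT T t x s) y) v"
    using metric_J[OF y x_def refl, of "vcomp M p (\<lambda>x. zT T t x s) y" v] vcomp_J(2)[OF y x_def refl, of "\<lambda>x. zT T t x s"] by simp
  finally show ?thesis unfolding x_def .
qed

abbreviation "tyJ p \<equiv> UNIV \<times> cimg M p \<times> J :: (real \<times> (real ^ 'n) \<times> real) set"

lemma open_tyJ: "open (tyJ p)" by (intro open_Times open_UNIV open_cimg open_J)

lemma smooth_That_comp:
  assumes "open V" "smooth_on V a" "smooth_on V b" "smooth_on V c" "smooth_on V d" "smooth_on V e"
    "\<And>z. z \<in> V \<Longrightarrow> b z \<in> cimg M p \<and> d z \<in> I \<and> e z \<in> J"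
  shows "smooth_on V (\<lambda>z. That T p (a z, b z, c z, d z, e z))"
  by (rule smooth_compose[OF assms(1) open_dom _ _ smooth_That[OF kin]])
    (use assms in \<open>auto intro!: smooth_Pair\<close>)

lemma smooth_cT: "smooth_on (tyJ p) (\<lambda>(t, y, s). cT T t (cinv M p y) s)"
proof -
  let ?e = "axis undefined 1 :: real ^ 'n"
  have pr: "smooth_on (tyJ p) (\<lambda>z. fst z)" "smooth_on (tyJ p) (\<lambda>z. fst (snd z))" "smooth_on (tyJ p) (\<lambda>z. snd (snd z))"
    by (intro smooth_intros open_tyJ)+
  have s: "smooth_on (tyJ p) (\<lambda>z. That T p (fst z, fst (snd z), v, r1, snd (snd z)))" for v
    by (rule smooth_That_comp[OF open_tyJ pr(1,2) smooth_const[OF open_tyJ] smooth_const[OF open_tyJ] pr(3)]) (use r1 in auto)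
  have g: "smooth_on (tyJ p) (\<lambda>z. gp p (fst (snd z)) ?e ?e)"
    by (rule ch.smooth_G[OF open_tyJ _ pr(2) smooth_const[OF open_tyJ] smooth_const[OF open_tyJ]]) auto
  have r0: "r1 > 0" using pos_I[OF r1] .
  have g0: "gp p y ?e ?e > 0" if "y \<in> cimg M p" for y by (rule ch.pos[OF that]) (simp add: axis_eq_0_iff)
  have "smooth_on (tyJ p) (\<lambda>z. (That T p (fst z, fst (snd z), ?e, r1, snd (snd z)) + That T p (fst z, fst (snd z), - ?e, r1, snd (snd z)) -
      2 * That T p (fst z, fst (snd z), 0, r1, snd (snd z))) / (r1 * gp p (fst (snd z)) ?e ?e))"
    by (intro smooth_divide smooth_diff smooth_add smooth_mult smooth_const open_tyJ s g) (use r0 g0 in fastforce)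
  then show ?thesis
  proof (rule smooth_cong[OF open_tyJ, rotated])
    fix z assume z: "z \<in> tyJ p"
    then have y: "fst (snd z) \<in> cimg M p" and s: "snd (snd z) \<in> J" by auto
    show "(That T p (fst z, fst (snd z), ?e, r1, snd (snd z)) + That T p (fst z, fst (snd z), - ?e, r1, snd (snd z)) -
      2 * That T p (fst z, fst (snd z), 0, r1, snd (snd z))) / (r1 * gp p (fst (snd z)) ?e ?e) = (\<lambda>(t, y, s). cT T t (cinv M p y) s) z"
      unfolding That_structure[OF y r1 s] case_prod_beta using r0 g0[OF y]
      by (simp add: ch.G_simps[OF y] field_simps)
  qed
qed

lemma smooth_zT: "smooth_on (tyJ p) (\<lambda>(t, y, s). vcomp M p (\<lambda>x. zT T t x s) y)"
proof -
  have pr: "smooth_on (tyJ p) (\<lambda>z. fst z)" "smooth_on (tyJ p) (\<lambda>z. fst (snd z))" "smooth_on (tyJ p) (\<lambda>z. snd (snd z))"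
    by (intro smooth_intros open_tyJ)+
  have s: "smooth_on (tyJ p) (\<lambda>z. That T p (fst z, fst (snd z), v, r1, snd (snd z)))" for v
    by (rule smooth_That_comp[OF open_tyJ pr(1,2) smooth_const[OF open_tyJ] smooth_const[OF open_tyJ] pr(3)]) (use r1 in auto)
  have r0: "r1 > 0" using pos_I[OF r1] .
  let ?a = "\<lambda>z a. (That T p (fst z, fst (snd z), a, r1, snd (snd z)) - That T p (fst z, fst (snd z), - a, r1, snd (snd z))) / (2 * r1)"
  have a: "?a z = gp p (fst (snd z)) (vcomp M p (\<lambda>x. zT T (fst z) x (snd (snd z))) (fst (snd z)))" if z: "z \<in> tyJ p" for z
  proof
    fix a
    have y: "fst (snd z) \<in> cimg M p" and s: "snd (snd z) \<in> J" using z by auto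
    show "?a z a = gp p (fst (snd z)) (vcomp M p (\<lambda>x. zT T (fst z) x (snd (snd z))) (fst (snd z))) a"
      unfolding That_structure[OF y r1 s] using r0 by (simp add: ch.G_simps[OF y] field_simps)
  qed
  have l: "linear (?a z)" if z: "z \<in> tyJ p" for z unfolding a[OF z] by (rule ch.lin2) (use z in auto)
  have "smooth_on (tyJ p) (\<lambda>z. ch.sharp p (fst (snd z)) (?a z))"
    by (rule ch.smooth_sharp[OF open_tyJ _ pr(2) _ l])
      (use r0 in \<open>auto intro!: smooth_divide smooth_diff smooth_const open_tyJ s\<close>)
  then show ?thesis
  proof (rule smooth_cong[OF open_tyJ, rotated])
    fix z assume z: "z \<in> tyJ p"
    then have y: "fst (snd z) \<in> cimg M p" by auto
    show "ch.sharp p (fst (snd z)) (?a z) = (\<lambda>(t, y, s). vcomp M p (\<lambda>x. zT T t x s) y) z"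
      unfolding a[OF z] case_prod_beta by (rule ch.sharp_unique[OF y]) simp
  qed
qed

lemma smooth_zT_vector: "s \<in> J \<Longrightarrow> smooth_vector M (\<lambda>x. zT T t x s)"
  unfolding smooth_vector_def
proof
  fix p assume s: "s \<in> J"
  have "smooth_on (cimg M p) (\<lambda>y. (\<lambda>(t, y, s). vcomp M p (\<lambda>x. zT T t x s) y) (t, y, s))"
    by (rule smooth_compose[OF open_cimg open_tyJ _ _ smooth_zT]) (use s in \<open>auto intro!: smooth_intros open_cimg\<close>)
  then show "smooth_on (cimg M p) (vcomp M p (\<lambda>x. zT T t x s))" by simp
qed

lemma smooth_cT_scalar: "s \<in> J \<Longrightarrow> smooth_scalar M (\<lambda>x. cT T t x s)"
  unfolding smooth_scalar_def
proof
  fix p assume s: "s \<in> J"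
  have "smooth_on (cimg M p) (\<lambda>y. (\<lambda>(t, y, s). cT T t (cinv M p y) s) (t, y, s))"
    by (rule smooth_compose[OF open_cimg open_tyJ _ _ smooth_cT]) (use s in \<open>auto intro!: smooth_intros open_cimg\<close>)
  then show "smooth_on (cimg M p) ((\<lambda>x. cT T t x s) \<circ> cinv M p)" by (simp add: o_def)
qed

lemma smooth_cT_s: "smooth_on J (cT T t x)"
proof -
  have "smooth_on J (\<lambda>s. (\<lambda>(t, y, s). cT T t (cinv M x y) s) (t, cmap M x x, s))"
    by (rule smooth_compose[OF open_J open_tyJ _ _ smooth_cT]) (auto intro!: smooth_intros open_J)
  then show ?thesis by simp
qed

lemma smooth_Q: "r \<in> I \<Longrightarrow> s \<in> J \<Longrightarrow> smooth_on (UNIV \<times> cimg M p) (\<lambda>(t, y). T t (cinv M p y) 0 r s)"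
proof -
  assume rs: "r \<in> I" "s \<in> J"
  have o: "open (UNIV \<times> cimg M p :: (real \<times> (real ^ 'n)) set)" by (intro open_Times open_UNIV open_cimg)
  have "smooth_on (UNIV \<times> cimg M p) (\<lambda>z. That T p (fst z, snd z, 0, r, s))"
    by (rule smooth_That_comp[OF o]) (use rs in \<open>auto intro!: smooth_intros o\<close>)
  then show ?thesis
    by (rule smooth_cong[OF o, rotated])
      (use linear_0[OF transition_linear] in \<open>auto simp: That_def\<close>)
qed

end

end


subsection \<open>Equations for the coefficients\<close>

lemma has_vector_derivative_curve2:
  fixes H :: "real \<times> 'a::euclidean_space \<Rightarrow> 'b::real_normed_vector"
  assumes H: "smooth_on (UNIV \<times> W) H" "open W" "y \<in> W"
  shows "((\<lambda>h. H (t + h, y + h *\<^sub>R v)) has_vector_derivative der H (t, y) (1, v)) (at 0)"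
    "((\<lambda>t. H (t, y)) has_vector_derivative der H (t, y) (1, 0)) (at t)"
    "der (\<lambda>y. H (t, y)) y v = der H (t, y) (0, v)" "der H (t, y) (1, v) = der H (t, y) (1, 0) + der H (t, y) (0, v)"
proof -
  have o: "open (UNIV \<times> W :: (real \<times> 'a) set)" by (intro open_Times open_UNIV H)
  have z: "(t, y) \<in> UNIV \<times> W" using H by simp
  have l: "linear (der H (t, y))" by (rule smooth_linear_der[OF H(1) o z])
  have "((\<lambda>h. (t + h, y + h *\<^sub>R v)) has_derivative (\<lambda>h. h *\<^sub>R (1, v))) (at 0)" by (auto intro!: derivative_eq_intros)
  from has_derivative_compose[OF this, of H "der H (t, y)"] smooth_has_derivative[OF H(1) o z]
  show "((\<lambda>h. H (t + h, y + h *\<^sub>R v)) has_vector_derivative der H (t, y) (1, v)) (at 0)"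
    by (simp only: has_vector_derivative_def linear_cmul[OF l] add_0_right scaleR_zero_left)
  have "(\<lambda>h. der H (t, y) (h, 0)) = (\<lambda>h. h *\<^sub>R der H (t, y) (1, 0))"
  proof
    fix h show "der H (t, y) (h, 0) = h *\<^sub>R der H (t, y) (1, 0)" using linear_cmul[OF l, of h "(1, 0)"] by simp
  qed
  with der_Pair_smooth(2)[OF H(1) o z] show "((\<lambda>t. H (t, y)) has_vector_derivative der H (t, y) (1, 0)) (at t)"
    by (simp only: has_vector_derivative_def)
  show "der (\<lambda>y. H (t, y)) y v = der H (t, y) (0, v)"
    using fun_cong[OF der_eq[OF der_Pair_smooth(1)[OF H(1) o z]]] .
  show "der H (t, y) (1, v) = der H (t, y) (1, 0) + der H (t, y) (0, v)"
    using linear_add[OF l, of "(1, 0)" "(0, v)"] by simp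
qed

lemma cubic_zero:
  assumes "\<And>l::real. l * a1 + l\<^sup>2 * a2 + l ^ 3 * a3 = 0" shows "a1 = 0" "a2 = 0" "a3 = 0"
  using assms[of 1] assms[of "-1"] assms[of 2] by (auto simp: power2_eq_square power3_eq_cube)

context fluid_eos
begin

definition ctT :: "('m, 'n) density \<Rightarrow> real \<Rightarrow> 'm \<Rightarrow> real \<Rightarrow> real" where
  "ctT T t x s = deriv (\<lambda>t. cT T t x s) t"

definition ztT :: "('m, 'n) density \<Rightarrow> real \<Rightarrow> 'm \<Rightarrow> real \<Rightarrow> real ^ 'n" where
  "ztT T t x s = vector_derivative (\<lambda>t. zT T t x s) (at t)"

context
  fixes T :: "('m, 'n) density" and x :: 'm and s :: real
  assumes T: "conserved T" and s: "s \<in> J"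
begin

abbreviation "y0 \<equiv> cmap M x x"
abbreviation "chat \<equiv> \<lambda>(t, y). cT T t (cinv M x y) s"
abbreviation "zhat \<equiv> \<lambda>(t, y). vcomp M x (\<lambda>x. zT T t x s) y"
abbreviation "Qhat r \<equiv> \<lambda>(t, y). T t (cinv M x y) 0 r s"

abbreviation "Qdt t r \<equiv> deriv (\<lambda>t. T t x 0 r s) t"
abbreviation "Qdx t r \<equiv> differential M (\<lambda>x. T t x 0 r s) x"
abbreviation "cdx t \<equiv> differential M (\<lambda>x. cT T t x s) x"
abbreviation "zc t \<equiv> vcomp M x (\<lambda>x. zT T t x s)"
abbreviation "zdiv t \<equiv> ch.divc x (zc t) y0"

lemma y0: "y0 \<in> cimg M x" by simp

lemma open_tY: "open (UNIV \<times> cimg M x :: (real \<times> (real ^ 'n)) set)" by (intro open_Times open_UNIV open_cimg)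

lemma smooth_chat: "smooth_on (UNIV \<times> cimg M x) chat"
proof -
  have "smooth_on (UNIV \<times> cimg M x) (\<lambda>z. (\<lambda>(t, y, s). cT T t (cinv M x y) s) (fst z, snd z, s))"
    by (rule smooth_compose[OF open_tY open_tyJ[OF T] _ _ smooth_cT[OF T]]) (use s in \<open>auto intro!: smooth_intros open_tY\<close>)
  then show ?thesis by (simp add: case_prod_unfold)
qed

lemma smooth_zhat: "smooth_on (UNIV \<times> cimg M x) zhat"
proof -
  have "smooth_on (UNIV \<times> cimg M x) (\<lambda>z. (\<lambda>(t, y, s). vcomp M x (\<lambda>x. zT T t x s) y) (fst z, snd z, s))"
    by (rule smooth_compose[OF open_tY open_tyJ[OF T] _ _ smooth_zT[OF T]]) (use s in \<open>auto intro!: smooth_intros open_tY\<close>)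
  then show ?thesis by (simp add: case_prod_unfold)
qed

lemmas chat = has_vector_derivative_curve2[OF smooth_chat open_cimg y0]
lemmas zhat = has_vector_derivative_curve2[OF smooth_zhat open_cimg y0]
lemmas Qhat = has_vector_derivative_curve2[OF smooth_Q[OF T _ s] open_cimg y0]

lemma ct: "((\<lambda>t. cT T t x s) has_real_derivative ctT T t x s) (at t)" "ctT T t x s = der chat (t, y0) (1, 0)"
proof -
  have 1: "((\<lambda>t. cT T t x s) has_real_derivative der chat (t, y0) (1, 0)) (at t)"
    using chat(2)[of t] by (simp add: has_real_derivative_iff_has_vector_derivative)
  then show 2: "ctT T t x s = der chat (t, y0) (1, 0)" unfolding ctT_def by (rule DERIV_imp_deriv)
  show "((\<lambda>t. cT T t x s) has_real_derivative ctT T t x s) (at t)" unfolding 2 by (rule 1)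
qed

lemma zt: "((\<lambda>t. zT T t x s) has_vector_derivative ztT T t x s) (at t)" "ztT T t x s = der zhat (t, y0) (1, 0)"
proof -
  have 1: "((\<lambda>t. zT T t x s) has_vector_derivative der zhat (t, y0) (1, 0)) (at t)"
    using zhat(2)[of t] by simp
  then show 2: "ztT T t x s = der zhat (t, y0) (1, 0)" unfolding ztT_def by (rule vector_derivative_at)
  show "((\<lambda>t. zT T t x s) has_vector_derivative ztT T t x s) (at t)" unfolding 2 by (rule 1)
qed

lemma dc: "cdx t v = der chat (t, y0) (0, v)"
  using chat(3)[of t v] by (simp add: differential_def o_def)

lemma dz: "der (zc t) y0 v = der zhat (t, y0) (0, v)"
  using zhat(3)[of t v] by simp

lemma Qt: "r \<in> I \<Longrightarrow> Qdt t r = der (Qhat r) (t, y0) (1, 0)"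
proof (rule DERIV_imp_deriv)
  assume r: "r \<in> I"
  show "((\<lambda>t. T t x 0 r s) has_real_derivative der (Qhat r) (t, y0) (1, 0)) (at t)"
    using Qhat(2)[OF r, of t] by (simp add: has_real_derivative_iff_has_vector_derivative)
qed

lemma dQ: "r \<in> I \<Longrightarrow> Qdx t r v = der (Qhat r) (t, y0) (0, v)"
  using Qhat(3)[of r t v] by (simp add: differential_def o_def)

definition Lz where "Lz t v = ch.liec x (zc t) y0 v v"

text \<open>The coefficient of \<open>r\<close> in the derivative of \<open>T\<close> along the
  flow: the derivative of \<open>c g(v, v) / 2 + g(zeta, v)\<close> along a geodesic, in which the
  terms with space derivatives of \<open>zeta\<close> and the metric combine to half a Lie
  derivative.\<close>

definition kap where
  "kap t v = 1/2 * (ctT T t x s + cdx t v) * metric M x v v + metric M x (ztT T t x s) v + 1/2 * Lz t v"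

lemma Af_eq:
  assumes r: "r \<in> I"
  shows "Af T x t y0 (v, r, s) = r * kap t v + (Qdt t r + Qdx t r v)"
  unfolding Af_def fst_conv
proof (rule der_curve[OF smooth_That[OF kin[OF T]] open_dom])
  let ?c = "ch.christ x y0 v v"
  let ?g = "metric M x"
  show "(t, y0, v, r, s) \<in> UNIV \<times> cimg M x \<times> UNIV \<times> I \<times> J" using r s by simp
  show "((\<lambda>h. (t + h, y0 + h *\<^sub>R v, v - h *\<^sub>R ?c, r, s)) has_derivative (\<lambda>h. h *\<^sub>R (1, v, - ?c, 0, 0))) (at 0)"
    by (auto intro!: derivative_eq_intros simp: zero_prod_def)
  show "(t + 0, y0 + 0 *\<^sub>R v, v - 0 *\<^sub>R ?c, r, s) = (t, y0, v, r, s)" by simp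
  have V: "open {h. y0 + h *\<^sub>R v \<in> cimg M x}"
    using continuous_open_vimage[OF open_cimg, of "\<lambda>h. y0 + h *\<^sub>R v" x] by (simp add: vimage_def continuous_intros)
  have 1: "((\<lambda>h. cT T (t + h) (cinv M x (y0 + h *\<^sub>R v)) s) has_real_derivative ctT T t x s + cdx t v) (at 0)"
    using chat(1)[of t v] unfolding ct(2) dc chat(4)[of t v] by (simp add: has_real_derivative_iff_has_vector_derivative)
  have 2: "((\<lambda>h. T (t + h) (cinv M x (y0 + h *\<^sub>R v)) 0 r s) has_real_derivative Qdt t r + Qdx t r v) (at 0)"
    using Qhat(1)[OF r, of t v] unfolding Qt[OF r] dQ[OF r] Qhat(4)[OF r, of t v] by (simp add: has_real_derivative_iff_has_vector_derivative)
  have "((\<lambda>h. gp x (y0 + h *\<^sub>R v) (zc (t + h) (y0 + h *\<^sub>R v)) (v - h *\<^sub>R ?c)) has_real_derivative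
    ch.dG x y0 v (zT T t x s) v + ?g (der zhat (t, y0) (1, v)) v - ?g (zT T t x s) ?c) (at 0)"
    using ch.has_derivative_along[OF y0 zhat(1)[of t v]] by simp
  also have "ch.dG x y0 v (zT T t x s) v + ?g (der zhat (t, y0) (1, v)) v - ?g (zT T t x s) ?c = ?g (ztT T t x s) v + 1/2 * Lz t v"
    using ch.lie_nabc[OF y0, of v "zc t"]
    unfolding zhat(4)[of t v] zt(2)[symmetric] dz[symmetric] Lz_def gp_center vcomp_center linear_add[OF linear_metric(2)] by simp
  finally have 3: "((\<lambda>h. gp x (y0 + h *\<^sub>R v) (zc (t + h) (y0 + h *\<^sub>R v)) (v - h *\<^sub>R ?c)) has_real_derivative
    ?g (ztT T t x s) v + 1/2 * Lz t v) (at 0)" .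
  have comb: "((\<lambda>h. r * (1/2 * a h * b h + d h) + e h) has_real_derivative r * (1/2 * a' * b 0 + d') + e') (at 0)"
    if "(a has_real_derivative a') (at 0)" "(b has_real_derivative 0) (at 0)" "(d has_real_derivative d') (at 0)" "(e has_real_derivative e') (at 0)"
    for a b d e a' d' e'
    using that by (auto intro!: derivative_eq_intros simp: algebra_simps)
  from comb[OF 1 ch.has_derivative_along_self[OF y0, of v] 3 2]
  have "((\<lambda>h. r * (1/2 * cT T (t + h) (cinv M x (y0 + h *\<^sub>R v)) s * gp x (y0 + h *\<^sub>R v) (v - h *\<^sub>R ?c) (v - h *\<^sub>R ?c) +
      gp x (y0 + h *\<^sub>R v) (zc (t + h) (y0 + h *\<^sub>R v)) (v - h *\<^sub>R ?c)) + T (t + h) (cinv M x (y0 + h *\<^sub>R v)) 0 r s)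
     has_real_derivative r * kap t v + (Qdt t r + Qdx t r v)) (at 0)"
    by (simp add: kap_def algebra_simps)
  then show "((\<lambda>h. That T x (t + h, y0 + h *\<^sub>R v, v - h *\<^sub>R ?c, r, s)) has_real_derivative
      r * kap t v + (Qdt t r + Qdx t r v)) (at 0)"
    by (rule has_field_derivative_transform_within_open[OF _ V]) (use That_structure[OF T _ r s] in auto)
qed

text \<open>The field \<open>Z\<close> of \<open>EL_zeroth\<close> is \<open>c v + zeta\<close>,
  where \<open>v\<close> has constant components. The Christoffel trace in the divergence of
  \<open>c v\<close> cancels against the one that multiplies the derivative of
  \<open>Bf\<close>.\<close>

lemma Af_der:
  assumes r: "r \<in> I"
  shows "der (Af T x t y0) (v, r, s) (0, \<delta>) = - der Pc (r, s) \<delta> * (cdx t v + zdiv t)"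
proof -
  let ?w = "(v, r, s)"
  have w: "?w \<in> \<Omega>" using r s by simp
  let ?z = "zc t"
  let ?c = "\<lambda>y. cT T t (cinv M x y) s"
  have sz: "smooth_on (cimg M x) ?z" by (rule smooth_vcomp[OF smooth_zT_vector[OF T s]])
  have sc: "smooth_on (cimg M x) ?c" using smooth_comp[OF smooth_cT_scalar[OF T s], of x t] by (simp add: o_def)
  define Z where "Z y = ?c y *\<^sub>R v + ?z y" for y
  have sZ: "smooth_on (cimg M x) Z" unfolding Z_def by (intro smooth_add smooth_scaleR smooth_const open_cimg sc sz)
  have TZ: "der (That T x) (t, y, ?w) (0, 0, a, 0, 0) = fst (snd ?w) * gp x y (Z y) a" if y: "y \<in> cimg M x" for y a
  proof (rule der_curve[OF smooth_That[OF kin[OF T]] open_dom])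
    show "(t, y, ?w) \<in> UNIV \<times> cimg M x \<times> \<Omega>" using y w by simp
    show "((\<lambda>h. (t, y, v + h *\<^sub>R a, r, s)) has_derivative (\<lambda>h. h *\<^sub>R (0, 0, a, 0, 0))) (at 0)"
      by (auto intro!: derivative_eq_intros simp: zero_prod_def)
    have "That T x (t, y, v + h *\<^sub>R a, r, s) = r * (1/2 * ?c y * (gp x y v v + 2 * h * gp x y v a + h\<^sup>2 * gp x y a a) + (gp x y (?z y) v + h * gp x y (?z y) a)) + T t (cinv M x y) 0 r s" for h
      unfolding That_structure[OF T y r s] by (simp add: ch.G_simps[OF y] ch.sym[OF y, of a v] power2_eq_square algebra_simps)
    then show "((\<lambda>h. That T x (t, y, v + h *\<^sub>R a, r, s)) has_real_derivative fst (snd ?w) * gp x y (Z y) a) (at 0)"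
      by (auto intro!: derivative_eq_intros simp: Z_def ch.G_simps[OF y])
  qed simp
  have "ch.divc x (\<lambda>y. ?c y *\<^sub>R v) y0 = cT T t x s * ch.divc x (\<lambda>y. v) y0 + cdx t v"
    using ch.divc_scale[OF y0 smooth_has_derivative[OF sc open_cimg y0], of "\<lambda>y. v"] by (simp add: differential_def o_def)
  moreover have "ch.divc x (\<lambda>y. v) y0 = (\<Sum>i\<in>UNIV. ch.christ x y0 (axis i 1) v $ i)"
    unfolding ch.divc_def ch.nabc_def by simp
  moreover have "ch.divc x Z y0 = ch.divc x (\<lambda>y. ?c y *\<^sub>R v) y0 + ch.divc x ?z y0"
    unfolding Z_def [abs_def]
    by (rule ch.divc_add[OF y0 smooth_has_derivative[OF smooth_scaleR[OF open_cimg sc smooth_const[OF open_cimg]] open_cimg y0]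
      smooth_has_derivative[OF sz open_cimg y0]])
  moreover have "der (Af T x t y0) ?w (0, \<delta>) + der (Bf T x t y0) ?w (0, \<delta>) * (\<Sum>i\<in>UNIV. ch.christ x y0 (axis i 1) (fst ?w) $ i)
     = - der Pc (snd ?w) \<delta> * ch.divc x Z y0"
    by (rule EL_zeroth[OF T y0 w sZ TZ])
  moreover have "der (Bf T x t y0) ?w (0, \<delta>) = - cT T t x s * der Pc (r, s) \<delta>"
    by (rule structure_at(2)[OF T r s])
  ultimately show ?thesis by (simp add: algebra_simps)
qed

text \<open>Equates two expressions for the derivative of \<open>Af\<close> in the density: the
  explicit form \<open>Af_eq\<close> and the Euler-Lagrange equation \<open>Af_der\<close>.\<close>

lemma Af_real:
  assumes r: "r \<in> I"
  shows "((\<lambda>r. Qdt t r + Qdx t r v) has_real_derivative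
     - der Pc (r, s) (1, 0) * (cdx t v + zdiv t) - kap t v) (at r)"
proof -
  have w: "(v, r, s) \<in> \<Omega>" using r s by simp
  have dA: "(Af T x t y0 has_derivative der (Af T x t y0) (v, r, s)) (at (v, r, s))" by (rule der_fix[OF smooth_Af[OF kin[OF T]] y0 w])
  have "((\<lambda>r. (v, r, s)) has_derivative (\<lambda>h. h *\<^sub>R (0, 1, 0))) (at r)"
    by (auto intro!: derivative_eq_intros simp: zero_prod_def)
  from has_derivative_compose[OF this dA]
  have "((\<lambda>r. Af T x t y0 (v, r, s)) has_real_derivative der (Af T x t y0) (v, r, s) (0, 1, 0)) (at r)"
    unfolding linear_cmul[OF has_derivative_linear[OF dA]] by (simp add: has_field_derivative_def mult_commute_abs)
  then have "((\<lambda>r. Af T x t y0 (v, r, s) - r * kap t v) has_real_derivative der (Af T x t y0) (v, r, s) (0, 1, 0) - kap t v) (at r)"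
    by (auto intro!: derivative_eq_intros)
  then have "((\<lambda>r. Qdt t r + Qdx t r v) has_real_derivative der (Af T x t y0) (v, r, s) (0, 1, 0) - kap t v) (at r)"
    by (rule has_field_derivative_transform_within_open[OF _ open_I r]) (simp add: Af_eq)
  then show ?thesis unfolding Af_der[OF r] .
qed

lemma linear_dQ: "r \<in> I \<Longrightarrow> Qdx t r (l *\<^sub>R v) = l * Qdx t r v"
  "cdx t (l *\<^sub>R v) = l * cdx t v"
proof -
  have z: "(t, y0) \<in> UNIV \<times> cimg M x" by simp
  show "r \<in> I \<Longrightarrow> Qdx t r (l *\<^sub>R v) = l * Qdx t r v"
    unfolding dQ using linear_cmul[OF smooth_linear_der[OF smooth_Q[OF T _ s] open_tY z], of r l "(0, v)"] by simp
  show "cdx t (l *\<^sub>R v) = l * cdx t v"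
    unfolding dc using linear_cmul[OF smooth_linear_der[OF smooth_chat open_tY z], of l "(0, v)"] by simp
qed

lemma linear_dz: "linear (der (zc t) y0)"
  by (rule smooth_linear_der[OF smooth_vcomp[OF smooth_zT_vector[OF T s]] open_cimg y0])

text \<open>With \<open>l v\<close> in place of \<open>v\<close>, the equation
  \<open>Af_real\<close> becomes polynomial in \<open>l\<close>. Degree 0 is the equation for the
  time derivative of the rest value; after its subtraction the degrees 3, 2 and 1 give the vanishing
  gradient of \<open>c\<close>, the Lie equation for \<open>zeta\<close> and the equation for the
  gradient of the rest value.\<close>

lemma conditions1:
  assumes r: "r \<in> I"
  shows cond_c: "cdx t v = 0"
    and cond_L: "Lz t v = - ctT T t x s * metric M x v v"
    and cond_Q: "((\<lambda>r. Qdx t r v) has_real_derivative - metric M x (ztT T t x s) v) (at r)"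
    and cond_Qt0: "((\<lambda>r. Qdt t r) has_real_derivative - der Pc (r, s) (1, 0) * zdiv t) (at r)"
proof -
  let ?g = "metric M x"
  define D where "D = zdiv t"
  define Pr where "Pr = der Pc (r, s) (1, 0)"
  define d where "d = cdx t v"
  have Lsc: "Lz t (l *\<^sub>R v) = l\<^sup>2 * Lz t v" for l
    unfolding Lz_def ch.liec_def by (simp add: linear_cmul[OF linear_dz] ch.dG_simps[OF y0] ch.G_simps[OF y0, unfolded gp_center] power2_eq_square algebra_simps)
  have gs: "?g (l *\<^sub>R v) w = l * ?g v w" "?g w (l *\<^sub>R v) = l * ?g w v" for l w
    by (simp_all add: linear_cmul[OF linear_metric(1)] linear_cmul[OF linear_metric(2)])
  have kl: "kap t (l *\<^sub>R v) = 1/2 * (ctT T t x s + l * d) * (l\<^sup>2 * ?g v v) + l * ?g (ztT T t x s) v + 1/2 * (l\<^sup>2 * Lz t v)" for l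
    unfolding kap_def Lsc gs linear_dQ(2) d_def by (simp add: power2_eq_square)
  have R: "((\<lambda>r. Qdt t r + l * Qdx t r v) has_real_derivative - Pr * (l * d + D) - kap t (l *\<^sub>R v)) (at r)" for l
  proof (rule has_field_derivative_transform_within_open[OF _ open_I r])
    show "((\<lambda>r. Qdt t r + Qdx t r (l *\<^sub>R v)) has_real_derivative - Pr * (l * d + D) - kap t (l *\<^sub>R v)) (at r)"
      using Af_real[OF r, of t "l *\<^sub>R v"] unfolding linear_dQ(2) Pr_def D_def d_def .
  qed (simp add: linear_dQ(1))
  from R[of 0] show 0: "((\<lambda>r. Qdt t r) has_real_derivative - der Pc (r, s) (1, 0) * zdiv t) (at r)"
    using kl[of 0] by (simp add: Pr_def D_def)
  define Y where "Y = - Pr * d - kap t v"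
  have Yd: "((\<lambda>r. Qdx t r v) has_real_derivative Y) (at r)"
    using DERIV_cong[OF DERIV_diff[OF R[of 1] 0], of Y] by (simp add: Y_def Pr_def D_def algebra_simps)
  have Yl: "l * Y = - Pr * (l * d) - kap t (l *\<^sub>R v)" for l
  proof -
    have "((\<lambda>r. Qdt t r + l * Qdx t r v) has_real_derivative - Pr * D + l * Y) (at r)"
      unfolding Pr_def D_def by (intro DERIV_add 0 DERIV_cmult Yd)
    from DERIV_unique[OF this R[of l]] show ?thesis by (simp add: algebra_simps)
  qed
  \<comment> \<open>A cubic in \<open>l\<close> without constant term that vanishes identically, so
    each coefficient is zero.\<close>
  have "l * (Y + Pr * d + ?g (ztT T t x s) v) + l\<^sup>2 * (1/2 * (ctT T t x s * ?g v v + Lz t v)) + l ^ 3 * (1/2 * d * ?g v v) = 0" for l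
    using Yl[of l] unfolding kl by (simp add: algebra_simps power2_eq_square power3_eq_cube)
  note c = cubic_zero[OF this]
  show d0: "cdx t v = 0"
  proof (cases "v = 0")
    case True then show ?thesis using linear_dQ(2)[of t 0 v] by simp
  next
    case False then show ?thesis using c(3) metric_pos[of v x] by (simp add: d_def)
  qed
  show "Lz t v = - ctT T t x s * metric M x v v" using c(2) by simp
  show "((\<lambda>r. Qdx t r v) has_real_derivative - metric M x (ztT T t x s) v) (at r)"
    using c(1) d0 Yd by (simp add: d_def add_eq_0_iff)
qed

lemma cond_lie: "lie_metric M (\<lambda>x. zT T t x s) x v w = - ctT T t x s * metric M x v w"
proof -
  obtain r where r: "r \<in> I" using ex_interior .
  have "ch.liec x (zc t) y0 v w = - ctT T t x s * gp x y0 v w"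
    by (rule ch.liec_polarize[OF y0 linear_dz]) (use cond_L[OF r] in \<open>simp add: Lz_def\<close>)
  then show ?thesis by (simp add: lie_center)
qed

text \<open>The trace of the Lie equation brings in the dimension, and with it the exponent of the
  polytropic case.\<close>

lemma cond_div: "zdiv t = - ctT T t x s * real CARD('n) / 2"
  by (rule ch.divc_lie[OF y0 linear_dz]) (use cond_lie[of t] in \<open>simp add: lie_center\<close>)

lemma cond_Qt: "r \<in> I \<Longrightarrow> ((\<lambda>r. Qdt t r) has_real_derivative real CARD('n) / 2 * ctT T t x s * der Pc (r, s) (1, 0)) (at r)"
  using cond_Qt0[of r t] unfolding cond_div by (simp add: mult_ac)

lemma Bf_center:
  assumes r: "r \<in> I"
  shows "Bf T x t y0 (0, r, s) = T t x 0 r s - r * deriv (\<lambda>r. T t x 0 r s) r"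
    "((\<lambda>r. T t x 0 r s) has_real_derivative deriv (\<lambda>r. T t x 0 r s) r) (at r)"
proof -
  have z: "(t, y0, 0, r, s) \<in> UNIV \<times> cimg M x \<times> \<Omega>" using r s by simp
  have hd: "(That T x has_derivative der (That T x) (t, y0, 0, r, s)) (at (t, y0, 0, r, s))"
    by (rule smooth_has_derivative[OF smooth_That[OF kin[OF T]] open_dom z])
  have "((\<lambda>r. (t, y0, 0, r, s)) has_derivative (\<lambda>h. h *\<^sub>R (0, 0, 0, 1, 0))) (at r)"
    by (auto intro!: derivative_eq_intros simp: zero_prod_def)
  from has_derivative_compose[OF this hd]
  have "((\<lambda>r. T t x 0 r s) has_derivative (\<lambda>h. der (That T x) (t, y0, 0, r, s) (h *\<^sub>R (0, 0, 0, 1, 0)))) (at r)"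
    by (simp only: That_center)
  then have d: "((\<lambda>r. T t x 0 r s) has_real_derivative der (That T x) (t, y0, 0, r, s) (0, 0, 0, 1, 0)) (at r)"
    unfolding linear_cmul[OF has_derivative_linear[OF hd]] by (simp add: has_field_derivative_def mult_commute_abs)
  show "Bf T x t y0 (0, r, s) = T t x 0 r s - r * deriv (\<lambda>r. T t x 0 r s) r"
    unfolding Bf_def using DERIV_imp_deriv[OF d] by (simp add: That_center)
  show "((\<lambda>r. T t x 0 r s) has_real_derivative deriv (\<lambda>r. T t x 0 r s) r) (at r)"
    using d DERIV_imp_deriv[OF d] by simp
qed

end

context
  fixes T :: "('m, 'n) density" and t :: real and x :: 'm
  assumes T: "conserved T"
begin

lemma line_real:
  assumes H: "(H has_derivative der H (0, r, s)) (at (0::real ^ 'n, r, s))"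
  shows "((\<lambda>r. H (0, r, s)) has_real_derivative der H (0, r, s) (0, 1, 0)) (at r)"
    "((\<lambda>s. H (0, r, s)) has_real_derivative der H (0, r, s) (0, 0, 1)) (at s)"
proof -
  have l: "linear (der H (0, r, s))" using H has_derivative_linear by blast
  have "((\<lambda>r. (0, r, s)) has_derivative (\<lambda>h. h *\<^sub>R (0, 1, 0))) (at r)" "((\<lambda>s. (0, r, s)) has_derivative (\<lambda>h. h *\<^sub>R (0, 0, 1))) (at s)"
    by (auto intro!: derivative_eq_intros simp: zero_prod_def)
  from has_derivative_compose[OF this(1) H] has_derivative_compose[OF this(2) H]
  show "((\<lambda>r. H (0, r, s)) has_real_derivative der H (0, r, s) (0, 1, 0)) (at r)"
    "((\<lambda>s. H (0, r, s)) has_real_derivative der H (0, r, s) (0, 0, 1)) (at s)"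
    unfolding linear_cmul[OF l] by (simp_all add: has_field_derivative_def mult_commute_abs)
qed

text \<open>At \<open>v = 0\<close> the quantity \<open>Bf\<close> is \<open>Q - r Q_r\<close> for
  the rest value \<open>Q\<close>, and \<open>structure_at\<close> gives its derivatives: those of
  \<open>- c P\<close> with \<open>c\<close> held fixed.\<close>

lemma cond_B:
  assumes r: "r \<in> I" and s: "s \<in> J"
  shows "((\<lambda>r. T t x 0 r s - r * deriv (\<lambda>r. T t x 0 r s) r) has_real_derivative - cT T t x s * der Pc (r, s) (1, 0)) (at r)"
    "((\<lambda>s. T t x 0 r s - r * deriv (\<lambda>r. T t x 0 r s) r) has_real_derivative - cT T t x s * der Pc (r, s) (0, 1)) (at s)"
proof -
  let ?y = "cmap M x x"
  have y: "?y \<in> cimg M x" by simp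
  have w: "(0, r, s) \<in> \<Omega>" using r s by simp
  note l = line_real[OF der_fix[OF smooth_Bf[OF kin[OF T]] y w], unfolded structure_at(2)[OF T r s]]
  show "((\<lambda>r. T t x 0 r s - r * deriv (\<lambda>r. T t x 0 r s) r) has_real_derivative - cT T t x s * der Pc (r, s) (1, 0)) (at r)"
    by (rule has_field_derivative_transform_within_open[OF l(1) open_I r]) (rule Bf_center[OF T s])
  show "((\<lambda>s. T t x 0 r s - r * deriv (\<lambda>r. T t x 0 r s) r) has_real_derivative - cT T t x s * der Pc (r, s) (0, 1)) (at s)"
    by (rule has_field_derivative_transform_within_open[OF l(2) open_J s]) (rule Bf_center[OF T _ r])
qed

text \<open>At \<open>v = 0\<close> the coefficient \<open>kap\<close> vanishes for every entropy,
  so \<open>Af\<close> reduces there to the time derivative of the rest value.\<close>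

lemma cond_Qs:
  assumes r: "r \<in> I" and s: "s \<in> J"
  shows "((\<lambda>s. deriv (\<lambda>t. T t x 0 r s) t) has_real_derivative real CARD('n) / 2 * ctT T t x s * der Pc (r, s) (0, 1)) (at s)"
proof -
  let ?y = "cmap M x x"
  have y: "?y \<in> cimg M x" by simp
  have w: "(0, r, s) \<in> \<Omega>" using r s by simp
  have k0: "kap T x s t 0 = 0" if "s \<in> J" for s
    unfolding kap_def[OF T that] Lz_def[OF T that] ch.liec_def using linear_0[OF linear_dz[OF T that]] linear_0[OF linear_metric(1)]
    by (simp add: ch.dG_simps[OF y] ch.G_simps[OF y, unfolded gp_center])
  have d0: "differential M (\<lambda>x. T t x 0 r s) x 0 = 0" if "s \<in> J" for s using linear_dQ(1)[OF T that r, of t x 0 0] by simp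
  have "((\<lambda>s. deriv (\<lambda>t. T t x 0 r s) t) has_real_derivative der (Af T x t ?y) (0, r, s) (0, 0, 1)) (at s)"
    by (rule has_field_derivative_transform_within_open[OF line_real(2)[OF der_fix[OF smooth_Af[OF kin[OF T]] y w]] open_J s])
      (simp add: Af_eq[OF T _ r] k0 d0)
  then show ?thesis
    unfolding Af_der[OF T s r] cond_c[OF T s r] cond_div[OF T s] by (simp add: mult_ac)
qed

end

end


subsection \<open>Killing fields\<close>

text \<open>Compactness of \<open>K\<close> times the unit sphere bounds \<open>f\<close> there;
  homogeneity in \<open>w\<close> extends the bound.\<close>

lemma homogeneous_bound:
  fixes f :: "'a::euclidean_space \<times> 'b::euclidean_space \<Rightarrow> 'c::real_normed_vector"
  assumes f: "continuous_on (U \<times> UNIV) f" and K: "compact K" "K \<subseteq> U" and h: "\<And>y c w. y \<in> K \<Longrightarrow> f (y, c *\<^sub>R w) = c *\<^sub>R f (y, w)"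
  obtains C where "C \<ge> 0" "\<And>y w. y \<in> K \<Longrightarrow> norm (f (y, w)) \<le> C * norm w"
proof -
  have "compact (f ` (K \<times> sphere 0 1))"
    by (intro compact_continuous_image continuous_on_subset[OF f] compact_Times K) (use K in auto)
  then obtain C where C: "\<And>z. z \<in> f ` (K \<times> sphere 0 1) \<Longrightarrow> norm z \<le> C"
    using compact_imp_bounded bounded_iff by metis
  show thesis
  proof (rule that[of "max C 0"])
    fix y w assume y: "y \<in> K"
    show "norm (f (y, w)) \<le> max C 0 * norm w"
    proof (cases "w = 0")
      case True
      then show ?thesis using h[OF y, of 0 0] by simp
    next
      case False
      have "norm (f (y, (1 / norm w) *\<^sub>R w)) \<le> max C 0"
        by (intro order_trans[OF C max.cobounded1] imageI) (use y False in auto)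
      then show ?thesis using False unfolding h[OF y] by (simp add: divide_le_eq)
    qed
  qed simp
qed

context coord_metric
begin

text \<open>\<open>prol y (X y, D X y) k a b\<close> collects the terms without second derivatives of \<open>X\<close> in the derivative
  along \<open>k\<close> of the Killing equation \<open>(\<L>\<^sub>X g)(a, b) = 0\<close>.\<close>

definition prol :: "real ^ 'n \<Rightarrow> (real ^ 'n) \<times> ((real ^ 'n) ^ 'n) \<Rightarrow> real ^ 'n \<Rightarrow> real ^ 'n \<Rightarrow> real ^ 'n \<Rightarrow> real" where
  "prol y \<omega> k a b = (let D = (\<lambda>v. \<Sum>i\<in>UNIV. (v $ i) *\<^sub>R (snd \<omega> $ i)) in
     (\<Sum>i\<in>UNIV. fst \<omega> $ i * der (\<lambda>y. dG y (axis i 1) a b) y k) + dG y (D k) a b + dG y k (D a) b + dG y k a (D b))"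

text \<open>The combination with two plus signs and one minus sign isolates one second derivative,
  as in the Koszul formula. Writing the covector as a sum over \<open>j\<close> makes it visibly
  linear.\<close>

definition prol2 :: "real ^ 'n \<Rightarrow> (real ^ 'n) \<times> ((real ^ 'n) ^ 'n) \<Rightarrow> real ^ 'n \<Rightarrow> real ^ 'n \<Rightarrow> real ^ 'n" where
  "prol2 y \<omega> k a = sharp y (\<lambda>b. \<Sum>j\<in>UNIV. b $ j *
     (- (prol y \<omega> k a (axis j 1) + prol y \<omega> a k (axis j 1) - prol y \<omega> (axis j 1) k a) / 2))"

lemma linear_coeffs: "linear (\<lambda>b::real ^ 'n. \<Sum>j\<in>UNIV. b $ j * c j)"
  by (intro linearI) (simp_all add: sum.distrib sum_distrib_left algebra_simps)

lemma smooth_dG_const: "smooth_on U (\<lambda>y. dG y v a b)"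
  by (rule smooth_dG[OF U]) (auto intro!: smooth_intros U)

lemma smooth_prol2: "smooth_on (U \<times> UNIV) (\<lambda>z. prol2 (fst z) (snd z) k a)"
proof -
  let ?V = "U \<times> UNIV :: ((real ^ 'n) \<times> (real ^ 'n) \<times> ((real ^ 'n) ^ 'n)) set"
  have o: "open ?V" by (intro open_Times open_UNIV U)
  have pr: "smooth_on ?V (\<lambda>z. fst z)" "smooth_on ?V (\<lambda>z. fst (snd z))" "smooth_on ?V (\<lambda>z. snd (snd z))"
    by (intro smooth_intros o)+
  have D: "smooth_on ?V (\<lambda>z. \<Sum>i\<in>UNIV. (v $ i) *\<^sub>R (snd (snd z) $ i))" for v
    by (intro smooth_sum smooth_scaleR smooth_const o smooth_bounded_linear[OF bounded_linear_vec_nth] pr)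
  have p: "smooth_on ?V (\<lambda>z. prol (fst z) (snd z) k a b)" for k a b
    unfolding prol_def Let_def
    by (intro smooth_add smooth_sum smooth_mult smooth_nth smooth_dG o pr D smooth_const
        smooth_der_compose[OF o _ pr(1) U smooth_dG_const]) auto
  show ?thesis unfolding prol2_def
    by (rule smooth_sharp[OF o _ pr(1) _ linear_coeffs]) (auto intro!: smooth_intros p o)
qed

lemma prol2_scale:
  assumes y: "y \<in> U" shows "prol2 y (c *\<^sub>R \<omega>) k a = c *\<^sub>R prol2 y \<omega> k a"
proof -
  have D: "(\<Sum>i\<in>UNIV. (v $ i) *\<^sub>R (snd (c *\<^sub>R \<omega>) $ i)) = c *\<^sub>R (\<Sum>i\<in>UNIV. (v $ i) *\<^sub>R (snd \<omega> $ i))" for v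
    by (simp add: scaleR_sum_right mult.commute)
  have p: "prol y (c *\<^sub>R \<omega>) k a b = c * prol y \<omega> k a b" for k a b
    unfolding prol_def Let_def D by (simp add: dG_simps[OF y] sum_distrib_left algebra_simps)
  show ?thesis
    by (rule G_eqD[OF y]) (simp only: prol2_def G_sharp[OF y linear_coeffs] p linear_cmul[OF lin1[OF y]],
      simp add: sum_distrib_left algebra_simps)
qed

text \<open>The derivative along \<open>k\<close> of the Killing equation for \<open>a\<close>,
  \<open>b\<close> contains second derivatives of \<open>X\<close> in the combination of
  \<open>key\<close>, symmetric in \<open>a\<close> and \<open>b\<close>. Permuting the three
  directions and using the symmetry of second derivatives solves for one of them, as for the
  Christoffel symbols.\<close>

lemma killing_second_derivative:
  assumes X: "smooth_on U X" and L: "\<And>y v w. y \<in> U \<Longrightarrow> liec X y v w = 0" and y: "y \<in> U"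
  shows "der (\<lambda>y. der X y a) y k = prol2 y (X y, \<chi> i. der X y (axis i 1)) k a"
proof -
  let ?\<omega> = "(X y, \<chi> i. der X y (axis i 1))"
  have D: "(\<Sum>i\<in>UNIV. (v $ i) *\<^sub>R (snd ?\<omega> $ i)) = der X y v" for v
    using linear_expand_axis[OF smooth_linear_der[OF X U y], of v] by simp
  have dX: "(X has_derivative der X y) (at y)" by (rule smooth_has_derivative[OF X U y])
  have ddX: "((\<lambda>y. der X y a) has_derivative (\<lambda>k. der (\<lambda>y. der X y a) y k)) (at y)" for a
    by (rule smooth_has_derivative[OF smooth_der[OF U X smooth_const[OF U]] U y])
  have key: "prol y ?\<omega> k a b = - G y (der (\<lambda>y. der X y a) y k) b - G y (der (\<lambda>y. der X y b) y k) a" for k a b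
  proof -
    have "((\<lambda>y. (\<Sum>i\<in>UNIV. X y $ i * dG y (axis i 1) a b) + G y (der X y a) b + G y a (der X y b)) has_derivative
      (\<lambda>k. (\<Sum>i\<in>UNIV. X y $ i * der (\<lambda>y. dG y (axis i 1) a b) y k + der X y k $ i * dG y (axis i 1) a b) +
      (dG y k (der X y a) b + G y (der (\<lambda>y. der X y a) y k) b + G y (der X y a) 0) +
      (dG y k a (der X y b) + G y 0 (der X y b) + G y a (der (\<lambda>y. der X y b) y k)))) (at y)"
      by (intro has_derivative_add has_derivative_sum has_derivative_mult bounded_linear.has_derivative[OF bounded_linear_vec_nth dX]
        smooth_has_derivative[OF smooth_dG_const U y] has_derivative_G[OF U y] has_derivative_ident ddX has_derivative_const)
    note d0 = has_derivative_transform_within_open[OF this U y, of "\<lambda>y. 0"]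
    have "(\<Sum>i\<in>UNIV. X y $ i * dG y (axis i 1) a b) + G y (der X y a) b + G y a (der X y b) = 0" if "y \<in> U" for y
      using L[OF that, of a b] linear_expand_axis[OF dG_linear1[OF that], of "X y" a b] unfolding liec_def by simp
    from fun_cong[OF has_derivative_unique[OF has_derivative_const d0[OF this]], of k]
    show ?thesis unfolding prol_def Let_def D fst_conv linear_expand_axis[OF dG_linear1[OF y], of "der X y k"]
      by (simp add: G_simps[OF y] sym[OF y, of a "der (\<lambda>y. der X y b) y k"] sum.distrib algebra_simps)
  qed
  have "- (prol y ?\<omega> k a b + prol y ?\<omega> a k b - prol y ?\<omega> b k a) / 2 = G y (der (\<lambda>y. der X y a) y k) b" for b
    unfolding key using der_swap[OF U y X, of k a] der_swap[OF U y X, of b k] der_swap[OF U y X, of b a] by simp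
  note e = this
  show ?thesis
    unfolding prol2_def e by (intro sharp_unique[OF y, symmetric]) (subst linear_expand_axis[OF lin2[OF y]], simp)
qed

text \<open>Along the segment from \<open>y1\<close> to \<open>y2\<close> the 1-jet of a Killing
  field solves a linear differential equation, by \<open>killing_second_derivative\<close>.
  Gronwall's argument applies: the squared norm \<open>f\<close> of the jet satisfies
  \<open>f' \<le> 2 K f\<close> and starts at 0.\<close>

lemma killing_unique:
  assumes X: "smooth_on U X" and L: "\<And>y v w. y \<in> U \<Longrightarrow> liec X y v w = 0"
    and B: "cball y0 R \<subseteq> U" "y1 \<in> cball y0 R" "y2 \<in> cball y0 R" and z: "X y1 = 0" "\<And>v. der X y1 v = 0"
  shows "X y2 = 0 \<and> (\<forall>v. der X y2 v = 0)"
proof -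
  define h where "h = y2 - y1"
  define w where "w y = (X y, \<chi> i. der X y (axis i 1))" for y
  have seg: "y1 + t *\<^sub>R h \<in> cball y0 R" if "0 \<le> t" "t \<le> 1" for t
    using convexD[OF convex_cball B(2,3), of "1 - t" t] that by (simp add: h_def algebra_simps)
  have o: "open (U \<times> UNIV :: ((real ^ 'n) \<times> (real ^ 'n) \<times> ((real ^ 'n) ^ 'n)) set)" by (intro open_Times open_UNIV U)
  have "\<exists>C\<ge>0. \<forall>y\<in>cball y0 R. \<forall>\<omega>. norm (prol2 y \<omega> h (axis i 1)) \<le> C * norm \<omega>" for i
  proof -
    have "prol2 (fst (y, c *\<^sub>R w)) (snd (y, c *\<^sub>R w)) h (axis i 1) = c *\<^sub>R prol2 (fst (y, w)) (snd (y, w)) h (axis i 1)"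
      if "y \<in> cball y0 R" for y c w unfolding fst_conv snd_conv by (rule prol2_scale) (use that B(1) in blast)
    from homogeneous_bound[OF smooth_continuous_on[OF smooth_prol2 o] compact_cball B(1) this]
    obtain C where "C \<ge> 0" "\<And>y \<omega>. y \<in> cball y0 R \<Longrightarrow> norm ((\<lambda>z. prol2 (fst z) (snd z) h (axis i 1)) (y, \<omega>)) \<le> C * norm \<omega>"
      by blast
    then show ?thesis by auto
  qed
  then obtain C where C: "\<And>i. C i \<ge> 0" "\<And>i y \<omega>. y \<in> cball y0 R \<Longrightarrow> norm (prol2 y \<omega> h (axis i 1)) \<le> C i * norm \<omega>" by metis
  define f where "f t = X (y1 + t *\<^sub>R h) \<bullet> X (y1 + t *\<^sub>R h) + (\<Sum>i\<in>UNIV. der X (y1 + t *\<^sub>R h) (axis i 1) \<bullet> der X (y1 + t *\<^sub>R h) (axis i 1))" for t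
  have fw: "f t = (norm (w (y1 + t *\<^sub>R h)))\<^sup>2" for t
    unfolding f_def w_def power2_norm_eq_inner by (simp add: inner_prod_def inner_vec_def)
  have nw: "norm (X y) \<le> norm (w y)" "norm (der X y (axis i 1)) \<le> norm (w y)" for y i
  proof -
    show "norm (X y) \<le> norm (w y)" unfolding w_def by (rule norm_fst_le)
    have "norm ((\<chi> i. der X y (axis i 1)) $ i) \<le> norm (\<chi> i. der X y (axis i 1))" by (rule Finite_Cartesian_Product.norm_nth_le)
    also have "\<dots> \<le> norm (w y)" unfolding w_def by (rule norm_snd_le)
    finally show "norm (der X y (axis i 1)) \<le> norm (w y)" by simp
  qed
  \<comment> \<open>The first sum bounds the derivative of \<open>X\<close> along \<open>h\<close>
    by the jet, the second the derivatives along \<open>h\<close> of the first partial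
    derivatives.\<close>
  define K where "K = (\<Sum>i\<in>UNIV. \<bar>h $ i\<bar>) + (\<Sum>i\<in>UNIV. C i)"
  have "\<exists>y. ((\<lambda>t. f t * exp (- (2 * K) * t)) has_real_derivative y) (at t) \<and> y \<le> 0" if t: "0 \<le> t" "t \<le> 1" for t
  proof -
    let ?y = "y1 + t *\<^sub>R h"
    have y: "?y \<in> cball y0 R" by (rule seg[OF t])
    then have yU: "?y \<in> U" using B by blast
    note hv = has_vector_derivative_line[OF _ U yU, where S = UNIV]
    have sd: "der (\<lambda>y. der X y a) ?y h = prol2 ?y (w ?y) h a" for a
      unfolding w_def by (rule killing_second_derivative[OF X _ yU]) (rule L)
    define f' where "f' = 2 * (X ?y \<bullet> der X ?y h) + (\<Sum>i\<in>UNIV. 2 * (der X ?y (axis i 1) \<bullet> prol2 ?y (w ?y) h (axis i 1)))"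
    have dd: "((\<lambda>t. H (y1 + t *\<^sub>R h) \<bullet> H (y1 + t *\<^sub>R h)) has_real_derivative 2 * (H ?y \<bullet> der H ?y h)) (at t)"
      if H: "smooth_on U H" for H :: "real ^ 'n \<Rightarrow> real ^ 'n"
      using bounded_bilinear.has_vector_derivative[OF bounded_bilinear_inner hv[OF H] hv[OF H]]
      by (simp add: has_real_derivative_iff_has_vector_derivative inner_commute)
    have "((\<lambda>t. f t) has_real_derivative f') (at t)"
      unfolding f_def f'_def
    proof (intro DERIV_add dd[OF X] DERIV_sum)
      fix i :: 'n
      show "((\<lambda>t. der X (y1 + t *\<^sub>R h) (axis i 1) \<bullet> der X (y1 + t *\<^sub>R h) (axis i 1)) has_real_derivative
         2 * (der X ?y (axis i 1) \<bullet> prol2 ?y (w ?y) h (axis i 1))) (at t)"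
        using dd[OF smooth_der[OF U X smooth_const[OF U, of "axis i 1"]]] sd[of "axis i 1"] by simp
    qed
    then have "((\<lambda>t. f t * exp (- (2 * K) * t)) has_real_derivative (f' - 2 * K * f t) * exp (- (2 * K) * t)) (at t)"
      by (auto intro!: derivative_eq_intros simp: algebra_simps)
    moreover have "f' \<le> 2 * K * f t"
    proof -
      let ?n = "norm (w ?y)"
      have lX: "linear (der X ?y)" by (rule smooth_linear_der[OF X U yU])
      have "norm (der X ?y h) = norm (\<Sum>i\<in>UNIV. (h $ i) *\<^sub>R der X ?y (axis i 1))"
        by (subst linear_expand_axis[OF lX]) simp
      also have "\<dots> \<le> (\<Sum>i\<in>UNIV. \<bar>h $ i\<bar> * ?n)"
        by (rule sum_norm_le) (use nw in \<open>auto intro: mult_left_mono\<close>)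
      finally have 1: "norm (der X ?y h) \<le> (\<Sum>i\<in>UNIV. \<bar>h $ i\<bar>) * ?n" by (simp add: sum_distrib_right)
      have "X ?y \<bullet> der X ?y h \<le> norm (X ?y) * norm (der X ?y h)" by (rule norm_cauchy_schwarz)
      also have "\<dots> \<le> ?n * ((\<Sum>i\<in>UNIV. \<bar>h $ i\<bar>) * ?n)" by (intro mult_mono nw 1) auto
      finally have 2: "X ?y \<bullet> der X ?y h \<le> (\<Sum>i\<in>UNIV. \<bar>h $ i\<bar>) * ?n\<^sup>2" by (simp add: power2_eq_square mult_ac)
      have 3: "der X ?y (axis i 1) \<bullet> prol2 ?y (w ?y) h (axis i 1) \<le> C i * ?n\<^sup>2" for i
      proof -
        have "der X ?y (axis i 1) \<bullet> prol2 ?y (w ?y) h (axis i 1) \<le> norm (der X ?y (axis i 1)) * norm (prol2 ?y (w ?y) h (axis i 1))"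
          by (rule norm_cauchy_schwarz)
        also have "\<dots> \<le> ?n * (C i * ?n)" by (intro mult_mono nw C(2) y) auto
        finally show ?thesis by (simp add: power2_eq_square mult_ac)
      qed
      have "f' \<le> 2 * ((\<Sum>i\<in>UNIV. \<bar>h $ i\<bar>) * ?n\<^sup>2) + (\<Sum>i\<in>UNIV. 2 * (C i * ?n\<^sup>2))"
        unfolding f'_def by (intro add_mono sum_mono mult_left_mono 2 3) auto
      also have "\<dots> = 2 * K * f t" unfolding fw K_def by (simp add: sum_distrib_left sum_distrib_right algebra_simps)
      finally show ?thesis .
    qed
    ultimately show ?thesis by (intro exI conjI) (auto simp: mult_le_0_iff)
  qed
  from DERIV_nonpos_imp_nonincreasing[of 0 1 "\<lambda>t. f t * exp (- (2 * K) * t)", OF _ this]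
  have "f 1 * exp (- (2 * K)) \<le> f 0" by simp
  also have "f 0 = 0" unfolding f_def using z by simp
  finally have "f 1 \<le> 0" by (simp add: mult_le_0_iff)
  then have "w y2 = 0" unfolding fw by (simp add: h_def)
  then have n: "norm (w y2) = 0" by simp
  have 1: "X y2 = 0" "der X y2 (axis i 1) = 0" for i using nw[of y2] n by auto
  have y2: "y2 \<in> U" using B by blast
  have "der X y2 v = 0" for v
    using linear_expand_axis[OF smooth_linear_der[OF X U y2], of v] 1(2) by simp
  with 1 show ?thesis by blast
qed

end


context fluid
begin

lemma chart_cball:
  obtains R W where "R > 0" "cball (cmap M a a) R \<subseteq> cimg M a" "open W" "a \<in> W" "W \<subseteq> cdom M a" "cmap M a ` W \<subseteq> cball (cmap M a a) R"
proof -
  obtain R where R: "R > 0" "cball (cmap M a a) R \<subseteq> cimg M a"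
    using open_contains_cball[of "cimg M a"] open_cimg cmap_in[OF in_cdom] by blast
  show thesis
  proof (rule that[OF R])
    show "open (cdom M a \<inter> cmap M a -` ball (cmap M a a) R)"
      by (rule continuous_open_preimage[OF continuous_on_cmap open_cdom open_ball])
  qed (use R in auto)
qed

lemma const_on_connected:
  assumes f: "smooth_scalar M f" and d: "\<And>x v. differential M f x v = 0"
  shows "f x = f x'"
proof (rule connected_local_const[of UNIV x x' f])
  show "connected (UNIV :: 'm set)" using M unfolding riemannian_manifold_def by blast
  show "x \<in> UNIV" "x' \<in> UNIV" by auto
  show "\<forall>a\<in>UNIV. \<forall>\<^sub>F b in at a within UNIV. f a = f b"
  proof
    fix a
    obtain R W where W: "R > 0" "cball (cmap M a a) R \<subseteq> cimg M a" "open W" "a \<in> W" "W \<subseteq> cdom M a" "cmap M a ` W \<subseteq> cball (cmap M a a) R"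
      by (rule chart_cball)
    have "\<exists>c. \<forall>y\<in>cball (cmap M a a) R. (f \<circ> cinv M a) y = c"
    proof (rule has_derivative_zero_constant[OF convex_cball])
      fix y assume "y \<in> cball (cmap M a a) R"
      then have y: "y \<in> cimg M a" using W by blast
      have "der (f \<circ> cinv M a) y = (\<lambda>v. 0)"
        using differential_chart[OF y refl refl f] d by (simp add: fun_eq_iff)
      then show "(f \<circ> cinv M a has_derivative (\<lambda>h. 0)) (at y within cball (cmap M a a) R)"
        using has_derivative_comp[OF f y] has_derivative_at_withinI by metis
    qed
    then obtain c where c: "\<And>y. y \<in> cball (cmap M a a) R \<Longrightarrow> (f \<circ> cinv M a) y = c" by blast
    have "f b = c" if "b \<in> W" for b
      using c[of "cmap M a b"] that W by (auto simp: subset_eq)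
    then show "\<forall>\<^sub>F b in at a. f a = f b"
      unfolding eventually_at_topological using W by (intro exI[of _ W]) simp
  qed
qed

text \<open>Within a ball of a chart the vanishing of the 1-jet passes from any point to any other,
  so it is a locally constant property of the point, and the manifold is connected.\<close>

lemma killing_zero:
  assumes X: "killing M X" and z: "X x0 = 0" "\<And>v. dvector M x0 v X = 0"
  shows "X x = 0"
proof -
  have sX: "smooth_vector M X" and L: "lie_metric M X x v w = 0" for x v w using X unfolding killing_def by auto
  \<comment> \<open>Stated with \<open>nabla\<close>, which transforms as a tensor; where
    \<open>X\<close> vanishes it equals the coordinate derivative.\<close>
  define Z where "Z x \<longleftrightarrow> X x = 0 \<and> (\<forall>v. nabla M x v X = 0)" for x
  have "Z x0 = Z x"
  proof (rule connected_local_const[of UNIV x0 x Z])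
    show "connected (UNIV :: 'm set)" using M unfolding riemannian_manifold_def by blast
    show "x0 \<in> UNIV" "x \<in> UNIV" by auto
    show "\<forall>a\<in>UNIV. \<forall>\<^sub>F b in at a within UNIV. Z a = Z b"
    proof
      fix a
      obtain R W where W: "R > 0" "cball (cmap M a a) R \<subseteq> cimg M a" "open W" "a \<in> W" "W \<subseteq> cdom M a" "cmap M a ` W \<subseteq> cball (cmap M a a) R"
        by (rule chart_cball)
      let ?Y = "vcomp M a X"
      define z where "z y \<longleftrightarrow> ?Y y = 0 \<and> (\<forall>v. der ?Y y v = 0)" for y
      have zz: "z y1 \<Longrightarrow> z y2" if "y1 \<in> cball (cmap M a a) R" "y2 \<in> cball (cmap M a a) R" for y1 y2
        unfolding z_def
        by (rule ch.killing_unique[OF smooth_vcomp[OF sX] _ W(2) that])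
          (use lie_chart[OF _ refl refl sX] L in auto)
      have Zz: "Z (cinv M a y) \<longleftrightarrow> z y" if y: "y \<in> cimg M a" for y
      proof -
        let ?x = "cinv M a y"
        let ?J = "transition M a ?x ?x"
        have J0: "?J v = 0 \<longleftrightarrow> v = 0" for v
          using J_inv(1)[OF y refl refl, of v] linear_0[OF linear_J[OF y refl refl]] linear_0[OF transition_linear[OF in_cdom cinv_in[OF y]]] by metis
        have 1: "X ?x = 0 \<longleftrightarrow> ?Y y = 0" using vcomp_J(2)[OF y refl refl, of X] J0 by metis
        have "(\<forall>v. nabla M ?x v X = 0) \<longleftrightarrow> (\<forall>v. nabla M ?x (?J v) X = 0)"
          using J_inv(2)[OF y refl refl] by metis
        also have "\<dots> \<longleftrightarrow> (\<forall>v. ch.nabc a ?Y y v = 0)"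
          unfolding nabla_chart[OF y refl refl sX] J0 ..
        finally show ?thesis unfolding Z_def z_def 1
          by (auto simp: ch.nabc_def linear_0[OF ch.christ_linear2[OF y]])
      qed
      have "Z a = Z b" if "b \<in> W" for b
      proof -
        have b: "b \<in> cdom M a" "cmap M a b \<in> cball (cmap M a a) R" using that W by (auto simp: subset_eq)
        show ?thesis using Zz[OF cmap_in[OF b(1)]] Zz[OF cmap_in[OF in_cdom]] b W(1)
            zz[of "cmap M a a" "cmap M a b"] zz[of "cmap M a b" "cmap M a a"] by auto
      qed
      then show "\<forall>\<^sub>F b in at a. Z a = Z b"
        unfolding eventually_at_topological using W by (intro exI[of _ W]) simp
    qed
  qed
  moreover have "Z x0"
    unfolding Z_def nabla_def using z linear_0[OF ch.christ_linear2[OF cmap_in[OF in_cdom]], of x0] by (simp add: christoffel_center)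
  ultimately show ?thesis unfolding Z_def by simp
qed

lemma vcomp_lincomb: "y \<in> cimg M p \<Longrightarrow> vcomp M p (\<lambda>z. a *\<^sub>R X z + Y z) y = a *\<^sub>R vcomp M p X y + vcomp M p Y y"
  using vcomp_add[of y p "\<lambda>z. a *\<^sub>R X z" Y] vcomp_scale[of y p "\<lambda>z. a" X] by simp

lemma smooth_vector_lincomb:
  assumes "smooth_vector M X" "smooth_vector M Y" shows "smooth_vector M (\<lambda>z. a *\<^sub>R X z + Y z)"
  by (rule smooth_vector_add[OF smooth_vector_scale assms(2)], unfold smooth_scalar_def o_def)
    (auto intro!: smooth_const open_cimg assms)

lemma dvector_lincomb:
  assumes "smooth_vector M X" "smooth_vector M Y"
  shows "dvector M x v (\<lambda>z. a *\<^sub>R X z + Y z) = a *\<^sub>R dvector M x v X + dvector M x v Y"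
proof -
  have y: "cmap M x x \<in> cimg M x" by simp
  have "(vcomp M x (\<lambda>z. a *\<^sub>R X z + Y z) has_derivative (\<lambda>v. a *\<^sub>R der (vcomp M x X) (cmap M x x) v + der (vcomp M x Y) (cmap M x x) v)) (at (cmap M x x))"
    by (rule has_derivative_transform_within_open[OF _ open_cimg y vcomp_lincomb[symmetric]])
      (intro derivative_intros has_derivative_vcomp[OF _ y] assms)
  from der_eq[OF this] show ?thesis unfolding dvector_def by simp
qed

lemma lie_lincomb:
  assumes "smooth_vector M X" "smooth_vector M Y"
  shows "lie_metric M (\<lambda>z. a *\<^sub>R X z + Y z) x v w = a * lie_metric M X x v w + lie_metric M Y x v w"
proof -
  have y: "cmap M x x \<in> cimg M x" by simp
  show ?thesis unfolding lie_metric_def dvector_lincomb[OF assms] dmetric_center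
    by (simp add: linear_add[OF linear_metric(1)] linear_add[OF linear_metric(2)] linear_cmul[OF linear_metric(1)] linear_cmul[OF linear_metric(2)]
      linear_add[OF ch.dG_linear1[OF y]] linear_cmul[OF ch.dG_linear1[OF y]] algebra_simps)
qed

lemma killing_lincomb:
  assumes "killing M X" "killing M Y" shows "killing M (\<lambda>z. a *\<^sub>R X z + Y z)"
  using assms smooth_vector_lincomb lie_lincomb unfolding killing_def by simp

lemma killing_0: "killing M (\<lambda>x. 0)"
proof -
  have v: "vcomp M p (\<lambda>x. 0) y = 0" if "y \<in> cimg M p" for p y
    using linear_0[OF transition_linear[OF in_cdom cinv_in[OF that]]] unfolding vcomp_def by simp
  have "smooth_vector M (\<lambda>x. 0)" unfolding smooth_vector_def
    by (intro allI smooth_cong[OF open_cimg v[symmetric]] smooth_const open_cimg)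
  from lie_lincomb[OF this this, of "-1"] this show ?thesis unfolding killing_def by simp
qed

lemma smooth_scalar_lincomb:
  assumes "smooth_scalar M f" "smooth_scalar M h" shows "smooth_scalar M (\<lambda>z. a * f z + h z)"
  using smooth_comp[OF assms(1)] smooth_comp[OF assms(2)] unfolding smooth_scalar_def o_def
  by (auto intro!: smooth_intros open_cimg)

lemma differential_lincomb:
  assumes "smooth_scalar M f" "smooth_scalar M h"
  shows "differential M (\<lambda>z. a * f z + h z) x v = a * differential M f x v + differential M h x v"
proof -
  have y: "cmap M x x \<in> cimg M x" by simp
  have "((\<lambda>z. a * f z + h z) \<circ> cinv M x has_derivative (\<lambda>v. a * differential M f x v + differential M h x v)) (at (cmap M x x))"
    using has_derivative_add[OF has_derivative_mult_right[OF has_derivative_comp[OF assms(1) y], of a] has_derivative_comp[OF assms(2) y]]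
    unfolding differential_def o_def .
  from der_eq[OF this] show ?thesis unfolding differential_def[of M "\<lambda>z. a * f z + h z"] by simp
qed

lemma grad_lincomb:
  assumes "smooth_scalar M f" "smooth_scalar M h"
  shows "grad M (\<lambda>z. a * f z + h z) x = a *\<^sub>R grad M f x + grad M h x"
  by (rule metric_eqD[where x = x])
    (simp add: grad_metric assms smooth_scalar_lincomb differential_lincomb linear_add[OF linear_metric(2)] linear_cmul[OF linear_metric(2)])

lemma smooth_scalar_const: "smooth_scalar M (\<lambda>x. c)"
  unfolding smooth_scalar_def o_def by (auto intro: smooth_const open_cimg)

lemma differential_const: "differential M (\<lambda>x. c) x v = 0"
  unfolding differential_def o_def using der_eq[OF has_derivative_const] by simp

lemma grad_const: "grad M (\<lambda>x. c) x = 0"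
  by (rule metric_eqD[where x = x]) (simp add: grad_metric smooth_scalar_const differential_const linear_0[OF linear_metric(2)])

definition jet :: "'m \<Rightarrow> ('m \<Rightarrow> real ^ 'n) \<Rightarrow> (real ^ 'n) \<times> ((real ^ 'n) ^ 'n)" where
  "jet p X = (X p, \<chi> j. dvector M p (axis j 1) X)"

text \<open>A Killing field is determined by its 1-jet at \<open>x0\<close>, so the jets of the
  members of \<open>V\<close> form a finite-dimensional space isomorphic to \<open>V\<close>. An
  orthonormal basis of it gives coefficients that are inner products of the jet with fixed vectors,
  hence smooth when the field depends smoothly on a parameter. \<open>V\<close> is left open so that
  it can also be the space of Killing gradients.\<close>

lemma killing_expand:
  assumes V: "\<And>X. X \<in> V \<Longrightarrow> killing M X" "(\<lambda>x. 0) \<in> V" "\<And>X Y a. X \<in> V \<Longrightarrow> Y \<in> V \<Longrightarrow> (\<lambda>z. a *\<^sub>R X z + Y z) \<in> V"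
  obtains N :: nat and B and \<beta> where "\<And>i. i < N \<Longrightarrow> B i \<in> V"
    "\<And>X x. X \<in> V \<Longrightarrow> X x = (\<Sum>i<N. (jet x0 X \<bullet> \<beta> i) *\<^sub>R B i x)"
proof -
  have sm: "X \<in> V \<Longrightarrow> smooth_vector M X" for X using V(1) unfolding killing_def by blast
  have jl: "jet x0 (\<lambda>z. a *\<^sub>R X z + Y z) = a *\<^sub>R jet x0 X + jet x0 Y" if "X \<in> V" "Y \<in> V" for X Y a
    unfolding jet_def using dvector_lincomb[OF sm[OF that(1)] sm[OF that(2)]] by (simp add: vec_eq_iff)
  have j0: "jet x0 (\<lambda>x. 0) = 0" using jl[OF V(2) V(2), of 1] by simp
  have sub: "subspace (jet x0 ` V)" unfolding subspace_def
  proof (intro conjI ballI allI)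
    show "0 \<in> jet x0 ` V" using j0 V(2) by (metis image_eqI)
    fix x y assume "x \<in> jet x0 ` V" "y \<in> jet x0 ` V"
    then obtain X Y where XY: "X \<in> V" "Y \<in> V" "x = jet x0 X" "y = jet x0 Y" by blast
    have "x + y = jet x0 (\<lambda>z. 1 *\<^sub>R X z + Y z)" unfolding jl[OF XY(1,2)] XY by simp
    then show "x + y \<in> jet x0 ` V" using V(3)[OF XY(1,2), of 1] by (rule image_eqI)
    have "c *\<^sub>R x = jet x0 (\<lambda>z. c *\<^sub>R X z + 0)" for c unfolding jl[OF XY(1) V(2)] XY j0 by simp
    then show "c *\<^sub>R x \<in> jet x0 ` V" for c using V(3)[OF XY(1) V(2), of c] by (rule image_eqI)
  qed
  obtain Bs where Bs: "Bs \<subseteq> jet x0 ` V" "pairwise orthogonal Bs" "\<And>x. x \<in> Bs \<Longrightarrow> norm x = 1" "independent Bs" "span Bs = jet x0 ` V"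
    using orthonormal_basis_subspace[OF sub] by metis
  have fin: "finite Bs" using Bs(4) by (rule independent_imp_finite)
  then obtain b where b: "bij_betw b {..<card Bs} Bs" using ex_bij_betw_nat_finite[of Bs] by (metis atLeast0LessThan)
  have bin: "b i \<in> Bs" if "i < card Bs" for i using b that unfolding bij_betw_def by auto
  define B where "B i = (SOME X. X \<in> V \<and> jet x0 X = b i)" for i
  have B: "B i \<in> V" "jet x0 (B i) = b i" if "i < card Bs" for i
  proof -
    have "b i \<in> jet x0 ` V" using bin[OF that] Bs(1) by blast
    then have "\<exists>X. X \<in> V \<and> jet x0 X = b i" by (metis imageE)
    then have "B i \<in> V \<and> jet x0 (B i) = b i" unfolding B_def by (rule someI_ex)
    then show "B i \<in> V" "jet x0 (B i) = b i" by auto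
  qed
  have comb: "(\<lambda>z. \<Sum>i<N. c i *\<^sub>R B i z) \<in> V \<and> jet x0 (\<lambda>z. \<Sum>i<N. c i *\<^sub>R B i z) = (\<Sum>i<N. c i *\<^sub>R b i)" if "N \<le> card Bs" for c N
    using that
  proof (induction N)
    case 0
    then show ?case using V(2) j0 by simp
  next
    case (Suc N)
    then have N: "N < card Bs" by simp
    let ?Y = "\<lambda>z. \<Sum>i<N. c i *\<^sub>R B i z"
    have Y: "?Y \<in> V" "jet x0 ?Y = (\<Sum>i<N. c i *\<^sub>R b i)" using Suc by auto
    have e: "(\<lambda>z. \<Sum>i<Suc N. c i *\<^sub>R B i z) = (\<lambda>z. c N *\<^sub>R B N z + ?Y z)" by (simp add: fun_eq_iff add.commute)
    show ?case unfolding e jl[OF B(1)[OF N] Y(1)] B(2)[OF N] Y(2) using V(3)[OF B(1)[OF N] Y(1), of "c N"] by (simp add: add.commute)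
  qed
  have exp: "w = (\<Sum>i<card Bs. (w \<bullet> b i) *\<^sub>R b i)" if "w \<in> jet x0 ` V" for w
  proof -
    have "w = (\<Sum>v\<in>Bs. (w \<bullet> v) *\<^sub>R v)"
      by (rule orthonormal_basis_expand[OF Bs(2,3) _ fin, symmetric]) (use that Bs(5) in auto)
    then show ?thesis using sum.reindex_bij_betw[OF b, of "\<lambda>v. (w \<bullet> v) *\<^sub>R v"] by simp
  qed
  show thesis
  proof (rule that[OF B(1)])
    fix X x assume X: "X \<in> V"
    define Y where "Y z = (\<Sum>i<card Bs. (jet x0 X \<bullet> b i) *\<^sub>R B i z)" for z
    have Y: "Y \<in> V" "jet x0 Y = jet x0 X"
      using comb[OF order_refl, of "\<lambda>i. jet x0 X \<bullet> b i"] exp[of "jet x0 X"] X unfolding Y_def by auto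
    \<comment> \<open>The difference between \<open>X\<close> and its expansion is a Killing field
      with vanishing jet.\<close>
    let ?Z = "\<lambda>z. (-1) *\<^sub>R Y z + X z"
    have Z: "?Z \<in> V" "jet x0 ?Z = 0" using V(3)[OF Y(1) X, of "-1"] jl[OF Y(1) X, of "-1"] Y(2) by auto
    have d0: "dvector M x0 v ?Z = 0" for v
    proof -
      have l: "linear (\<lambda>v. dvector M x0 v ?Z)" unfolding dvector_def
        using has_derivative_linear[OF has_derivative_vcomp[OF sm[OF Z(1)] cmap_in[OF in_cdom]]] .
      have "dvector M x0 (axis j 1) ?Z = 0" for j
        using arg_cong[OF Z(2), of "\<lambda>w. snd w $ j"] unfolding jet_def by simp
      then show ?thesis using linear_expand_axis[OF l, of v] by simp
    qed
    have "?Z x0 = 0" using Z(2) unfolding jet_def by (simp add: zero_prod_def)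
    from killing_zero[OF V(1)[OF Z(1)] this d0] have "?Z x = 0" .
    then show "X x = (\<Sum>i<card Bs. (jet x0 X \<bullet> b i) *\<^sub>R B i x)"
      unfolding Y_def jet_def by simp
  qed simp
qed

end


subsection \<open>Conserved families\<close>

lemma smooth_antideriv:
  fixes K g :: "real \<Rightarrow> real"
  assumes J: "open J" and K: "\<And>s. s \<in> J \<Longrightarrow> (K has_real_derivative g s) (at s)" and g: "smooth_on J g"
  shows "smooth_on J K"
  unfolding smooth_iff_ck
proof
  fix k
  have "ck (Suc k) J K"
  proof (rule ck_SucI'[OF J, where f' = "\<lambda>s h. g s * h"])
    show "(K has_derivative (*) (g s)) (at s)" if "s \<in> J" for s
      using K[OF that] unfolding has_field_derivative_def .
    show "ck k J (\<lambda>s. g s * b)" for b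
      using smooth_mult[OF J g smooth_const[OF J, of b]] smooth_iff_ck by blast
  qed
  then show "ck k J K" by (rule ck_Suc_imp)
qed

text \<open>The end points are taken as extended reals because the interval may be
  unbounded.\<close>

lemma antideriv_exists:
  assumes J: "open_interval J" and g: "smooth_on J (g :: real \<Rightarrow> real)"
  obtains K where "\<And>s. s \<in> J \<Longrightarrow> (K has_real_derivative g s) (at s)" "smooth_on J K"
proof -
  have oJ: "open J" and iJ: "is_interval J" and nJ: "J \<noteq> {}" using J unfolding open_interval_def by auto
  define a where "a = Inf (ereal ` J)"
  define b where "b = Sup (ereal ` J)"
  have mem: "x \<in> J" if "a < ereal x" "ereal x < b" for x
  proof -
    have "\<exists>y\<in>J. y < x" "\<exists>z\<in>J. x < z"
      using that unfolding a_def b_def Inf_less_iff less_Sup_iff by auto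
    then show ?thesis using iJ[unfolded is_interval_1] by (meson less_imp_le)
  qed
  have inb: "a < ereal x \<and> ereal x < b" if x: "x \<in> J" for x
  proof -
    obtain \<epsilon> where \<epsilon>: "\<epsilon> > 0" "ball x \<epsilon> \<subseteq> J" using oJ x open_contains_ball by blast
    have "x - \<epsilon> / 2 \<in> J" "x + \<epsilon> / 2 \<in> J" using \<epsilon> by (auto simp: dist_real_def subset_eq)
    then have "a \<le> ereal (x - \<epsilon> / 2)" "ereal (x + \<epsilon> / 2) \<le> b"
      unfolding a_def b_def by (auto intro: Inf_lower Sup_upper)
    moreover have "ereal (x - \<epsilon> / 2) < ereal x" "ereal x < ereal (x + \<epsilon> / 2)" using \<epsilon> by auto
    ultimately show ?thesis by (meson le_less_trans less_le_trans)
  qed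
  obtain x where "x \<in> J" using nJ by blast
  then have "a < b" using inb less_trans by blast
  moreover have "isCont g x" if "a < ereal x" "ereal x < b" for x
    using smooth_has_derivative[OF g oJ mem[OF that]] has_derivative_continuous by blast
  ultimately obtain K where "\<And>x. a < ereal x \<Longrightarrow> ereal x < b \<Longrightarrow> (K has_vector_derivative g x) (at x)"
    using einterval_antiderivative[of a b g] by blast
  then have K: "\<And>s. s \<in> J \<Longrightarrow> (K has_real_derivative g s) (at s)"
    using inb by (simp add: has_real_derivative_iff_has_vector_derivative)
  show thesis by (rule that[OF K smooth_antideriv[OF oJ K g]])
qed

locale fluid_energy = fluid_eos M I J P for M :: "('m::{t2_space, second_countable_topology}, 'n::finite) riemannian" and I J P +
  fixes e :: "real \<Rightarrow> real \<Rightarrow> real"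
  assumes e: "thermodynamic_energy I J P e"
begin

lemma smooth_e: "smooth_on (I \<times> J) (\<lambda>(r, s). e r s)"
  and e_deriv: "r \<in> I \<Longrightarrow> s \<in> J \<Longrightarrow> ((\<lambda>r. e r s) has_real_derivative P r s / r\<^sup>2) (at r)"
  using e unfolding thermodynamic_energy_def by auto

text \<open>So \<open>b = r e\<close> and \<open>F = P\<close> satisfy the condition
  \<open>db\<close> of \<open>conserved_family\<close>.\<close>

lemma re_deriv: "r \<in> I \<Longrightarrow> s \<in> J \<Longrightarrow> ((\<lambda>r. r * e r s) has_real_derivative (r * e r s + P r s) / r) (at r)"
  using pos_I[of r] by (auto intro!: derivative_eq_intros e_deriv simp: field_simps power2_eq_square)

lemma homothetic_killing: "killing M X \<Longrightarrow> homothetic M X (\<lambda>x. 0)"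
  unfolding killing_def homothetic_def by (simp add: smooth_scalar_const grad_const)

lemma smooth_ps:
  assumes "smooth_scalar M \<psi>" "smooth_on J f"
  shows "smooth_on (cimg M p \<times> J) (\<lambda>(y, s). \<psi> (cinv M p y))" "smooth_on (cimg M p \<times> J) (\<lambda>(y, s). f s)"
proof -
  have o: "open (cimg M p \<times> J)" by (intro open_Times open_cimg open_J)
  have "smooth_on (cimg M p \<times> J) (\<lambda>z. (\<psi> \<circ> cinv M p) (fst z))"
    by (rule smooth_compose[OF o open_cimg _ _ smooth_comp[OF assms(1)]]) (auto intro!: smooth_intros o)
  then show "smooth_on (cimg M p \<times> J) (\<lambda>(y, s). \<psi> (cinv M p y))" by (simp add: case_prod_unfold)
  have "smooth_on (cimg M p \<times> J) (\<lambda>z. f (snd z))"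
    by (rule smooth_compose[OF o open_J _ _ assms(2)]) (auto intro!: smooth_intros o)
  then show "smooth_on (cimg M p \<times> J) (\<lambda>(y, s). f s)" by (simp add: case_prod_unfold)
qed

lemma smooth_rs: "smooth_on J f \<Longrightarrow> smooth_on (I \<times> J) (\<lambda>(r, s). f s)"
  unfolding case_prod_unfold
  by (rule smooth_compose[OF open_IJ open_J]) (auto intro!: smooth_intros open_IJ)

text \<open>The case \<open>f = 1\<close>, \<open>F = P\<close>, \<open>b = r e\<close>,
  \<open>\<Lambda> = 0\<close> of \<open>conserved_family\<close>.\<close>

lemma conserved_general:
  assumes X: "killing M X" and \<psi>: "smooth_scalar M \<psi>" and h: "smooth_on J h"
    and d: "\<And>x v. \<beta> * metric M x (X x) v + differential M \<psi> x v = 0"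
  shows "conserved (\<lambda>t x v r s. c0 * (1/2 * r * metric M x v v + r * e r s) +
    (\<alpha> + \<beta> * t) * r * metric M x (X x) v + r * (\<psi> x + h s))"
proof (rule conserved_cong[OF _ conserved_family[where X = X and \<Lambda> = "\<lambda>x. 0" and f = "\<lambda>s. 1" and b = "\<lambda>r s. r * e r s"
      and F = P and q = "\<lambda>x s. \<psi> x + h s" and \<alpha> = \<alpha> and \<beta> = \<beta> and ?c0.0 = c0, OF homothetic_killing[OF X]]])
  show "smooth_on J (\<lambda>s. 1)" by (intro smooth_intros open_J)
  have "smooth_on (I \<times> J) (\<lambda>z. fst z * (\<lambda>(r, s). e r s) z)" by (intro smooth_intros open_IJ smooth_e)
  then show "smooth_on (I \<times> J) (\<lambda>(r, s). r * e r s)" by (simp add: case_prod_unfold)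
  have o: "open (cimg M p \<times> J)" for p by (intro open_Times open_cimg open_J)
  show "smooth_on (cimg M p \<times> J) (\<lambda>(y, s). \<psi> (cinv M p y) + h s)" for p
    using smooth_add[OF o smooth_ps[OF \<psi> h, of p]] by (simp add: case_prod_unfold)
  show "\<beta> * 1 * metric M x (X x) v + differential M (\<lambda>x. \<psi> x + h s) x v = 0" for x v s
    using differential_lincomb[OF \<psi> smooth_scalar_const[of "h s"], of 1 x v] d[of x v] by (simp add: differential_const)
qed (simp_all add: P re_deriv)

text \<open>The polytropic law as a differential equation, the form in which it is used and in which
  \<open>polytropic_if_ctT\<close> finds it again.\<close>

lemma polytropic_deriv:
  assumes p: "polytropic CARD('n) I J (\<lambda>r s. P r s - P\<^sub>0)" and rs: "r \<in> I" "s \<in> J"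
  shows "(1 + real CARD('n) / 2) * (P r s - P\<^sub>0) = real CARD('n) / 2 * (r * der Pc (r, s) (1, 0))"
proof -
  obtain \<sigma> where \<sigma>: "\<And>r s. r \<in> I \<Longrightarrow> s \<in> J \<Longrightarrow> P r s - P\<^sub>0 = \<sigma> s * r powr (1 + 2 / real CARD('n))"
    using p unfolding polytropic_def by blast
  let ?n = "real CARD('n)"
  have n0: "?n > 0" by simp
  have r0: "r > 0" using pos_I rs by blast
  have "((\<lambda>r. \<sigma> s * r powr (1 + 2 / ?n)) has_real_derivative \<sigma> s * ((1 + 2 / ?n) * r powr (2 / ?n))) (at r)"
    using r0 by (auto intro!: derivative_eq_intros)
  then have "((\<lambda>r. P r s - P\<^sub>0) has_real_derivative \<sigma> s * ((1 + 2 / ?n) * r powr (2 / ?n))) (at r)"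
    by (rule has_field_derivative_transform_within_open[OF _ open_I rs(1)]) (use \<sigma> rs in auto)
  moreover have "((\<lambda>r. P r s - P\<^sub>0) has_real_derivative der Pc (r, s) (1, 0)) (at r)"
    using DERIV_diff[OF der_Pc(1)[OF rs] DERIV_const[of P\<^sub>0]] by simp
  ultimately have "der Pc (r, s) (1, 0) = \<sigma> s * ((1 + 2 / ?n) * r powr (2 / ?n))" by (rule DERIV_unique[rotated])
  then have "r * der Pc (r, s) (1, 0) = (1 + 2 / ?n) * (P r s - P\<^sub>0)"
    unfolding \<sigma>[OF rs] using r0 by (simp add: powr_add)
  then show ?thesis using n0 by (simp add: field_simps)
qed

text \<open>The case \<open>f = 1\<close>, \<open>F = P - P\<^sub>0\<close>,
  \<open>b = n F / 2\<close> of \<open>conserved_family\<close>: for this \<open>b\<close> the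
  condition \<open>db\<close> is the polytropic equation.\<close>

lemma conserved_polytropic:
  assumes p: "polytropic CARD('n) I J (\<lambda>r s. P r s - P\<^sub>0)" and X: "homothetic M X \<Lambda>" and \<psi>: "smooth_scalar M \<psi>"
    and d: "\<And>x v. \<beta> * metric M x (X x) v + differential M \<psi> x v = 0"
  shows "conserved (\<lambda>t x v r s. (\<alpha> + \<beta> * t) * r * metric M x (X x) v + r * \<psi> x
    - \<Lambda> x * (\<alpha> * t + \<beta> * t\<^sup>2 / 2) / 2 * (r * metric M x v v + real CARD('n) * (P r s - P\<^sub>0)))"
proof -
  let ?n = "real CARD('n)"
  have sP: "smooth_on (I \<times> J) (\<lambda>z. Pc z - P\<^sub>0)" by (intro smooth_diff P smooth_const open_IJ)
  show ?thesis
  proof (rule conserved_cong[OF _ conserved_family[where X = X and \<Lambda> = \<Lambda> and f = "\<lambda>s. 1" and b = "\<lambda>r s. ?n / 2 * (P r s - P\<^sub>0)"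
      and F = "\<lambda>r s. P r s - P\<^sub>0" and q = "\<lambda>x s. \<psi> x" and \<alpha> = \<alpha> and \<beta> = \<beta> and ?c0.0 = 0, OF X]])
    show "smooth_on J (\<lambda>s. 1)" by (intro smooth_intros open_J)
    show "smooth_on (I \<times> J) (\<lambda>(r, s). P r s - P\<^sub>0)" using sP by (simp add: case_prod_unfold)
    show "smooth_on (I \<times> J) (\<lambda>(r, s). ?n / 2 * (P r s - P\<^sub>0))"
      using smooth_mult[OF open_IJ smooth_const[OF open_IJ, of "?n / 2"] sP] by (simp add: case_prod_unfold)
    show "smooth_on (cimg M p \<times> J) (\<lambda>(y, s). \<psi> (cinv M p y))" for p
      by (rule smooth_ps(1)[OF \<psi> smooth_const[OF open_J]])
    show "\<beta> * 1 * metric M x (X x) v + differential M \<psi> x v = 0" for x v using d by simp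
    fix r s assume rs: "r \<in> I" "s \<in> J"
    have "((\<lambda>z. Pc z - P\<^sub>0) has_derivative der Pc (r, s)) (at (r, s))"
      using has_derivative_diff[OF smooth_has_derivative[OF P open_IJ, of "(r, s)"] has_derivative_const[of P\<^sub>0]] rs by simp
    then show "der (\<lambda>(r, s). P r s - P\<^sub>0) (r, s) (h, k) = 1 * der (\<lambda>(r, s). P r s) (r, s) (h, k)" for h k
      using der_eq[of "\<lambda>(r, s). P r s - P\<^sub>0"] by (simp add: case_prod_unfold)
    have "((\<lambda>r. ?n / 2 * (P r s - P\<^sub>0)) has_real_derivative ?n / 2 * (der Pc (r, s) (1, 0) - 0)) (at r)"
      by (intro DERIV_cmult DERIV_diff der_Pc rs DERIV_const)
    moreover have "?n / 2 * (der Pc (r, s) (1, 0) - 0) = (?n / 2 * (P r s - P\<^sub>0) + (P r s - P\<^sub>0)) / r"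
      using polytropic_deriv[OF p rs] pos_I[OF rs(1)] by (simp add: field_simps)
    ultimately show "((\<lambda>r. ?n / 2 * (P r s - P\<^sub>0)) has_real_derivative (?n / 2 * (P r s - P\<^sub>0) + (P r s - P\<^sub>0)) / r) (at r)"
      by (simp only:)
  qed (simp_all add: field_simps)
qed

lemma isobaric_der:
  assumes \<kappa>: "\<And>r s. r \<in> I \<Longrightarrow> s \<in> J \<Longrightarrow> P r s = \<kappa> s" and rs: "r \<in> I" "s \<in> J"
  shows "der Pc (r, s) (h, k) = deriv \<kappa> s * k" "(\<kappa> has_real_derivative deriv \<kappa> s) (at s)" "smooth_on J (deriv \<kappa>)"
proof -
  have d: "(\<kappa> has_real_derivative der Pc (r, s) (0, 1)) (at s)" if rs: "r \<in> I" "s \<in> J" for r s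
    by (rule has_field_derivative_transform_within_open[OF der_Pc(2)[OF rs] open_J rs(2)]) (use \<kappa> rs in auto)
  note dk = DERIV_imp_deriv[OF d]
  show "(\<kappa> has_real_derivative deriv \<kappa> s) (at s)" using d[OF rs] dk[OF rs] by simp
  have "((\<lambda>r. \<kappa> s) has_real_derivative der Pc (r, s) (1, 0)) (at r)"
    by (rule has_field_derivative_transform_within_open[OF der_Pc(1)[OF rs] open_I rs(1)]) (use \<kappa> rs in auto)
  then have 1: "der Pc (r, s) (1, 0) = 0" using DERIV_const DERIV_unique by blast
  have l: "linear (der Pc (r, s))" by (rule smooth_linear_der[OF P open_IJ]) (use rs in simp)
  have "der Pc (r, s) (h, k) = h * der Pc (r, s) (1, 0) + k * der Pc (r, s) (0, 1)"
    using linear_add[OF l, of "h *\<^sub>R (1, 0)" "k *\<^sub>R (0, 1)"] linear_cmul[OF l, of h "(1, 0)"] linear_cmul[OF l, of k "(0, 1)"] by simp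
  then show "der Pc (r, s) (h, k) = deriv \<kappa> s * k" unfolding 1 dk[OF rs] by simp
  have "smooth_on J (\<lambda>s. der Pc (r, s) (0, 1))"
    by (rule smooth_der_compose[OF open_J _ _ open_IJ P]) (use rs in \<open>auto intro!: smooth_intros open_J\<close>)
  then show "smooth_on J (deriv \<kappa>)" by (rule smooth_cong[OF open_J, rotated]) (simp add: dk[OF rs(1)])
qed

text \<open>The case \<open>F = K\<close>, \<open>b = - K\<close>: both are independent of the
  density and their sum is zero, so \<open>db\<close> holds for any weight \<open>f\<close>.\<close>

lemma conserved_isobaric:
  assumes \<kappa>: "\<And>r s. r \<in> I \<Longrightarrow> s \<in> J \<Longrightarrow> P r s = \<kappa> s" and X: "killing M X" and \<psi>: "smooth_scalar M \<psi>" and f: "smooth_on J f"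
    and d: "\<And>x v. \<beta> * metric M x (X x) v + differential M \<psi> x v = 0"
    and K: "\<And>s. s \<in> J \<Longrightarrow> (K has_real_derivative f s * deriv \<kappa> s) (at s)"
  shows "conserved (\<lambda>t x v r s. c0 * (1/2 * r * metric M x v v * f s - K s) +
    (\<alpha> + \<beta> * t) * f s * r * metric M x (X x) v + r * \<psi> x * f s)"
proof (rule conserved_cong[OF _ conserved_family[where X = X and \<Lambda> = "\<lambda>x. 0" and f = f and b = "\<lambda>r s. - K s"
      and F = "\<lambda>r s. K s" and q = "\<lambda>x s. \<psi> x * f s" and \<alpha> = \<alpha> and \<beta> = \<beta> and ?c0.0 = c0, OF homothetic_killing[OF X] f]])
  obtain r where r: "r \<in> I" using ex_interior .
  have "smooth_on J K"
    by (rule smooth_antideriv[OF open_J K smooth_mult[OF open_J f]])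
      (auto simp: open_interval_def intro: ex_interior isobaric_der(3)[OF \<kappa>])
  then show s: "smooth_on (I \<times> J) (\<lambda>(r, s). K s)" by (rule smooth_rs)
  show "smooth_on (I \<times> J) (\<lambda>(r, s). - K s)" using smooth_minus[OF open_IJ s] by (simp add: case_prod_unfold)
  have o: "open (cimg M p \<times> J)" for p by (intro open_Times open_cimg open_J)
  show "smooth_on (cimg M p \<times> J) (\<lambda>(y, s). \<psi> (cinv M p y) * f s)" for p
    using smooth_mult[OF o smooth_ps[OF \<psi> f, of p]] by (simp add: case_prod_unfold)
  show "\<beta> * f s * metric M x (X x) v + differential M (\<lambda>x. \<psi> x * f s) x v = 0" for x v s
  proof -
    have "differential M (\<lambda>x. \<psi> x * f s) x v = f s * differential M \<psi> x v"
      using differential_lincomb[OF \<psi> smooth_scalar_const[of 0], of "f s" x v] by (simp add: differential_const mult.commute)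
    then show ?thesis using d[of x v] by algebra
  qed
  fix r s assume rs: "r \<in> I" "s \<in> J"
  have "((\<lambda>z. K (snd z)) has_derivative (\<lambda>z. f s * deriv \<kappa> s * snd z)) (at (r, s))"
    by (rule has_derivative_compose[OF bounded_linear_imp_has_derivative[OF bounded_linear_snd]])
      (use K[OF rs(2)] in \<open>simp add: has_field_derivative_def\<close>)
  from der_eq[OF this] show "der (\<lambda>(r, s). K s) (r, s) (h, k) = f s * der (\<lambda>(r, s). P r s) (r, s) (h, k)" for h k
    using isobaric_der(1)[OF \<kappa> rs] by (simp add: case_prod_unfold)
qed (simp_all add: algebra_simps)

end


section \<open>Trivial densities and linear combinations\<close>

context fluid_energy
begin

text \<open>Both alternatives of triviality leave a function of time and place. For a divergence
  this is \<open>trivial_no_dependence\<close>, integrated over the convex set of states.\<close>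

lemma trivial_const:
  assumes T: "conserved T" and tr: "trivial_density M I J P T"
    and rs: "r \<in> I" "s \<in> J" "r' \<in> I" "s' \<in> J"
  shows "T t x v r s = T t x v' r' s'"
  using tr unfolding trivial_density_def
proof (elim disjE exE conjE)
  fix \<Theta>
  assume vf: "vec_fun \<Theta>" and eq: "\<forall>t u \<rho> S u' \<rho>' S' x. formal_solution M I J P u \<rho> S u' \<rho>' S' \<longrightarrow>
      T t x (u x) (\<rho> x) (S x) = divergence M (\<Theta> t u \<rho> S) x"
  have tr: "T t x (u x) (\<rho> x) (S x) = divergence M (\<Theta> t u \<rho> S) x" if "fluid_st u \<rho> S" for u \<rho> S x
    using formal_solution_exists[OF that] eq by blast
  define N where "N = (\<lambda>w. That T x (t, cmap M x x, w))"
  have d: "der (That T x) (t, cmap M x x, w) (0, 0, \<eta>) = 0" if "w \<in> \<Omega>" for w \<eta>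
    using trivial_no_dependence[OF vf kin[OF T] tr, of "fst (snd w)" "snd (snd w)" x "fst w" \<eta>] that by (cases w) auto
  have "\<exists>c. \<forall>w\<in>\<Omega>. N w = c"
  proof (rule has_derivative_zero_constant[OF convex_\<Omega>])
    fix w assume w: "w \<in> \<Omega>"
    have "(t, cmap M x x, w) \<in> UNIV \<times> cimg M x \<times> UNIV \<times> I \<times> J" using w by auto
    from smooth_has_derivative[OF smooth_That[OF kin[OF T]] open_dom this]
    have "(N has_derivative (\<lambda>\<eta>. der (That T x) (t, cmap M x x, w) (0, 0, \<eta>))) (at w)"
      unfolding N_def by (rule has_derivative_compose[rotated]) (auto intro!: derivative_eq_intros)
    then show "(N has_derivative (\<lambda>h. 0)) (at w within \<Omega>)" unfolding d[OF w] by (rule has_derivative_at_withinI)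
  qed
  then obtain c where "\<And>w. w \<in> \<Omega> \<Longrightarrow> N w = c" by blast
  from this[of "(v, r, s)"] this[of "(v', r', s')"] rs show ?thesis unfolding N_def That_center by simp
qed (use rs in auto)

text \<open>\<open>generated\<close> with the trivial part already reduced to a function of time and
  place and without the demand that this part be conserved; \<open>generated_iff\<close> compares
  the two.\<close>

definition comb :: "('m, 'n) density set \<Rightarrow> ('m, 'n) density \<Rightarrow> bool" where
  "comb F T \<longleftrightarrow> (\<exists>(N::nat) c L h. (\<forall>i<N. L i \<in> F) \<and>
     (\<forall>t x v. \<forall>r\<in>I. \<forall>s\<in>J. T t x v r s = (\<Sum>i<N. c i * L i t x v r s) + h t x))"

lemma comb_member: "L \<in> F \<Longrightarrow> comb F L"
  unfolding comb_def by (intro exI[of _ "1::nat"] exI[of _ "\<lambda>i. 1"] exI[of _ "\<lambda>i. L"] exI[of _ "\<lambda>t x. 0"]) auto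

lemma comb_base: "comb F (\<lambda>t x v r s. h t x)"
  unfolding comb_def by (intro exI[of _ "0::nat"] exI[of _ undefined] exI[of _ h]) auto

lemma comb_cong: "comb F T \<Longrightarrow> (\<And>t x v r s. r \<in> I \<Longrightarrow> s \<in> J \<Longrightarrow> T' t x v r s = T t x v r s) \<Longrightarrow> comb F T'"
  unfolding comb_def by simp

lemma comb_mono: "comb F T \<Longrightarrow> F \<subseteq> F' \<Longrightarrow> comb F' T"
  unfolding comb_def by blast

lemma comb_lincomb:
  assumes "comb F T1" "comb F T2" shows "comb F (\<lambda>t x v r s. a * T1 t x v r s + T2 t x v r s)"
proof -
  obtain N1 c1 L1 h1 where 1: "\<And>i. i < N1 \<Longrightarrow> L1 i \<in> F"
    "\<And>t x v r s. r \<in> I \<Longrightarrow> s \<in> J \<Longrightarrow> T1 t x v r s = (\<Sum>i<N1::nat. c1 i * L1 i t x v r s) + h1 t x"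
    using assms(1) unfolding comb_def by blast
  obtain N2 c2 L2 h2 where 2: "\<And>i. i < N2 \<Longrightarrow> L2 i \<in> F"
    "\<And>t x v r s. r \<in> I \<Longrightarrow> s \<in> J \<Longrightarrow> T2 t x v r s = (\<Sum>i<N2::nat. c2 i * L2 i t x v r s) + h2 t x"
    using assms(2) unfolding comb_def by blast
  define c where "c i = (if i < N1 then a * c1 i else c2 (i - N1))" for i
  define L where "L i = (if i < N1 then L1 i else L2 (i - N1))" for i
  have s: "(\<Sum>i<N1 + N2. c i * L i t x v r s) = (\<Sum>i<N1. a * (c1 i * L1 i t x v r s)) + (\<Sum>i<N2. c2 i * L2 i t x v r s)" for t x v r s
    unfolding lessThan_atLeast0 sum.atLeastLessThan_concat[symmetric, of 0 N1 "N1 + N2", simplified]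
    using sum.shift_bounds_nat_ivl[of "\<lambda>i. c i * L i t x v r s" 0 N1 N2] by (simp add: c_def L_def add.commute mult.assoc)
  show ?thesis unfolding comb_def
  proof (intro exI conjI allI impI ballI)
    show "L i \<in> F" if "i < N1 + N2" for i using that 1(1)[of i] 2(1)[of "i - N1"] unfolding L_def by auto
    show "a * T1 t x v r s + T2 t x v r s = (\<Sum>i<N1 + N2. c i * L i t x v r s) + (a * h1 t x + h2 t x)" if "r \<in> I" "s \<in> J" for t x v r s
      unfolding s 1(2)[OF that] 2(2)[OF that] by (simp add: sum_distrib_left algebra_simps)
  qed
qed

lemma comb_sum:
  assumes "\<And>i. i < (N::nat) \<Longrightarrow> comb F (T i)" shows "comb F (\<lambda>t x v r s. \<Sum>i<N. T i t x v r s)"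
  using assms
proof (induction N)
  case 0
  then show ?case using comb_base[of F "\<lambda>t x. 0"] by simp
next
  case (Suc N)
  then show ?case using comb_lincomb[of F "T N" "\<lambda>t x v r s. \<Sum>i<N. T i t x v r s" 1] by (simp add: add.commute)
qed

lemma conserved_sum:
  assumes "\<And>i. i < (N::nat) \<Longrightarrow> conserved (L i)" and T: "conserved T"
  shows "conserved (\<lambda>t x v r s. (\<Sum>i<N. c i * L i t x v r s) + T t x v r s)"
  using assms(1)
proof (induction N)
  case 0
  then show ?case using T by simp
next
  case (Suc N)
  then show ?case
    using conserved_lincomb[of "L N" "\<lambda>t x v r s. (\<Sum>i<N. c i * L i t x v r s) + T t x v r s" "c N"] by (simp add: algebra_simps)
qed

text \<open>What remains of a conserved density after subtraction of conserved ones is conserved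
  automatically, so only its dependence on time and place alone has to be known.\<close>

lemma generated_iff:
  assumes F: "\<And>L. L \<in> F \<Longrightarrow> conserved L"
  shows "generated M I J P F T \<longleftrightarrow> conserved T \<and> comb F T"
proof
  assume "generated M I J P F T"
  then obtain N c L T0 where L: "\<And>i. i < N \<Longrightarrow> L i \<in> F" and T0: "conserved T0" "trivial_density M I J P T0"
    and T: "\<And>t x v r s. r \<in> I \<Longrightarrow> s \<in> J \<Longrightarrow> T t x v r s = (\<Sum>i<N::nat. c i * L i t x v r s) + T0 t x v r s"
    unfolding generated_def by blast
  have FL: "conserved (L i)" if "i < N" for i using F L that by blast
  have "conserved T"
    by (rule conserved_cong[OF T[symmetric] conserved_sum[OF FL T0(1)]])
  moreover obtain r1 s1 where "r1 \<in> I" "s1 \<in> J" using ex_interior .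
  then have "T0 t x v r s = T0 t x 0 r1 s1" if "r \<in> I" "s \<in> J" for t x v r s
    using trivial_const[OF T0 that] by blast
  then have "comb F T" unfolding comb_def
    by (intro exI[of _ N] exI[of _ c] exI[of _ L] exI[of _ "\<lambda>t x. T0 t x 0 r1 s1"]) (simp add: L T)
  ultimately show "conserved T \<and> comb F T" ..
next
  assume a: "conserved T \<and> comb F T"
  then obtain N c L h where L: "\<And>i. i < N \<Longrightarrow> L i \<in> F"
    and T: "\<And>t x v r s. r \<in> I \<Longrightarrow> s \<in> J \<Longrightarrow> T t x v r s = (\<Sum>i<N::nat. c i * L i t x v r s) + h t x"
    unfolding comb_def by blast
  define T0 where "T0 t x v r s = (\<Sum>i<N. (- c i) * L i t x v r s) + T t x v r s" for t x v r s
  have FL: "conserved (L i)" if "i < N" for i using F L that by blast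
  have "conserved T0"
    unfolding T0_def by (rule conserved_sum) (use FL a in auto)
  moreover have "trivial_density M I J P T0"
    unfolding trivial_density_def T0_def by (intro disjI2 exI[of _ h]) (simp add: T sum_negf)
  ultimately show "generated M I J P F T"
    unfolding generated_def using L
    by (intro exI[of _ N] exI[of _ c] exI[of _ L] exI[of _ T0]) (simp add: T0_def sum_negf)
qed

lemma general_conserved: "T \<in> general_densities M J e \<Longrightarrow> conserved T"
  unfolding general_densities_def
proof (elim UnE CollectE exE conjE singletonE)
  note g = conserved_general[OF killing_0 smooth_scalar_const]
  have z: "0 * metric M x 0 v + differential M (\<lambda>x. 0) x v = 0" for x v by (simp add: differential_const)
  show "T = mass_density \<Longrightarrow> ?thesis"
    using g[OF smooth_const[OF open_J, of 1] z, of 0 0] by (simp add: mass_density_def)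
  show "T = entropy_density f \<Longrightarrow> nonconstant_fun J f \<Longrightarrow> ?thesis" for f
    using g[OF _ z, of f 0 0] by (simp add: entropy_density_def nonconstant_fun_def)
  show "T = energy_density M e \<Longrightarrow> ?thesis"
    using g[OF smooth_const[OF open_J, of 0] z, of 1 0] by (simp add: energy_density_def algebra_simps)
  show "T = momentum_density M \<zeta> \<Longrightarrow> killing M \<zeta> \<Longrightarrow> ?thesis" for \<zeta>
    using conserved_general[OF _ smooth_scalar_const[of 0] smooth_const[OF open_J, of 0], of \<zeta> 0 0 1]
    by (simp add: momentum_density_def differential_const metric_sym mult.commute)
  show "T = galilean_momentum_density M \<psi> \<Longrightarrow> smooth_scalar M \<psi> \<Longrightarrow> killing M (grad M \<psi>) \<Longrightarrow> ?thesis" for \<psi>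
    using conserved_general[OF _ _ smooth_const[OF open_J, of 0], of "grad M \<psi>" \<psi> "-1" 0 0]
    by (simp add: galilean_momentum_density_def grad_metric algebra_simps)
qed

lemma polytropic_conserved:
  assumes p: "polytropic CARD('n) I J (\<lambda>r s. P r s - P\<^sub>0)"
  shows "T \<in> polytropic_densities M (\<lambda>r s. P r s - P\<^sub>0) \<Longrightarrow> conserved T"
  unfolding polytropic_densities_def
proof (elim UnE CollectE exE conjE)
  show "T = similarity_energy_density M (\<lambda>r s. P r s - P\<^sub>0) \<xi> \<Lambda> \<Longrightarrow> homothetic M \<xi> \<Lambda> \<Longrightarrow> ?thesis" for \<xi> \<Lambda>
    using conserved_polytropic[OF p _ smooth_scalar_const[of 0], of \<xi> \<Lambda> 0 1]
    by (simp add: similarity_energy_density_def differential_const metric_sym mult_ac)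
  show "T = galilean_energy_density M (\<lambda>r s. P r s - P\<^sub>0) \<theta> \<Lambda> \<Longrightarrow> smooth_scalar M \<theta> \<Longrightarrow> homothetic M (grad M \<theta>) \<Lambda> \<Longrightarrow> ?thesis" for \<theta> \<Lambda>
    using conserved_polytropic[OF p, of "grad M \<theta>" \<Lambda> \<theta> "-1" 0]
    by (simp add: galilean_energy_density_def grad_metric algebra_simps)
qed

lemma isobaric_conserved:
  assumes \<kappa>: "\<And>r s. r \<in> I \<Longrightarrow> s \<in> J \<Longrightarrow> P r s = \<kappa> s"
  shows "T \<in> isobaric_densities M J \<kappa> \<union> isobaric_galilean_densities M J \<Longrightarrow> conserved T"
  unfolding isobaric_densities_def isobaric_galilean_densities_def
proof (elim UnE CollectE exE conjE)
  have z: "0 * metric M x v w + differential M (\<lambda>x. 0) x v' = 0" for x v w v' by (simp add: differential_const)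
  obtain r1 s1 where r1: "r1 \<in> I" "s1 \<in> J" using ex_interior .
  have sm: "smooth_on J (\<lambda>s. f s * deriv \<kappa> s)" if "smooth_on J f" for f
    by (intro smooth_mult open_J that isobaric_der(3)[OF \<kappa> r1])
  show "T = nonisentropic_momentum_density M \<zeta> f \<Longrightarrow> killing M \<zeta> \<Longrightarrow> nonconstant_fun J f \<Longrightarrow> ?thesis" for \<zeta> f
  proof -
    assume a: "T = nonisentropic_momentum_density M \<zeta> f" "killing M \<zeta>" "nonconstant_fun J f"
    then have f: "smooth_on J f" unfolding nonconstant_fun_def by blast
    obtain K where "\<And>s. s \<in> J \<Longrightarrow> (K has_real_derivative f s * deriv \<kappa> s) (at s)"
      using antideriv_exists[OF J sm[OF f]] by blast
    from conserved_isobaric[OF \<kappa> a(2) smooth_scalar_const[of 0] f z this, of 0 1] show ?thesis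
      by (simp add: a(1) nonisentropic_momentum_density_def metric_sym mult_ac)
  qed
  show "T = nonisentropic_galilean_density M \<psi> f \<Longrightarrow> smooth_scalar M \<psi> \<Longrightarrow> killing M (grad M \<psi>) \<Longrightarrow> nonconstant_fun J f \<Longrightarrow> ?thesis" for \<psi> f
  proof -
    assume a: "T = nonisentropic_galilean_density M \<psi> f" "smooth_scalar M \<psi>" "killing M (grad M \<psi>)" "nonconstant_fun J f"
    then have f: "smooth_on J f" unfolding nonconstant_fun_def by blast
    obtain K where K: "\<And>s. s \<in> J \<Longrightarrow> (K has_real_derivative f s * deriv \<kappa> s) (at s)"
      using antideriv_exists[OF J sm[OF f]] by blast
    have "-1 * metric M x (grad M \<psi> x) v + differential M \<psi> x v = 0" for x v by (simp add: grad_metric a)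
    from conserved_isobaric[OF \<kappa> a(3,2) f this K, of 0 0] show ?thesis
      by (simp add: a(1,2) nonisentropic_galilean_density_def grad_metric algebra_simps)
  qed
  show "T = nonisentropic_energy_density M f K \<Longrightarrow> nonconstant_fun J f \<Longrightarrow> antideriv_on J (\<lambda>s. f s * deriv \<kappa> s) K \<Longrightarrow> ?thesis" for f K
    using conserved_isobaric[OF \<kappa> killing_0 smooth_scalar_const[of 0] _ z, of f K 1 0]
    by (simp add: nonconstant_fun_def antideriv_on_def nonisentropic_energy_density_def)
qed

end


subsection \<open>Classification\<close>

context fluid_energy
begin

text \<open>Where \<open>c_t\<close> is nonzero, this asks that
  \<open>r e - n P / 2 - r \<epsilon>\<close> be independent of \<open>r\<close>. With
  \<open>\<epsilon>\<close> subtracted from the energy, the coefficient \<open>qT\<close> is then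
  constant in time.\<close>

abbreviation balanced :: "('m, 'n) density \<Rightarrow> (real \<Rightarrow> real) \<Rightarrow> bool" where
  "balanced T \<epsilon> \<equiv> \<forall>t x. \<forall>r\<in>I. \<forall>r'\<in>I. \<forall>s\<in>J. ctT T t x s * (r * e r s - real CARD('n) / 2 * P r s - r * \<epsilon> s) =
    ctT T t x s * (r' * e r' s - real CARD('n) / 2 * P r' s - r' * \<epsilon> s)"

context
  fixes T :: "('m, 'n) density" and \<epsilon> :: "real \<Rightarrow> real"
  assumes T: "conserved T" and \<epsilon>: "smooth_on J \<epsilon>"
begin

lemma ex_r2: "\<exists>r2\<in>I. r2 \<noteq> r1"
proof -
  obtain \<delta> where \<delta>: "\<delta> > 0" "ball r1 \<delta> \<subseteq> I" using open_I r1 open_contains_ball by blast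
  then have "r1 + \<delta> / 2 \<in> I" by (auto simp: subset_eq dist_real_def)
  then show ?thesis using \<delta> by (intro bexI[of _ "r1 + \<delta> / 2"]) auto
qed

text \<open>A second density: an affine function of \<open>r\<close> is recovered from its values at
  \<open>r1\<close> and \<open>r2\<close>.\<close>

definition "r2 = (SOME r. r \<in> I \<and> r \<noteq> r1)"

lemma r2: "r2 \<in> I" "r2 \<noteq> r1"
  using someI_ex[of "\<lambda>r. r \<in> I \<and> r \<noteq> r1"] ex_r2 unfolding r2_def by blast+

definition "aq = 1 / (r2 - r1)"
definition "bq s = \<epsilon> s - aq * (r2 * e r2 s - r1 * e r1 s)"
text \<open>The slope in \<open>r\<close> of the rest value after subtraction of the energy term
  \<open>c (r e - r \<epsilon>)\<close>, as a difference quotient between \<open>r1\<close> and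
  \<open>r2\<close>. It is written as a nested linear combination ending in 0 to fit the rules for
  combinations of scalar fields.\<close>

definition "qT t x s = aq * T t x 0 r2 s + (- aq * T t x 0 r1 s + (bq s * cT T t x s + 0))"
definition "dT t x s = T t x 0 r1 s - cT T t x s * (r1 * e r1 s - r1 * \<epsilon> s) - r1 * qT t x s"

text \<open>By \<open>cond_B\<close> the expression \<open>Q - r Q_r + c P\<close> does not depend
  on \<open>r\<close>, where \<open>Q\<close> is the rest value. This is a linear equation in
  \<open>r\<close>; a particular solution is \<open>c r e\<close> plus a constant, and the
  homogeneous solutions are the multiples of \<open>r\<close>.\<close>

lemma Q_affine:
  assumes r: "r \<in> I" and s: "s \<in> J"
  shows "T t x 0 r s = cT T t x s * (r * e r s - r * \<epsilon> s) + r * qT t x s + dT t x s"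
    "dT t x s = T t x 0 r s - r * deriv (\<lambda>r. T t x 0 r s) r + cT T t x s * P r s"
proof -
  define c where "c = cT T t x s"
  define k where "k = T t x 0 r s - r * deriv (\<lambda>r. T t x 0 r s) r + c * P r s"
  have k: "T t x 0 r' s - r' * deriv (\<lambda>r. T t x 0 r s) r' + c * P r' s = k" if r': "r' \<in> I" for r'
    unfolding k_def
  proof (rule const_deriv_zero[OF conv_I _ r' r])
    show "((\<lambda>r. T t x 0 r s - r * deriv (\<lambda>r. T t x 0 r s) r + c * P r s) has_real_derivative 0) (at r)" if "r \<in> I" for r
      using DERIV_add[OF cond_B(1)[OF T that s, of t x] DERIV_cmult[OF der_Pc(1)[OF that s], of c]] unfolding c_def by simp
  qed
  \<comment> \<open>The factor of \<open>r\<close> in the general solution; the equation for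
    \<open>Q\<close> says that it has derivative zero.\<close>
  define w where "w r = (T t x 0 r s - c * (r * e r s) - k) / r" for r
  have w: "w r' = w r" if r': "r' \<in> I" for r'
  proof (rule const_deriv_zero[OF conv_I _ r' r])
    fix r assume r: "r \<in> I"
    let ?D = "deriv (\<lambda>r. T t x 0 r s) r"
    have r0: "r \<noteq> 0" using pos_I[OF r] by simp
    have "((\<lambda>r. T t x 0 r s - c * (r * e r s) - k) has_real_derivative ?D - c * ((r * e r s + P r s) / r) - 0) (at r)"
      by (intro DERIV_diff DERIV_cmult re_deriv r s DERIV_const Bf_center(2)[OF T s r])
    from DERIV_divide[OF this DERIV_ident r0]
    have "(w has_real_derivative ((?D - c * ((r * e r s + P r s) / r) - 0) * r - (T t x 0 r s - c * (r * e r s) - k) * 1) / (r * r)) (at r)"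
      unfolding w_def .
    moreover have "(?D - c * ((r * e r s + P r s) / r) - 0) * r - (T t x 0 r s - c * (r * e r s) - k) * 1 = 0"
    proof -
      have "(r * e r s + P r s) / r * r = r * e r s + P r s" using r0 by simp
      then show ?thesis using k[OF r] by algebra
    qed
    ultimately show "(w has_real_derivative 0) (at r)" by simp
  qed
  have W: "T t x 0 r' s = c * (r' * e r' s) + k + r' * w r" if "r' \<in> I" for r'
    using w[OF that] pos_I[OF that] unfolding w_def by (simp add: field_simps)
  have q: "qT t x s = w r + c * \<epsilon> s"
    unfolding qT_def bq_def W[OF r2(1)] W[OF r1] c_def[symmetric] aq_def using r2(2) by (simp add: divide_simps) (simp add: algebra_simps)
  have d: "dT t x s = k" unfolding dT_def q W[OF r1] c_def[symmetric] by (simp add: algebra_simps)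
  show "dT t x s = T t x 0 r s - r * deriv (\<lambda>r. T t x 0 r s) r + cT T t x s * P r s"
    unfolding d k_def c_def ..
  show "T t x 0 r s = cT T t x s * (r * e r s - r * \<epsilon> s) + r * qT t x s + dT t x s"
    unfolding d q W[OF r] c_def[symmetric] by (simp add: algebra_simps)
qed

lemma d_deriv:
  assumes r: "r \<in> I" and s: "s \<in> J"
  shows "((\<lambda>s. dT t x s - cT T t x s * P r s) has_real_derivative - cT T t x s * der Pc (r, s) (0, 1)) (at s)"
  by (rule has_field_derivative_transform_within_open[OF cond_B(2)[OF T r s, of t x] open_J s]) (simp add: Q_affine(2)[OF r])

lemma smooth_Q_scalar: "r \<in> I \<Longrightarrow> s \<in> J \<Longrightarrow> smooth_scalar M (\<lambda>x. T t x 0 r s)"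
  unfolding smooth_scalar_def
proof
  fix p assume rs: "r \<in> I" "s \<in> J"
  have "smooth_on (cimg M p) (\<lambda>y. (\<lambda>(t, y). T t (cinv M p y) 0 r s) (t, y))"
    by (rule smooth_compose[OF open_cimg _ _ _ smooth_Q[OF T rs]])
      (auto intro!: smooth_intros open_cimg open_Times open_UNIV)
  then show "smooth_on (cimg M p) ((\<lambda>x. T t x 0 r s) \<circ> cinv M p)" by (simp add: o_def)
qed

lemma smooth_Q_s: "r \<in> I \<Longrightarrow> smooth_on J (T t x 0 r)"
proof -
  assume r: "r \<in> I"
  have "smooth_on J (\<lambda>s. That T x (t, cmap M x x, 0, r, s))"
    by (rule smooth_That_comp[OF T open_J]) (auto intro!: smooth_intros open_J simp: r)
  then show ?thesis unfolding That_center .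
qed

lemma smooth_qT: "s \<in> J \<Longrightarrow> smooth_scalar M (\<lambda>x. qT t x s)"
  unfolding qT_def
  by (intro smooth_scalar_lincomb smooth_Q_scalar r1 r2(1) smooth_cT_scalar[OF T] smooth_scalar_const)

lemma smooth_qT_s: "smooth_on J (qT t x)"
proof -
  have e: "smooth_on J (\<lambda>s. e r s)" if "r \<in> I" for r
  proof -
    have "smooth_on J (\<lambda>s. (\<lambda>(r, s). e r s) (r, s))"
      by (rule smooth_compose[OF open_J open_IJ _ _ smooth_e]) (use that in \<open>auto intro!: smooth_intros open_J\<close>)
    then show ?thesis by simp
  qed
  have b: "smooth_on J bq" unfolding bq_def
    by (intro smooth_diff smooth_mult smooth_const open_J \<epsilon> e r1 r2(1))
  show ?thesis unfolding qT_def
    by (intro smooth_add smooth_mult smooth_const open_J b smooth_cT_s[OF T] smooth_Q_s r1 r2(1))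
qed

lemma Q_t:
  assumes r: "r \<in> I" and s: "s \<in> J"
  shows "((\<lambda>t. T t x 0 r s) has_real_derivative deriv (\<lambda>t. T t x 0 r s) t) (at t)"
  using Qhat(2)[OF T s r, of x t] Qt[OF T s r, of x t] by (simp add: has_real_derivative_iff_has_vector_derivative)

context
  assumes H: "balanced T \<epsilon>"
begin

text \<open>\<open>cond_Qt\<close> makes \<open>Q_t - n c_t P / 2\<close> independent of
  \<open>r\<close>. Compared at \<open>r1\<close> and \<open>r2\<close> and combined with
  \<open>balanced\<close>, the pressure disappears and the time derivative of the slope is
  zero.\<close>

lemma qT_const:
  assumes s: "s \<in> J" shows "qT t x s = qT 0 x s"
proof (rule const_deriv_zero[of UNIV "\<lambda>t. qT t x s" t 0])
  fix t
  let ?Q = "\<lambda>r. deriv (\<lambda>t. T t x 0 r s) t"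
  let ?c = "real CARD('n) / 2 * ctT T t x s"
  have "?Q r2 - ?c * P r2 s = ?Q r1 - ?c * P r1 s"
  proof (rule const_deriv_zero[OF conv_I _ r2(1) r1])
    show "((\<lambda>r. ?Q r - ?c * P r s) has_real_derivative 0) (at r)" if "r \<in> I" for r
      using DERIV_diff[OF cond_Qt[OF T s that, where x = x and t = t] DERIV_cmult[OF der_Pc(1)[OF that s], of ?c]] by simp
  qed
  moreover have "ctT T t x s * (r2 * e r2 s - real CARD('n) / 2 * P r2 s - r2 * \<epsilon> s) =
       ctT T t x s * (r1 * e r1 s - real CARD('n) / 2 * P r1 s - r1 * \<epsilon> s)" using H r1 r2(1) s by blast
  ultimately have "?Q r2 - ?Q r1 = ctT T t x s * (r2 * e r2 s - r1 * e r1 s) - (r2 - r1) * (ctT T t x s * \<epsilon> s)"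
    by algebra
  then have 0: "aq * ?Q r2 + (- aq * ?Q r1 + (bq s * ctT T t x s + 0)) = 0"
    unfolding aq_def bq_def using r2(2) by (simp add: divide_simps) algebra
  have "((\<lambda>t. qT t x s) has_real_derivative aq * ?Q r2 + (- aq * ?Q r1 + (bq s * ctT T t x s + 0))) (at t)"
    unfolding qT_def by (intro DERIV_add DERIV_cmult Q_t s r1 r2(1) ct(1)[OF T s] DERIV_const)
  then show "((\<lambda>t. qT t x s) has_real_derivative 0) (at t)" unfolding 0 .
qed auto

text \<open>By \<open>cond_Q\<close> the gradient of the rest value is affine in \<open>r\<close>
  with slope \<open>- zeta_t\<close>; the energy term contributes nothing because \<open>c\<close>
  has no gradient.\<close>

lemma grad_qT:
  assumes s: "s \<in> J" shows "ztT T t x s = - grad M (\<lambda>x. qT 0 x s) x"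
proof (rule metric_eqD[where x = x])
  fix v
  let ?D = "\<lambda>r. differential M (\<lambda>x. T t x 0 r s) x v"
  have "?D r2 + metric M x (ztT T t x s) v * r2 = ?D r1 + metric M x (ztT T t x s) v * r1"
  proof (rule const_deriv_zero[OF conv_I _ r2(1) r1])
    show "((\<lambda>r. ?D r + metric M x (ztT T t x s) v * r) has_real_derivative 0) (at r)" if "r \<in> I" for r
      using DERIV_add[OF cond_Q[OF T s that, where x = x and t = t and v = v] DERIV_cmult[OF DERIV_ident, of "metric M x (ztT T t x s) v"]] by simp
  qed
  then have 1: "aq * (?D r2 - ?D r1) = - metric M x (ztT T t x s) v"
    unfolding aq_def using r2(2) by (simp add: divide_simps) algebra
  have "differential M (\<lambda>x. qT 0 x s) x v = differential M (\<lambda>x. qT t x s) x v" using qT_const[OF s] by metis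
  also have "\<dots> = aq * ?D r2 + (- aq * ?D r1 + (bq s * differential M (\<lambda>x. cT T t x s) x v + 0))"
    unfolding qT_def
    by (simp only: differential_lincomb smooth_scalar_lincomb smooth_Q_scalar[OF r1 s] smooth_Q_scalar[OF r2(1) s]
      smooth_cT_scalar[OF T s] smooth_scalar_const differential_const)
  also have "\<dots> = - metric M x (ztT T t x s) v" unfolding cond_c[OF T s r1] using 1 by argo
  finally have "metric M x (grad M (\<lambda>x. qT 0 x s) x) v = - metric M x (ztT T t x s) v"
    by (simp add: grad_metric smooth_qT[OF s])
  then show "metric M x (ztT T t x s) v = metric M x (- grad M (\<lambda>x. qT 0 x s) x) v"
    by (simp add: linear_neg[OF linear_metric(2)])
qed

text \<open>The velocity \<open>- grad q\<close> of \<open>zeta\<close> does not change in time by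
  \<open>qT_const\<close>.\<close>

lemma zT_affine:
  assumes s: "s \<in> J" shows "zT T t x s = zT T 0 x s - t *\<^sub>R grad M (\<lambda>x. qT 0 x s) x"
proof -
  let ?g = "grad M (\<lambda>x. qT 0 x s) x"
  obtain c where c: "\<And>t. zT T t x s + t *\<^sub>R ?g = c"
  proof (rule has_vector_derivative_zero_constant[OF convex_UNIV])
    show "((\<lambda>t. zT T t x s + t *\<^sub>R ?g) has_vector_derivative 0) (at t within UNIV)" for t
      using has_vector_derivative_add[OF zt(1)[OF T s, of x t] has_vector_derivative_scaleR[OF DERIV_ident has_vector_derivative_const, of ?g]]
      by (simp add: grad_qT[OF s])
  qed auto
  from c[of t] c[of 0] show ?thesis by (simp add: algebra_simps)
qed

text \<open>The linear motion of \<open>zeta\<close> in time becomes the term with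
  \<open>- t\<close>, which together with \<open>q\<close> forms the pattern of the Galilean
  densities.\<close>

lemma unified_structure:
  assumes r: "r \<in> I" and s: "s \<in> J"
  shows "T t x v r s = cT T t x s * (1/2 * r * metric M x v v + r * e r s - r * \<epsilon> s)
    + r * (metric M x (zT T 0 x s) v + qT 0 x s - t * differential M (\<lambda>x. qT 0 x s) x v) + dT t x s"
proof -
  have "metric M x (zT T t x s) v = metric M x (zT T 0 x s) v - t * differential M (\<lambda>x. qT 0 x s) x v"
    unfolding zT_affine[OF s, of t]
    by (simp add: linear_diff[OF linear_metric(2)] linear_cmul[OF linear_metric(2)] grad_metric smooth_qT[OF s])
  note z = this
  show ?thesis
    unfolding structure_at(1)[OF T r s, of t x v] z Q_affine(1)[OF r s, of t x] qT_const[OF s, of t] by (simp add: algebra_simps)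
qed

end

end

end


text \<open>The algebra of \<open>comb_polytropic\<close>. Here \<open>p\<close> is the pressure,
  \<open>P\<close> the constant subtracted from it, and \<open>m\<close>, \<open>l\<close> are the
  homothety factors. The hypothesis turns \<open>r e - r \<epsilon>\<close> into a multiple of
  \<open>p - P\<close> up to a constant; the terms are then sorted into energy, similarity energy,
  Galilean energy, volumetric entropy and a function of time and place.\<close>

lemma polytropic_identity:
  fixes r :: real
  assumes "r * e = - P + n / 2 * (p - P) + r * \<epsilon>"
  shows "(c - m * t + l * t\<^sup>2 / 2) * (1/2 * r * A + r * e - r * \<epsilon>) + r * (B + q - t * D) + r * f + d =
    c * (r * (1/2 * A + e)) + (1 * (r * B - 1/2 * m * t * (r * A + n * (p - P))) +
     (1 * (r * (q - t * D) + 1/4 * l * t\<^sup>2 * (r * A + n * (p - P))) + (1 * (r * (f - c * \<epsilon>)) + (d + (- m * t + l * t\<^sup>2 / 2) * - P))))"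
proof -
  have "r * e - r * \<epsilon> = - P + n / 2 * (p - P)" using assms by simp
  then have *: "1/2 * r * A + r * e - r * \<epsilon> = 1/2 * (r * A + n * (p - P)) - P" by (simp add: algebra_simps)
  have "c * (r * (1/2 * A + e)) = c * (1/2 * (r * A + n * (p - P)) - P) + c * (r * \<epsilon>)"
    unfolding *[symmetric] by (simp add: algebra_simps)
  then show ?thesis unfolding * by (simp add: field_simps)
qed

section \<open>Densities for a pressure that depends generically on the mass density\<close>

context fluid_energy
begin

lemma cT_const: "conserved T \<Longrightarrow> s \<in> J \<Longrightarrow> cT T t x s = cT T t x' s"
  by (rule const_on_connected[OF smooth_cT_scalar]) (auto intro: cond_c r1)

lemma ctT_const: "conserved T \<Longrightarrow> s \<in> J \<Longrightarrow> ctT T t x s = ctT T t x' s"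
  unfolding ctT_def by (metis cT_const)

text \<open>\<open>d_deriv\<close> gives the entropy derivative of \<open>d - c P\<close>. As
  \<open>c\<close> does not depend on the entropy here, adding \<open>c P\<close> back leaves
  derivative zero.\<close>

lemma dT_const:
  assumes T: "conserved T" and \<epsilon>: "smooth_on J \<epsilon>" and g: gen_r and s: "s \<in> J" "s' \<in> J"
  shows "dT T \<epsilon> t x s = dT T \<epsilon> t x s'"
proof (rule const_deriv_zero[OF conv_J _ s])
  fix s0 assume s0: "s0 \<in> J"
  have "((\<lambda>s. dT T \<epsilon> t x s - cT T t x s * P r1 s + cT T t x s0 * P r1 s) has_real_derivative
      - cT T t x s0 * der Pc (r1, s0) (0, 1) + cT T t x s0 * der Pc (r1, s0) (0, 1)) (at s0)"
    by (rule DERIV_add[OF d_deriv[OF T \<epsilon> r1 s0] DERIV_cmult[OF der_Pc(2)[OF r1 s0]]])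
  then have "((\<lambda>s. dT T \<epsilon> t x s - cT T t x s * P r1 s + cT T t x s0 * P r1 s) has_real_derivative 0) (at s0)" by simp
  then show "((\<lambda>s. dT T \<epsilon> t x s) has_real_derivative 0) (at s0)"
  proof (rule has_field_derivative_transform_within_open[OF _ open_J s0])
    show "dT T \<epsilon> t x s - cT T t x s * P r1 s + cT T t x s0 * P r1 s = dT T \<epsilon> t x s" if "s \<in> J" for s
      using structure_at(3)[OF T g that s0, of t x] by simp
  qed
qed

text \<open>Generic \<open>P_r\<close> makes \<open>c\<close> and \<open>zeta\<close> independent of
  the entropy. The Lie equation for \<open>zeta - t grad q\<close> at all times forces
  \<open>c_t\<close> to be affine in \<open>t\<close>, so \<open>c\<close> is quadratic; its
  coefficients are the homothety factors \<open>\<mu>0\<close> of \<open>zeta\<close> and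
  \<open>\<mu>1\<close> of \<open>grad q\<close>.\<close>

lemma generic_structure:
  assumes T: "conserved T" and \<epsilon>: "smooth_on J \<epsilon>" and g: gen_r and s1: "s1 \<in> J"
    and H: "balanced T \<epsilon>"
  obtains c0 \<mu>0 \<mu>1 \<zeta> q f d where "\<mu>0 = - ctT T 0 x1 s1" "\<mu>1 = ctT T 1 x1 s1 - ctT T 0 x1 s1"
    "smooth_vector M \<zeta>" "\<And>x v w. lie_metric M \<zeta> x v w = \<mu>0 * metric M x v w"
    "smooth_scalar M q" "smooth_vector M (grad M q)" "\<And>x v w. lie_metric M (grad M q) x v w = \<mu>1 * metric M x v w"
    "smooth_on J f"
    "\<And>t x v r s. r \<in> I \<Longrightarrow> s \<in> J \<Longrightarrow> T t x v r s = (c0 - \<mu>0 * t + \<mu>1 * t\<^sup>2 / 2) * (1/2 * r * metric M x v v + r * e r s - r * \<epsilon> s)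
       + r * (metric M x (\<zeta> x) v + q x - t * differential M q x v) + r * f s + d t x"
proof -
  define c where "c t = cT T t x1 s1" for t
  define c' where "c' t = ctT T t x1 s1" for t
  define \<zeta> where "\<zeta> x = zT T 0 x s1" for x
  define qs where "qs s x = qT T \<epsilon> 0 x s" for s x
  define d where "d t x = dT T \<epsilon> t x s1" for t x
  have cT: "cT T t x s = c t" if "s \<in> J" for t x s
    unfolding c_def using structure_at(3)[OF T g that s1, of t x] cT_const[OF T s1, of t x x1] by simp
  have c't: "ctT T t x s1 = c' t" for t x unfolding c'_def by (rule ctT_const[OF T s1])
  have zT: "zT T t x s = zT T t x s1" if "s \<in> J" for t x s
    using structure_at(3)[OF T g that s1, of t x] by simp
  have qsm: "smooth_scalar M (qs s)" if "s \<in> J" for s unfolding qs_def by (rule smooth_qT[OF T \<epsilon> that])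
  have aff: "zT T t x s = \<zeta> x - t *\<^sub>R grad M (qs s) x" if "s \<in> J" for t x s
    unfolding qs_def \<zeta>_def zT[OF that, symmetric] by (rule zT_affine[OF T \<epsilon> H that])
  have gq: "grad M (qs s) x = grad M (qs s1) x" if "s \<in> J" for s x
    using aff[OF that, of 1 x] aff[OF s1, of 1 x] zT[OF that, of 1 x] by simp
  have dq: "differential M (qs s) x v = differential M (qs s1) x v" if "s \<in> J" for s x v
    using gq[OF that, of x] grad_metric[OF qsm[OF that], of x v] grad_metric[OF qsm[OF s1], of x v] by simp
  \<comment> \<open>All \<open>qs s\<close> have the same gradient and so differ by constants on the
    connected manifold; \<open>f\<close> is that constant.\<close>
  define f where "f s = qs s x1 - qs s1 x1" for s
  have q: "qs s x = qs s1 x + f s" if s: "s \<in> J" for s x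
  proof -
    have "(\<lambda>z. (-1) * qs s1 z + qs s z) x = (\<lambda>z. (-1) * qs s1 z + qs s z) x1"
    proof (rule const_on_connected[OF smooth_scalar_lincomb[OF qsm[OF s1] qsm[OF s]]])
      show "differential M (\<lambda>z. (-1) * qs s1 z + qs s z) x v = 0" for x v
        using differential_lincomb[OF qsm[OF s1] qsm[OF s], of "-1" x v] dq[OF s, of x v] by linarith
    qed
    then show ?thesis unfolding f_def by simp
  qed
  have f: "smooth_on J f"
  proof -
    have "smooth_on J (\<lambda>s. qT T \<epsilon> 0 x1 s - qs s1 x1)"
      by (intro smooth_diff open_J smooth_const) (use smooth_qT_s[OF T \<epsilon>, of 0 x1] in simp)
    then show ?thesis unfolding f_def qs_def .
  qed
  have z: "smooth_vector M (\<lambda>x. zT T t x s1)" for t by (rule smooth_zT_vector[OF T s1])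
  have gr: "grad M (qs s1) = (\<lambda>x. (-1) *\<^sub>R zT T 1 x s1 + \<zeta> x)"
    using aff[OF s1, of 1] by (simp add: fun_eq_iff)
  have sg: "smooth_vector M (grad M (qs s1))"
    unfolding gr \<zeta>_def by (rule smooth_vector_lincomb[OF z z])
  have lz: "lie_metric M \<zeta> x v w = - c' 0 * metric M x v w" for x v w
    unfolding \<zeta>_def using cond_lie[OF T s1, where t = 0 and x = x and v = v and w = w] by (simp add: c't)
  \<comment> \<open>The difference between the Lie equations at the times 0 and
    \<open>t\<close>.\<close>
  have lt: "t * lie_metric M (grad M (qs s1)) x v w = (c' t - c' 0) * metric M x v w" for t x v w
  proof -
    have "lie_metric M (\<lambda>x. (- t) *\<^sub>R grad M (qs s1) x + \<zeta> x) x v w = - c' t * metric M x v w"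
      using cond_lie[OF T s1, where t = t and x = x and v = v and w = w] aff[OF s1, of t] by (simp add: c't)
    then show ?thesis using lie_lincomb[OF sg z[of 0, folded \<zeta>_def], of "- t" x v w] lz by (simp add: algebra_simps)
  qed
  have lg: "lie_metric M (grad M (qs s1)) x v w = (c' 1 - c' 0) * metric M x v w" for x v w
    using lt[of 1] by simp
  have c'_aff: "c' t = c' 0 + t * (c' 1 - c' 0)" for t
  proof -
    have "metric M x1 (axis undefined 1) (axis undefined 1) > 0" by (rule metric_pos) (simp add: axis_eq_0_iff)
    moreover have "(c' t - c' 0) * metric M x1 (axis undefined 1) (axis undefined 1) = t * (c' 1 - c' 0) * metric M x1 (axis undefined 1) (axis undefined 1)"
      using lt[of t x1 "axis undefined 1" "axis undefined 1"] unfolding lg by (metis mult.assoc)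
    ultimately have "c' t - c' 0 = t * (c' 1 - c' 0)" using mult_right_cancel by (metis less_irrefl)
    then show ?thesis by simp
  qed
  have c_eq: "c t = c 0 - (- c' 0) * t + (c' 1 - c' 0) * t\<^sup>2 / 2" for t
  proof -
    have "c t - (c' 0 * t + (c' 1 - c' 0) * t\<^sup>2 / 2) = c 0 - (c' 0 * 0 + (c' 1 - c' 0) * 0\<^sup>2 / 2)"
    proof (rule const_deriv_zero[of UNIV "\<lambda>t. c t - (c' 0 * t + (c' 1 - c' 0) * t\<^sup>2 / 2)" t 0])
      fix t
      have "(c has_real_derivative c' t) (at t)" unfolding c_def c'_def by (rule ct(1)[OF T s1])
      moreover have "((\<lambda>t. c' 0 * t + (c' 1 - c' 0) * t\<^sup>2 / 2) has_real_derivative c' t) (at t)"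
        by (subst c'_aff) (auto intro!: derivative_eq_intros)
      ultimately show "((\<lambda>t. c t - (c' 0 * t + (c' 1 - c' 0) * t\<^sup>2 / 2)) has_real_derivative 0) (at t)"
        using DERIV_diff by fastforce
    qed auto
    then show ?thesis by simp
  qed
  have TT: "T t x v r s = (c 0 - (- c' 0) * t + (c' 1 - c' 0) * t\<^sup>2 / 2) * (1/2 * r * metric M x v v + r * e r s - r * \<epsilon> s)
       + r * (metric M x (\<zeta> x) v + qs s1 x - t * differential M (qs s1) x v) + r * f s + d t x" if rs: "r \<in> I" "s \<in> J" for t x v r s
  proof -
    have "T t x v r s = c t * (1/2 * r * metric M x v v + r * e r s - r * \<epsilon> s)
      + r * (metric M x (\<zeta> x) v + qs s x - t * differential M (qs s) x v) + d t x"
      using unified_structure[OF T \<epsilon> H rs, of t x v] dT_const[OF T \<epsilon> g rs(2) s1, of t x]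
      unfolding cT[OF rs(2)] zT[OF rs(2)] d_def \<zeta>_def qs_def by simp
    then show ?thesis unfolding dq[OF rs(2)] q[OF rs(2), of x] c_eq[of t] by (simp add: algebra_simps)
  qed
  show thesis
    by (rule that[OF _ _ z[of 0, folded \<zeta>_def] _ qsm[OF s1] sg lg f TT]) (simp_all add: c'_def lz[unfolded c'_def])
qed

lemma comb_entropy:
  assumes f: "smooth_on J f" and F: "general_densities M J e \<subseteq> F"
  shows "comb F (\<lambda>t x v r s. r * f s)"
proof (cases "f constant_on J")
  case True
  then obtain k where "\<And>s. s \<in> J \<Longrightarrow> f s = k" unfolding constant_on_def by blast
  moreover have "comb F mass_density" by (rule comb_member) (use F in \<open>auto simp: general_densities_def\<close>)
  from comb_lincomb[OF this comb_base[of F "\<lambda>t x. 0"], of k]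
  have "comb F (\<lambda>t x v r s. k * r)" unfolding mass_density_def by simp
  ultimately show ?thesis by (elim comb_cong) simp
next
  case False
  with f have "comb F (entropy_density f)" by (intro comb_member) (use F in \<open>auto simp: general_densities_def nonconstant_fun_def\<close>)
  then show ?thesis unfolding entropy_density_def .
qed

lemma member_general:
  "energy_density M e \<in> general_densities M J e"
  "killing M \<zeta> \<Longrightarrow> momentum_density M \<zeta> \<in> general_densities M J e"
  "smooth_scalar M \<psi> \<Longrightarrow> killing M (grad M \<psi>) \<Longrightarrow> galilean_momentum_density M \<psi> \<in> general_densities M J e"
  unfolding general_densities_def by auto

text \<open>Without \<open>c_t\<close> both homothety factors vanish, so \<open>\<zeta>\<close> and
  \<open>grad M q\<close> are Killing and no further densities are needed.\<close>

lemma comb_general: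
  assumes T: "conserved T" and g: gen_r and c: "\<And>t x s. s \<in> J \<Longrightarrow> ctT T t x s = 0"
  shows "comb (general_densities M J e) T"
proof -
  obtain r0 s1 where s1: "s1 \<in> J" using ex_interior .
  have H: "balanced T (\<lambda>s. 0)" by (simp add: c)
  obtain c0 \<mu>0 \<mu>1 \<zeta> q f d where l: "\<mu>0 = - ctT T 0 undefined s1" "\<mu>1 = ctT T 1 undefined s1 - ctT T 0 undefined s1"
    and \<zeta>: "smooth_vector M \<zeta>" "\<And>x v w. lie_metric M \<zeta> x v w = \<mu>0 * metric M x v w"
    and q: "smooth_scalar M q" "smooth_vector M (grad M q)" "\<And>x v w. lie_metric M (grad M q) x v w = \<mu>1 * metric M x v w"
    and f: "smooth_on J f"
    and TT: "\<And>t x v r s. r \<in> I \<Longrightarrow> s \<in> J \<Longrightarrow> T t x v r s = (c0 - \<mu>0 * t + \<mu>1 * t\<^sup>2 / 2) * (1/2 * r * metric M x v v + r * e r s - r * 0)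
       + r * (metric M x (\<zeta> x) v + q x - t * differential M q x v) + r * f s + d t x"
    by (rule generic_structure[OF T smooth_const[OF open_J] g s1 H, where ?x1.0 = undefined], rule that)
  have l0: "\<mu>0 = 0" "\<mu>1 = 0" unfolding l by (simp_all add: c s1)
  have k: "killing M \<zeta>" "killing M (grad M q)" using \<zeta> q unfolding l0 killing_def by auto
  show ?thesis
    by (rule comb_cong[OF comb_lincomb[OF comb_member[OF member_general(1)]
        comb_lincomb[OF comb_member[OF member_general(2)[OF k(1)]]
        comb_lincomb[OF comb_member[OF member_general(3)[OF q(1) k(2)]]
        comb_lincomb[OF comb_entropy[OF f order_refl] comb_base[of _ d], of 1], of 1], of 1], of c0]])
     (simp add: TT l0 energy_density_def momentum_density_def galilean_momentum_density_def metric_sym algebra_simps)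
qed

text \<open>Integrates the energy when the pressure satisfies a linear first-order equation in
  \<open>r\<close>: then \<open>(r e + k - a P) / r\<close> has derivative zero. It is applied with
  \<open>a = n / 2\<close> to polytropic and with \<open>a = -1\<close>, \<open>k = 0\<close> to
  isobaric pressures.\<close>

lemma affine_energy:
  assumes a: "\<And>r s. r \<in> I \<Longrightarrow> s \<in> J \<Longrightarrow> P r s + a * P r s - k = a * (r * der Pc (r, s) (1, 0))"
  obtains \<epsilon> where "smooth_on J \<epsilon>" "\<And>r s. r \<in> I \<Longrightarrow> s \<in> J \<Longrightarrow> r * e r s = a * P r s - k + r * \<epsilon> s"
proof -
  let ?y = "\<lambda>r s. r * e r s + k - a * P r s"
  define \<epsilon> where "\<epsilon> s = ?y r1 s / r1" for s
  have c: "?y r s / r = \<epsilon> s" if rs: "r \<in> I" "s \<in> J" for r s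
    unfolding \<epsilon>_def
  proof (rule const_deriv_zero[OF conv_I _ rs(1) r1])
    fix r assume r: "r \<in> I"
    have r0: "r \<noteq> 0" using pos_I[OF r] by simp
    have y: "((\<lambda>r. ?y r s) has_real_derivative (r * e r s + P r s) / r + 0 - a * der Pc (r, s) (1, 0)) (at r)"
      by (intro DERIV_diff DERIV_add DERIV_cmult re_deriv der_Pc r rs DERIV_const)
    have k: "k = P r s + a * P r s - a * (r * der Pc (r, s) (1, 0))" using a[OF r rs(2)] by simp
    from DERIV_divide[OF y DERIV_ident r0] show "((\<lambda>r. ?y r s / r) has_real_derivative 0) (at r)"
      by (rule DERIV_cong) (simp add: k r0 field_simps)
  qed
  have "smooth_on J (\<lambda>s. (r1 * (\<lambda>(r, s). e r s) (r1, s) + k - a * Pc (r1, s)) / r1)"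
    by (intro smooth_divide smooth_diff smooth_add smooth_mult smooth_const open_J
        smooth_compose[OF open_J open_IJ _ _ smooth_e] smooth_compose[OF open_J open_IJ _ _ P])
      (use r1 pos_I[OF r1] in \<open>auto intro!: smooth_intros open_J\<close>)
  then have "smooth_on J \<epsilon>" unfolding \<epsilon>_def by simp
  moreover have "r * e r s = a * P r s - k + r * \<epsilon> s" if "r \<in> I" "s \<in> J" for r s
    using c[OF that] pos_I[OF that(1)] by (simp add: field_simps)
  ultimately show thesis by (rule that)
qed

text \<open>The second alternative of \<open>eos_cases\<close> makes the pressure a function of the
  entropy, and generic \<open>P_s\<close> keeps this function from being constant.\<close>

lemma isobaric_if_not_gen_r:
  assumes "\<not> gen_r"
  obtains \<kappa> where "isobaric_entropy I J P \<kappa>"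
proof -
  have z: "\<And>q. q \<in> I \<times> J \<Longrightarrow> der Pc q (1, 0) = 0" and g: "generically_nonzero (I \<times> J) (\<lambda>q. der Pc q (0, 1))"
    using eos_cases assms by auto
  have P1: "P r s = P r1 s" if rs: "r \<in> I" "s \<in> J" for r s
    by (rule const_deriv_zero[OF conv_I _ rs(1) r1]) (use der_Pc(1)[OF _ rs(2)] z rs(2) in fastforce)
  have "\<not> P r1 constant_on J"
  proof
    assume "P r1 constant_on J"
    then obtain k where k: "\<And>s. s \<in> J \<Longrightarrow> P r1 s = k" unfolding constant_on_def by blast
    have "der Pc (r, s) (0, 1) = 0" if rs: "r \<in> I" "s \<in> J" for r s
    proof -
      have "((\<lambda>s. k) has_real_derivative der Pc (r, s) (0, 1)) (at s)"
        by (rule has_field_derivative_transform_within_open[OF der_Pc(2)[OF rs] open_J rs(2)]) (use P1[OF rs(1)] k in auto)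
      then show ?thesis using DERIV_const DERIV_unique by blast
    qed
    moreover have "I \<times> J \<noteq> {}" using I J unfolding open_interval_def by auto
    ultimately show False using g open_IJ unfolding generically_nonzero_def by blast
  qed
  with P1 have "isobaric_entropy I J P (P r1)" unfolding isobaric_entropy_def by blast
  then show thesis by (rule that)
qed

text \<open>With \<open>P_r = 0\<close> the polytropic equation leaves only
  \<open>P = P\<^sub>0\<close>, and a constant pressure is not an equation of state.\<close>

lemma gen_r_polytropic:
  assumes p: "polytropic CARD('n) I J (\<lambda>r s. P r s - P\<^sub>0)" shows gen_r
proof (rule ccontr)
  assume g: "\<not> gen_r"
  then have z: "\<And>q. q \<in> I \<times> J \<Longrightarrow> der Pc q (1, 0) = 0" using eos_cases by auto
  have n: "1 + real CARD('n) / 2 \<noteq> 0" by (simp add: add_pos_nonneg less_imp_neq[symmetric])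
  have c: "P r1 s = P\<^sub>0" if "s \<in> J" for s
    using polytropic_deriv[OF p r1 that] z[of "(r1, s)"] r1 that n by simp
  obtain \<kappa> where \<kappa>: "isobaric_entropy I J P \<kappa>" by (rule isobaric_if_not_gen_r[OF g])
  with c r1 have "\<kappa> s = P\<^sub>0" if "s \<in> J" for s using that unfolding isobaric_entropy_def by metis
  then show False using \<kappa> unfolding isobaric_entropy_def constant_on_def by blast
qed

lemma comb_polytropic:
  assumes p: "polytropic CARD('n) I J (\<lambda>r s. P r s - P\<^sub>0)" and T: "conserved T"
  shows "comb (general_densities M J e \<union> polytropic_densities M (\<lambda>r s. P r s - P\<^sub>0)) T" (is "comb ?F T")
proof -
  obtain r0 s1 where s1: "s1 \<in> J" using ex_interior .
  obtain \<epsilon> where \<epsilon>: "smooth_on J \<epsilon>" and re: "\<And>r s. r \<in> I \<Longrightarrow> s \<in> J \<Longrightarrow> r * e r s = - P\<^sub>0 + real CARD('n) / 2 * (P r s - P\<^sub>0) + r * \<epsilon> s"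
  proof (rule affine_energy[of "real CARD('n) / 2" "P\<^sub>0 + real CARD('n) / 2 * P\<^sub>0"])
    show "P r s + real CARD('n) / 2 * P r s - (P\<^sub>0 + real CARD('n) / 2 * P\<^sub>0) = real CARD('n) / 2 * (r * der Pc (r, s) (1, 0))"
      if "r \<in> I" "s \<in> J" for r s using polytropic_deriv[OF p that] by (simp add: field_simps)
  qed (rule that, assumption, simp add: field_simps)
  \<comment> \<open>With this \<open>\<epsilon>\<close> the bracket is the constant
    \<open>- (1 + n / 2) P\<^sub>0\<close>.\<close>
  have H: "balanced T \<epsilon>" by (simp add: re field_simps)
  obtain c0 \<mu>0 \<mu>1 \<zeta> q f d where
        \<zeta>: "smooth_vector M \<zeta>" "\<And>x v w. lie_metric M \<zeta> x v w = \<mu>0 * metric M x v w"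
    and q: "smooth_scalar M q" "smooth_vector M (grad M q)" "\<And>x v w. lie_metric M (grad M q) x v w = \<mu>1 * metric M x v w"
    and f: "smooth_on J f"
    and TT: "\<And>t x v r s. r \<in> I \<Longrightarrow> s \<in> J \<Longrightarrow> T t x v r s = (c0 - \<mu>0 * t + \<mu>1 * t\<^sup>2 / 2) * (1/2 * r * metric M x v v + r * e r s - r * \<epsilon> s)
       + r * (metric M x (\<zeta> x) v + q x - t * differential M q x v) + r * f s + d t x"
    by (rule generic_structure[OF T \<epsilon> gen_r_polytropic[OF p] s1 H, where ?x1.0 = undefined], rule that)
  have h: "homothetic M \<zeta> (\<lambda>x. \<mu>0)" "homothetic M (grad M q) (\<lambda>x. \<mu>1)"
    using \<zeta> q unfolding homothetic_def by (simp_all add: smooth_scalar_const grad_const)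
  have m: "energy_density M e \<in> ?F" "similarity_energy_density M (\<lambda>r s. P r s - P\<^sub>0) \<zeta> (\<lambda>x. \<mu>0) \<in> ?F"
     "galilean_energy_density M (\<lambda>r s. P r s - P\<^sub>0) q (\<lambda>x. \<mu>1) \<in> ?F"
    using h q(1) unfolding polytropic_densities_def by (auto simp: general_densities_def)
  have F: "general_densities M J e \<subseteq> ?F" by blast
  \<comment> \<open>The energy density contains \<open>e\<close>, the structure formula
    \<open>e - \<epsilon>\<close>; the difference is a volumetric entropy.\<close>
  have f': "smooth_on J (\<lambda>s. f s - c0 * \<epsilon> s)"
    by (intro smooth_diff smooth_mult smooth_const open_J f \<epsilon>)
  show ?thesis
  proof (rule comb_cong[OF comb_lincomb[OF comb_member[OF m(1)] comb_lincomb[OF comb_member[OF m(2)]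
        comb_lincomb[OF comb_member[OF m(3)] comb_lincomb[OF comb_entropy[OF f' F]
         comb_base[of _ "\<lambda>t x. d t x + (- \<mu>0 * t + \<mu>1 * t\<^sup>2 / 2) * (- P\<^sub>0)"], of 1], of 1], of 1], of c0]])
    fix t x v r s assume rs: "r \<in> I" "s \<in> J"
    show "T t x v r s = c0 * energy_density M e t x v r s +
       (1 * similarity_energy_density M (\<lambda>r s. P r s - P\<^sub>0) \<zeta> (\<lambda>x. \<mu>0) t x v r s +
        (1 * galilean_energy_density M (\<lambda>r s. P r s - P\<^sub>0) q (\<lambda>x. \<mu>1) t x v r s +
         (1 * (r * (f s - c0 * \<epsilon> s)) + (d t x + (- \<mu>0 * t + \<mu>1 * t\<^sup>2 / 2) * - P\<^sub>0))))"
      unfolding TT[OF rs] energy_density_def similarity_energy_density_def galilean_energy_density_def metric_sym[of x v "\<zeta> x"]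
      by (rule polytropic_identity[OF re[OF rs]])
  qed
qed

text \<open>The time derivative of the rest value is known twice: the Euler-Lagrange equations give
  \<open>n c_t P / 2\<close> plus a number, \<open>Q_affine\<close> gives \<open>c_t r e\<close>
  plus an affine function of \<open>r\<close>. The derivative in \<open>r\<close> of this identity,
  combined with the identity itself, eliminates \<open>e\<close> and leaves the polytropic
  equation.\<close>

lemma polytropic_if_ctT:
  assumes T: "conserved T" and g: gen_r and s0: "s0 \<in> J" and nz: "ctT T t x s0 \<noteq> 0"
  obtains P\<^sub>0 where "polytropic CARD('n) I J (\<lambda>r s. P r s - P\<^sub>0)"
proof -
  let ?\<epsilon> = "\<lambda>s::real. 0::real"
  let ?n = "real CARD('n)"
  have \<epsilon>: "smooth_on J ?\<epsilon>" by (rule smooth_const[OF open_J])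
  define c' where "c' = ctT T t x s0"
  have c': "ctT T t x s = c'" if "s \<in> J" for s
    unfolding c'_def ctT_def using structure_at(3)[OF T g that s0] by simp
  let ?Q = "\<lambda>r s. deriv (\<lambda>t. T t x 0 r s) t"
  have kr: "?Q r s - ?n / 2 * c' * P r s = ?Q r' s - ?n / 2 * c' * P r' s" if rs: "r \<in> I" "r' \<in> I" "s \<in> J" for r r' s
  proof (rule const_deriv_zero[OF conv_I _ rs(1,2)])
    show "((\<lambda>r. ?Q r s - ?n / 2 * c' * P r s) has_real_derivative 0) (at r)" if "r \<in> I" for r
      using DERIV_diff[OF cond_Qt[OF T rs(3) that, where x = x and t = t] DERIV_cmult[OF der_Pc(1)[OF that rs(3)], of "?n / 2 * c'"]]
      by (simp add: c' rs(3))
  qed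
  have ks: "?Q r s - ?n / 2 * c' * P r s = ?Q r s' - ?n / 2 * c' * P r s'" if rs: "r \<in> I" "s \<in> J" "s' \<in> J" for r s s'
  proof (rule const_deriv_zero[OF conv_J _ rs(2,3)])
    show "((\<lambda>s. ?Q r s - ?n / 2 * c' * P r s) has_real_derivative 0) (at s)" if "s \<in> J" for s
      using DERIV_diff[OF cond_Qs[OF T rs(1) that, where x = x and t = t] DERIV_cmult[OF der_Pc(2)[OF rs(1) that], of "?n / 2 * c'"]]
      by (simp add: c' that)
  qed
  \<comment> \<open>Independent of the density by \<open>cond_Qt\<close> and of the entropy by
    \<open>cond_Qs\<close>. With \<open>dT_const\<close> this makes \<open>P0\<close> a number and
    not a function of the entropy.\<close>
  define k where "k = ?Q r1 s0 - ?n / 2 * c' * P r1 s0"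
  have k: "?Q r s = ?n / 2 * c' * P r s + k" if "r \<in> I" "s \<in> J" for r s
    using kr[OF that(1) r1 that(2)] ks[OF r1 that(2) s0] unfolding k_def by simp
  note Q_t' = Q_t[OF T \<epsilon>] and aff = Q_affine(1)[OF T \<epsilon>] and r2' = r2[OF T \<epsilon>]
  define q' where "q' s = aq * ?Q r2 s + (- aq * ?Q r1 s + (bq ?\<epsilon> s * c' + 0))" for s
  define d' where "d' s = ?Q r1 s - c' * (r1 * e r1 s - r1 * 0) - r1 * q' s" for s
  have q': "((\<lambda>t. qT T ?\<epsilon> t x s) has_real_derivative q' s) (at t)" if s: "s \<in> J" for s
    unfolding q'_def c'[OF s, symmetric] qT_def[OF T \<epsilon>]
    by (intro DERIV_add DERIV_cmult Q_t' s r1 r2'(1) ct(1)[OF T s] DERIV_const)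
  have cd: "((\<lambda>t. cT T t x s * k) has_real_derivative c' * k) (at t)" if "s \<in> J" for s k
    using DERIV_cmult_right[OF ct(1)[OF T that, of x t]] unfolding c'[OF that] .
  have d': "((\<lambda>t. dT T ?\<epsilon> t x s) has_real_derivative d' s) (at t)" if s: "s \<in> J" for s
    unfolding d'_def dT_def[OF T \<epsilon>] by (intro DERIV_diff DERIV_cmult cd q' Q_t' s r1)
  have dd: "d' s = d' s0" if s: "s \<in> J" for s
    using d'[OF s] d'[OF s0] dT_const[OF T \<epsilon> g s s0, of _ x] DERIV_unique by simp
  have E: "c' * (r * e r s) + r * q' s + d' s0 - ?n / 2 * c' * P r s = k" if rs: "r \<in> I" "s \<in> J" for r s
  proof -
    have "((\<lambda>t. T t x 0 r s) has_real_derivative c' * (r * e r s - r * 0) + r * q' s + d' s) (at t)"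
      unfolding aff[OF rs] by (intro DERIV_add DERIV_cmult cd q' d' rs)
    with Q_t'[OF rs, of x t] have "?Q r s = c' * (r * e r s - r * 0) + r * q' s + d' s" using DERIV_unique by blast
    then show ?thesis using k[OF rs] dd[OF rs(2)] by simp
  qed
  define P0 where "P0 = (d' s0 - k) / (c' * (1 + ?n / 2))"
  have nz': "c' * (1 + ?n / 2) \<noteq> 0" using nz unfolding c'_def by (simp add: add_pos_nonneg less_imp_neq[symmetric])
  have ode: "(1 + ?n / 2) * (P r s - P0) = ?n / 2 * (r * der Pc (r, s) (1, 0))" if rs: "r \<in> I" "s \<in> J" for r s
  proof -
    have r0: "r \<noteq> 0" using pos_I rs by fastforce
    let ?D = "(r * e r s + P r s) / r"
    have "((\<lambda>r. c' * (r * e r s) + r * q' s + d' s0 - ?n / 2 * c' * P r s) has_real_derivative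
       c' * ?D + 1 * q' s + 0 - ?n / 2 * c' * der Pc (r, s) (1, 0)) (at r)"
      by (intro DERIV_diff DERIV_add DERIV_cmult DERIV_cmult_right DERIV_ident DERIV_const re_deriv der_Pc rs)
    then have "((\<lambda>r. k) has_real_derivative c' * ?D + 1 * q' s + 0 - ?n / 2 * c' * der Pc (r, s) (1, 0)) (at r)"
      by (rule has_field_derivative_transform_within_open[OF _ open_I rs(1)]) (use E rs in simp)
    then have 0: "c' * ?D + q' s - ?n / 2 * c' * der Pc (r, s) (1, 0) = 0" using DERIV_const DERIV_unique by fastforce
    have "c' * (D * r) + r * q' s - ?n / 2 * c' * (r * der Pc (r, s) (1, 0)) = r * (c' * D + q' s - ?n / 2 * c' * der Pc (r, s) (1, 0))" for D
      by (simp add: algebra_simps)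
    from this[of ?D] have "c' * (r * e r s + P r s) + r * q' s - ?n / 2 * c' * (r * der Pc (r, s) (1, 0)) = 0"
      unfolding 0 using r0 by simp
    then have "c' * ((1 + ?n / 2) * P r s - ?n / 2 * (r * der Pc (r, s) (1, 0))) = d' s0 - k"
      using E[OF rs] by (simp add: algebra_simps)
    moreover have "d' s0 - k = c' * ((1 + ?n / 2) * P0)" unfolding P0_def using nz' by simp
    ultimately have "(1 + ?n / 2) * P r s - ?n / 2 * (r * der Pc (r, s) (1, 0)) = (1 + ?n / 2) * P0"
      using nz unfolding c'_def by simp
    then show ?thesis by (simp add: right_diff_distrib)
  qed
  let ?\<gamma> = "1 + 2 / ?n"
  \<comment> \<open>By the equation just obtained, \<open>(P - P0) r powr - ?\<gamma>\<close> is
    constant in \<open>r\<close>; this is its value at \<open>r1\<close>.\<close>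
  define \<sigma> where "\<sigma> s = (P r1 s - P0) * r1 powr - ?\<gamma>" for s
  have "P r s - P0 = \<sigma> s * r powr ?\<gamma>" if rs: "r \<in> I" "s \<in> J" for r s
  proof -
    have "(P r s - P0) * r powr - ?\<gamma> = \<sigma> s" unfolding \<sigma>_def
    proof (rule const_deriv_zero[OF conv_I _ rs(1) r1])
      fix r assume r: "r \<in> I"
      have r0: "r > 0" using pos_I[OF r] .
      have "((\<lambda>r. (P r s - P0) * r powr - ?\<gamma>) has_real_derivative
          (der Pc (r, s) (1, 0) - 0) * r powr - ?\<gamma> + (- ?\<gamma> * r powr (- ?\<gamma> - 1)) * (P r s - P0)) (at r)"
        by (intro DERIV_mult DERIV_diff der_Pc r rs DERIV_const has_real_derivative_powr r0)
      moreover have rD: "r * der Pc (r, s) (1, 0) = ?\<gamma> * (P r s - P0)"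
        using ode[OF r rs(2)] by (simp add: field_simps)
      have "(der Pc (r, s) (1, 0) - 0) * r powr - ?\<gamma> + (- ?\<gamma> * r powr (- ?\<gamma> - 1)) * (P r s - P0) = 0"
      proof -
        have 1: "(D - 0) * w + (- g * (w / r)) * X = w / r * (r * D - g * X)" for D w g X :: real using r0 by (simp add: field_simps)
        have 2: "r powr (- ?\<gamma> - 1) = r powr - ?\<gamma> / r"
          unfolding powr_diff[of r "- ?\<gamma>" 1] powr_one[OF less_imp_le[OF r0]] ..
        show ?thesis unfolding 2 1 rD by (simp only: diff_self mult_zero_right)
      qed
      ultimately show "((\<lambda>r. (P r s - P0) * r powr - ?\<gamma>) has_real_derivative 0) (at r)" by simp
    qed
    then have "\<sigma> s * r powr ?\<gamma> = (P r s - P0) * (r powr - ?\<gamma> * r powr ?\<gamma>)" by (simp add: mult.assoc)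
    also have "r powr - ?\<gamma> * r powr ?\<gamma> = 1"
      unfolding powr_minus[of r ?\<gamma>] using pos_I[OF rs(1)] by (intro left_inverse) simp
    finally show ?thesis by simp
  qed
  then have "polytropic CARD('n) I J (\<lambda>r s. P r s - P0)" unfolding polytropic_def by blast
  then show thesis by (rule that)
qed

lemma nonspecial:
  assumes "\<not> special_eos CARD('n) I J P" and T: "conserved T"
  shows "comb (general_densities M J e) T"
proof (rule comb_general[OF T])
  show g: gen_r using isobaric_if_not_gen_r assms(1) unfolding special_eos_def by metis
  show "ctT T t x s = 0" if s: "s \<in> J" for t x s
  proof (rule ccontr)
    assume "ctT T t x s \<noteq> 0"
    then obtain P0 where "polytropic CARD('n) I J (\<lambda>r s. P r s - P0)" by (rule polytropic_if_ctT[OF T g s])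
    then show False using assms(1) unfolding special_eos_def by blast
  qed
qed

end


section \<open>The isobaric-entropy case\<close>

context fluid_energy
begin

lemma linear_differential: "smooth_scalar M f \<Longrightarrow> linear (differential M f x)"
  unfolding differential_def using has_derivative_linear[OF has_derivative_comp[OF _ cmap_in[OF in_cdom]]] .

lemma smooth_dvector_zT:
  assumes T: "conserved T"
  shows "smooth_on J (\<lambda>s. zT T t x s)" "smooth_on J (\<lambda>s. dvector M x v (\<lambda>x. zT T t x s))"
proof -
  let ?Z = "\<lambda>(t, y, s). vcomp M x (\<lambda>x. zT T t x s) y"
  let ?V = "UNIV \<times> cimg M x \<times> J :: (real \<times> (real ^ 'n) \<times> real) set"
  let ?y = "cmap M x x"
  note Z = smooth_zT[OF T, of x] and o = open_tyJ[OF T, of x]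
  have m: "(t, ?y, s) \<in> ?V" if "s \<in> J" for s using that by simp
  have p: "smooth_on J (\<lambda>s. (t, ?y, s))" by (intro smooth_intros open_J)
  have "smooth_on J (\<lambda>s. ?Z (t, ?y, s))" by (rule smooth_compose[OF open_J o m p Z])
  then show "smooth_on J (\<lambda>s. zT T t x s)" by simp
  have d: "der ?Z (t, ?y, s) (0, v, 0) = dvector M x v (\<lambda>x. zT T t x s)" if s: "s \<in> J" for s
  proof -
    have "((\<lambda>y. (t, y, s)) has_derivative (\<lambda>h. (0, h, 0))) (at ?y)" by (auto intro!: derivative_eq_intros simp: zero_prod_def)
    from has_derivative_compose[OF this smooth_has_derivative[OF Z o m[OF s]]]
    have "(vcomp M x (\<lambda>x. zT T t x s) has_derivative (\<lambda>h. der ?Z (t, ?y, s) (0, h, 0))) (at ?y)" by simp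
    from der_eq[OF this] show ?thesis unfolding dvector_def by simp
  qed
  have "smooth_on J (\<lambda>s. der ?Z (t, ?y, s) (0, v, 0))"
    by (rule smooth_der_compose[OF open_J m p o Z smooth_const[OF open_J]])
  then show "smooth_on J (\<lambda>s. dvector M x v (\<lambda>x. zT T t x s))"
    by (rule smooth_cong[OF open_J d, rotated])
qed

text \<open>The coefficients in \<open>killing_expand\<close> have this form, so they depend
  smoothly on the entropy.\<close>

lemma smooth_jet:
  assumes T: "conserved T"
  shows "smooth_on J (\<lambda>s. jet x (\<lambda>x. zT T t x s) \<bullet> b)"
proof -
  have "smooth_on J (\<lambda>s. zT T t x s \<bullet> fst b + (\<Sum>j\<in>UNIV. dvector M x (axis j 1) (\<lambda>x. zT T t x s) \<bullet> (snd b $ j)))"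
    by (intro smooth_add smooth_sum smooth_inner smooth_dvector_zT[OF T] open_J smooth_const)
  then show ?thesis by (cases b) (simp add: jet_def inner_vec_def)
qed

lemma differential_sum:
  assumes "\<And>i. i < (N::nat) \<Longrightarrow> smooth_scalar M (\<psi> i)"
  shows "smooth_scalar M (\<lambda>z. \<Sum>i<N. c i * \<psi> i z) \<and> (\<forall>x v. differential M (\<lambda>z. \<Sum>i<N. c i * \<psi> i z) x v = (\<Sum>i<N. c i * differential M (\<psi> i) x v))"
  using assms
proof (induction N)
  case 0
  then show ?case by (simp add: smooth_scalar_const differential_const)
next
  case (Suc N)
  let ?h = "\<lambda>z. \<Sum>i<N. c i * \<psi> i z"
  have e: "(\<lambda>z. \<Sum>i<Suc N. c i * \<psi> i z) = (\<lambda>z. c N * \<psi> N z + ?h z)" by (simp add: fun_eq_iff add.commute)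
  have s: "smooth_scalar M (\<psi> N)" "smooth_scalar M ?h" using Suc by auto
  show ?case unfolding e differential_lincomb[OF s] using smooth_scalar_lincomb[OF s, of "c N"] Suc by (simp add: add.commute)
qed

context
  fixes \<kappa> :: "real \<Rightarrow> real"
  assumes iso: "isobaric_entropy I J P \<kappa>"
begin

lemma \<kappa>: "r \<in> I \<Longrightarrow> s \<in> J \<Longrightarrow> P r s = \<kappa> s"
  using iso unfolding isobaric_entropy_def by blast

lemma isobaric_generic: "generically_nonzero (I \<times> J) (\<lambda>q. der Pc q (0, 1))"
proof -
  have "\<not> gen_r"
  proof
    assume "gen_r"
    moreover have "I \<times> J \<noteq> {}" using I J unfolding open_interval_def by auto
    ultimately obtain q where "q \<in> I \<times> J" "der Pc q (1, 0) \<noteq> 0"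
      using open_IJ unfolding gen_r_def generically_nonzero_def by blast
    then show False using isobaric_der(1)[OF \<kappa>, of "fst q" "snd q" 1 0] by auto
  qed
  then show ?thesis using eos_cases by blast
qed

lemma isobaric_energy:
  obtains \<epsilon> where "smooth_on J \<epsilon>" "\<And>r s. r \<in> I \<Longrightarrow> s \<in> J \<Longrightarrow> r * e r s = - \<kappa> s + r * \<epsilon> s"
proof (rule affine_energy[of "-1" 0])
  show "P r s + -1 * P r s - 0 = -1 * (r * der Pc (r, s) (1, 0))" if "r \<in> I" "s \<in> J" for r s
    using isobaric_der(1)[OF \<kappa> that, of 1 0] by simp
qed (rule that, assumption, simp add: \<kappa>)

text \<open>The part \<open>D\<close> of the rest value that does not grow with \<open>r\<close>
  satisfies \<open>D_s = - c P_s\<close> by \<open>cond_B\<close> and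
  \<open>D_ts = n c_t P_s / 2\<close> by \<open>cond_Qs\<close>. Equality of the mixed derivatives
  gives \<open>(1 + n / 2) c_t P_s = 0\<close>, and \<open>P_s\<close> is generically
  nonzero.\<close>

lemma isobaric_ctT:
  assumes T: "conserved T" and s: "s \<in> J"
  shows "ctT T t x s = 0"
proof -
  have "smooth_on J (\<lambda>s::real. 0::real)" by (rule smooth_const[OF open_J])
  note r2' = r2[OF T this]
  \<comment> \<open>In the isobaric case the rest value is affine in \<open>r\<close>; this is its
    value at \<open>r = 0\<close>, extrapolated from \<open>r1\<close> and
    \<open>r2\<close>.\<close>
  define D where "D = (\<lambda>(t, s). T t x 0 r1 s - r1 * (1 / (r2 - r1) * (T t x 0 r2 s - T t x 0 r1 s)))"
  let ?C = "\<lambda>(t, s). cT T t x s"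
  have o: "open (UNIV \<times> J :: (real \<times> real) set)" by (intro open_Times open_UNIV open_J)
  have sQ: "smooth_on (UNIV \<times> J) (\<lambda>z. That T x (fst z, cmap M x x, 0, r, snd z))" if "r \<in> I" for r
    by (rule smooth_That_comp[OF T o]) (use that in \<open>auto intro!: smooth_intros o\<close>)
  have "smooth_on (UNIV \<times> J) (\<lambda>z. That T x (fst z, cmap M x x, 0, r1, snd z) - r1 * (1 / (r2 - r1) *
      (That T x (fst z, cmap M x x, 0, r2, snd z) - That T x (fst z, cmap M x x, 0, r1, snd z))))"
    by (intro smooth_diff smooth_mult smooth_const o sQ r1 r2'(1))
  then have sD: "smooth_on (UNIV \<times> J) D" unfolding D_def That_center case_prod_unfold .
  have sDc: "smooth_on (UNIV \<times> J) (\<lambda>z. der D z h)" for h by (rule smooth_der[OF o sD smooth_const[OF o]])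
  have "smooth_on (UNIV \<times> J) (\<lambda>z. (\<lambda>(t, y, s). cT T t (cinv M x y) s) (fst z, cmap M x x, snd z))"
    by (rule smooth_compose[OF o open_tyJ[OF T] _ _ smooth_cT[OF T]]) (auto intro!: smooth_intros o)
  then have sC: "smooth_on (UNIV \<times> J) ?C" by (simp add: case_prod_unfold)
  have ct': "ctT T t x s = der ?C (t, s) (1, 0)" if s: "s \<in> J" for t s
    using has_vector_derivative_curve2(2)[OF sC open_J s, of t] ct(1)[OF T s, of x t]
    by (auto simp: has_real_derivative_iff_has_vector_derivative dest: vector_derivative_unique_at)
  obtain \<epsilon> where \<epsilon>: "smooth_on J \<epsilon>" and re: "\<And>r s. r \<in> I \<Longrightarrow> s \<in> J \<Longrightarrow> r * e r s = - \<kappa> s + r * \<epsilon> s"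
    by (rule isobaric_energy, rule that)
  have Q: "T t x 0 r s = dT T \<epsilon> t x s - cT T t x s * \<kappa> s + r * qT T \<epsilon> t x s" if "r \<in> I" "s \<in> J" for t r s
    using Q_affine(1)[OF T \<epsilon> that, of t x] re[OF that] by (simp add: algebra_simps)
  have DQ: "D (t, s) = dT T \<epsilon> t x s - cT T t x s * P r1 s" if "s \<in> J" for t s
    unfolding D_def using Q[OF r1 that, of t] Q[OF r2'(1) that, of t] r2'(2) \<kappa>[OF r1 that]
    by (simp add: left_diff_distrib[symmetric])
  have Ds: "der D (t, s) (0, 1) = - cT T t x s * deriv \<kappa> s" if s: "s \<in> J" for t s
  proof -
    have "((\<lambda>s. D (t, s)) has_real_derivative - cT T t x s * der Pc (r1, s) (0, 1)) (at s)"
      by (rule has_field_derivative_transform_within_open[OF d_deriv[OF T \<epsilon> r1 s, of t x] open_J s]) (simp add: DQ)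
    then have "((\<lambda>s. D (t, s)) has_derivative (*) (- cT T t x s * deriv \<kappa> s)) (at s)"
      using isobaric_der(1)[OF \<kappa> r1 s, of 0 1] unfolding has_field_derivative_def by simp
    from der_eq[OF this] has_vector_derivative_curve2(3)[OF sD open_J s, of t 1] show ?thesis by simp
  qed
  let ?d = "\<lambda>t s. deriv (\<lambda>t. T t x 0 r1 s) t - r1 * (1 / (r2 - r1) * (deriv (\<lambda>t. T t x 0 r2 s) t - deriv (\<lambda>t. T t x 0 r1 s) t))"
  have Dt: "der D (t, s) (1, 0) = ?d t s"
    if s: "s \<in> J" for t s
  proof -
    have "((\<lambda>t. D (t, s)) has_real_derivative ?d t s) (at t)"
      unfolding D_def prod.case by (intro DERIV_diff DERIV_cmult Q_t[OF T \<epsilon>] r1 r2'(1) s)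
    then show ?thesis using has_vector_derivative_curve2(2)[OF sD open_J s, of t]
      by (auto simp: has_real_derivative_iff_has_vector_derivative dest: vector_derivative_unique_at)
  qed
  have z: "der Pc q (0, 1) * ctT T t x (snd q) = 0" if q: "q \<in> I \<times> J" for q
  proof -
    obtain r s where rs: "q = (r, s)" "r \<in> I" "s \<in> J" using q by auto
    have ts: "(t, s) \<in> UNIV \<times> J" using rs by simp
    let ?c = "real CARD('n) / 2 * ctT T t x s * deriv \<kappa> s"
    have Qs: "((\<lambda>s. deriv (\<lambda>t. T t x 0 r s) t) has_real_derivative ?c) (at s)" if "r \<in> I" for r
      using cond_Qs[OF T that rs(3), of x t] isobaric_der(1)[OF \<kappa> that rs(3), of 0 1] by simp
    have "((\<lambda>s. ?d t s)
        has_real_derivative ?c - r1 * (1 / (r2 - r1) * (?c - ?c))) (at s)"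
      by (intro DERIV_diff DERIV_cmult Qs r1 r2'(1))
    then have "((\<lambda>s. der D (t, s) (1, 0)) has_real_derivative ?c - r1 * (1 / (r2 - r1) * (?c - ?c))) (at s)"
      by (rule has_field_derivative_transform_within_open[OF _ open_J rs(3)]) (simp add: Dt)
    then have "((\<lambda>s. (\<lambda>z. der D z (1, 0)) (t, s)) has_derivative (*) ?c) (at s)"
      by (simp add: has_field_derivative_def)
    from der_eq[OF this] has_vector_derivative_curve2(3)[OF sDc[of "(1, 0)"] open_J rs(3), where t = t and v = 1]
    have 1: "der (\<lambda>z. der D z (1, 0)) (t, s) (0, 1) = ?c" by simp
    have "((\<lambda>t. - cT T t x s * deriv \<kappa> s) has_real_derivative - ctT T t x s * deriv \<kappa> s) (at t)"
      by (intro DERIV_cmult_right DERIV_minus ct(1)[OF T rs(3)])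
    then have "((\<lambda>t. der D (t, s) (0, 1)) has_real_derivative - ctT T t x s * deriv \<kappa> s) (at t)"
      unfolding Ds[OF rs(3)] .
    then have 2: "der (\<lambda>z. der D z (0, 1)) (t, s) (1, 0) = - ctT T t x s * deriv \<kappa> s"
      using has_vector_derivative_curve2(2)[OF sDc[of "(0, 1)"] open_J rs(3), where t = t]
      by (auto simp: has_real_derivative_iff_has_vector_derivative dest: vector_derivative_unique_at)
    have "?c = - ctT T t x s * deriv \<kappa> s" using 1 2 der_swap[OF o ts sD, of "(1, 0)" "(0, 1)"] by simp
    then have "(1 + real CARD('n) / 2) * (ctT T t x s * deriv \<kappa> s) = 0" by (simp add: algebra_simps)
    moreover have "1 + real CARD('n) / 2 \<noteq> 0" by (simp add: add_pos_nonneg less_imp_neq[symmetric])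
    ultimately show ?thesis using rs isobaric_der(1)[OF \<kappa> rs(2,3), of 0 1] by auto
  qed
  have "smooth_on (I \<times> J) (\<lambda>q. der ?C (t, snd q) (1, 0))"
    by (rule smooth_der_compose[OF open_IJ _ _ o sC]) (auto intro!: smooth_intros open_IJ)
  then have "continuous_on (I \<times> J) (\<lambda>q. der ?C (t, snd q) (1, 0))" by (rule smooth_continuous_on[OF _ open_IJ])
  then have c: "continuous_on (I \<times> J) (\<lambda>q. ctT T t x (snd q))"
    by (rule continuous_on_eq) (auto simp: ct')
  from generically_nonzero_zero[OF isobaric_generic open_IJ c z, of "(r1, s)"] show ?thesis using r1 s by simp
qed

end

end


context fluid_energy
begin

context
  fixes \<kappa> :: "real \<Rightarrow> real" and F
  assumes iso: "isobaric_entropy I J P \<kappa>"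
  defines "F \<equiv> general_densities M J e \<union> isobaric_densities M J \<kappa> \<union> isobaric_galilean_densities M J"
begin

lemma general_sub: "general_densities M J e \<subseteq> F" unfolding F_def by blast

text \<open>The isobaric families require a nonconstant \<open>f\<close>; for constant
  \<open>f\<close> the density is a multiple of a general one. The same division occurs in the two
  lemmas that follow.\<close>

lemma comb_momentum:
  assumes "killing M \<zeta>" "smooth_on J f" shows "comb F (nonisentropic_momentum_density M \<zeta> f)"
proof (cases "f constant_on J")
  case True
  then obtain k where k: "\<And>s. s \<in> J \<Longrightarrow> f s = k" unfolding constant_on_def by blast
  have "comb F (momentum_density M \<zeta>)" using comb_member[OF member_general(2)[OF assms(1)]] comb_mono general_sub by blast
  from comb_lincomb[OF this comb_base[of F "\<lambda>t x. 0"], of k] show ?thesis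
    by (rule comb_cong) (simp add: momentum_density_def nonisentropic_momentum_density_def k)
next
  case False
  with assms show ?thesis
    by (intro comb_member) (auto simp: F_def isobaric_densities_def nonconstant_fun_def)
qed

lemma comb_galilean:
  assumes "smooth_scalar M \<psi>" "killing M (grad M \<psi>)" "smooth_on J f" shows "comb F (nonisentropic_galilean_density M \<psi> f)"
proof (cases "f constant_on J")
  case True
  then obtain k where k: "\<And>s. s \<in> J \<Longrightarrow> f s = k" unfolding constant_on_def by blast
  have "comb F (galilean_momentum_density M \<psi>)" using comb_member[OF member_general(3)[OF assms(1,2)]] comb_mono general_sub by blast
  from comb_lincomb[OF this comb_base[of F "\<lambda>t x. 0"], of k] show ?thesis
    by (rule comb_cong) (simp add: galilean_momentum_density_def nonisentropic_galilean_density_def k)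
next
  case False
  with assms show ?thesis
    by (intro comb_member) (auto simp: F_def isobaric_galilean_densities_def nonconstant_fun_def)
qed

text \<open>For constant \<open>f = k\<close> the antiderivative is \<open>k \<kappa>\<close> up to
  a number, and \<open>r e = - \<kappa> + r \<epsilon>\<close> turns the density into
  \<open>k\<close> times the energy, corrected by a volumetric entropy and that number.\<close>

lemma comb_energy:
  assumes f: "smooth_on J f" and K: "\<And>s. s \<in> J \<Longrightarrow> (K has_real_derivative f s * deriv \<kappa> s) (at s)"
  shows "comb F (nonisentropic_energy_density M f K)"
proof (cases "f constant_on J")
  case True
  then obtain k where k: "\<And>s. s \<in> J \<Longrightarrow> f s = k" unfolding constant_on_def by blast
  obtain \<epsilon> where \<epsilon>: "smooth_on J \<epsilon>" and re: "\<And>r s. r \<in> I \<Longrightarrow> s \<in> J \<Longrightarrow> r * e r s = - \<kappa> s + r * \<epsilon> s"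
    by (rule isobaric_energy[OF iso], rule that)
  obtain s1 where s1: "s1 \<in> J" using ex_interior .
  have Kk: "K s = k * \<kappa> s + (K s1 - k * \<kappa> s1)" if s: "s \<in> J" for s
  proof -
    have "K s - k * \<kappa> s = K s1 - k * \<kappa> s1"
    proof (rule const_deriv_zero[OF conv_J _ s s1])
      show "((\<lambda>s. K s - k * \<kappa> s) has_real_derivative 0) (at s)" if "s \<in> J" for s
        using DERIV_diff[OF K[OF that] DERIV_cmult[OF isobaric_der(2)[OF \<kappa>[OF iso] r1 that], of k]] k[OF that] by simp
    qed
    then show ?thesis by simp
  qed
  have E: "comb F (energy_density M e)" using comb_member[OF member_general(1)] comb_mono general_sub by blast
  have f': "smooth_on J (\<lambda>s. - k * \<epsilon> s)" by (intro smooth_mult smooth_const open_J \<epsilon>)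
  from comb_lincomb[OF E comb_lincomb[OF comb_entropy[OF f' general_sub] comb_base[of F "\<lambda>t x. - (K s1 - k * \<kappa> s1)"], of 1], of k]
  show ?thesis
  proof (rule comb_cong)
    fix t x v r s assume rs: "r \<in> I" "s \<in> J"
    have E': "r * (1/2 * metric M x v v + e r s) = 1/2 * r * metric M x v v - \<kappa> s + r * \<epsilon> s"
      using re[OF rs] by (simp add: distrib_left)
    show "nonisentropic_energy_density M f K t x v r s =
       k * energy_density M e t x v r s + (1 * (r * (- k * \<epsilon> s)) + - (K s1 - k * \<kappa> s1))"
      unfolding nonisentropic_energy_density_def energy_density_def k[OF rs(2)] Kk[OF rs(2)] E' by (simp add: algebra_simps)
  qed
next
  case False
  with f K show ?thesis
    by (intro comb_member) (auto simp: F_def isobaric_densities_def nonconstant_fun_def antideriv_on_def)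
qed

text \<open>All coefficients depend on the entropy here, while combinations have constant
  coefficients. The fields \<open>zeta\<close> at time 0 and \<open>grad q\<close> are Killing for
  each entropy; expanded by \<open>killing_expand\<close> in finite bases that do not depend on it,
  they contribute one nonisentropic density for each basis element.\<close>

lemma comb_isobaric:
  assumes T: "conserved T" shows "comb F T"
proof -
  obtain \<epsilon> where \<epsilon>: "smooth_on J \<epsilon>" and re: "\<And>r s. r \<in> I \<Longrightarrow> s \<in> J \<Longrightarrow> r * e r s = - \<kappa> s + r * \<epsilon> s"
    by (rule isobaric_energy[OF iso], rule that)
  obtain s1 where s1: "s1 \<in> J" using ex_interior .
  note ct0 = isobaric_ctT[OF iso T]
  have H: "balanced T \<epsilon>" by (simp add: ct0)
  fix x0 :: 'm
  define c where "c s = cT T 0 x0 s" for s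
  define q where "q x s = qT T \<epsilon> 0 x s" for x s
  \<comment> \<open>The rest value extrapolated to density 0. Its entropy derivative is
    \<open>- c \<kappa>'\<close> at every time and place, so it splits into a function of time and
    place and the antiderivative \<open>K\<close>.\<close>
  define D where "D t x s = dT T \<epsilon> t x s - cT T t x s * P r1 s" for t x s
  define K where "K s = - (D 0 x0 s - D 0 x0 s1)" for s
  have sc: "smooth_on J c" unfolding c_def by (rule smooth_cT_s[OF T])
  have cT: "cT T t x s = c s" if s: "s \<in> J" for t x s
  proof -
    have "cT T t x0 s = cT T 0 x0 s"
      by (rule const_deriv_zero[of UNIV "\<lambda>t. cT T t x0 s" t 0]) (use ct(1)[OF T s, of x0] ct0[OF s] in simp_all)
    then show ?thesis unfolding c_def using cT_const[OF T s, of t x x0] by simp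
  qed
  have Dd: "((\<lambda>s. D t x s) has_real_derivative - c s * deriv \<kappa> s) (at s)" if "s \<in> J" for t x s
    using d_deriv[OF T \<epsilon> r1 that, of t x] isobaric_der(1)[OF \<kappa>[OF iso] r1 that, of 0 1] cT[OF that, of t x] unfolding D_def by simp
  have Kd: "(K has_real_derivative c s * deriv \<kappa> s) (at s)" if "s \<in> J" for s
    unfolding K_def using DERIV_minus[OF DERIV_diff[OF Dd[OF that, of 0 x0] DERIV_const]] by simp
  have DK: "D t x s = D t x s1 - K s" if s: "s \<in> J" for t x s
  proof -
    have "D t x s - D 0 x0 s = D t x s1 - D 0 x0 s1"
      by (rule const_deriv_zero[OF conv_J _ s s1]) (use DERIV_diff[OF Dd Dd] in fastforce)
    then show ?thesis unfolding K_def by simp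
  qed
  have sq: "smooth_scalar M (\<lambda>x. q x s)" if "s \<in> J" for s unfolding q_def by (rule smooth_qT[OF T \<epsilon> that])
  have TT: "T t x v r s = nonisentropic_energy_density M c K t x v r s + r * metric M x v (zT T 0 x s)
      + r * (q x s - t * differential M (\<lambda>x. q x s) x v) + D t x s1" if rs: "r \<in> I" "s \<in> J" for t x v r s
    using unified_structure[OF T \<epsilon> H rs, of t x v] DK[OF rs(2), of t x] re[OF rs] \<kappa>[OF iso r1 rs(2)]
    unfolding q_def[symmetric] cT[OF rs(2)] D_def nonisentropic_energy_density_def metric_sym[of x v "zT T 0 x s"] by (simp add: algebra_simps)
  have kz: "killing M (\<lambda>x. zT T t x s)" if "s \<in> J" for t s
    using cond_lie[OF T that, where t = t] smooth_zT_vector[OF T that] ct0[OF that] unfolding killing_def by simp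
  let ?K = "{X. killing M X}"
  obtain N :: nat and B \<beta> where "\<And>i. i < N \<Longrightarrow> B i \<in> ?K"
    and "\<And>X x. X \<in> ?K \<Longrightarrow> X x = (\<Sum>i<N. (jet x0 X \<bullet> \<beta> i) *\<^sub>R B i x)"
    by (rule killing_expand[of ?K x0]; (rule that | (auto intro: killing_0 killing_lincomb)[1]))
  note B = this(1)[unfolded mem_Collect_eq] and Bx = this(2)[unfolded mem_Collect_eq]
  have m: "comb F (\<lambda>t x v r s. r * metric M x v (zT T 0 x s))"
  proof (rule comb_cong[OF comb_sum[of N F "\<lambda>i. nonisentropic_momentum_density M (B i) (\<lambda>s. jet x0 (\<lambda>x. zT T 0 x s) \<bullet> \<beta> i)"]])
    show "comb F (nonisentropic_momentum_density M (B i) (\<lambda>s. jet x0 (\<lambda>x. zT T 0 x s) \<bullet> \<beta> i))" if "i < N" for i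
      by (rule comb_momentum[OF B[OF that]]) (rule smooth_jet[OF T])
    fix t x v r s assume rs: "r \<in> I" "s \<in> J"
    have "metric M x v (zT T 0 x s) = metric M x v (\<Sum>i<N. (jet x0 (\<lambda>x. zT T 0 x s) \<bullet> \<beta> i) *\<^sub>R B i x)"
      using Bx[OF kz[OF rs(2), of 0], of x] by simp
    then show "r * metric M x v (zT T 0 x s) =
       (\<Sum>i<N. nonisentropic_momentum_density M (B i) (\<lambda>s. jet x0 (\<lambda>x. zT T 0 x s) \<bullet> \<beta> i) t x v r s)"
      unfolding nonisentropic_momentum_density_def
      by (simp add: linear_sum[OF linear_metric(1)] linear_cmul[OF linear_metric(1)] sum_distrib_left mult_ac)
  qed

  \<comment> \<open>Expanding \<open>grad q\<close> within the Killing gradients, and not within all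
    Killing fields, gives basis elements that have potentials.\<close>
  let ?V = "{X. \<exists>\<psi>. smooth_scalar M \<psi> \<and> killing M X \<and> X = grad M \<psi>}"
  have gq: "grad M (\<lambda>x. q x s) = (\<lambda>x. (-1) *\<^sub>R zT T 1 x s + zT T 0 x s)" if "s \<in> J" for s
    using zT_affine[OF T \<epsilon> H that, of 1] unfolding q_def by (simp add: fun_eq_iff)
  have kg: "grad M (\<lambda>x. q x s) \<in> ?V" if "s \<in> J" for s
  proof -
    have "killing M (grad M (\<lambda>x. q x s))" unfolding gq[OF that] by (rule killing_lincomb[OF kz[OF that] kz[OF that]])
    with sq[OF that] show ?thesis by blast
  qed
  obtain N' :: nat and B' \<beta>' where B': "\<And>i. i < N' \<Longrightarrow> B' i \<in> ?V"
    and Bx': "\<And>X x. X \<in> ?V \<Longrightarrow> X x = (\<Sum>i<N'. (jet x0 X \<bullet> \<beta>' i) *\<^sub>R B' i x)"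
  proof (rule killing_expand[of ?V x0])
    have "(\<lambda>x. 0) = grad M (\<lambda>x. 0)" by (simp add: grad_const fun_eq_iff)
    then show "(\<lambda>x. 0) \<in> ?V" using killing_0 smooth_scalar_const[of 0] by blast
    fix X Y a assume "X \<in> ?V" "Y \<in> ?V"
    then obtain \<psi> \<phi> where p: "smooth_scalar M \<psi>" "killing M X" "X = grad M \<psi>" "smooth_scalar M \<phi>" "killing M Y" "Y = grad M \<phi>" by blast
    have "(\<lambda>z. a *\<^sub>R X z + Y z) = grad M (\<lambda>z. a * \<psi> z + \<phi> z)"
      unfolding p(3,6) by (simp add: fun_eq_iff grad_lincomb[OF p(1,4)])
    then show "(\<lambda>z. a *\<^sub>R X z + Y z) \<in> ?V"
      using smooth_scalar_lincomb[OF p(1,4), of a] killing_lincomb[OF p(2,5), of a] by blast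
  qed ((rule that, assumption+) | blast)+
  obtain \<psi> where \<psi>: "\<And>i. i < N' \<Longrightarrow> smooth_scalar M (\<psi> i)" "\<And>i. i < N' \<Longrightarrow> killing M (grad M (\<psi> i))" "\<And>i. i < N' \<Longrightarrow> B' i = grad M (\<psi> i)"
    using B' by (simp only: mem_Collect_eq) metis
  define b where "b i s = jet x0 (grad M (\<lambda>x. q x s)) \<bullet> \<beta>' i" for i s
  have sb: "smooth_on J (b i)" for i
  proof -
    have "smooth_on J (\<lambda>s. (-1) * (jet x0 (\<lambda>x. zT T 1 x s) \<bullet> \<beta>' i) + jet x0 (\<lambda>x. zT T 0 x s) \<bullet> \<beta>' i)"
      by (intro smooth_add smooth_mult smooth_const open_J smooth_jet[OF T])
    then show ?thesis
    proof (rule smooth_cong[OF open_J, rotated])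
      fix s assume s: "s \<in> J"
      have "jet x0 (grad M (\<lambda>x. q x s)) = (-1) *\<^sub>R jet x0 (\<lambda>x. zT T 1 x s) + jet x0 (\<lambda>x. zT T 0 x s)"
        unfolding gq[OF s] jet_def
        using dvector_lincomb[OF smooth_zT_vector[OF T s, of 1] smooth_zT_vector[OF T s, of 0], of x0 _ "-1"] by (simp add: vec_eq_iff)
      then show "(-1) * (jet x0 (\<lambda>x. zT T 1 x s) \<bullet> \<beta>' i) + jet x0 (\<lambda>x. zT T 0 x s) \<bullet> \<beta>' i = b i s"
        unfolding b_def by (simp add: inner_diff_left)
    qed
  qed
  have dq: "differential M (\<lambda>x. q x s) x v = (\<Sum>i<N'. b i s * differential M (\<psi> i) x v)" if s: "s \<in> J" for s x v
  proof -
    have "metric M x (grad M (\<lambda>x. q x s) x) v = metric M x (\<Sum>i<N'. b i s *\<^sub>R B' i x) v"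
      using Bx'[OF kg[OF s], of x] unfolding b_def by simp
    also have "\<dots> = (\<Sum>i<N'. b i s * metric M x (B' i x) v)"
      by (simp add: linear_sum[OF linear_metric(2)] linear_cmul[OF linear_metric(2)])
    also have "\<dots> = (\<Sum>i<N'. b i s * differential M (\<psi> i) x v)"
      by (intro sum.cong refl) (simp add: \<psi> grad_metric)
    finally show ?thesis by (simp add: grad_metric sq[OF s])
  qed
  \<comment> \<open>For each entropy, \<open>q\<close> and the combination of potentials have the
    same gradient; their difference is constant on the manifold and becomes a volumetric
    entropy.\<close>
  define f where "f s = q x0 s - (\<Sum>i<N'. b i s * \<psi> i x0)" for s
  have q: "q x s = (\<Sum>i<N'. b i s * \<psi> i x) + f s" if s: "s \<in> J" for x s
  proof -
    note d = differential_sum[of N' \<psi> "\<lambda>i. b i s", OF \<psi>(1)]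
    have "(\<lambda>z. (-1) * (\<Sum>i<N'. b i s * \<psi> i z) + q z s) x = (\<lambda>z. (-1) * (\<Sum>i<N'. b i s * \<psi> i z) + q z s) x0"
    proof (rule const_on_connected)
      show "smooth_scalar M (\<lambda>z. (-1) * (\<Sum>i<N'. b i s * \<psi> i z) + q z s)"
        by (rule smooth_scalar_lincomb[OF _ sq[OF s]]) (use d in blast)
      show "differential M (\<lambda>z. (-1) * (\<Sum>i<N'. b i s * \<psi> i z) + q z s) x v = 0" for x v
        using differential_lincomb[OF conjunct1[OF d] sq[OF s], of "-1" x v] d dq[OF s, of x v] by simp
    qed
    then show ?thesis unfolding f_def by simp
  qed
  have sf: "smooth_on J f"
    unfolding f_def q_def by (intro smooth_diff smooth_sum smooth_mult smooth_const open_J sb smooth_qT_s[OF T \<epsilon>])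
  have g: "comb F (\<lambda>t x v r s. \<Sum>i<N'. nonisentropic_galilean_density M (\<psi> i) (b i) t x v r s)"
    by (rule comb_sum) (intro comb_galilean \<psi> sb)
  show ?thesis
  proof (rule comb_cong[OF comb_lincomb[OF comb_energy[OF sc Kd] comb_lincomb[OF m comb_lincomb[OF g
     comb_lincomb[OF comb_entropy[OF sf general_sub] comb_base[of F "\<lambda>t x. D t x s1"], of 1], of 1], of 1], of 1]])
    fix t x v r s assume rs: "r \<in> I" "s \<in> J"
    have "(\<Sum>i<N'. nonisentropic_galilean_density M (\<psi> i) (b i) t x v r s) = r * ((\<Sum>i<N'. b i s * \<psi> i x) - t * (\<Sum>i<N'. b i s * differential M (\<psi> i) x v))"
      unfolding nonisentropic_galilean_density_def
      by (simp add: sum_distrib_left sum_subtractf[symmetric] algebra_simps)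
    then show "T t x v r s = 1 * nonisentropic_energy_density M c K t x v r s + (1 * (r * metric M x v (zT T 0 x s)) +
       (1 * (\<Sum>i<N'. nonisentropic_galilean_density M (\<psi> i) (b i) t x v r s) + (1 * (r * f s) + D t x s1)))"
      unfolding TT[OF rs] dq[OF rs(2)] unfolding q[OF rs(2)] by (simp add: algebra_simps)
  qed
qed

end

end


subsection \<open>Extra densities\<close>

context fluid_energy
begin

text \<open>For combinations of general densities the coefficient of the kinetic term is a single
  constant, and the part odd in the velocity, divided by \<open>r\<close>, does not depend on the
  entropy. Extra densities are recognised by violating one of the two.\<close>

lemma general_invariants:
  assumes "comb (general_densities M J e) T"
  obtains c A where "\<And>t x v r s. r \<in> I \<Longrightarrow> s \<in> J \<Longrightarrow> T t x v r s + T t x (- v) r s - 2 * T t x 0 r s = c * (r * metric M x v v)"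
    "\<And>t x v r s. r \<in> I \<Longrightarrow> s \<in> J \<Longrightarrow> T t x v r s - T t x (- v) r s = r * A t x v"
proof -
  let ?E = "\<lambda>L c A. \<forall>t x v r s. L t x v r s + L t x (- v) r s - 2 * L t x 0 r s = c * (r * metric M x v v) \<and>
    L t x v r s - L t x (- v) r s = r * A t x v"
  have E: "\<exists>c A. ?E L c A" if "L \<in> general_densities M J e" for L :: "('m, 'n) density"
    using that unfolding general_densities_def
  proof (elim UnE CollectE exE conjE singletonE)
    note m = linear_0[OF linear_metric(2)] linear_neg[OF linear_metric(1)] linear_neg[OF linear_metric(2)]
    show "L = mass_density \<Longrightarrow> ?thesis"
      by (intro exI[of _ 0] exI[of _ "\<lambda>t x v. 0"]) (simp add: mass_density_def)
    show "L = entropy_density f \<Longrightarrow> ?thesis" for f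
      by (intro exI[of _ 0] exI[of _ "\<lambda>t x v. 0"]) (simp add: entropy_density_def)
    show "L = energy_density M e \<Longrightarrow> ?thesis"
      by (intro exI[of _ 1] exI[of _ "\<lambda>t x v. 0"]) (simp add: energy_density_def m algebra_simps)
    show "L = momentum_density M \<zeta> \<Longrightarrow> ?thesis" for \<zeta>
      by (intro exI[of _ 0] exI[of _ "\<lambda>t x v. 2 * metric M x v (\<zeta> x)"]) (simp add: momentum_density_def m algebra_simps)
    show "L = galilean_momentum_density M \<psi> \<Longrightarrow> smooth_scalar M \<psi> \<Longrightarrow> ?thesis" for \<psi>
      by (intro exI[of _ 0] exI[of _ "\<lambda>t x v. - 2 * t * differential M \<psi> x v"])
        (simp add: galilean_momentum_density_def linear_0[OF linear_differential] linear_neg[OF linear_differential] algebra_simps)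
  qed
  obtain N k L h where L: "\<And>i. i < N \<Longrightarrow> L i \<in> general_densities M J e"
    and T: "\<And>t x v r s. r \<in> I \<Longrightarrow> s \<in> J \<Longrightarrow> T t x v r s = (\<Sum>i<N::nat. k i * L i t x v r s) + h t x"
    using assms unfolding comb_def by blast
  have "\<forall>i. \<exists>c A. i < N \<longrightarrow> ?E (L i) c A" using E L by blast
  then obtain c A where cA: "\<And>i. i < N \<Longrightarrow> ?E (L i) (c i) (A i)" by metis
  show thesis
  proof (rule that)
    fix t x v r s assume rs: "r \<in> I" "s \<in> J"
    have "T t x v r s + T t x (- v) r s - 2 * T t x 0 r s = (\<Sum>i<N. k i * (L i t x v r s + L i t x (- v) r s - 2 * L i t x 0 r s))"
      unfolding T[OF rs] by (simp add: sum_distrib_left sum.distrib sum_subtractf algebra_simps)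
    also have "\<dots> = (\<Sum>i<N. k i * (c i * (r * metric M x v v)))" by (rule sum.cong) (use cA in auto)
    finally show "T t x v r s + T t x (- v) r s - 2 * T t x 0 r s = (\<Sum>i<N. k i * c i) * (r * metric M x v v)"
      by (simp add: sum_distrib_right mult.assoc)
    have "T t x v r s - T t x (- v) r s = (\<Sum>i<N. k i * (L i t x v r s - L i t x (- v) r s))"
      unfolding T[OF rs] by (simp add: sum_subtractf algebra_simps)
    also have "\<dots> = (\<Sum>i<N. k i * (r * A i t x v))" by (rule sum.cong) (use cA in auto)
    finally show "T t x v r s - T t x (- v) r s = r * (\<Sum>i<N. k i * A i t x v)"
      by (simp add: sum_distrib_left mult_ac)
  qed
qed

lemma extra_iff: "extra_density M I J P e T \<longleftrightarrow> conserved T \<and> \<not> comb (general_densities M J e) T"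
  unfolding extra_density_def using generated_iff[OF general_conserved] by blast

text \<open>Triviality makes the density constant in \<open>r\<close>, and a quantity proportional
  to \<open>r\<close> that agrees at \<open>r1\<close> and \<open>r2\<close> is zero.\<close>

lemma trivial_proportional_zero:
  assumes T: "conserved T" "trivial_density M I J P T" and h: "\<And>t x v r s. T t x v r s = r * h t x v s"
    and rs: "r \<in> I" "s \<in> J"
  shows "T t x v r s = 0"
proof -
  have \<epsilon>: "smooth_on J (\<lambda>s::real. 0::real)" by (rule smooth_const[OF open_J])
  note r2' = r2[OF T(1) \<epsilon>]
  have "r1 * h t x v s = r2 * h t x v s"
    using trivial_const[OF T r1 rs(2) r2'(1) rs(2), of t x v v] unfolding h .
  then show ?thesis using r2'(2) unfolding h by simp
qed

lemma metric_axis_pos: "metric M x (axis i 1) (axis i 1) > 0"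
  by (rule metric_pos) (simp add: axis_eq_0_iff)

lemma general_nontrivial:
  assumes T: "T \<in> general_densities M J e" and tr: "trivial_density M I J P T" and rs: "r \<in> I" "s \<in> J"
  shows "T t x v r s = 0"
proof -
  note c = general_conserved[OF T]
  show ?thesis using T unfolding general_densities_def
  proof (elim UnE CollectE exE conjE singletonE)
    \<comment> \<open>The internal energy need not be proportional to \<open>r\<close>; here the
      dependence on the velocity contradicts triviality.\<close>
    assume a: "T = energy_density M e"
    show ?thesis
      using trivial_const[OF c tr rs rs, of 0 x "axis undefined 1" 0] metric_axis_pos[of x undefined] pos_I[OF rs(1)]
      unfolding a energy_density_def by (simp add: linear_0[OF linear_metric(2)])
  next
    assume "T = mass_density"
    then show ?thesis
      by (intro trivial_proportional_zero[OF c tr _ rs, where h = "\<lambda>t x v s. 1"]) (simp add: mass_density_def)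
  next
    fix f assume "T = entropy_density f"
    then show ?thesis
      by (intro trivial_proportional_zero[OF c tr _ rs, where h = "\<lambda>t x v s. f s"]) (simp add: entropy_density_def)
  next
    fix \<zeta> assume "T = momentum_density M \<zeta>"
    then show ?thesis
      by (intro trivial_proportional_zero[OF c tr _ rs, where h = "\<lambda>t x v s. metric M x v (\<zeta> x)"]) (simp add: momentum_density_def)
  next
    fix \<psi> assume "T = galilean_momentum_density M \<psi>"
    then show ?thesis
      by (intro trivial_proportional_zero[OF c tr _ rs, where h = "\<lambda>t x v s. \<psi> x - t * differential M \<psi> x v"])
        (simp add: galilean_momentum_density_def)
  qed
qed

text \<open>The coefficient of the kinetic term is \<open>- \<Lambda> t\<close> in one case and
  \<open>\<Lambda> t\<^sup>2 / 2\<close> in the other; both differ between the times 0 and 1,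
  against \<open>general_invariants\<close>.\<close>

lemma polytropic_extra:
  assumes \<Lambda>: "\<Lambda> x \<noteq> 0"
  shows "\<not> comb (general_densities M J e) (similarity_energy_density M (\<lambda>r s. P r s - P\<^sub>0) \<xi> \<Lambda>)"
    "smooth_scalar M \<theta> \<Longrightarrow> \<not> comb (general_densities M J e) (galilean_energy_density M (\<lambda>r s. P r s - P\<^sub>0) \<theta> \<Lambda>)"
proof -
  let ?v = "axis undefined 1 :: real ^ 'n"
  obtain r0 s where s: "s \<in> J" using ex_interior .
  note m = linear_0[OF linear_metric(2)] linear_neg[OF linear_metric(1)] linear_neg[OF linear_metric(2)]
  have pos: "r1 * metric M x ?v ?v \<noteq> 0" using metric_axis_pos[of x undefined] pos_I[OF r1] by simp
  have key: "\<not> comb (general_densities M J e) T"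
    if T: "\<And>t v. T t x v r1 s + T t x (- v) r1 s - 2 * T t x 0 r1 s = k t * (r1 * metric M x v v)" and k: "k 0 \<noteq> k (1::real)" for k T
  proof
    assume cb: "comb (general_densities M J e) T"
    obtain c A where c: "\<And>t x v r s. r \<in> I \<Longrightarrow> s \<in> J \<Longrightarrow> T t x v r s + T t x (- v) r s - 2 * T t x 0 r s = c * (r * metric M x v v)"
      by (rule general_invariants[OF cb], rule that)
    have "k t = c" for t using T[of t ?v] c[OF r1 s, of t x ?v] pos by simp
    then show False using k by simp
  qed
  show "\<not> comb (general_densities M J e) (similarity_energy_density M (\<lambda>r s. P r s - P\<^sub>0) \<xi> \<Lambda>)"
    by (rule key[of _ "\<lambda>t. - \<Lambda> x * t"]) (use \<Lambda> in \<open>simp_all add: similarity_energy_density_def m algebra_simps\<close>)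
  show "\<not> comb (general_densities M J e) (galilean_energy_density M (\<lambda>r s. P r s - P\<^sub>0) \<theta> \<Lambda>)" if \<theta>: "smooth_scalar M \<theta>"
    by (rule key[of _ "\<lambda>t. 1/2 * \<Lambda> x * t\<^sup>2"])
      (use \<Lambda> in \<open>simp_all add: galilean_energy_density_def m linear_0[OF linear_differential[OF \<theta>]]
        linear_neg[OF linear_differential[OF \<theta>]] field_simps\<close>)
qed

text \<open>The invariants would make \<open>f\<close> constant: through the odd part for the
  momentum, through the kinetic coefficient for the energy. For the momentum the nonzero value
  provides a point where the Killing field does not vanish.\<close>

lemma isobaric_extra:
  assumes T: "T \<in> isobaric_densities M J \<kappa>" and nz: "r \<in> I" "s \<in> J" "T t x v r s \<noteq> 0"
  shows "\<not> comb (general_densities M J e) T"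
proof
  assume cb: "comb (general_densities M J e) T"
  obtain c A where c: "\<And>t x v r s. r \<in> I \<Longrightarrow> s \<in> J \<Longrightarrow> T t x v r s + T t x (- v) r s - 2 * T t x 0 r s = c * (r * metric M x v v)"
    "\<And>t x v r s. r \<in> I \<Longrightarrow> s \<in> J \<Longrightarrow> T t x v r s - T t x (- v) r s = r * A t x v"
    by (rule general_invariants[OF cb], rule that)
  note m = linear_0[OF linear_metric(2)] linear_neg[OF linear_metric(1)] linear_neg[OF linear_metric(2)]
  have r0: "r1 \<noteq> 0" using pos_I[OF r1] by simp
  show False using T unfolding isobaric_densities_def
  proof (elim UnE CollectE exE conjE)
    fix \<zeta> f assume a: "T = nonisentropic_momentum_density M \<zeta> f" "nonconstant_fun J f"
    have "metric M x v (\<zeta> x) \<noteq> 0" using nz(3) unfolding a nonisentropic_momentum_density_def by auto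
    then have z: "\<zeta> x \<noteq> 0" using linear_0[OF linear_metric(1)] by metis
    have "metric M x (\<zeta> x) (\<zeta> x) \<noteq> 0" using metric_pos[OF z] by (metis less_irrefl)
    moreover have "2 * metric M x (\<zeta> x) (\<zeta> x) * f s = A 0 x (\<zeta> x)" if "s \<in> J" for s
    proof -
      have "r1 * (2 * metric M x (\<zeta> x) (\<zeta> x) * f s) = r1 * A 0 x (\<zeta> x)"
        using c(2)[OF r1 that, of 0 x "\<zeta> x"] unfolding a nonisentropic_momentum_density_def by (simp add: m algebra_simps)
      then show ?thesis using r0 by simp
    qed
    ultimately have "f s = A 0 x (\<zeta> x) / (2 * metric M x (\<zeta> x) (\<zeta> x))" if "s \<in> J" for s
      using that by (simp add: nonzero_eq_divide_eq mult.commute)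
    then have "f constant_on J" unfolding constant_on_def by blast
    then show False using a(2) unfolding nonconstant_fun_def by blast
  next
    fix f K assume a: "T = nonisentropic_energy_density M f K" "nonconstant_fun J f"
    let ?v = "axis undefined 1 :: real ^ 'n"
    have p: "r1 * metric M x ?v ?v \<noteq> 0" using metric_axis_pos[of x undefined] r0 by simp
    have "f s = c" if "s \<in> J" for s
    proof -
      have "f s * (r1 * metric M x ?v ?v) = c * (r1 * metric M x ?v ?v)"
        using c(1)[OF r1 that, of 0 x ?v] unfolding a nonisentropic_energy_density_def by (simp add: m algebra_simps)
      then show ?thesis using p by simp
    qed
    then have "f constant_on J" unfolding constant_on_def by blast
    then show False using a(2) unfolding nonconstant_fun_def by blast
  qed
qed

end

theorem theorem3p1:
  fixes M :: "('m::{t2_space, second_countable_topology}, 'n::finite) riemannian"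
    and I J :: "real set"
    and P e :: "real \<Rightarrow> real \<Rightarrow> real"
  assumes M: "riemannian_manifold M" and n: "CARD('n) > 1"
    and I: "open_interval I" "I \<subseteq> {0<..}" and J: "open_interval J"
    and P: "equation_of_state I J P"
    and e: "thermodynamic_energy I J P e"
  shows
    \<comment> \<open>(i)\<close>
    "(\<forall>T\<in>general_densities M J e. conserved_density M I J P T \<and>
        ((\<exists>t x v. \<exists>r\<in>I. \<exists>s\<in>J. T t x v r s \<noteq> 0) \<longrightarrow> \<not> trivial_density M I J P T)) \<and>
     (\<not> special_eos CARD('n) I J P \<longrightarrow>
        (\<forall>T. conserved_density M I J P T \<longleftrightarrow> generated M I J P (general_densities M J e) T)) \<and>
    \<comment> \<open>(ii)\<close>
     ((\<exists>T. extra_density M I J P e T) \<longrightarrow> special_eos CARD('n) I J P) \<and>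
    \<comment> \<open>(ii), polytropic case\<close>
     (\<forall>P\<^sub>0. polytropic CARD('n) I J (\<lambda>r s. P r s - P\<^sub>0) \<longrightarrow>
        (\<forall>T. conserved_density M I J P T \<longleftrightarrow>
           generated M I J P
             (general_densities M J e \<union> polytropic_densities M (\<lambda>r s. P r s - P\<^sub>0)) T) \<and>
        (\<forall>\<xi> \<Lambda>. homothetic M \<xi> \<Lambda> \<and> (\<exists>x. \<Lambda> x \<noteq> 0) \<longrightarrow>
           extra_density M I J P e (similarity_energy_density M (\<lambda>r s. P r s - P\<^sub>0) \<xi> \<Lambda>)) \<and>
        (\<forall>\<theta> \<Lambda>. smooth_scalar M \<theta> \<and> homothetic M (grad M \<theta>) \<Lambda> \<and> (\<exists>x. \<Lambda> x \<noteq> 0) \<longrightarrow>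
           extra_density M I J P e (galilean_energy_density M (\<lambda>r s. P r s - P\<^sub>0) \<theta> \<Lambda>))) \<and>
    \<comment> \<open>(ii), isobaric-entropy case\<close>
     (\<forall>\<kappa>. isobaric_entropy I J P \<kappa> \<longrightarrow>
        (\<forall>T. conserved_density M I J P T \<longleftrightarrow>
           generated M I J P
             (general_densities M J e \<union> isobaric_densities M J \<kappa> \<union> isobaric_galilean_densities M J) T) \<and>
        (\<forall>T\<in>isobaric_densities M J \<kappa>.
           (\<exists>t x v. \<exists>r\<in>I. \<exists>s\<in>J. T t x v r s \<noteq> 0) \<longrightarrow> extra_density M I J P e T))"
proof -
  interpret fluid_energy M I J P e
    by unfold_locales (use M n I J P e in \<open>auto simp: equation_of_state_def\<close>)
  let ?G = "general_densities M J e"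
  show ?thesis
  proof (intro conjI allI impI ballI)
    show "conserved T" if "T \<in> ?G" for T by (rule general_conserved[OF that])
    show "\<not> trivial_density M I J P T" if "T \<in> ?G" "\<exists>t x v. \<exists>r\<in>I. \<exists>s\<in>J. T t x v r s \<noteq> 0" for T
      using general_nontrivial[OF that(1)] that(2) by blast
    show "conserved T = generated M I J P ?G T" if "\<not> special_eos CARD('n) I J P" for T
      using nonspecial[OF that, of T] generated_iff[of ?G T, OF general_conserved] by blast
    show "special_eos CARD('n) I J P" if "\<exists>T. extra_density M I J P e T"
      using that nonspecial unfolding extra_iff by blast
  next
    fix P\<^sub>0 T assume p: "polytropic CARD('n) I J (\<lambda>r s. P r s - P\<^sub>0)"
    let ?D = "polytropic_densities M (\<lambda>r s. P r s - P\<^sub>0)"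
    show "conserved T = generated M I J P (?G \<union> ?D) T"
      using generated_iff[of "?G \<union> ?D" T] general_conserved polytropic_conserved[OF p] comb_polytropic[OF p, of T] by blast
  next
    fix P\<^sub>0 \<xi> \<Lambda> assume p: "polytropic CARD('n) I J (\<lambda>r s. P r s - P\<^sub>0)" and h: "homothetic M \<xi> \<Lambda> \<and> (\<exists>x. \<Lambda> x \<noteq> 0)"
    then show "extra_density M I J P e (similarity_energy_density M (\<lambda>r s. P r s - P\<^sub>0) \<xi> \<Lambda>)"
      unfolding extra_iff using polytropic_extra(1)[of \<Lambda> _ P\<^sub>0 \<xi>] polytropic_conserved[OF p]
      unfolding polytropic_densities_def by blast
  next
    fix P\<^sub>0 \<theta> \<Lambda> assume p: "polytropic CARD('n) I J (\<lambda>r s. P r s - P\<^sub>0)"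
      and h: "smooth_scalar M \<theta> \<and> homothetic M (grad M \<theta>) \<Lambda> \<and> (\<exists>x. \<Lambda> x \<noteq> 0)"
    then show "extra_density M I J P e (galilean_energy_density M (\<lambda>r s. P r s - P\<^sub>0) \<theta> \<Lambda>)"
      unfolding extra_iff using polytropic_extra(2)[of \<Lambda> _ \<theta> P\<^sub>0] polytropic_conserved[OF p]
      unfolding polytropic_densities_def by blast
  next
    fix \<kappa> T assume iso: "isobaric_entropy I J P \<kappa>"
    note c = isobaric_conserved[OF \<kappa>[OF iso]]
    show "conserved T = generated M I J P (?G \<union> isobaric_densities M J \<kappa> \<union> isobaric_galilean_densities M J) T"
      using generated_iff[of "?G \<union> isobaric_densities M J \<kappa> \<union> isobaric_galilean_densities M J" T]
        general_conserved c comb_isobaric[OF iso, of T] by blast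
    show "extra_density M I J P e T" if T: "T \<in> isobaric_densities M J \<kappa>" "\<exists>t x v. \<exists>r\<in>I. \<exists>s\<in>J. T t x v r s \<noteq> 0"
      unfolding extra_iff using isobaric_extra[OF T(1)] c T by blast
  qed
qed


end
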